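(* Let $n\ge3$, $s\ge1$, and consider the quasi-split $\imath$quantum group $\mathbf U^\imath$ of type A.3 (affine type $A^{(1)}_{n-1}$, $\tau(i)=-i$ mod $n$) with the parameters given in the context; put $n'=\lfloor\frac{n-1}2\rfloor$. The combinatorial $K$-matrix $\mathcal K_{\mathcal B_s}(x):\mathcal B_s(x)\to\mathcal B_s(x^{-1})$ exists and is given by $$\mathcal K_{\mathcal B_s}(x)(x^db_\alpha)=x^{d+I(\alpha)}\begin{cases}b_\alpha&(s\text{ even}),\\ b_{\alpha+(-1)^{i-1}(\mathbf e_{i'}-\mathbf e_{n-i'+1})}&(s\text{ odd}),\end{cases}$$ where for $s$ odd $i$ is the unique index $1\le i\le n$ such that Case $(i)$ (defined in the context) holds for $\alpha$, and $i'=\lfloor\frac{i+1}2\rfloor$. The energy function is $$I(\alpha)=-2\left\lfloor\frac{\alpha_n+\gamma_1+\chi(s\text{ is even})}2\right\rfloor,$$ where $\gamma_{n'}=(\alpha_{n-n'}-\alpha_{n'})_+$, $\gamma_j=(\gamma_{j+1}+\alpha_{n-j}-\alpha_j)_+$ for $j=n'-1,n'-2,\dots,1$, $(m)_+=\max(m,0)$, and $\chi(P)=1$ if $P$ is true and $0$ otherwise.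
   Context: Type A setting. $I=\mathbb Z/n\mathbb Z$; $\mathbf U$ is the quantum affine algebra of type $A^{(1)}_{n-1}$ over $\mathbb C(q)$ with Chevalley generators $E_i,F_i,K_i^{\pm1}$ and coproduct $\Delta(E_i)=E_i\otimes1+K_i\otimes E_i$, $\Delta(F_i)=F_i\otimes K_i^{-1}+1\otimes F_i$, $\Delta(K_i)=K_i\otimes K_i$. For $\alpha=(\alpha_1,\dots,\alpha_n)\in\mathbb Z_{\ge0}^n$ with $\sum\alpha_i=s$, indices mod $n$, $\mathbf e_i$ standard basis vectors, $[m]=\frac{q^m-q^{-m}}{q-q^{-1}}$: the KR module $\mathcal W_s$ has basis $v_\alpha$ with $E_iv_\alpha=[\alpha_i+1]v_{\alpha+\mathbf e_i-\mathbf e_{i+1}}$, $F_iv_\alpha=[\alpha_{i+1}+1]v_{\alpha-\mathbf e_i+\mathbf e_{i+1}}$, $K_iv_\alpha=q^{\alpha_i-\alpha_{i+1}}v_\alpha$ (vectors with a negative index entry are $0$). $\mathcal W=\mathcal W_1$, with basis $v_j=v_{\mathbf e_j}$. $U(x)$ is $U$ (scalars extended to $\mathbb C(q,x)$) with $E_0,F_0$ acting as $xE_0,x^{-1}F_0$. $\mathcal W_s(x)$ is embedded in $\mathcal W(q^{1-s}x)\otimes\mathcal W(q^{3-s}x)\otimes\cdots\otimes\mathcal W(q^{s-1}x)$ by $v_\alpha=\sum_{\mathbf i}q^{-\#\{p<p':\,i_p>i_{p'}\}}v_{i_1}\otimes\cdots\otimes v_{i_s}$, sum over $\mathbf i\in\{1,\dots,n\}^s$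 containing each $i$ exactly $\alpha_i$ times. Quantum $K$-matrix (untwisted type). $\mathbf U^\imath\subset\mathbf U$ is generated by $K_iK_{-i}^{-1}$ and $B_i=F_i+\varsigma_iE_{-i}K_i^{-1}$, $i\in I$, where $\varsigma_0=q^{-1}$; $\varsigma_{n'+1}=q^{-1}$ if $n$ is even, $\varsigma_{n'+1}=q$ if $n$ is odd; $\varsigma_i=1$ otherwise. $K_{\mathcal W}(x):\mathcal W(x)\to\mathcal W(x^{-1})$ is the $\mathbf U^\imath$-linear map $v_j\mapsto v_{n+1-j}$. $R_{\mathcal W,\mathcal W}(u,v):\mathcal W(u)\otimes\mathcal W(v)\to\mathcal W(v)\otimes\mathcal W(u)$ is the $\mathbf U$-linear isomorphism (for generic $u/v$), unique up to scalar. $K_{\mathcal W_s}(x):\mathcal W_s(x)\to\mathcal W_s(x^{-1})$ is the restriction to $\mathcal W_s(x)$ of $K^{(s)}(x)\cdots K^{(1)}(x)$, where $K^{(j)}(x)=K_1(q^{-s+2j-1}x)R_{1,2}(q^{s-2j+3}x^{-1},q^{-s+2j-1}x)R_{2,3}(q^{s-2j+5}x^{-1},q^{-s+2j-1}x)\cdots R_{j-1,j}(q^{s-1}x^{-1},q^{-s+2j-1}x)$, $K_1$ is $K_{\mathcal W}$ on the first component and $R_{i,i+1}$ is $R_{\mathcal W,\mathcal W}$ on components $i,i+1$. It is $\mathbf U^\imath$-linear. Combinatorial $K$-matrix. Let $\mathbf A_x=\mathbb C(q,x)\cap\mathbb C(x)[[q^{-1}]]$, and let $\mathcal L_s(x)=\mathcal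 L_s(x^{-1})$ be the $\mathbf A_x$-span of the $v_\alpha$; $b_\alpha$ is the class of $v_\alpha$ modulo $q^{-1}$, $\mathcal B_s(x)=\mathcal B_s(x^{-1})=\{x^db_\alpha\mid d\in\mathbb Z\}$ as sets (the first attached to $\mathcal W_s(x)$, the second to $\mathcal W_s(x^{-1})$). Rescale $K_{\mathcal W_s}(x)$ by a nonzero scalar in $\mathbb C(q,x)$ so that it preserves these lattices and the induced $\mathbb C(x)$-linear map $\bar K_{\mathcal W_s}(x)$ modulo $q^{-1}$ is nonzero. If (for a suitable such scalar) the restriction of $\bar K_{\mathcal W_s}(x)$ to $\mathcal B_s(x)$ is a bijection $\mathcal B_s(x)\to\mathcal B_s(x^{-1})$, it is called the combinatorial $K$-matrix on $\mathcal B_s$; it is unique up to multiplication by a power of $x$. Cases. For $0\le i\le n'$: Case $(2i+1)$ holds for $\alpha$ if (a) $\alpha_k+\alpha_{k+1}+\cdots+\alpha_i<\alpha_{n-i}+\cdots+\alpha_{n-k}$ for all $1\le k\le i$; (b) $\alpha_{i+1}+\cdots+\alpha_k\ge\alpha_{n-k}+\cdots+\alpha_{n-i-1}$ for all $i+1\le k\le n'$; (c) $\alpha_1+\cdots+\alpha_i+\alpha_{n-i}+\cdots+\alpha_n$ is odd. Case $(2i+2)$ holds for $\alpha$ if (a') $\alpha_k+\cdots+\alpha_i\le\alpha_{n-i}+\cdots+\alpha_{n-k}$ for all $1\le k\le i$; (b') $\alpha_{i+1}+\cdots+\alpha_k>\alpha_{n-k}+\cdots+\alpha_{n-i-1}$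 for all $i+1\le k\le n'$; (c') $\alpha_1+\cdots+\alpha_i+\alpha_{n-i}+\cdots+\alpha_n$ is even. When $s$ is odd, every such $\alpha$ satisfies exactly one Case $(i)$ with $1\le i\le n$. *)

theory Defs
  imports
    "HOL-Computational_Algebra.Fraction_Field"
    "HOL-Computational_Algebra.Formal_Laurent_Series"
    "HOL-Computational_Algebra.Polynomial"
begin

section \<open>The fields C(x) and C(q,x), and the ring A_x\<close>

type_synonym cx = "complex poly fract"

text \<open>C(q,x) is realised as the field of rational functions in q over C(x).\<close>
type_synonym cqx = "cx poly fract"

definition cx_x :: cx where
  "cx_x = Fraction_Field.Fract [:0, 1:] 1"

definition qq :: cqx where
  "qq = Fraction_Field.Fract [:0, 1:] 1"

definition xx :: cqx where
  "xx = Fraction_Field.Fract [:cx_x:] 1"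

text \<open>The expansion of a rational function as a Laurent series in the inverse of q with
  coefficients in C(x). The variable of the library's Laurent series stands for the inverse
  of q, hence q itself is sent to \<^const>\<open>fls_X_inv\<close>.\<close>

definition expand_poly :: "cx poly \<Rightarrow> cx fls" where
  "expand_poly p = poly (map_poly fls_const p) fls_X_inv"

definition q_expansion :: "cqx \<Rightarrow> cx fls" where
  "q_expansion f = (THE g. \<exists>a b. b \<noteq> 0 \<and> f = Fraction_Field.Fract a b
                             \<and> g = expand_poly a / expand_poly b)"

lemma expand_poly_0 [simp]: "expand_poly 0 = 0"
  by (simp add: expand_poly_def)

lemma expand_poly_pCons: "expand_poly (pCons c p) = fls_const c + fls_X_inv * expand_poly p"
  by (simp add: expand_poly_def map_poly_pCons)

lemma expand_poly_add: "expand_poly (a + b) = expand_poly a + expand_poly b"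
  by (induction a b rule: poly_induct2) (simp_all add: expand_poly_pCons algebra_simps fls_plus_const)

lemma expand_poly_smult: "expand_poly (smult c a) = fls_const c * expand_poly a"
  by (induction a) (simp_all add: expand_poly_pCons algebra_simps fls_const_mult_const)

lemma expand_poly_mult: "expand_poly (a * b) = expand_poly a * expand_poly b"
proof (induction a)
  case (pCons c a)
  then show ?case
    by (simp add: expand_poly_add expand_poly_smult expand_poly_pCons algebra_simps)
qed simp

lemma expand_poly_nth: "fls_nth (expand_poly p) k = (if k \<le> 0 then coeff p (nat (- k)) else 0)"
proof (induction p arbitrary: k)
  case (pCons c p)
  have "fls_nth (fls_X_inv * expand_poly p) k = fls_nth (expand_poly p) (k + 1)"
    by (simp add: fls_X_inv_times_conv_shift(1))
  with pCons.IH[of "k + 1"] show ?case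
    by (auto simp: expand_poly_pCons coeff_pCons nat_eq_iff split: nat.splits intro!: arg_cong[of _ _ "coeff p"])
qed simp

lemma expand_poly_eq_0_iff [simp]: "expand_poly p = 0 \<longleftrightarrow> p = 0"
proof
  assume "expand_poly p = 0"
  then have "coeff p m = 0" for m
    using expand_poly_nth[of p "- int m"] by simp
  then show "p = 0" by (simp add: poly_eq_iff)
qed simp

lemma q_expansion_Fract:
  assumes "b \<noteq> 0"
  shows "q_expansion (Fraction_Field.Fract a b) = expand_poly a / expand_poly b"
  unfolding q_expansion_def
proof (rule the_equality)
  fix g
  assume "\<exists>a' b'. b' \<noteq> 0 \<and> Fraction_Field.Fract a b = Fraction_Field.Fract a' b'
            \<and> g = expand_poly a' / expand_poly b'"
  then obtain a' b' where b': "b' \<noteq> 0" and g: "g = expand_poly a' / expand_poly b'"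
    and eq: "Fraction_Field.Fract a b = Fraction_Field.Fract a' b'"
    by blast
  from eq b' assms have "a * b' = a' * b" by (simp add: eq_fract)
  then have "expand_poly a * expand_poly b' = expand_poly a' * expand_poly b"
    by (metis expand_poly_mult)
  with b' assms show "g = expand_poly a / expand_poly b"
    by (simp add: g frac_eq_eq)
qed (use assms in blast)

definition A_x :: "cqx set" where
  "A_x = {f. q_expansion f \<in> range fps_to_fls}"

definition mod_qinv :: "cqx \<Rightarrow> cx" where
  "mod_qinv f = fls_nth (q_expansion f) 0"

definition q_int :: "int \<Rightarrow> cqx" where
  "q_int m = (qq powi m - qq powi (- m)) / (qq - qq powi (-1))"


section \<open>Vector spaces with a basis\<close>

text \<open>A vector is the family of its coordinates with respect to a given finite basis B (a set
  of labels), extended by zero outside of B. A linear map is given by the images of the basis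
  vectors, and \<open>lin B M\<close> is its linear extension to the span of B.\<close>

type_synonym ('b, 'c) lmap = "'b \<Rightarrow> 'c \<Rightarrow> cqx"

definition vspan :: "'b set \<Rightarrow> ('b \<Rightarrow> cqx) set" where
  "vspan B = {f. \<forall>b. b \<notin> B \<longrightarrow> f b = 0}"

definition unit_vec :: "'b \<Rightarrow> 'b \<Rightarrow> cqx" where
  "unit_vec b = (\<lambda>c. if c = b then 1 else 0)"

definition lin :: "'b set \<Rightarrow> ('b, 'c) lmap \<Rightarrow> ('b \<Rightarrow> cqx) \<Rightarrow> 'c \<Rightarrow> cqx" where
  "lin B M f = (\<lambda>c. \<Sum>b\<in>B. f b * M b c)"

definition intertwines :: "'b set \<Rightarrow> 'c set \<Rightarrow> ('b, 'c) lmap \<Rightarrow> ('b, 'b) lmap \<Rightarrow> ('c, 'c) lmap \<Rightarrow> bool"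
  where
  "intertwines B C M a a' \<longleftrightarrow> (\<forall>b\<in>B. lin B M (a b) = lin C a' (M b))"

definition tensor :: "('b, 'b) lmap \<Rightarrow> ('c, 'c) lmap \<Rightarrow> ('b \<times> 'c, 'b \<times> 'c) lmap" where
  "tensor a a' = (\<lambda>(b, c) (b', c'). a b b' * a' c c')"

definition add_lmap :: "('b, 'c) lmap \<Rightarrow> ('b, 'c) lmap \<Rightarrow> ('b, 'c) lmap" where
  "add_lmap a a' = (\<lambda>b c. a b c + a' b c)"


section \<open>Kirillov-Reshetikhin modules\<close>

text \<open>Elements of the index set Z/nZ are represented by 0, ..., n-1, whereas positions in
  \<open>\<alpha>\<close> are represented by 1, ..., n. The entries of \<open>\<alpha>\<close> attached to a node i are those at
  \<open>pos n i\<close> and \<open>i + 1\<close>.\<close>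

definition pos :: "nat \<Rightarrow> nat \<Rightarrow> nat" where
  "pos n i = (if i = 0 then n else i)"

definition neg_node :: "nat \<Rightarrow> nat \<Rightarrow> nat" where
  "neg_node n i = (n - i) mod n"

definition comps :: "nat \<Rightarrow> nat \<Rightarrow> (nat \<Rightarrow> int) set" where
  "comps n s = {\<alpha>. (\<forall>k\<in>{1..n}. \<alpha> k \<ge> 0) \<and> (\<forall>k. k \<notin> {1..n} \<longrightarrow> \<alpha> k = 0) \<and> (\<Sum>k=1..n. \<alpha> k) = int s}"

definition ee :: "nat \<Rightarrow> nat \<Rightarrow> int" where
  "ee k = (\<lambda>j. if j = k then 1 else 0)"

definition kr_vec :: "(nat \<Rightarrow> int) \<Rightarrow> (nat \<Rightarrow> int) \<Rightarrow> cqx" where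
  "kr_vec \<alpha> = (if \<exists>k. \<alpha> k < 0 then (\<lambda>_. 0) else unit_vec \<alpha>)"

text \<open>The action of the Chevalley generators on the module with spectral parameter u; the
  third one is the action of the m-th power of K_i.\<close>

definition kr_E :: "nat \<Rightarrow> cqx \<Rightarrow> nat \<Rightarrow> (nat \<Rightarrow> int, nat \<Rightarrow> int) lmap" where
  "kr_E n u i \<alpha> = (\<lambda>\<beta>. (if i = 0 then u else 1) * q_int (\<alpha> (pos n i) + 1)
       * kr_vec (\<lambda>k. \<alpha> k + ee (pos n i) k - ee (i + 1) k) \<beta>)"

definition kr_F :: "nat \<Rightarrow> cqx \<Rightarrow> nat \<Rightarrow> (nat \<Rightarrow> int, nat \<Rightarrow> int) lmap" where
  "kr_F n u i \<alpha> = (\<lambda>\<beta>. (if i = 0 then inverse u else 1) * q_int (\<alpha> (i + 1) + 1)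
       * kr_vec (\<lambda>k. \<alpha> k - ee (pos n i) k + ee (i + 1) k) \<beta>)"

definition kr_K :: "nat \<Rightarrow> nat \<Rightarrow> int \<Rightarrow> (nat \<Rightarrow> int, nat \<Rightarrow> int) lmap" where
  "kr_K n i m \<alpha> = (\<lambda>\<beta>. qq powi (m * (\<alpha> (pos n i) - \<alpha> (i + 1))) * kr_vec \<alpha> \<beta>)"

text \<open>The vector representation is the case s = 1, with its basis labelled by 1, ..., n.\<close>

definition on_W :: "(nat \<Rightarrow> int, nat \<Rightarrow> int) lmap \<Rightarrow> (nat, nat) lmap" where
  "on_W a j = (\<lambda>k. a (ee j) (ee k))"

definition W_E :: "nat \<Rightarrow> cqx \<Rightarrow> nat \<Rightarrow> (nat, nat) lmap" where
  "W_E n u i = on_W (kr_E n u i)"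

definition W_F :: "nat \<Rightarrow> cqx \<Rightarrow> nat \<Rightarrow> (nat, nat) lmap" where
  "W_F n u i = on_W (kr_F n u i)"

definition W_K :: "nat \<Rightarrow> nat \<Rightarrow> int \<Rightarrow> (nat, nat) lmap" where
  "W_K n i m = on_W (kr_K n i m)"


section \<open>The R-matrix\<close>

text \<open>The action on the tensor product of two vector representations, by the coproduct.\<close>

definition WW_E :: "nat \<Rightarrow> cqx \<Rightarrow> cqx \<Rightarrow> nat \<Rightarrow> (nat \<times> nat, nat \<times> nat) lmap" where
  "WW_E n u v i = add_lmap (tensor (W_E n u i) unit_vec) (tensor (W_K n i 1) (W_E n v i))"

definition WW_F :: "nat \<Rightarrow> cqx \<Rightarrow> cqx \<Rightarrow> nat \<Rightarrow> (nat \<times> nat, nat \<times> nat) lmap" where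
  "WW_F n u v i = add_lmap (tensor (W_F n u i) (W_K n i (-1))) (tensor unit_vec (W_F n v i))"

definition WW_K :: "nat \<Rightarrow> nat \<Rightarrow> int \<Rightarrow> (nat \<times> nat, nat \<times> nat) lmap" where
  "WW_K n i m = tensor (W_K n i m) (W_K n i m)"

definition is_R_matrix :: "nat \<Rightarrow> cqx \<Rightarrow> cqx \<Rightarrow> (nat \<times> nat, nat \<times> nat) lmap \<Rightarrow> bool" where
  "is_R_matrix n u v R \<longleftrightarrow>
     (let B = {1..n} \<times> {1..n} in
       bij_betw (lin B R) (vspan B) (vspan B) \<and> (\<forall>b\<in>B. R b \<in> vspan B) \<and>
       (\<forall>i<n. intertwines B B R (WW_E n u v i) (WW_E n v u i) \<and>
              intertwines B B R (WW_F n u v i) (WW_F n v u i) \<and>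
              (\<forall>m\<in>{1, -1}. intertwines B B R (WW_K n i m) (WW_K n i m))))"


section \<open>The quantum K-matrix\<close>

definition half :: "nat \<Rightarrow> nat" where
  "half n = (n - 1) div 2"

definition varsig :: "nat \<Rightarrow> nat \<Rightarrow> cqx" where
  "varsig n i = (if i = 0 then qq powi (-1)
                 else if i = half n + 1 then (if even n then qq powi (-1) else qq)
                 else 1)"

text \<open>The action on W(u) of the generators B_i and of the product of K_i with the inverse
  of K_{-i}.\<close>

definition W_B :: "nat \<Rightarrow> cqx \<Rightarrow> nat \<Rightarrow> (nat, nat) lmap" where
  "W_B n u i = add_lmap (W_F n u i)
     (\<lambda>j k. varsig n i * lin {1..n} (W_E n u (neg_node n i)) (W_K n i (-1) j) k)"

definition W_KK :: "nat \<Rightarrow> nat \<Rightarrow> (nat, nat) lmap" where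
  "W_KK n i = (\<lambda>j. lin {1..n} (W_K n i 1) (W_K n (neg_node n i) (-1) j))"

definition is_K_W :: "nat \<Rightarrow> cqx \<Rightarrow> (nat, nat) lmap \<Rightarrow> bool" where
  "is_K_W n u KW \<longleftrightarrow>
     (\<forall>j\<in>{1..n}. KW j = unit_vec (n + 1 - j)) \<and>
     (\<forall>i<n. intertwines {1..n} {1..n} KW (W_B n u i) (W_B n (inverse u) i) \<and>
            intertwines {1..n} {1..n} KW (W_KK n i) (W_KK n i))"

text \<open>The basis of the s-fold tensor power of W is labelled by words. Tensor components are
  numbered from 1, list entries from 0.\<close>

definition tensor_words :: "nat \<Rightarrow> nat \<Rightarrow> nat list set" where
  "tensor_words n s = {w. length w = s \<and> set w \<subseteq> {1..n}}"

definition word_inv :: "nat list \<Rightarrow> nat" where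
  "word_inv w = card {(p, p'). p < p' \<and> p' < length w \<and> w ! p > w ! p'}"

definition embed_KR :: "nat \<Rightarrow> nat \<Rightarrow> (nat \<Rightarrow> int, nat list) lmap" where
  "embed_KR n s \<alpha> = (\<lambda>w. if w \<in> tensor_words n s \<and> (\<forall>k\<in>{1..n}. int (count_list w k) = \<alpha> k)
                          then qq powi (- int (word_inv w)) else 0)"

definition K_first :: "(nat, nat) lmap \<Rightarrow> (nat list, nat list) lmap" where
  "K_first KW w = (\<lambda>w'. if length w' = length w \<and> (\<forall>p<length w. p \<noteq> 0 \<longrightarrow> w' ! p = w ! p)
                         then KW (w ! 0) (w' ! 0) else 0)"

definition R_at :: "nat \<Rightarrow> (nat \<times> nat, nat \<times> nat) lmap \<Rightarrow> (nat list, nat list) lmap" where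
  "R_at k R w = (\<lambda>w'. if length w' = length w
                          \<and> (\<forall>p<length w. p \<noteq> k - 1 \<and> p \<noteq> k \<longrightarrow> w' ! p = w ! p)
                        then R (w ! (k - 1), w ! k) (w' ! (k - 1), w' ! k) else 0)"

text \<open>The spectral parameters of the j-th factor: \<open>par_K s j\<close> is the argument of K_1, which is
  also the second argument of all R-matrices, and \<open>par_R s j k\<close> is the first argument of
  the R-matrix acting on the components k, k+1, for \<open>1 \<le> k < j\<close>.\<close>

definition par_K :: "nat \<Rightarrow> nat \<Rightarrow> cqx" where
  "par_K s j = qq powi (- int s + 2 * int j - 1) * xx"

definition par_R :: "nat \<Rightarrow> nat \<Rightarrow> nat \<Rightarrow> cqx" where
  "par_R s j k = qq powi (int s - 2 * int j + 2 * int k + 1) * inverse xx"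

text \<open>In a product of operators the rightmost one acts first: the R-matrices are applied for
  \<open>k = j-1, ..., 1\<close>, and the factors for \<open>j = 1, ..., s\<close>.\<close>

definition K_factor :: "nat \<Rightarrow> nat \<Rightarrow> (cqx \<Rightarrow> (nat, nat) lmap)
    \<Rightarrow> (cqx \<Rightarrow> cqx \<Rightarrow> (nat \<times> nat, nat \<times> nat) lmap) \<Rightarrow> nat
    \<Rightarrow> (nat list \<Rightarrow> cqx) \<Rightarrow> nat list \<Rightarrow> cqx" where
  "K_factor n s KW R j f =
     lin (tensor_words n s) (K_first (KW (par_K s j)))
       (fold (\<lambda>k. lin (tensor_words n s) (R_at k (R (par_R s j k) (par_K s j)))) (rev [1..<j]) f)"

definition K_total :: "nat \<Rightarrow> nat \<Rightarrow> (cqx \<Rightarrow> (nat, nat) lmap)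
    \<Rightarrow> (cqx \<Rightarrow> cqx \<Rightarrow> (nat \<times> nat, nat \<times> nat) lmap)
    \<Rightarrow> (nat list \<Rightarrow> cqx) \<Rightarrow> nat list \<Rightarrow> cqx" where
  "K_total n s KW R f = fold (K_factor n s KW R) [1..<s + 1] f"

text \<open>The R-matrices are only determined up to scalars, and so is the quantum K-matrix: \<open>\<kappa>\<close> is
  a quantum K-matrix if it is obtained from some choice of R-matrices.\<close>

definition quantum_K_matrix :: "nat \<Rightarrow> nat \<Rightarrow> (nat \<Rightarrow> int, nat \<Rightarrow> int) lmap \<Rightarrow> bool" where
  "quantum_K_matrix n s \<kappa> \<longleftrightarrow>
     (\<exists>KW R.
        (\<forall>j\<in>{1..s}. is_K_W n (par_K s j) (KW (par_K s j))) \<and>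
        (\<forall>j\<in>{1..s}. \<forall>k\<in>{1..<j}.
           is_R_matrix n (par_R s j k) (par_K s j) (R (par_R s j k) (par_K s j))) \<and>
        (\<forall>\<alpha>\<in>comps n s. \<kappa> \<alpha> \<in> vspan (comps n s) \<and>
           lin (comps n s) (embed_KR n s) (\<kappa> \<alpha>) = K_total n s KW R (embed_KR n s \<alpha>)))"


section \<open>The combinatorial K-matrix\<close>

definition kr_lattice :: "nat \<Rightarrow> nat \<Rightarrow> ((nat \<Rightarrow> int) \<Rightarrow> cqx) set" where
  "kr_lattice n s = {f \<in> vspan (comps n s). \<forall>\<alpha>\<in>comps n s. f \<alpha> \<in> A_x}"

definition lattice_class :: "((nat \<Rightarrow> int) \<Rightarrow> cqx) \<Rightarrow> (nat \<Rightarrow> int) \<Rightarrow> cx" where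
  "lattice_class f = (\<lambda>\<alpha>. mod_qinv (f \<alpha>))"

definition x_pow_b :: "int \<Rightarrow> (nat \<Rightarrow> int) \<Rightarrow> (nat \<Rightarrow> int) \<Rightarrow> cx" where
  "x_pow_b d \<alpha> = (\<lambda>\<beta>. if \<beta> = \<alpha> then cx_x powi d else 0)"

definition crystal :: "nat \<Rightarrow> nat \<Rightarrow> ((nat \<Rightarrow> int) \<Rightarrow> cx) set" where
  "crystal n s = {x_pow_b d \<alpha> | d \<alpha>. \<alpha> \<in> comps n s}"

text \<open>\<open>Kbar\<close> is the map induced modulo the inverse of q by the rescaled quantum K-matrix.\<close>

definition combinatorial_K_matrix :: "nat \<Rightarrow> nat \<Rightarrow> (nat \<Rightarrow> int, nat \<Rightarrow> int) lmap
    \<Rightarrow> (((nat \<Rightarrow> int) \<Rightarrow> cx) \<Rightarrow> ((nat \<Rightarrow> int) \<Rightarrow> cx)) \<Rightarrow> bool" where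
  "combinatorial_K_matrix n s \<kappa> \<K> \<longleftrightarrow>
     (\<exists>c Kbar. c \<noteq> 0 \<and>
      (let \<kappa>' = lin (comps n s) (\<lambda>\<alpha> \<beta>. c * \<kappa> \<alpha> \<beta>) in
        (\<forall>f\<in>kr_lattice n s. \<kappa>' f \<in> kr_lattice n s) \<and>
        (\<forall>f\<in>kr_lattice n s. Kbar (lattice_class f) = lattice_class (\<kappa>' f)) \<and>
        (\<exists>f\<in>kr_lattice n s. Kbar (lattice_class f) \<noteq> (\<lambda>_. 0)) \<and>
        bij_betw Kbar (crystal n s) (crystal n s) \<and>
        (\<forall>b\<in>crystal n s. \<K> b = Kbar b)))"

definition kcase :: "nat \<Rightarrow> nat \<Rightarrow> (nat \<Rightarrow> int) \<Rightarrow> bool" where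
  "kcase n m \<alpha> \<longleftrightarrow>
     (\<exists>i\<le>half n.
        (m = 2 * i + 1 \<and>
         (\<forall>k\<in>{1..i}. (\<Sum>j=k..i. \<alpha> j) < (\<Sum>j=n-i..n-k. \<alpha> j)) \<and>
         (\<forall>k\<in>{i+1..half n}. (\<Sum>j=i+1..k. \<alpha> j) \<ge> (\<Sum>j=n-k..n-i-1. \<alpha> j)) \<and>
         odd ((\<Sum>j=1..i. \<alpha> j) + (\<Sum>j=n-i..n. \<alpha> j))) \<or>
        (m = 2 * i + 2 \<and>
         (\<forall>k\<in>{1..i}. (\<Sum>j=k..i. \<alpha> j) \<le> (\<Sum>j=n-i..n-k. \<alpha> j)) \<and>
         (\<forall>k\<in>{i+1..half n}. (\<Sum>j=i+1..k. \<alpha> j) > (\<Sum>j=n-k..n-i-1. \<alpha> j)) \<and>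
         even ((\<Sum>j=1..i. \<alpha> j) + (\<Sum>j=n-i..n. \<alpha> j))))"

definition case_index :: "nat \<Rightarrow> (nat \<Rightarrow> int) \<Rightarrow> nat" where
  "case_index n \<alpha> = (THE i. 1 \<le> i \<and> i \<le> n \<and> kcase n i \<alpha>)"

definition case_shift :: "nat \<Rightarrow> nat \<Rightarrow> (nat \<Rightarrow> int) \<Rightarrow> nat \<Rightarrow> int" where
  "case_shift n i \<alpha> =
     (let i' = (i + 1) div 2 in
       (\<lambda>k. \<alpha> k + (-1) ^ (i - 1) * (ee i' k - ee (n - i' + 1) k)))"

function energy_gamma :: "nat \<Rightarrow> (nat \<Rightarrow> int) \<Rightarrow> nat \<Rightarrow> int" where
  "energy_gamma n \<alpha> j =
     (if j \<ge> half n then max (\<alpha> (n - half n) - \<alpha> (half n)) 0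
      else max (energy_gamma n \<alpha> (j + 1) + \<alpha> (n - j) - \<alpha> j) 0)"
  by auto
termination
  by (relation "measure (\<lambda>(n, \<alpha>, j). half n - j)") auto

declare energy_gamma.simps [simp del]

definition energy :: "nat \<Rightarrow> nat \<Rightarrow> (nat \<Rightarrow> int) \<Rightarrow> int" where
  "energy n s \<alpha> = - 2 * ((\<alpha> n + energy_gamma n \<alpha> 1 + (if even s then 1 else 0)) div 2)"

end

theory Submission
  imports Defs "HOL-Library.Function_Algebras" "HOL-Computational_Algebra.Polynomial"
begin

text \<open>On words, the R-matrix acts as \<open>T - z T\<^sup>-\<^sup>1\<close> and the K-matrix of the vector representation
  as the generator J of the Hecke algebra of type B with parameter 1 at the special node.
  On the symmetric part, fusion turns the product defining the K-matrix into a ratio of values of the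
  central polynomial \<open>C(z) = \<Prod>\<^sub>i (z - Y\<^sub>i)\<close> in the Jucys-Murphy elements, and a q-difference
  equation expresses C(z) through \<open>X = \<Sum>\<^sub>i Y\<^sub>i\<close>. So the K-matrix is diagonalised by the
  eigenvectors of X, which are built by adding one pair of letters \<open>j, n + 1 - j\<close> at a time, starting
  from the middle. Modulo the inverse of q such an eigenvector is a basis vector, or the sum or
  difference of two basis vectors that the combinatorial K-matrix exchanges, and the eigenvalue of the
  K-matrix is a power of x up to sign.\<close>

section \<open>Rational functions in q, expanded at infinity\<close>

text \<open>The entries of the product of R-matrices are out of reach, but its spectrum is not. To
  every \<alpha> and every sign \<epsilon> belongs an eigenvector reducing to half of b_\<alpha> +
  \<epsilon> b_{\<sigma>\<alpha>}. Its K-eigenvalue is a product of ratios (q^{s-1} x - r q^{2i}) /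
  (q^{s-1} / x - r q^{2i}) with r = 1 or r = -1. Each ratio tends to x^2 or to 1, except for one
  with 2i = s - 1, present for odd s only, which tends to - r x. After a common rescaling the
  eigenvalue therefore reduces to \<epsilon>^s times a power of x. Adding the images for both signs
  leaves b_\<alpha> for even s and b_{\<sigma>\<alpha>} for odd s: this is the dichotomy of the
  theorem. The exponent is -tau up to a shift, where tau is \<alpha>_n + \<gamma>_1 rounded to the
  parity of s; this is the floor in the energy. The sums over both signs also reduce to the standard
  basis, so the eigenvectors span, and it is from this that the KR module is seen to be stable under
  the product at all.\<close>

lemma expand_poly_1 [simp]: "expand_poly 1 = 1"
  by (simp add: one_pCons expand_poly_pCons)

lemma q_expansion_add: "q_expansion (f + g) = q_expansion f + q_expansion g"
proof -
  obtain a b where f: "f = Fraction_Field.Fract a b" and b: "b \<noteq> 0" by (cases f)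
  obtain c d where g: "g = Fraction_Field.Fract c d" and d: "d \<noteq> 0" by (cases g)
  show ?thesis using b d
    by (simp add: f g q_expansion_Fract expand_poly_add expand_poly_mult field_simps)
qed

lemma q_expansion_mult: "q_expansion (f * g) = q_expansion f * q_expansion g"
proof -
  obtain a b where f: "f = Fraction_Field.Fract a b" and b: "b \<noteq> 0" by (cases f)
  obtain c d where g: "g = Fraction_Field.Fract c d" and d: "d \<noteq> 0" by (cases g)
  show ?thesis using b d
    by (simp add: f g q_expansion_Fract expand_poly_mult)
qed

lemma q_expansion_0 [simp]: "q_expansion 0 = 0"
  by (simp add: Zero_fract_def q_expansion_Fract)

lemma q_expansion_1 [simp]: "q_expansion 1 = 1"
  by (simp add: One_fract_def q_expansion_Fract)

lemma q_expansion_minus: "q_expansion (- f) = - q_expansion f"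
  using q_expansion_add[of f "- f"] by (simp add: eq_neg_iff_add_eq_0 add.commute)

lemma q_expansion_diff: "q_expansion (f - g) = q_expansion f - q_expansion g"
  using q_expansion_add[of f "- g"] by (simp add: q_expansion_minus)

lemma q_expansion_inverse: "q_expansion (inverse f) = inverse (q_expansion f)"
proof (cases "f = 0")
  case False
  then have "q_expansion f * q_expansion (inverse f) = 1"
    by (simp flip: q_expansion_mult)
  then show ?thesis by (simp add: inverse_unique)
qed simp

definition const_x :: "cx \<Rightarrow> cqx" where
  "const_x c = Fraction_Field.Fract [:c:] 1"

lemma q_expansion_const_x: "q_expansion (const_x c) = fls_const c"
  by (simp add: const_x_def q_expansion_Fract expand_poly_pCons)

lemma q_expansion_qq: "q_expansion qq = fls_X_inv"
  by (simp add: qq_def q_expansion_Fract expand_poly_pCons)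

lemma xx_eq_const: "xx = const_x cx_x"
  by (simp add: xx_def const_x_def)

lemma Fract_eq_0_iff: "b \<noteq> 0 \<Longrightarrow> Fraction_Field.Fract a b = 0 \<longleftrightarrow> a = 0"
  for a b :: "'a::idom"
  by (simp add: Zero_fract_def eq_fract)

lemma cx_x_nonzero [simp]: "cx_x \<noteq> 0"
  by (simp add: cx_x_def Fract_eq_0_iff)

lemma qq_nonzero [simp]: "qq \<noteq> 0"
  by (simp add: qq_def Fract_eq_0_iff)

lemma xx_nonzero [simp]: "xx \<noteq> 0"
  by (simp add: xx_def Fract_eq_0_iff)

lemma const_x_0 [simp]: "const_x 0 = 0"
  by (simp add: const_x_def Fract_eq_0_iff)

lemma const_x_1 [simp]: "const_x 1 = 1"
  by (simp add: const_x_def One_fract_def[where 'a = "cx poly"] one_pCons)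

lemma const_x_mult: "const_x (c * d) = const_x c * const_x d"
  by (simp add: const_x_def mult.commute)

lemma const_x_add: "const_x (c + d) = const_x c + const_x d"
  by (simp add: const_x_def)

lemma const_x_eq_0_iff [simp]: "const_x c = 0 \<longleftrightarrow> c = 0"
  by (simp add: const_x_def Fract_eq_0_iff)

text \<open>\<open>lead_q d f L\<close>: f has degree at most d in q, and L is its coefficient of q to the d.\<close>

definition lead_q :: "int \<Rightarrow> cqx \<Rightarrow> cx \<Rightarrow> bool" where
  "lead_q d f L \<longleftrightarrow> (\<forall>k< -d. fls_nth (q_expansion f) k = 0) \<and> fls_nth (q_expansion f) (- d) = L"

lemma A_x_iff: "f \<in> A_x \<longleftrightarrow> (\<forall>k<0. fls_nth (q_expansion f) k = 0)"
proof
  assume "f \<in> A_x"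
  then show "\<forall>k<0. fls_nth (q_expansion f) k = 0" by (auto simp: A_x_def)
next
  assume *: "\<forall>k<0. fls_nth (q_expansion f) k = 0"
  have "q_expansion f = fps_to_fls (fls_regpart (q_expansion f))"
    using * by (intro fls_eqI) auto
  then show "f \<in> A_x" unfolding A_x_def by blast
qed

lemma lead_q_0_iff: "lead_q 0 f L \<longleftrightarrow> f \<in> A_x \<and> mod_qinv f = L"
  by (auto simp: lead_q_def A_x_iff mod_qinv_def)

lemma lead_qD: "lead_q 0 f L \<Longrightarrow> f \<in> A_x" "lead_q 0 f L \<Longrightarrow> mod_qinv f = L"
  by (auto simp: lead_q_0_iff)

lemma lead_q_unique: "lead_q d f L \<Longrightarrow> lead_q d f L' \<Longrightarrow> L = L'"
  by (auto simp: lead_q_def)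

lemma lead_q_zero [simp]: "lead_q d 0 0"
  by (simp add: lead_q_def)

lemma lead_q_add: "lead_q d f L \<Longrightarrow> lead_q d g M \<Longrightarrow> lead_q d (f + g) (L + M)"
  by (auto simp: lead_q_def q_expansion_add)

lemma lead_q_minus: "lead_q d f L \<Longrightarrow> lead_q d (- f) (- L)"
  by (auto simp: lead_q_def q_expansion_minus)

lemma lead_q_diff: "lead_q d f L \<Longrightarrow> lead_q d g M \<Longrightarrow> lead_q d (f - g) (L - M)"
  by (auto simp: lead_q_def q_expansion_diff)

lemma lead_q_sum: "(\<And>i. i \<in> I \<Longrightarrow> lead_q d (f i) (L i)) \<Longrightarrow> lead_q d (sum f I) (sum L I)"
  by (induction I rule: infinite_finite_induct) (auto intro: lead_q_add)

lemma lead_q_lower: "lead_q d f L \<Longrightarrow> d < e \<Longrightarrow> lead_q e f 0"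
  by (auto simp: lead_q_def)

lemma lead_q_mult:
  assumes "lead_q d f L" "lead_q e g M"
  shows "lead_q (d + e) (f * g) (L * M)"
proof (cases "q_expansion f = 0 \<or> q_expansion g = 0")
  case True
  then show ?thesis using assms by (auto simp: lead_q_def q_expansion_mult)
next
  case False
  let ?f = "q_expansion f" and ?g = "q_expansion g"
  have df: "fls_subdegree ?f \<ge> - d" and dg: "fls_subdegree ?g \<ge> - e"
    using False assms by (auto simp: lead_q_def intro!: fls_subdegree_geI)
  have 1: "fls_nth (?f * ?g) k = 0" if "k < - (d + e)" for k
    using that df dg by (intro fls_times_nth_eq0) auto
  have 2: "fls_nth (?f * ?g) (- (d + e)) = L * M"
  proof (cases "fls_subdegree ?f = - d \<and> fls_subdegree ?g = - e")
    case True
    then show ?thesis using assms fls_times_base[of ?f ?g] by (auto simp: lead_q_def)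
  next
    case False
    then have "- (d + e) < fls_subdegree ?f + fls_subdegree ?g" using df dg by auto
    then have "fls_nth (?f * ?g) (- (d + e)) = 0" by (rule fls_times_nth_eq0)
    moreover have "L = 0 \<or> M = 0"
      using False df dg assms by (auto simp: lead_q_def)
    ultimately show ?thesis by auto
  qed
  show ?thesis using 1 2 by (auto simp: lead_q_def q_expansion_mult)
qed

lemma lead_q_qq: "lead_q 1 qq 1"
  by (auto simp: lead_q_def q_expansion_qq)

lemma lead_q_const_x: "lead_q 0 (const_x c) c"
  by (auto simp: lead_q_def q_expansion_const_x)

lemma lead_q_one: "lead_q 0 1 1"
  using lead_q_const_x[of 1] by simp

lemma lead_q_inverse:
  assumes "lead_q d f L" "L \<noteq> 0"
  shows "lead_q (- d) (inverse f) (inverse L)"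
proof -
  let ?f = "q_expansion f"
  have nz: "?f \<noteq> 0" using assms by (auto simp: lead_q_def)
  have deg: "fls_subdegree ?f = - d"
    using assms by (intro fls_subdegree_eqI) (auto simp: lead_q_def)
  have deg': "fls_subdegree (inverse ?f) = d"
    using nz deg by simp
  have "fls_nth (?f * inverse ?f) (- d + d) = fls_nth ?f (- d) * fls_nth (inverse ?f) d"
    using fls_times_base[of ?f "inverse ?f"] by (simp add: deg deg')
  then have "fls_nth (inverse ?f) d = inverse L"
    using nz assms by (simp add: lead_q_def) (metis inverse_unique)
  then show ?thesis using deg' by (auto simp: lead_q_def q_expansion_inverse)
qed

lemma lead_q_divide:
  "lead_q d f L \<Longrightarrow> lead_q e g M \<Longrightarrow> M \<noteq> 0 \<Longrightarrow> lead_q (d - e) (f / g) (L / M)"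
  using lead_q_mult[OF _ lead_q_inverse] by (simp add: divide_inverse)

lemma lead_q_power: "lead_q d f L \<Longrightarrow> lead_q (int m * d) (f ^ m) (L ^ m)"
  by (induction m) (auto simp: lead_q_one algebra_simps dest: lead_q_mult)

lemma lead_q_powi:
  assumes "lead_q d f L" "L \<noteq> 0"
  shows "lead_q (m * d) (f powi m) (L powi m)"
proof (cases "m \<ge> 0")
  case True
  then show ?thesis using lead_q_power[OF assms(1), of "nat m"] by (simp add: power_int_def)
next
  case False
  then show ?thesis
    using lead_q_power[OF lead_q_inverse[OF assms], of "nat (- m)"] by (simp add: power_int_def)
qed

lemma lead_q_qpow: "lead_q m (qq powi m) 1"
  using lead_q_powi[OF lead_q_qq, of m] by simp

lemma lead_q_qpow_mult: "lead_q d f L \<Longrightarrow> lead_q (m + d) (qq powi m * f) L"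
  using lead_q_mult[OF lead_q_qpow] by fastforce

lemma lead_q_nonzero: "lead_q d f L \<Longrightarrow> L \<noteq> 0 \<Longrightarrow> f \<noteq> 0"
  by (auto simp: lead_q_def)

lemma q_expansion_eq_0_iff [simp]: "q_expansion f = 0 \<longleftrightarrow> f = 0"
  by (metis q_expansion_0 q_expansion_inverse q_expansion_mult q_expansion_1 right_inverse
      mult_zero_left one_neq_zero)

lemma qq_powi_eq_iff: "qq powi m = qq powi k \<longleftrightarrow> m = k"
proof
  assume *: "qq powi m = qq powi k"
  show "m = k"
  proof (rule ccontr)
    assume "m \<noteq> k"
    then consider "m < k" | "k < m" by linarith
    then show False
    proof cases
      case 1
      from lead_q_lower[OF lead_q_qpow 1] * have "lead_q k (qq powi k) 0" by simp
      with lead_q_qpow show False using lead_q_unique zero_neq_one by metis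
    next
      case 2
      from lead_q_lower[OF lead_q_qpow 2] * have "lead_q m (qq powi m) 0" by simp
      with lead_q_qpow show False using lead_q_unique zero_neq_one by metis
    qed
  qed
qed simp

lemma qq_power_eq_1_iff: "qq ^ m = 1 \<longleftrightarrow> m = 0"
  using qq_powi_eq_iff[of "int m" 0] by simp

text \<open>The eigenvectors carry a factor 1/2 and are separated by their signs, so 2 has to be
  invertible.\<close>

lemma two_neq_0_cx: "(2::cx) \<noteq> 0"
proof -
  have "(2::cx) = Fraction_Field.Fract 2 1"
    unfolding one_add_one[symmetric] One_fract_def by simp
  moreover have "Fraction_Field.Fract (2::complex poly) 1 \<noteq> 0"
    by (simp add: Fract_eq_0_iff)
  ultimately show ?thesis by metis
qed

lemma two_eq_const: "2 = const_x 2"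
  using const_x_add[of 1 1] by simp

lemma two_neq_0_cqx: "(2::cqx) \<noteq> 0"
  by (simp add: two_eq_const two_neq_0_cx)

text \<open>With d the largest degree in q among the nonzero entries, q^{-d} w lies in the lattice
  and has nonzero reduction. An eigenvector may be rescaled freely, and this choice makes its
  reduction meaningful.\<close>

lemma primitive_scaling:
  assumes "finite I" "i0 \<in> I" "w i0 \<noteq> (0::cqx)"
  shows "\<exists>d L. (\<forall>i\<in>I. lead_q d (w i) (L i)) \<and> (\<exists>i\<in>I. L i \<noteq> 0)"
proof -
  let ?I = "{i\<in>I. w i \<noteq> 0}"
  define d where "d = Max ((\<lambda>i. - fls_subdegree (q_expansion (w i))) ` ?I)"
  have fin: "finite ((\<lambda>i. - fls_subdegree (q_expansion (w i))) ` ?I)" using assms by auto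
  have "d \<in> (\<lambda>i. - fls_subdegree (q_expansion (w i))) ` ?I"
    unfolding d_def using assms fin by (intro Max_in) auto
  then obtain i1 where i1: "i1 \<in> I" "w i1 \<noteq> 0" "d = - fls_subdegree (q_expansion (w i1))" by auto
  have le: "- fls_subdegree (q_expansion (w i)) \<le> d" if "i \<in> I" "w i \<noteq> 0" for i
    unfolding d_def using fin that by (intro Max_ge) auto
  let ?L = "\<lambda>i. fls_nth (q_expansion (w i)) (- d)"
  have "lead_q d (w i) (?L i)" if "i \<in> I" for i
    using le[OF that] by (cases "w i = 0") (auto simp: lead_q_def)
  moreover have "?L i1 \<noteq> 0" using i1 by simp
  ultimately show ?thesis using i1(1) by (intro exI[of _ d] exI[of _ ?L]) auto
qed

lemma q_minus_qinv_nonzero: "qq - qq powi (-1) \<noteq> 0"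
  using qq_powi_eq_iff[of 1 "-1"] by simp

lemma q_int_0 [simp]: "q_int 0 = 0"
  by (simp add: q_int_def)

lemma q_int_minus: "q_int (- m) = - q_int m"
  by (simp add: q_int_def minus_divide_left)

lemma q_int_1 [simp]: "q_int 1 = 1"
  using q_minus_qinv_nonzero by (simp add: q_int_def)

lemma lead_q_int_pos: "m > 0 \<Longrightarrow> lead_q (m - 1) (q_int m) 1"
proof -
  assume m: "m > 0"
  have 1: "lead_q m (qq powi m - qq powi (- m)) 1"
    using lead_q_diff[OF lead_q_qpow[of m] lead_q_lower[OF lead_q_qpow[of "- m"], of m]] m by simp
  have 2: "lead_q 1 (qq - qq powi (-1)) 1"
    using lead_q_diff[OF lead_q_qq lead_q_lower[OF lead_q_qpow[of "-1"], of 1]] by simp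
  show ?thesis using lead_q_divide[OF 1 2] by (simp add: q_int_def)
qed

lemma lead_q_int: "lead_q (\<bar>m\<bar> - 1) (q_int m) (of_int (sgn m))"
proof -
  consider "m > 0" | "m = 0" | "m < 0" by linarith
  then show ?thesis
  proof cases
    case 3
    then show ?thesis using lead_q_minus[OF lead_q_int_pos[of "- m"]] by (simp add: q_int_minus)
  qed (use lead_q_int_pos in auto)
qed

lemma q_int_add_1: "q_int (m + 1) = inverse qq * q_int m + qq powi m"
  using q_minus_qinv_nonzero
  by (simp add: q_int_def field_simps power_int_add power_int_minus power_int_diff)

section \<open>Eigenvectors of a tridiagonal operator\<close>

text \<open>The operator on functions of \<open>c = 0, \<dots>, m\<close> through which the operators Z below act on
  one pair of letters, if t labels the eigenvalue on the inner letters.\<close>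

definition tri_eig :: "int \<Rightarrow> int \<Rightarrow> int \<Rightarrow> (int \<Rightarrow> cqx) \<Rightarrow> bool" where
  "tri_eig t m t' w \<longleftrightarrow> (\<forall>c. 0 \<le> c \<and> c \<le> m \<longrightarrow>
     q_int t' * w c = qq powi (2 * c - m) * q_int t * w c + q_int c * w (c - 1)
       + qq powi (2 * c + 1 - m) * q_int (m - c) * w (c + 1))"

text \<open>The algebraic core of the ladder, with q^c, q^m, q^t and q^t' as variables a, M, t and
  u. The hypotheses E1 and E2 are rows c and c - 1 of the old equation, multiplied by [m + 1 - c]
  and [c] up to a scalar: rows m + 1 and -1 do not exist, and exactly there these factors
  vanish.\<close>

lemma tri_eig_ladder_identity:
  fixes q a M t u :: "'k::field"
  assumes nz: "q \<noteq> 0" "a \<noteq> 0" "M \<noteq> 0" "t \<noteq> 0" "u \<noteq> 0" "h \<noteq> 0" and h: "h = q - inverse q"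
    and E1: "\<And>x. x * (M * q / a - a / (M * q)) * ((u - 1 / u) * w0)
      = x * (M * q / a - a / (M * q)) * (a\<^sup>2 / M * (t - 1 / t) * w0 + (a - 1 / a) * w1 + a\<^sup>2 * q / M * (M / a - a / M) * w2)"
    and E2: "\<And>x. x * (a - 1 / a) * ((u - 1 / u) * w1)
      = x * (a - 1 / a) * (a\<^sup>2 / (M * q\<^sup>2) * (t - 1 / t) * w1 + (a / q - q / a) * w3 + a\<^sup>2 / (M * q) * (M * q / a - a / (M * q)) * w0)"
    and e: "e * e = 1"
    and u': "u' - 1 / u' = q * (u - 1 / u) + h * 1 / u \<and> e = 1 \<or>  u' - 1 / u' = (u - 1 / u) / q - h / u \<and> e = - 1"
    and ue: "e = 1 \<Longrightarrow> ue = u" "e = - 1 \<Longrightarrow> ue = 1 / u"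
  shows "(u' - 1 / u') * ((M * q / a - a / (M * q)) * w0 + e * (ue * M * q / a) * (a - 1 / a) * w1)
    = a\<^sup>2 / (M * q) * (t - 1 / t) * ((M * q / a - a / (M * q)) * w0 + e * (ue * M * q / a) * (a - 1 / a) * w1)
      + (a - 1 / a) * ((M * q\<^sup>2 / a - a / (M * q\<^sup>2)) * w1 + e * (ue * M * q\<^sup>2 / a) * (a / q - q / a) * w3)
      + a\<^sup>2 / M * (M * q / a - a / (M * q)) * ((M / a - a / M) * w2 + e * (ue * M / a) * (a * q - 1 / (a * q)) * w0)"
    (is "?L = ?R")
proof -
  define F1 where "F1 = (M * q / a - a / (M * q)) * ((u - 1 / u) * w0)
      - (M * q / a - a / (M * q)) * (a\<^sup>2 / M * (t - 1 / t) * w0 + (a - 1 / a) * w1 + a\<^sup>2 * q / M * (M / a - a / M) * w2)"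
  define F2 where "F2 = (a - 1 / a) * ((u - 1 / u) * w1)
      - (a - 1 / a) * (a\<^sup>2 / (M * q\<^sup>2) * (t - 1 / t) * w1 + (a / q - q / a) * w3 + a\<^sup>2 / (M * q) * (M * q / a - a / (M * q)) * w0)"
  have F: "F1 = 0" "F2 = 0" using E1[of 1] E2[of 1] by (simp_all add: F1_def F2_def)
  \<comment> \<open>The defect of the new row is an explicit combination of the defects of the two
    old rows.\<close>
  have "?L - ?R = F1 / q + e * (ue * M * q\<^sup>2 / a) * F2"
    using u'
  proof
    assume "u' - 1 / u' = q * (u - 1 / u) + h * 1 / u \<and> e = 1"
    then show ?thesis unfolding F1_def F2_def using nz ue
      by (simp add: h) (simp add: field_simps power2_eq_square)
  next
    assume "u' - 1 / u' = (u - 1 / u) / q - h / u \<and> e = - 1"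
    then show ?thesis unfolding F1_def F2_def using nz ue
      by (simp add: h) (simp add: field_simps power2_eq_square)
  qed
  then show ?thesis by (simp add: F)
qed


text \<open>Enlarging m by one moves the eigenvalue label by e = 1 or e = -1. Starting from m = 0
  with the label t, this reaches the m + 1 labels t - m, t - m + 2, ..., t + m, as many as the
  operator has dimensions.\<close>

lemma tri_eig_ladder:
  assumes w: "tri_eig t m t' w" and m: "m \<ge> 0" and e: "e = 1 \<or> e = - 1"
  defines "w' \<equiv> \<lambda>c. q_int (m + 1 - c) * w c + of_int e * qq powi (e * t' + m + 1 - c) * q_int c * w (c - 1)"
  shows "tri_eig t (m + 1) (t' + e) w'"
  unfolding tri_eig_def
proof (intro allI impI)
  fix c :: int
  assume c: "0 \<le> c \<and> c \<le> m + 1"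
  define h where "h = qq - inverse qq"
  define a M T u u' ue where "a = qq powi c" "M = qq powi m" "T = qq powi t" "u = qq powi t'"
    "u' = qq powi (t' + e)" "ue = qq powi (e * t')"
  note abbr = this
  have h: "h \<noteq> 0" using q_minus_qinv_nonzero by (simp add: h_def power_int_minus)
  have nz: "qq \<noteq> 0" "a \<noteq> 0" "M \<noteq> 0" "T \<noteq> 0" "u \<noteq> 0" by (simp_all add: abbr)
  have qi: "q_int k = (qq powi k - 1 / qq powi k) / h" for k
    by (simp add: q_int_def h_def power_int_minus divide_inverse)
  have ex: "qq powi (2 * c - m) = a\<^sup>2 / M" "qq powi (2 * c + 1 - m) = a\<^sup>2 * qq / M"
     "qq powi (2 * (c - 1) - m) = a\<^sup>2 / (M * qq\<^sup>2)" "qq powi (2 * (c - 1) + 1 - m) = a\<^sup>2 / (M * qq)"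
     "qq powi (2 * c - (m + 1)) = a\<^sup>2 / (M * qq)" "qq powi (2 * c + 1 - (m + 1)) = a\<^sup>2 / M"
     "qq powi (m + 1 - c) = M * qq / a" "qq powi (m - c) = M / a" "qq powi (c - 1) = a / qq"
     "qq powi (c + 1) = a * qq" "qq powi (m - (c - 1)) = M * qq / a" "qq powi (m + 1 - (c - 1)) = M * qq\<^sup>2 / a"
     "qq powi (m + 1 - (c + 1)) = M / a"
     "qq powi (e * t' + m + 1 - c) = ue * M * qq / a" "qq powi (e * t' + m + 1 - (c - 1)) = ue * M * qq\<^sup>2 / a"
     "qq powi (e * t' + m + 1 - (c + 1)) = ue * M / a"
    by (simp_all add: abbr power_int_add power_int_diff power_int_mult field_simps power2_eq_square
        power_int_minus)
  have clear: "X * x0 = P * Y * x0 + Z * x1 + Q * V * x2"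
    if "h \<noteq> 0" "X / h * x0 = P * (Y / h) * x0 + Z / h * x1 + Q * (V / h) * x2" for X Y Z V P Q x0 x1 x2 :: cqx
    using that by (simp add: field_simps)
  have E1: "x * (M * qq / a - a / (M * qq)) * ((u - 1 / u) * w c)
      = x * (M * qq / a - a / (M * qq)) * (a\<^sup>2 / M * (T - 1 / T) * w c + (a - 1 / a) * w (c - 1) + a\<^sup>2 * qq / M * (M / a - a / M) * w (c + 1))" for x
  proof (cases "c \<le> m")
    case True
    then have "q_int t' * w c = qq powi (2 * c - m) * q_int t * w c + q_int c * w (c - 1)
       + qq powi (2 * c + 1 - m) * q_int (m - c) * w (c + 1)"
      using w c by (auto simp: tri_eig_def)
    then have "(u - 1 / u) * w c = a\<^sup>2 / M * (T - 1 / T) * w c + (a - 1 / a) * w (c - 1)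
      + a\<^sup>2 * qq / M * (M / a - a / M) * w (c + 1)"
      unfolding ex qi abbr(3,4,1)[symmetric] by - (rule clear[OF h], simp)
    then show ?thesis by simp
  next
    case False
    then have "c = m + 1" using c by simp
    then have "a = M * qq" by (simp add: abbr power_int_add)
    then show ?thesis using nz by simp
  qed
  have E2: "x * (a - 1 / a) * ((u - 1 / u) * w (c - 1))
      = x * (a - 1 / a) * (a\<^sup>2 / (M * qq\<^sup>2) * (T - 1 / T) * w (c - 1) + (a / qq - qq / a) * w (c - 2) + a\<^sup>2 / (M * qq) * (M * qq / a - a / (M * qq)) * w c)" for x
  proof (cases "c \<ge> 1")
    case True
    then have "q_int t' * w (c - 1) = qq powi (2 * (c - 1) - m) * q_int t * w (c - 1) + q_int (c - 1) * w (c - 1 - 1)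
       + qq powi (2 * (c - 1) + 1 - m) * q_int (m - (c - 1)) * w (c - 1 + 1)"
      using w c unfolding tri_eig_def by (metis diff_ge_0_iff_ge diff_le_eq)
    then have "(u - 1 / u) * w (c - 1) = a\<^sup>2 / (M * qq\<^sup>2) * (T - 1 / T) * w (c - 1) + (a / qq - qq / a) * w (c - 2)
      + a\<^sup>2 / (M * qq) * (M * qq / a - a / (M * qq)) * w c"
      unfolding ex qi abbr(3,4)[symmetric] by - (rule clear[OF h], simp)
    then show ?thesis by simp
  next
    case False
    then have "c = 0" using c by simp
    then have "a = 1" by (simp add: abbr)
    then show ?thesis by simp
  qed
  have u': "u' - 1 / u' = qq * (u - 1 / u) + h * 1 / u \<and> of_int e = (1::cqx)
      \<or> u' - 1 / u' = (u - 1 / u) / qq - h / u \<and> of_int e = - (1::cqx)"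
  proof (rule disjE[OF e])
    assume "e = 1"
    then have "u' = u * qq" by (simp add: abbr power_int_add)
    then show ?thesis using \<open>e = 1\<close> nz by (intro disjI1) (simp add: h_def field_simps)
  next
    assume "e = - 1"
    then have "u' = u / qq" by (simp add: abbr power_int_diff)
    moreover have "u / qq - 1 / (u / qq) = (u - 1 / u) / qq - h / u"
      using nz by (simp add: h_def field_simps)
    ultimately show ?thesis using \<open>e = - 1\<close> by simp
  qed
  have e2: "of_int e * of_int e = (1::cqx)" using e by auto
  \<comment> \<open>The sign e is an integer, but the identity sees only its image in the field; it
    can be recovered because 2 is nonzero there.\<close>
  have two: "(1::cqx) \<noteq> - 1"
    using two_neq_0_cqx by (metis add.right_inverse one_add_one)
  have ue1: "of_int e = (1::cqx) \<Longrightarrow> ue = u" and ue2: "of_int e = - (1::cqx) \<Longrightarrow> ue = 1 / u"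
    using e two by (auto simp: abbr power_int_minus divide_inverse)
  note key = tri_eig_ladder_identity[OF nz h h_def E1 E2 e2 u' ue1 ue2]
  have W: "w' c = ((M * qq / a - a / (M * qq)) * w c + of_int e * (ue * M * qq / a) * (a - 1 / a) * w (c - 1)) / h"
    "w' (c - 1) = ((M * qq\<^sup>2 / a - a / (M * qq\<^sup>2)) * w (c - 1) + of_int e * (ue * M * qq\<^sup>2 / a) * (a / qq - qq / a) * w (c - 2)) / h"
    "w' (c + 1) = ((M / a - a / M) * w (c + 1) + of_int e * (ue * M / a) * (a * qq - 1 / (a * qq)) * w c) / h"
    unfolding w'_def qi ex abbr(1)[symmetric] by (simp_all add: add_divide_distrib)
  have restore: "X / h * (W0 / h) = P * (Y / h) * (W0 / h) + Z / h * (W1 / h) + Q * (V / h) * (W2 / h)"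
    if "h \<noteq> 0" "X * W0 = P * Y * W0 + Z * W1 + Q * V * W2" for X Y Z V P Q W0 W1 W2 :: cqx
    using that by (simp add: field_simps)
  show "q_int (t' + e) * w' c = qq powi (2 * c - (m + 1)) * q_int t * w' c + q_int c * w' (c - 1)
       + qq powi (2 * c + 1 - (m + 1)) * q_int (m + 1 - c) * w' (c + 1)"
    unfolding W ex qi[of t] qi[of c] qi[of "m + 1 - c"] qi[of "t' + e"] abbr(3,5)[symmetric] abbr(1)[symmetric]
    using restore[OF h key] by simp
qed

lemma q_int_nonzero: "m \<noteq> 0 \<Longrightarrow> q_int m \<noteq> 0"
  using lead_q_nonzero[OF lead_q_int[of m]] by (auto simp: sgn_if)

text \<open>The value at 0 is multiplied by the nonzero [m + 1] at every rung of the ladder, so it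
  certifies that the eigenvector does not vanish. Climbing with e = 1 gives all labels but the
  lowest one, which needs e = -1.\<close>

lemma tri_eig_exists:
  assumes "k \<le> m"
  shows "\<exists>w. w 0 \<noteq> 0 \<and> tri_eig t (int m) (t + int m - 2 * int k) w"
  using assms
proof (induction m arbitrary: k)
  case 0
  show ?case using 0 by (intro exI[of _ "\<lambda>_. 1"]) (auto simp: tri_eig_def)
next
  case (Suc m)
  have step: "\<exists>w. w 0 \<noteq> 0 \<and> tri_eig t (int (Suc m)) (t' + e) w"
    if "w 0 \<noteq> 0" "tri_eig t (int m) t' w" "e = 1 \<or> e = - 1" for w t' e
    using tri_eig_ladder[OF that(2) _ that(3)] q_int_nonzero[of "int m + 1"] that(1)
    by (intro exI conjI) (auto simp: add.commute)
  show ?case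
  proof (cases "k \<le> m")
    case True
    then obtain w where "w 0 \<noteq> 0" "tri_eig t (int m) (t + int m - 2 * int k) w" using Suc by blast
    from step[OF this, of 1] show ?thesis by (simp add: algebra_simps)
  next
    case False
    then have k: "k = Suc m" using Suc by simp
    obtain w where "w 0 \<noteq> 0" "tri_eig t (int m) (t + int m - 2 * int m) w" using Suc by blast
    from step[OF this, of "- 1"] show ?thesis by (simp add: k algebra_simps)
  qed
qed

lemma tri_eig_scale: "tri_eig t m t' w \<Longrightarrow> tri_eig t m t' (\<lambda>c. x * w c)"
  unfolding tri_eig_def by (auto simp: algebra_simps)

text \<open>The two conditions say exactly that t' = t + m - 2k with 0 \<le> k \<le> m.\<close>

lemma tri_eig_primitive:
  assumes "\<bar>t' - t\<bar> \<le> m" "even (t + m - t')"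
  shows "\<exists>w L. tri_eig t m t' w \<and> (\<forall>c\<in>{0..m}. lead_q 0 (w c) (L c)) \<and> (\<exists>c\<in>{0..m}. L c \<noteq> 0)"
proof -
  obtain k where k: "t + m - t' = 2 * k" using assms(2) by (elim evenE)
  have "m \<ge> 0" "k \<ge> 0" "k \<le> m" using assms(1) k by auto
  then obtain w where w: "w 0 \<noteq> 0" "tri_eig t m t' w"
    using tri_eig_exists[of "nat k" "nat m" t] k that by (auto simp: nat_le_eq_zle algebra_simps)
  obtain d L where L: "\<forall>c\<in>{0..m}. lead_q d (w c) (L c)" "\<exists>c\<in>{0..m}. L c \<noteq> 0"
    using primitive_scaling[of "{0..m}" 0 w] w(1) \<open>m \<ge> 0\<close> by auto
  have "lead_q 0 (qq powi (- d) * w c) (L c)" if "c \<in> {0..m}" for c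
    using lead_q_qpow_mult[of d "w c" "L c" "- d"] L(1) that by simp
  then show ?thesis using tri_eig_scale[OF w(2)] L(2) by blast
qed

text \<open>Row c of the equation, read at the coefficient of q^D. The four terms have degrees at
  most |t'| - 1, 2c - m + |t| - 1, c - 1 and c; taking D as the largest of them leaves a short
  linear relation between neighbouring values of L.\<close>

lemma tri_eig_row:
  assumes w: "tri_eig t m t' w" and L: "\<forall>c\<in>{0..m}. lead_q 0 (w c) (L c)"
    and c: "0 \<le> c" "c \<le> m"
    and D: "D \<ge> \<bar>t'\<bar> - 1" "D \<ge> 2 * c - m + \<bar>t\<bar> - 1" "D \<ge> c - 1" "c < m \<Longrightarrow> D \<ge> c"
  shows "(if D = \<bar>t'\<bar> - 1 then of_int (sgn t') * L c else 0)
    = (if D = 2 * c - m + \<bar>t\<bar> - 1 then of_int (sgn t) * L c else 0)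
      + (if D = c - 1 then of_int (sgn c) * L (c - 1) else 0)
      + (if D = c \<and> c < m then L (c + 1) else 0)"
proof -
  have up: "lead_q D f (if D = d then l else 0)" if "lead_q d f l" "D \<ge> d" for d f l
    using that lead_q_lower[of d f l D] by auto
  have 1: "lead_q D (q_int t' * w c) (if D = \<bar>t'\<bar> - 1 then of_int (sgn t') * L c else 0)"
    using lead_q_mult[OF lead_q_int[of t'], of 0 "w c" "L c"] L c D by (intro up) auto
  have 2: "lead_q D (qq powi (2 * c - m) * q_int t * w c)
      (if D = 2 * c - m + \<bar>t\<bar> - 1 then of_int (sgn t) * L c else 0)"
    using lead_q_mult[OF lead_q_qpow_mult[OF lead_q_int[of t], of "2 * c - m"], of 0 "w c" "L c"] L c D
    by (intro up) (auto simp: add_diff_eq)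
  have 3: "lead_q D (q_int c * w (c - 1)) (if D = c - 1 then of_int (sgn c) * L (c - 1) else 0)"
  proof (cases "c = 0")
    case False
    then show ?thesis
      using lead_q_mult[OF lead_q_int[of c], of 0 "w (c - 1)" "L (c - 1)"] L c D by (intro up) auto
  qed simp
  have 4: "lead_q D (qq powi (2 * c + 1 - m) * q_int (m - c) * w (c + 1)) (if D = c \<and> c < m then L (c + 1) else 0)"
  proof (cases "c = m")
    case False
    then have cm: "c < m" using c by simp
    have "lead_q ((2 * c + 1 - m) + (m - c - 1) + 0) (qq powi (2 * c + 1 - m) * q_int (m - c) * w (c + 1)) (1 * L (c + 1))"
      using L c cm by (intro lead_q_mult lead_q_qpow_mult lead_q_int_pos) auto
    then have "lead_q c (qq powi (2 * c + 1 - m) * q_int (m - c) * w (c + 1)) (L (c + 1))"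
      by (simp add: algebra_simps)
    from up[OF this D(4)[OF cm]] show ?thesis using cm by simp
  qed simp
  have "q_int t' * w c = qq powi (2 * c - m) * q_int t * w c + q_int c * w (c - 1)
       + qq powi (2 * c + 1 - m) * q_int (m - c) * w (c + 1)"
    using w c by (auto simp: tri_eig_def)
  then show ?thesis
    using lead_q_unique[OF 1] lead_q_add[OF lead_q_add[OF 2 3] 4] by simp
qed

lemma tri_eig_normalize:
  assumes w: "tri_eig t m t' w" and L: "\<forall>c\<in>{0..m}. lead_q 0 (w c) (L c)"
    and ne: "L c0 \<noteq> 0"
  shows "\<exists>w'. tri_eig t m t' w' \<and> (\<forall>c\<in>{0..m}. lead_q 0 (w' c) (L c / L c0))"
proof -
  have "lead_q 0 (const_x (inverse (L c0)) * w c) (L c / L c0)" if "c \<in> {0..m}" for c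
    using lead_q_mult[OF lead_q_const_x[of "inverse (L c0)"], of 0 "w c" "L c"] L that
    by (simp add: divide_inverse mult.commute)
  then show ?thesis using tri_eig_scale[OF w] by blast
qed

text \<open>If a < |t|, the diagonal terms win in every row: for c > c0 the degree 2c - m + |t| - 1
  of the operator is strictly the largest, for c < c0 the degree |t'| - 1 of the eigenvalue. Either
  way L c = 0, and only c = c0, where the two degrees agree, survives.\<close>

lemma tri_eig_single:
  assumes a: "0 \<le> a" "a < \<bar>t\<bar>" and c0: "c0 \<ge> 0"
  shows "\<exists>w. tri_eig t (a + c0) (sgn t * (\<bar>t\<bar> + c0 - a)) w
     \<and> (\<forall>c\<in>{0..a + c0}. lead_q 0 (w c) (if c = c0 then 1 else 0))"
proof -
  define m where "m = a + c0"
  define t' where "t' = sgn t * (\<bar>t\<bar> + c0 - a)"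
  have t': "\<bar>t'\<bar> = \<bar>t\<bar> + c0 - a" using a c0 by (auto simp: t'_def sgn_if)
  have "\<bar>t' - t\<bar> \<le> m" "even (t + m - t')" using a c0 by (auto simp: t'_def m_def sgn_if)
  then obtain w L where w: "tri_eig t m t' w" and L: "\<forall>c\<in>{0..m}. lead_q 0 (w c) (L c)"
    and ne: "\<exists>c\<in>{0..m}. L c \<noteq> 0"
    using tri_eig_primitive by blast
  have z: "L c = 0" if c: "0 \<le> c" "c \<le> m" "c \<noteq> c0" for c
  proof (cases "c > c0")
    case True
    then show ?thesis
      using tri_eig_row[OF w L c(1,2), of "2 * c - m + \<bar>t\<bar> - 1"] a c0 t' m_def
      by (auto simp: sgn_if split: if_splits)
  next
    case False
    then show ?thesis
      using tri_eig_row[OF w L c(1,2), of "\<bar>t'\<bar> - 1"] a c0 c t' m_def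
      by (auto simp: sgn_if split: if_splits)
  qed
  have "L c0 \<noteq> 0" using ne z by (metis atLeastAtMost_iff)
  from tri_eig_normalize[OF w L this] obtain w' where
    w': "tri_eig t m t' w'" "\<forall>c\<in>{0..m}. lead_q 0 (w' c) (L c / L c0)" by blast
  have "L c / L c0 = (if c = c0 then 1 else 0)" if "c \<in> {0..m}" for c
    using z[of c] that \<open>L c0 \<noteq> 0\<close> by auto
  then show ?thesis using w' unfolding m_def t'_def by (intro exI[of _ w']) auto
qed

text \<open>If |t| \<le> a, two neighbouring values survive: the coefficient of q^(\<tau> - 1) in
  row \<tau> - 1 reads e L(\<tau> - 1) = L(\<tau>). For \<tau> = 0 the second value lies outside of
  the range, and the reduction is a single basis vector.\<close>

lemma tri_eig_pair:
  assumes a: "\<bar>t\<bar> \<le> a" "even (t - a)" and \<tau>: "\<tau> \<ge> 0" and e: "e = 1 \<or> e = - 1"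
  shows "\<exists>w. tri_eig t (a + \<tau>) (e * \<tau>) w
     \<and> (\<forall>c\<in>{0..a + \<tau>}. lead_q 0 (w c) (if c = \<tau> then 1 else if c = \<tau> - 1 then of_int e else 0))"
proof -
  define m where "m = a + \<tau>"
  define t' where "t' = e * \<tau>"
  have t': "\<bar>t'\<bar> = \<tau>" using \<tau> e by (auto simp: t'_def)
  have a0: "a \<ge> 0" using a by simp
  have "\<bar>t' - t\<bar> \<le> m" "even (t + m - t')" using a \<tau> e by (auto simp: t'_def m_def)
  then obtain w L where w: "tri_eig t m t' w" and L: "\<forall>c\<in>{0..m}. lead_q 0 (w c) (L c)"
    and ne: "\<exists>c\<in>{0..m}. L c \<noteq> 0"
    using tri_eig_primitive by blast
  have z: "L c = 0" if c: "0 \<le> c" "c \<le> m" "c \<noteq> \<tau>" "c \<noteq> \<tau> - 1" for c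
  proof -
    consider "c < \<tau> - 1" | "c > \<tau>" "m - c \<ge> \<bar>t\<bar> - 1" | "c > \<tau>" "m - c \<le> \<bar>t\<bar> - 2"
      using c by linarith
    then show ?thesis
    proof cases
      case 1
      then show ?thesis
        using tri_eig_row[OF w L c(1,2), of "\<tau> - 1"] a \<tau> c t' m_def e t'_def
        by (auto simp: sgn_if split: if_splits)
    next
      \<comment> \<open>In row c - 1 the term with w c is the only one of degree c - 1.\<close>
      case 2
      then show ?thesis
        using tri_eig_row[OF w L, of "c - 1" "c - 1"] a \<tau> c t' m_def
        by (auto simp: sgn_if split: if_splits)
    next
      case 3
      then show ?thesis
        using tri_eig_row[OF w L c(1,2), of "2 * c - m + \<bar>t\<bar> - 1"] a \<tau> c t' m_def
        by (auto simp: sgn_if split: if_splits)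
    qed
  qed
  have r': "of_int e * L (\<tau> - 1) = L \<tau>" if "\<tau> \<ge> 1"
    using tri_eig_row[OF w L, of "\<tau> - 1" "\<tau> - 1"] a a0 \<tau> that t' m_def e t'_def
    by (auto simp: sgn_if split: if_splits)
  have r: "L (\<tau> - 1) = of_int e * L \<tau>" if "\<tau> \<ge> 1"
    unfolding r'[OF that, symmetric] using e by auto
  have ne': "L \<tau> \<noteq> 0"
  proof
    assume 0: "L \<tau> = 0"
    obtain c where c: "0 \<le> c" "c \<le> m" "L c \<noteq> 0" using ne by auto
    then have "c = \<tau> - 1" using z 0 by metis
    then show False using r 0 c by auto
  qed
  from tri_eig_normalize[OF w L ne'] obtain w' where
    w': "tri_eig t m t' w'" "\<forall>c\<in>{0..m}. lead_q 0 (w' c) (L c / L \<tau>)" by blast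
  have "L c / L \<tau> = (if c = \<tau> then 1 else if c = \<tau> - 1 then of_int e else 0)" if "c \<in> {0..m}" for c
    using z[of c] r that ne' by auto
  then show ?thesis using w' unfolding m_def t'_def by (intro exI[of _ w']) auto
qed

section \<open>The R-matrix of the vector representation\<close>

lemma ee_eq_iff [simp]: "ee j = ee k \<longleftrightarrow> j = k"
  by (auto simp: ee_def fun_eq_iff split: if_splits)

lemma W_F_eq:
  assumes "n \<ge> 2" "i < n"
  shows "W_F n u i j k = (if j = pos n i \<and> k = i + 1 then (if i = 0 then inverse u else 1) else 0)"
proof -
  have p: "pos n i \<noteq> i + 1" using assms by (auto simp: pos_def)
  show ?thesis
  proof (cases "j = pos n i")
    case True
    have "(\<lambda>l. ee j l - ee (pos n i) l + ee (i + 1) l) = ee (i + 1)" by (simp add: True)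
    moreover have "kr_vec (ee (i + 1)) = unit_vec (ee (i + 1))" by (auto simp: kr_vec_def ee_def)
    moreover have "ee j (i + 1) = 0" using p True by (simp add: ee_def)
    ultimately show ?thesis
      using True by (simp add: W_F_def on_W_def kr_F_def unit_vec_def)
  next
    case False
    have "ee j (pos n i) - ee (pos n i) (pos n i) + ee (i + 1) (pos n i) < 0"
      using False p by (simp add: ee_def)
    then have "kr_vec (\<lambda>l. ee j l - ee (pos n i) l + ee (i + 1) l) = (\<lambda>_. 0)"
      unfolding kr_vec_def by (simp only: if_P[OF exI[of _ "pos n i"]])
    then show ?thesis using False by (simp add: W_F_def on_W_def kr_F_def)
  qed
qed

lemma W_E_eq:
  assumes "n \<ge> 2" "i < n"
  shows "W_E n u i j k = (if j = i + 1 \<and> k = pos n i then (if i = 0 then u else 1) else 0)"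
proof -
  have p: "pos n i \<noteq> i + 1" using assms by (auto simp: pos_def)
  show ?thesis
  proof (cases "j = i + 1")
    case True
    have "(\<lambda>l. ee j l + ee (pos n i) l - ee (i + 1) l) = ee (pos n i)" by (simp add: True)
    moreover have "kr_vec (ee (pos n i)) = unit_vec (ee (pos n i))" by (auto simp: kr_vec_def ee_def)
    moreover have "ee j (pos n i) = 0" using p True by (simp add: ee_def)
    ultimately show ?thesis
      using True by (simp add: W_E_def on_W_def kr_E_def unit_vec_def)
  next
    case False
    have "ee j (i + 1) + ee (pos n i) (i + 1) - ee (i + 1) (i + 1) < 0"
      using False p by (simp add: ee_def)
    then have "kr_vec (\<lambda>l. ee j l + ee (pos n i) l - ee (i + 1) l) = (\<lambda>_. 0)"
      unfolding kr_vec_def by (simp only: if_P[OF exI[of _ "i + 1"]])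
    then show ?thesis using False by (simp add: W_E_def on_W_def kr_E_def)
  qed
qed

lemma W_K_eq: "W_K n i m j k = (if j = k then qq powi (m * (ee j (pos n i) - ee j (i + 1))) else 0)"
proof -
  have "kr_vec (ee j) = unit_vec (ee j)" by (auto simp: kr_vec_def ee_def)
  then show ?thesis by (auto simp: W_K_def on_W_def kr_K_def unit_vec_def)
qed

lemma lin_unit_vec: "finite B \<Longrightarrow> b \<in> B \<Longrightarrow> lin B M (unit_vec b) = M b"
  by (rule ext) (simp add: lin_def unit_vec_def if_distrib[of "\<lambda>x. x * _"] cong: if_cong)

lemma sum_two:
  fixes f :: "'b \<Rightarrow> cqx"
  assumes "finite B" "b \<in> B" "b' \<in> B"
    and "\<And>a. a \<in> B \<Longrightarrow> f a = (if a = b then x else 0) + (if a = b' then x' else 0)"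
  shows "sum f B = x + x'"
proof -
  have "sum f B = (\<Sum>a\<in>B. (if a = b then x else 0) + (if a = b' then x' else 0))"
    using assms by (intro sum.cong) auto
  then show ?thesis using assms by (simp add: sum.distrib)
qed

text \<open>Here z is the ratio v / u. The common scalar is fixed so that every entry is linear in z
  and the value at z = 0 is the Hecke generator T.\<close>

definition R_explicit :: "cqx \<Rightarrow> (nat \<times> nat, nat \<times> nat) lmap" where
  "R_explicit z = (\<lambda>(j, k) (j', k').
     if j = k then (if j' = j \<and> k' = j then qq - z / qq else 0)
     else if j' = j \<and> k' = k then (if j < k then 1 else z) * (qq - inverse qq)
     else if j' = k \<and> k' = j then 1 - z else 0)"

text \<open>Node i joins the cyclically consecutive letters p and t: F_i replaces p by t, and E_i
  replaces t by p. The coproduct therefore contributes at most two terms to each side of an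
  intertwining relation; the following lemmas list them.\<close>

context
  fixes n i p t :: nat
  assumes n: "n \<ge> 2" and i: "i < n"
  defines "p \<equiv> pos n i" and "t \<equiv> i + 1"
begin

lemma node_range: "p \<in> {1..n}" "t \<in> {1..n}" "p \<noteq> t"
  using n i by (auto simp: p_def t_def pos_def)

lemma WW_F_left:
  assumes "j \<in> {1..n}" "k \<in> {1..n}"
  shows "lin ({1..n} \<times> {1..n}) R (WW_F n u v i (j, k)) b'
    = (if j = p then (if i = 0 then inverse u else 1) * qq powi (ee k t - ee k p) * R (t, k) b' else 0)
      + (if k = p then (if i = 0 then inverse v else 1) * R (j, t) b' else 0)"
  unfolding lin_def
proof (rule sum_two[where b = "(t, k)" and b' = "(j, t)"])
  fix b :: "nat \<times> nat"
  assume "b \<in> {1..n} \<times> {1..n}"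
  then obtain a c where b: "b = (a, c)" by auto
  show "WW_F n u v i (j, k) b * R b b' = (if b = (t, k) then (if j = p then (if i = 0 then inverse u else 1) * qq powi (ee k t - ee k p) * R (t, k) b' else 0) else 0)
    + (if b = (j, t) then (if k = p then (if i = 0 then inverse v else 1) * R (j, t) b' else 0) else 0)"
    using node_range(3)
    unfolding b WW_F_def WW_E_def add_lmap_def tensor_def W_F_eq[OF n i] W_E_eq[OF n i] W_K_eq
      p_def[symmetric] t_def[symmetric] unit_vec_def prod.case
    by (cases "j = p"; cases "k = p"; cases "a = t"; cases "c = t"; simp; auto)
qed (use assms node_range in auto)

lemma WW_F_right:
  assumes "j \<in> {1..n}" "k \<in> {1..n}"
  shows "lin ({1..n} \<times> {1..n}) (WW_F n v u i) g (j, k)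
    = (if j = t then (if i = 0 then inverse v else 1) * qq powi (ee k t - ee k p) * g (p, k) else 0)
      + (if k = t then (if i = 0 then inverse u else 1) * g (j, p) else 0)"
  unfolding lin_def
proof (rule sum_two[where b = "(p, k)" and b' = "(j, p)"])
  fix b :: "nat \<times> nat"
  assume "b \<in> {1..n} \<times> {1..n}"
  then obtain a c where b: "b = (a, c)" by auto
  show "g b * WW_F n v u i b (j, k) = (if b = (p, k) then (if j = t then (if i = 0 then inverse v else 1) * qq powi (ee k t - ee k p) * g (p, k) else 0) else 0)
    + (if b = (j, p) then (if k = t then (if i = 0 then inverse u else 1) * g (j, p) else 0) else 0)"
    using node_range(3)
    unfolding b WW_F_def WW_E_def add_lmap_def tensor_def W_F_eq[OF n i] W_E_eq[OF n i] W_K_eq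
      p_def[symmetric] t_def[symmetric] unit_vec_def prod.case
    by (cases "j = t"; cases "k = t"; cases "a = p"; cases "c = p"; simp; auto)
qed (use assms node_range in auto)

lemma WW_E_left:
  assumes "j \<in> {1..n}" "k \<in> {1..n}"
  shows "lin ({1..n} \<times> {1..n}) R (WW_E n u v i (j, k)) b'
    = (if j = t then (if i = 0 then u else 1) * R (p, k) b' else 0)
      + (if k = t then (if i = 0 then v else 1) * qq powi (ee j p - ee j t) * R (j, p) b' else 0)"
  unfolding lin_def
proof (rule sum_two[where b = "(p, k)" and b' = "(j, p)"])
  fix b :: "nat \<times> nat"
  assume "b \<in> {1..n} \<times> {1..n}"
  then obtain a c where b: "b = (a, c)" by auto
  show "WW_E n u v i (j, k) b * R b b' = (if b = (p, k) then (if j = t then (if i = 0 then u else 1) * R (p, k) b' else 0) else 0)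
    + (if b = (j, p) then (if k = t then (if i = 0 then v else 1) * qq powi (ee j p - ee j t) * R (j, p) b' else 0) else 0)"
    using node_range(3)
    unfolding b WW_F_def WW_E_def add_lmap_def tensor_def W_F_eq[OF n i] W_E_eq[OF n i] W_K_eq
      p_def[symmetric] t_def[symmetric] unit_vec_def prod.case
    by (cases "j = t"; cases "k = t"; cases "a = p"; cases "c = p"; simp; auto)
qed (use assms node_range in auto)

lemma WW_E_right:
  assumes "j \<in> {1..n}" "k \<in> {1..n}"
  shows "lin ({1..n} \<times> {1..n}) (WW_E n v u i) g (j, k)
    = (if j = p then (if i = 0 then v else 1) * g (t, k) else 0)
      + (if k = p then (if i = 0 then u else 1) * qq powi (ee j p - ee j t) * g (j, t) else 0)"
  unfolding lin_def
proof (rule sum_two[where b = "(t, k)" and b' = "(j, t)"])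
  fix b :: "nat \<times> nat"
  assume "b \<in> {1..n} \<times> {1..n}"
  then obtain a c where b: "b = (a, c)" by auto
  show "g b * WW_E n v u i b (j, k) = (if b = (t, k) then (if j = p then (if i = 0 then v else 1) * g (t, k) else 0) else 0)
    + (if b = (j, t) then (if k = p then (if i = 0 then u else 1) * qq powi (ee j p - ee j t) * g (j, t) else 0) else 0)"
    using node_range(3)
    unfolding b WW_F_def WW_E_def add_lmap_def tensor_def W_F_eq[OF n i] W_E_eq[OF n i] W_K_eq
      p_def[symmetric] t_def[symmetric] unit_vec_def prod.case
    by (cases "j = p"; cases "k = p"; cases "a = t"; cases "c = t"; simp; auto)
qed (use assms node_range in auto)

lemma WW_K_left:
  assumes "j \<in> {1..n}" "k \<in> {1..n}"
  shows "lin ({1..n} \<times> {1..n}) R (WW_K n i m (j, k)) b' = qq powi (m * (ee j p - ee j t + ee k p - ee k t)) * R (j, k) b'"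
proof -
  have "WW_K n i m (j, k) b * R b b' = (if b = (j, k) then qq powi (m * (ee j p - ee j t + ee k p - ee k t)) * R (j, k) b' else 0)" for b
    unfolding WW_K_def tensor_def W_K_eq p_def[symmetric] t_def[symmetric]
    by (cases b) (auto simp: power_int_add[symmetric] algebra_simps)
  then show ?thesis unfolding lin_def using assms by simp
qed

lemma WW_K_right:
  assumes "j \<in> {1..n}" "k \<in> {1..n}"
  shows "lin ({1..n} \<times> {1..n}) (WW_K n i m) g (j, k) = qq powi (m * (ee j p - ee j t + ee k p - ee k t)) * g (j, k)"
proof -
  have "g b * WW_K n i m b (j, k) = (if b = (j, k) then qq powi (m * (ee j p - ee j t + ee k p - ee k t)) * g (j, k) else 0)" for b
    unfolding WW_K_def tensor_def W_K_eq p_def[symmetric] t_def[symmetric]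
    by (cases b) (auto simp: power_int_add[symmetric] algebra_simps)
  then show ?thesis unfolding lin_def using assms by simp
qed

end

section \<open>Uniqueness of the R-matrix up to a scalar\<close>

lemma R_matrix_relations:
  assumes R: "is_R_matrix n u v R" and n: "n \<ge> 2" and i: "i < n"
    and jk: "j \<in> {1..n}" "k \<in> {1..n}" "j' \<in> {1..n}" "k' \<in> {1..n}"
  defines "p \<equiv> pos n i" and "t \<equiv> i + 1"
  shows "(if j = p then (if i = 0 then inverse u else 1) * qq powi (ee k t - ee k p) * R (t, k) (j', k') else 0)
      + (if k = p then (if i = 0 then inverse v else 1) * R (j, t) (j', k') else 0)
    = (if j' = t then (if i = 0 then inverse v else 1) * qq powi (ee k' t - ee k' p) * R (j, k) (p, k') else 0)
      + (if k' = t then (if i = 0 then inverse u else 1) * R (j, k) (j', p) else 0)" (is ?F)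
    and "R (j, k) (j', k') \<noteq> 0 \<Longrightarrow>
      ee j p - ee j t + ee k p - ee k t = ee j' p - ee j' t + ee k' p - ee k' t"
proof -
  have b: "(j, k) \<in> {1..n} \<times> {1..n}" using jk by simp
  have "lin ({1..n} \<times> {1..n}) R (WW_F n u v i (j, k)) (j', k')
      = lin ({1..n} \<times> {1..n}) (WW_F n v u i) (R (j, k)) (j', k')"
    and K: "lin ({1..n} \<times> {1..n}) R (WW_K n i 1 (j, k)) (j', k')
      = lin ({1..n} \<times> {1..n}) (WW_K n i 1) (R (j, k)) (j', k')"
  proof -
    have "intertwines ({1..n} \<times> {1..n}) ({1..n} \<times> {1..n}) R (WW_F n u v i) (WW_F n v u i)"
      "intertwines ({1..n} \<times> {1..n}) ({1..n} \<times> {1..n}) R (WW_K n i 1) (WW_K n i 1)"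
      using R i unfolding is_R_matrix_def Let_def by blast+
    then show "lin ({1..n} \<times> {1..n}) R (WW_F n u v i (j, k)) (j', k')
      = lin ({1..n} \<times> {1..n}) (WW_F n v u i) (R (j, k)) (j', k')"
      "lin ({1..n} \<times> {1..n}) R (WW_K n i 1 (j, k)) (j', k')
      = lin ({1..n} \<times> {1..n}) (WW_K n i 1) (R (j, k)) (j', k')"
      using b unfolding intertwines_def by metis+
  qed
  then show ?F
    using jk unfolding p_def t_def by (simp only: WW_F_left[OF n i] WW_F_right[OF n i])
  assume nz: "R (j, k) (j', k') \<noteq> 0"
  have "qq powi (1 * (ee j p - ee j t + ee k p - ee k t)) = qq powi (1 * (ee j' p - ee j' t + ee k' p - ee k' t))"
    using K nz jk unfolding p_def t_def by (simp only: WW_K_left[OF n i] WW_K_right[OF n i]) simp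
  then show "ee j p - ee j t + ee k p - ee k t = ee j' p - ee j' t + ee k' p - ee k' t"
    by (simp only: qq_powi_eq_iff) simp
qed

text \<open>The weights at the nodes determine the content of a pair of letters up to a constant
  added at all letters, and the constant is 0 because both contents have total 2.\<close>

lemma weights_determine_pair:
  assumes n: "n \<ge> 1" and jk: "j \<in> {1..n}" "k \<in> {1..n}" "j' \<in> {1..n}" "k' \<in> {1..n}"
    and w: "\<And>i. i < n \<Longrightarrow> ee j (pos n i) - ee j (i + 1) + ee k (pos n i) - ee k (i + 1)
      = ee j' (pos n i) - ee j' (i + 1) + ee k' (pos n i) - ee k' (i + 1)"
  shows "(j', k') = (j, k) \<or> (j', k') = (k, j)"
proof -
  define f where "f l = ee j l + ee k l - ee j' l - ee k' l" for l
  have succ: "f (Suc l) = f l" if "1 \<le> l" "l < n" for l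
    using w[of l] that by (simp add: f_def pos_def)
  have const: "1 \<le> l \<Longrightarrow> l \<le> n \<Longrightarrow> f l = f 1" for l
  proof (induction l rule: dec_induct)
    case (step m)
    then have "f (Suc m) = f m" by (intro succ) auto
    then show ?case using step by simp
  qed simp
  have one: "sum (ee m) {1..n} = 1" if "m \<in> {1..n}" for m
    using that by (simp add: ee_def)
  have "(\<Sum>l=1..n. f l) = 0"
    unfolding f_def sum_subtractf sum.distrib using jk by (simp only: one)
  moreover have "(\<Sum>l=1..n. f l) = (\<Sum>l=1..n. f 1)"
    by (intro sum.cong refl const) simp_all
  ultimately have "f 1 = 0" using n by simp
  then have "f l = 0" if "l \<in> {1..n}" for l using const[of l] that by simp
  then have "f j = 0" "f k = 0" using jk by blast+
  then show ?thesis unfolding f_def ee_def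
    by (cases "j' = j"; cases "k' = j"; cases "j' = k"; cases "k' = k"; cases "j = k"; simp)
qed

text \<open>An argument may be moved by one as long as it does not meet the other argument, so only
  the order of the two arguments matters.\<close>

lemma shift_invariant:
  fixes f :: "nat \<Rightarrow> nat \<Rightarrow> cqx"
  assumes l: "\<And>p k. 1 \<le> p \<Longrightarrow> p < n \<Longrightarrow> k \<in> {1..n} \<Longrightarrow> k \<noteq> p \<Longrightarrow> k \<noteq> p + 1 \<Longrightarrow> f (p + 1) k = f p k"
    and r: "\<And>p k. 1 \<le> p \<Longrightarrow> p < n \<Longrightarrow> k \<in> {1..n} \<Longrightarrow> k \<noteq> p \<Longrightarrow> k \<noteq> p + 1 \<Longrightarrow> f k (p + 1) = f k p"
  shows "1 \<le> j \<Longrightarrow> j < k \<Longrightarrow> k \<le> n \<Longrightarrow> f j k = f 1 n"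
    and "1 \<le> k \<Longrightarrow> k < j \<Longrightarrow> j \<le> n \<Longrightarrow> f j k = f n 1"
proof -
  have r': "f j m = f j k" if "1 \<le> j" "j < k" "k \<le> m" "m \<le> n" for j k m
    using that(3,4)
  proof (induction m rule: dec_induct)
    case (step m)
    then show ?case using r[of m j] that by simp
  qed simp
  have l': "f m k = f j k" if "1 \<le> j" "j \<le> m" "m < k" "k \<le> n" for j k m
    using that(2,3)
  proof (induction m rule: dec_induct)
    case (step m)
    then show ?case using l[of m k] that by simp
  qed simp
  have l'': "f m k = f j k" if "1 \<le> k" "k < j" "j \<le> m" "m \<le> n" for j k m
    using that(3,4)
  proof (induction m rule: dec_induct)
    case (step m)
    then show ?case using l[of m k] that by simp
  qed simp
  have r'': "f j m = f j k" if "1 \<le> k" "k \<le> m" "m < j" "j \<le> n" for j k m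
    using that(2,3)
  proof (induction m rule: dec_induct)
    case (step m)
    then show ?case using r[of m j] that by simp
  qed simp
  show "1 \<le> j \<Longrightarrow> j < k \<Longrightarrow> k \<le> n \<Longrightarrow> f j k = f 1 n"
    using r'[of j k n] l'[of 1 j n] by simp
  show "1 \<le> k \<Longrightarrow> k < j \<Longrightarrow> j \<le> n \<Longrightarrow> f j k = f n 1"
    using l''[of k j n] r''[of 1 k n] by simp
qed

text \<open>By weights, the image of (j, k) lies in the span of (j, k) and (k, j). The nodes 1, ...,
  n - 1 reduce the unknowns to one entry r for equal letters and two entries for each order of
  distinct letters. Node 0 ties the two orders together through v / u; this uses the letter 2, which
  for n \<ge> 3 differs from the letters n and 1 of that node. The remaining linear system has one
  free parameter because v / u is not q^2.\<close>

lemma R_matrix_unique: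
  assumes R: "is_R_matrix n u v R" and n: "n \<ge> 3" and uv: "u \<noteq> 0" "v \<noteq> 0" "v / u \<noteq> qq\<^sup>2"
  shows "\<exists>c. c \<noteq> 0 \<and> (\<forall>b\<in>{1..n} \<times> {1..n}. \<forall>b'. R b b' = c * R_explicit (v / u) b b')"
proof -
  let ?B = "{1..n} \<times> {1..n}"
  have n2: "n \<ge> 2" using n by simp
  note F = R_matrix_relations(1)[OF R n2]
  have supp: "R (j, k) (j', k') = 0"
    if "j \<in> {1..n}" "k \<in> {1..n}" "(j', k') \<noteq> (j, k)" "(j', k') \<noteq> (k, j)" for j k j' k'
  proof (cases "(j', k') \<in> ?B")
    case True
    show ?thesis
    proof (rule ccontr)
      assume nz: "R (j, k) (j', k') \<noteq> 0"
      have r': "j' \<in> {1..n}" "k' \<in> {1..n}" using True by blast+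
      have "(j', k') = (j, k) \<or> (j', k') = (k, j)"
      proof (rule weights_determine_pair[OF _ that(1,2) r'])
        show "1 \<le> n" using n by simp
      qed (rule R_matrix_relations(2)[OF R n2 _ that(1,2) r' nz])
      then show False using that(3,4) by blast
    qed
  next
    case False
    have "R (j, k) \<in> vspan ?B" using R that(1,2) unfolding is_R_matrix_def Let_def by blast
    then show ?thesis using False unfolding vspan_def by blast
  qed
  define A where "A j k = R (j, k) (j, k)" for j k
  define D where "D j k = R (j, k) (k, j)" for j k
  have adj: "A (p + 1) (p + 1) = A p p \<and> A p (p + 1) + inverse qq * D (p + 1) p = A p p
      \<and> inverse qq * A (p + 1) p + D p (p + 1) = inverse qq * A p p" if p: "1 \<le> p" "p < n" for p
  proof -
    have i: "p < n" and r: "p \<in> {1..n}" "p + 1 \<in> {1..n}" "pos n p = p" "p \<noteq> 0" using p by (auto simp: pos_def)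
    have 1: "inverse qq * R (p + 1, p) (p + 1, p) + R (p, p + 1) (p + 1, p) = inverse qq * R (p, p) (p, p)"
      using F[OF i r(1,1,2,1)] r by (simp add: ee_def power_int_minus)
    have 2: "inverse qq * R (p + 1, p) (p, p + 1) + R (p, p + 1) (p, p + 1) = R (p, p) (p, p)"
      using F[OF i r(1,1,1,2)] r by (simp add: ee_def power_int_minus)
    have 3: "R (p + 1, p + 1) (p + 1, p + 1) = qq * R (p + 1, p) (p, p + 1) + R (p + 1, p) (p + 1, p)"
      using F[OF i r(2,1,2,2)] r by (simp add: ee_def power_int_minus)
    have 4: "qq * R (p + 1, p + 1) (p + 1, p + 1) = qq * R (p, p + 1) (p, p + 1) + R (p, p + 1) (p + 1, p)"
      using F[OF i r(1,2,2,2)] r by (simp add: ee_def power_int_minus)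
    \<comment> \<open>The four relations involve the same block of entries for p and p + 1;
      eliminating it leaves (q + 1/q) (?r - ?r') = 0.\<close>
    let ?r = "R (p + 1, p + 1) (p + 1, p + 1)" and ?r' = "R (p, p) (p, p)"
    have "inverse qq * ?r + qq * ?r
        = inverse qq * (qq * R (p + 1, p) (p, p + 1) + R (p + 1, p) (p + 1, p))
          + (qq * R (p, p + 1) (p, p + 1) + R (p, p + 1) (p + 1, p))"
      unfolding 4 by (simp only: 3)
    also have "\<dots> = qq * (inverse qq * R (p + 1, p) (p, p + 1) + R (p, p + 1) (p, p + 1))
          + (inverse qq * R (p + 1, p) (p + 1, p) + R (p, p + 1) (p + 1, p))"
      by (simp add: field_simps)
    also have "\<dots> = inverse qq * ?r' + qq * ?r'" unfolding 1 2 by simp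
    finally have "inverse qq * ?r + qq * ?r = inverse qq * ?r' + qq * ?r'" .
    then have "(inverse qq + qq) * (?r - ?r') = 0" by (simp add: algebra_simps)
    moreover have "inverse qq + qq \<noteq> 0"
    proof -
      have "lead_q 1 (inverse qq + qq) (0 + 1)"
        using lead_q_lower[OF lead_q_inverse[OF lead_q_qq], of 1] by (intro lead_q_add lead_q_qq) auto
      then show ?thesis using lead_q_nonzero by fastforce
    qed
    ultimately have "?r = ?r'" by simp
    then show ?thesis using 1 2 by (simp add: A_def D_def add.commute)
  qed
  have shift: "A (p + 1) k = A p k \<and> D (p + 1) k = D p k \<and> A k (p + 1) = A k p \<and> D k (p + 1) = D k p"
    if "1 \<le> p" "p < n" "k \<in> {1..n}" "k \<noteq> p" "k \<noteq> p + 1" for p k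
  proof -
    have i: "p < n" and r: "p \<in> {1..n}" "p + 1 \<in> {1..n}" "k \<in> {1..n}" "pos n p = p" "p \<noteq> 0"
      using that by (auto simp: pos_def)
    show ?thesis
      using F[OF i r(1,3,2,3)] F[OF i r(1,3,3,2)] F[OF i r(3,1,2,3)] F[OF i r(3,1,3,2)] r that
      by (simp add: ee_def A_def D_def)
  qed
  note shA = shift_invariant[of n A] and shD = shift_invariant[of n D]
  define r where "r = A 1 1"
  have rr: "1 \<le> p \<Longrightarrow> p \<le> n \<Longrightarrow> A p p = r" for p
  proof (induction p rule: dec_induct)
    case (step p)
    then show ?case using adj[of p] by simp
  qed (simp add: r_def)
  define a b d e where "a = A 1 n" and "b = A n 1" and "d = D 1 n" and "e = D n 1"
  have A1: "A j k = a" if "1 \<le> j" "j < k" "k \<le> n" for j k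
    unfolding a_def using shift that by (intro shA(1)) auto
  have A2: "A j k = b" if "1 \<le> k" "k < j" "j \<le> n" for j k
    unfolding b_def using shift that by (intro shA(2)) auto
  have D1: "D j k = d" if "1 \<le> j" "j < k" "k \<le> n" for j k
    unfolding d_def using shift that by (intro shD(1)) auto
  have D2: "D j k = e" if "1 \<le> k" "k < j" "j \<le> n" for j k
    unfolding e_def using shift that by (intro shD(2)) auto
  have i0: "0 < n" and r0: "n \<in> {1..n}" "1 \<in> {1..n}" "2 \<in> {1..n}" "pos n 0 = n" using n by (auto simp: pos_def)
  have "inverse u * A 1 2 = inverse v * A n 2" "inverse u * D 1 2 = inverse u * D n 2"
    using F[OF i0 r0(1,3), of 1 2] F[OF i0 r0(1,3), of 2 1] r0 n by (simp_all add: ee_def A_def D_def)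
  then have z: "b = v / u * a" "e = d"
    using A1[of 1 2] A2[of 2 n] D1[of 1 2] D2[of 2 n] n uv by (simp_all add: field_simps)
  have eqs: "a + inverse qq * e = r" "inverse qq * b + d = inverse qq * r"
    using adj[of 1] rr[of 1] A1[of 1 2] A2[of 1 2] D1[of 1 2] D2[of 1 2] n by (simp_all add: numeral_2_eq_2)
  define zz where "zz = v / u"
  \<comment> \<open>The scalar is read off from the entry for equal letters.\<close>
  define c where "c = r / (qq - zz / qq)"
  have nz2: "qq\<^sup>2 - zz \<noteq> 0" using uv(3) by (simp add: zz_def)
  then have nz: "qq - zz / qq \<noteq> 0" by (simp add: field_simps power2_eq_square)
  have rc: "r = c * (qq - zz / qq)" using nz by (simp add: c_def)
  have d': "d = inverse qq * r - inverse qq * (zz * a)" using eqs(2) z(1) by (simp add: zz_def algebra_simps)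
  have "a * (1 - zz / qq\<^sup>2) = r * (1 - 1 / qq\<^sup>2)"
    using eqs(1) unfolding z(2) d' by (simp add: field_simps power2_eq_square)
  then have "qq\<^sup>2 * (a * (1 - zz / qq\<^sup>2)) = qq\<^sup>2 * (r * (1 - 1 / qq\<^sup>2))" by simp
  moreover have "qq\<^sup>2 * (r * (1 - 1 / qq\<^sup>2)) = c * (qq - inverse qq) * (qq\<^sup>2 - zz)"
    unfolding rc by (simp add: field_simps power2_eq_square)
  moreover have "qq\<^sup>2 * (a * (1 - zz / qq\<^sup>2)) = a * (qq\<^sup>2 - zz)"
    by (simp add: field_simps)
  ultimately have "a * (qq\<^sup>2 - zz) = c * (qq - inverse qq) * (qq\<^sup>2 - zz)" by simp
  then have a: "a = c * (qq - inverse qq)" using nz2 by simp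
  have b: "b = c * (zz * (qq - inverse qq))" using z(1) a by (simp add: zz_def)
  have d: "d = c * (1 - zz)" unfolding d' a rc by (simp add: field_simps power2_eq_square)
  have form: "R (j, k) b' = c * R_explicit zz (j, k) b'" if jk: "j \<in> {1..n}" "k \<in> {1..n}" for j k b'
  proof (cases b')
    case (Pair j' k')
    consider "j = k" | "j < k" | "k < j" by linarith
    then show ?thesis
    proof cases
      case 1
      then show ?thesis using supp[OF jk, of j' k'] rr[of j] jk rc Pair by (auto simp: R_explicit_def A_def)
    next
      case 2
      then show ?thesis using supp[OF jk, of j' k'] A1[of j k] D1[of j k] jk a d Pair
        by (auto simp: R_explicit_def A_def D_def)
    next
      case 3
      then show ?thesis using supp[OF jk, of j' k'] A2[of k j] D2[of k j] jk b d z(2) Pair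
        by (auto simp: R_explicit_def A_def D_def)
    qed
  qed
  \<comment> \<open>For c = 0 the vector labelled (1, 1) would be killed, contrary to
    bijectivity.\<close>
  have "c \<noteq> 0"
  proof
    assume "c = 0"
    then have "R (1, 1) = (\<lambda>_. 0)" using form[of 1 1] n by (simp add: fun_eq_iff)
    then have "lin ?B R (unit_vec (1, 1)) = lin ?B R (\<lambda>_. 0)"
      using n by (subst lin_unit_vec) (auto simp: lin_def fun_eq_iff)
    moreover have "bij_betw (lin ?B R) (vspan ?B) (vspan ?B)"
      using R by (simp add: is_R_matrix_def Let_def)
    moreover have "unit_vec (1, 1) \<in> vspan ?B" "(\<lambda>_. 0) \<in> vspan ?B"
      using n by (auto simp: vspan_def unit_vec_def)
    ultimately have "unit_vec (1::nat, 1::nat) = (\<lambda>_. 0)"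
      unfolding bij_betw_def by (blast dest: inj_onD)
    then have "unit_vec (1::nat, 1::nat) (1, 1) = 0" by simp
    then show False by (simp add: unit_vec_def)
  qed
  then show ?thesis using form unfolding zz_def by (intro exI[of _ c]) auto
qed

section \<open>Existence of the R-matrix\<close>

lemma lin_R_explicit:
  assumes f: "j \<in> {1..n}" "k \<in> {1..n}"
  shows "lin ({1..n} \<times> {1..n}) (R_explicit z) f (j, k)
    = (if j = k then (qq - z / qq) * f (j, j)
       else (if j < k then 1 else z) * (qq - inverse qq) * f (j, k) + (1 - z) * f (k, j))"
proof (cases "j = k")
  case True
  have "f b * R_explicit z b (j, k) = (if b = (j, j) then (qq - z / qq) * f (j, j) else 0)" for b
    using True by (cases b) (auto simp: R_explicit_def)
  then show ?thesis unfolding lin_def using True f by simp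
next
  case False
  show ?thesis unfolding lin_def if_not_P[OF False]
  proof (rule sum_two[where b = "(j, k)" and b' = "(k, j)"])
    fix b :: "nat \<times> nat"
    show "f b * R_explicit z b (j, k) = (if b = (j, k) then (if j < k then 1 else z) * (qq - inverse qq) * f (j, k) else 0)
      + (if b = (k, j) then (1 - z) * f (k, j) else 0)"
      using False by (cases b) (auto simp: R_explicit_def)
  qed (use f in auto)
qed

text \<open>Unitarity: R(z) R(1/z) is the scalar N, which is nonzero away from z = q^2 and z =
  q^{-2}.\<close>

lemma R_explicit_bij:
  assumes z: "z \<noteq> 0" "z \<noteq> qq\<^sup>2" "z \<noteq> inverse (qq\<^sup>2)"
  shows "bij_betw (lin ({1..n} \<times> {1..n}) (R_explicit z)) (vspan ({1..n} \<times> {1..n})) (vspan ({1..n} \<times> {1..n}))"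
proof -
  let ?B = "{1..n} \<times> {1..n}"
  define N where "N = qq\<^sup>2 + inverse (qq\<^sup>2) - z - inverse z"
  have "N * z = - ((z - qq\<^sup>2) * (z - inverse (qq\<^sup>2)))"
    using z by (simp add: N_def field_simps power2_eq_square)
  then have N: "N \<noteq> 0" using z by auto
  have inv: "lin ?B (R_explicit x) (lin ?B (R_explicit y) f) b = N * f b"
    if "b \<in> ?B" "x = z \<and> y = inverse z \<or> x = inverse z \<and> y = z" for f x y b
  proof -
    obtain j k where b: "b = (j, k)" "j \<in> {1..n}" "k \<in> {1..n}" using \<open>b \<in> ?B\<close> by auto
    have xy: "x * y = 1" and Nxy: "N = qq\<^sup>2 + inverse (qq\<^sup>2) - x - y" using that(2) z(1) by (auto simp: N_def)
    have x0: "x \<noteq> 0" using xy by auto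
    then have y: "y = 1 / x" "x \<noteq> 0" using xy by (simp_all add: field_simps)
    have N': "N = qq\<^sup>2 + inverse (qq\<^sup>2) - x - 1 / x" unfolding Nxy y(1) ..
    consider "j = k" | "j < k" | "k < j" by linarith
    then show ?thesis
      unfolding N' y(1) b(1) lin_R_explicit[OF b(2,3)] lin_R_explicit[OF b(3,2)]
        lin_R_explicit[OF b(2,2)] lin_R_explicit[OF b(3,3)]
      using y(2) by cases (simp_all add: field_simps power2_eq_square)
  qed
  have vs: "lin ?B (R_explicit x) f \<in> vspan ?B" for x f
    unfolding vspan_def lin_def by (auto simp: R_explicit_def intro!: sum.neutral)
  have scale: "lin ?B M (\<lambda>b. c * f b) = (\<lambda>b. c * lin ?B M f b)" for M c and f :: "nat \<times> nat \<Rightarrow> cqx"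
    by (auto simp: lin_def sum_distrib_left mult.assoc)
  have outside: "f b = 0 \<and> lin ?B (R_explicit x) g b = 0" if "b \<notin> ?B" "f \<in> vspan ?B" for b f x g
    using that vs[of x g] unfolding vspan_def by blast
  show ?thesis
  proof (rule bij_betw_byWitness[where f' = "\<lambda>f b. inverse N * lin ?B (R_explicit (inverse z)) f b"])
    show "\<forall>f\<in>vspan ?B. (\<lambda>b. inverse N * lin ?B (R_explicit (inverse z)) (lin ?B (R_explicit z) f) b) = f"
    proof (intro ballI ext)
      fix f b
      assume "f \<in> vspan ?B"
      then show "inverse N * lin ?B (R_explicit (inverse z)) (lin ?B (R_explicit z) f) b = f b"
        using outside[of b f "inverse z" "lin ?B (R_explicit z) f"] inv[of b "inverse z" z f] N by (cases "b \<in> ?B") simp_all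
    qed
    show "\<forall>f\<in>vspan ?B. lin ?B (R_explicit z) (\<lambda>b. inverse N * lin ?B (R_explicit (inverse z)) f b) = f"
      unfolding scale
    proof (intro ballI ext)
      fix f b
      assume "f \<in> vspan ?B"
      then show "inverse N * lin ?B (R_explicit z) (lin ?B (R_explicit (inverse z)) f) b = f b"
        using outside[of b f z "lin ?B (R_explicit (inverse z)) f"] inv[of b z "inverse z" f] N by (cases "b \<in> ?B") simp_all
    qed
    show "lin ?B (R_explicit z) ` vspan ?B \<subseteq> vspan ?B" using vs by auto
    show "(\<lambda>f b. inverse N * lin ?B (R_explicit (inverse z)) f b) ` vspan ?B \<subseteq> vspan ?B"
      using vs[of "inverse z"] unfolding vspan_def by auto
  qed
qed

text \<open>Leading terms in q force k = l, and then x^m = 1 contradicts the degree in x. This is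
  the genericity of the spectral parameters, whose ratios are monomials in q and x.\<close>

lemma qq_powi_xx_neq: "m \<noteq> 0 \<Longrightarrow> qq powi k * xx ^ m \<noteq> qq powi l"
proof
  assume m: "m \<noteq> 0" and eq: "qq powi k * xx ^ m = qq powi l"
  have lx: "lead_q (k + int m * 0) (qq powi k * xx ^ m) (cx_x ^ m)"
    using lead_q_qpow_mult[OF lead_q_power[OF lead_q_const_x]] unfolding xx_eq_const .
  then have lx: "lead_q k (qq powi k * xx ^ m) (cx_x ^ m)" by simp
  have x: "cx_x ^ m \<noteq> 1"
  proof -
    have "cx_x ^ m = Fraction_Field.Fract ([:0, 1:] ^ m) 1"
      unfolding cx_x_def by (induction m) (simp_all add: One_fract_def)
    moreover have "[:0, 1:] ^ m \<noteq> (1 :: complex poly)"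
    proof
      assume "[:0, 1:] ^ m = (1 :: complex poly)"
      then have "degree ([:0, 1:] ^ m :: complex poly) = 0" by simp
      then show False using m by (simp add: degree_power_eq)
    qed
    ultimately show ?thesis by (simp add: One_fract_def eq_fract)
  qed
  have ll: "lead_q l (qq powi k * xx ^ m) 1" unfolding eq by (rule lead_q_qpow)
  consider "k < l" | "l < k" | "k = l" by linarith
  then show False
  proof cases
    case 1
    from lead_q_unique[OF lead_q_lower[OF lx 1] ll] show ?thesis by simp
  next
    case 2
    from lead_q_unique[OF lead_q_lower[OF ll 2] lx] show ?thesis by simp
  next
    case 3
    from lead_q_unique[OF lx ll[folded 3]] show ?thesis using x by simp
  qed
qed

text \<open>The shape of the R-matrix with the weights left abstract. The letters of node i satisfy
  p < t for i \<noteq> 0, but p = n and t = 1 for i = 0; with abstract weights one computation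
  serves both orders.\<close>

definition six_vertex :: "cqx \<Rightarrow> (nat \<Rightarrow> nat \<Rightarrow> cqx) \<Rightarrow> cqx \<Rightarrow> (nat \<times> nat, nat \<times> nat) lmap" where
  "six_vertex r A D = (\<lambda>(j, k) (j', k').
     if j = k then (if j' = j \<and> k' = j then r else 0)
     else if j' = j \<and> k' = k then A j k
     else if j' = k \<and> k' = j then D else 0)"

text \<open>\<open>\<alpha>\<close> and \<open>\<beta>\<close> carry the spectral parameters,
  \<open>a\<close> and \<open>b\<close> the powers of q by which K_i^{-1} acts on p and t. A letter
  outside of the node only compares values of \<open>A\<close>, and on the two letters of the node
  four scalar identities remain. \<open>six_vertex_E\<close> is the analogue for E_i.\<close>

lemma six_vertex_F:
  fixes p t :: nat and a b c d \<alpha> \<beta> :: cqx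
  assumes ne: "p \<noteq> t"
    and far: "\<And>l. l \<in> {j, k} \<Longrightarrow> l \<noteq> p \<Longrightarrow> l \<noteq> t \<Longrightarrow> \<alpha> * A t l = \<beta> * A p l \<and> \<beta> * A l t = \<alpha> * A l p"
    and pp: "\<alpha> * a * A t p + \<beta> * D = \<beta> * a * r" "\<alpha> * a * D + \<beta> * A p t = \<alpha> * r"
    and pt: "\<alpha> * b * r = \<beta> * b * A p t + \<alpha> * D" "\<beta> * r = \<beta> * b * D + \<alpha> * A t p"
  defines "e \<equiv> \<lambda>l. if l = p then a else if l = t then b else 1"
  shows "(if j = p then \<alpha> * e k * six_vertex r A D (t, k) (j', k') else 0)
      + (if k = p then \<beta> * six_vertex r A D (j, t) (j', k') else 0)
    = (if j' = t then \<beta> * e k' * six_vertex r A D (j, k) (p, k') else 0)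
      + (if k' = t then \<alpha> * six_vertex r A D (j, k) (j', p) else 0)"
proof -
  consider "j = p" "k = p" | "j = p" "k = t" | "j = t" "k = p" | "j = p" "k \<noteq> p" "k \<noteq> t"
    | "k = p" "j \<noteq> p" "j \<noteq> t" | "j \<noteq> p" "k \<noteq> p" by blast
  then show ?thesis
  proof cases
    case 1
    show ?thesis unfolding 1 six_vertex_def prod.case e_def using ne pp
      by (cases "j' = t"; cases "k' = t"; cases "j' = p"; cases "k' = p"; simp add: algebra_simps)
  next
    case 2
    show ?thesis unfolding 2 six_vertex_def prod.case e_def using ne pt
      by (cases "j' = t"; cases "k' = t"; cases "j' = p"; cases "k' = p"; simp add: algebra_simps)
  next
    case 3
    show ?thesis unfolding 3 six_vertex_def prod.case e_def using ne pt
      by (cases "j' = t"; cases "k' = t"; cases "j' = p"; cases "k' = p"; simp add: algebra_simps)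
  next
    case 4
    then have f: "\<alpha> * A t k = \<beta> * A p k" using far[of k] by simp
    show ?thesis unfolding 4(1) six_vertex_def prod.case e_def using ne 4(2,3) f
      by (cases "j' = t"; cases "k' = t"; cases "j' = k"; cases "k' = k"; simp)
  next
    case 5
    then have f: "\<beta> * A j t = \<alpha> * A j p" using far[of j] by simp
    show ?thesis unfolding 5(1) six_vertex_def prod.case e_def using ne 5(2,3) f
      by (cases "j' = t"; cases "k' = t"; cases "j' = j"; cases "k' = j"; simp)
  next
    case 6
    then show ?thesis by (simp add: six_vertex_def)
  qed
qed

lemma six_vertex_E:
  fixes p t :: nat and a b c d \<alpha> \<beta> :: cqx
  assumes ne: "p \<noteq> t"
    and far: "\<And>l. l \<in> {j, k} \<Longrightarrow> l \<noteq> p \<Longrightarrow> l \<noteq> t \<Longrightarrow> \<alpha> * A p l = \<beta> * A t l \<and> \<beta> * A l p = \<alpha> * A l t"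
    and tt: "\<alpha> * A p t + \<beta> * a * D = \<beta> * r" "\<alpha> * D + \<beta> * a * A t p = \<alpha> * a * r"
    and tp: "\<alpha> * r = \<beta> * A t p + \<alpha> * b * D" "\<beta> * b * r = \<beta> * D + \<alpha> * b * A p t"
  defines "e \<equiv> \<lambda>l. if l = p then b else if l = t then a else 1"
  shows "(if j = t then \<alpha> * six_vertex r A D (p, k) (j', k') else 0)
      + (if k = t then \<beta> * e j * six_vertex r A D (j, p) (j', k') else 0)
    = (if j' = p then \<beta> * six_vertex r A D (j, k) (t, k') else 0)
      + (if k' = p then \<alpha> * e j' * six_vertex r A D (j, k) (j', t) else 0)"
proof -
  consider "j = t" "k = t" | "j = p" "k = t" | "j = t" "k = p" | "j = t" "k \<noteq> p" "k \<noteq> t"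
    | "k = t" "j \<noteq> p" "j \<noteq> t" | "j \<noteq> t" "k \<noteq> t" by blast
  then show ?thesis
  proof cases
    case 1
    show ?thesis unfolding 1 six_vertex_def prod.case e_def using ne tt
      by (cases "j' = t"; cases "k' = t"; cases "j' = p"; cases "k' = p"; simp add: algebra_simps)
  next
    case 2
    show ?thesis unfolding 2 six_vertex_def prod.case e_def using ne tp
      by (cases "j' = t"; cases "k' = t"; cases "j' = p"; cases "k' = p"; simp add: algebra_simps)
  next
    case 3
    show ?thesis unfolding 3 six_vertex_def prod.case e_def using ne tp
      by (cases "j' = t"; cases "k' = t"; cases "j' = p"; cases "k' = p"; simp add: algebra_simps)
  next
    case 4
    then have f: "\<alpha> * A p k = \<beta> * A t k" using far[of k] by simp
    show ?thesis unfolding 4(1) six_vertex_def prod.case e_def using ne 4(2,3) f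
      by (cases "j' = p"; cases "k' = p"; cases "j' = k"; cases "k' = k"; simp)
  next
    case 5
    then have f: "\<beta> * A j p = \<alpha> * A j t" using far[of j] by simp
    show ?thesis unfolding 5(1) six_vertex_def prod.case e_def using ne 5(2,3) f
      by (cases "j' = p"; cases "k' = p"; cases "j' = j"; cases "k' = j"; simp)
  next
    case 6
    then show ?thesis by (simp add: six_vertex_def)
  qed
qed

lemma R_explicit_six_vertex:
  "R_explicit z = six_vertex (qq - z / qq) (\<lambda>j k. (if j < k then 1 else z) * (qq - inverse qq)) (1 - z)"
  by (simp add: R_explicit_def six_vertex_def fun_eq_iff)

lemma R_explicit_zero:
  assumes "c \<noteq> (j, k)" "c \<noteq> (k, j)"
  shows "R_explicit z (j, k) c = 0"
  using assms by (cases c; cases "fst c = j"; cases "fst c = k"; simp add: R_explicit_def)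

lemma WW_support:
  assumes n: "n \<ge> 2" and i: "i < n" and c: "c \<notin> {1..n} \<times> {1..n}" and b: "b \<in> {1..n} \<times> {1..n}"
  shows "WW_E n u v i b c = 0" "WW_F n u v i b c = 0" "WW_K n i m b c = 0"
proof -
  obtain j k j' k' where bc: "b = (j, k)" "c = (j', k')" by (cases b; cases c)
  have E0: "W_E n x i l l' = 0" and F0: "W_F n x i l l' = 0" if "l' \<notin> {1..n}" for x l l'
    using that n i by (auto simp: W_E_eq W_F_eq pos_def)
  have K0: "W_K n i x l l' = 0" and U0: "unit_vec l l' = 0" if "l \<in> {1..n}" "l' \<notin> {1..n}" for x l l'
    using that by (auto simp: W_K_eq unit_vec_def)
  have jk: "j \<in> {1..n}" "k \<in> {1..n}" using b bc by auto
  have "j' \<notin> {1..n} \<or> k' \<notin> {1..n}" using c bc by auto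
  then show "WW_E n u v i b c = 0" "WW_F n u v i b c = 0" "WW_K n i m b c = 0"
    unfolding bc WW_E_def WW_F_def WW_K_def add_lmap_def tensor_def prod.case
    using E0 F0 K0[OF jk(1)] K0[OF jk(2)] U0[OF jk(1)] U0[OF jk(2)] by (elim disjE; simp)+
qed

lemma intertwinesI:
  assumes M: "\<And>b c. b \<in> B \<Longrightarrow> c \<notin> B \<Longrightarrow> M b c = 0"
    and a: "\<And>b c. b \<in> B \<Longrightarrow> c \<notin> B \<Longrightarrow> a' b c = 0"
    and eq: "\<And>b c. b \<in> B \<Longrightarrow> c \<in> B \<Longrightarrow> lin B M (a b) c = lin B a' (M b) c"
  shows "intertwines B B M a a'"
  unfolding intertwines_def
proof (intro ballI ext)
  fix b c
  assume b: "b \<in> B"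
  show "lin B M (a b) c = lin B a' (M b) c"
  proof (cases "c \<in> B")
    case False
    then have "lin B M (a b) c = 0" "lin B a' (M b) c = 0"
      unfolding lin_def using M a by (auto intro!: sum.neutral)
    then show ?thesis by simp
  qed (rule eq[OF b])
qed

lemma R_explicit_is_R_matrix:
  assumes n: "n \<ge> 2" and uv: "u \<noteq> 0" "v \<noteq> 0" "v / u \<noteq> qq\<^sup>2" "v / u \<noteq> inverse (qq\<^sup>2)"
  shows "is_R_matrix n u v (R_explicit (v / u))"
proof -
  let ?B = "{1..n} \<times> {1..n}"
  define z where "z = v / u"
  define h where "h = qq - inverse qq"
  define A where "A = (\<lambda>j k :: nat. (if j < k then 1 else z) * h)"
  define r where "r = qq - z / qq"
  have Rz: "R_explicit z = six_vertex r A (1 - z)"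
    unfolding A_def h_def r_def by (rule R_explicit_six_vertex)
  have R0: "R_explicit z b c = 0" if "b \<in> ?B" "c \<notin> ?B" for b c
  proof -
    obtain j k where b: "b = (j, k)" by (cases b)
    then have "c \<noteq> (j, k)" "c \<noteq> (k, j)" using that by auto
    then show ?thesis unfolding b by (rule R_explicit_zero)
  qed
  then have vs: "\<forall>b\<in>?B. R_explicit z b \<in> vspan ?B"
    unfolding vspan_def by simp
  have main: "intertwines ?B ?B (R_explicit z) (WW_E n u v i) (WW_E n v u i)
      \<and> intertwines ?B ?B (R_explicit z) (WW_F n u v i) (WW_F n v u i)
      \<and> (\<forall>m\<in>{1, -1}. intertwines ?B ?B (R_explicit z) (WW_K n i m) (WW_K n i m))" if i: "i < n" for i
  proof (intro conjI ballI)
    define p t where "p = pos n i" and "t = i + 1"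
    have ne: "p \<noteq> t" using n i by (auto simp: p_def t_def pos_def)
    have nonzero: "A p t = h" "A t p = z * h" "l \<noteq> p \<Longrightarrow> l \<noteq> t \<Longrightarrow> A t l = A p l"
      "l \<noteq> p \<Longrightarrow> l \<noteq> t \<Longrightarrow> A l t = A l p" if "i \<noteq> 0" for l
      using that unfolding A_def p_def t_def pos_def by auto
    have zero: "A p t = z * h" "A t p = h"
      "l \<in> {1..n} \<Longrightarrow> l \<noteq> p \<Longrightarrow> l \<noteq> t \<Longrightarrow> A t l = h \<and> A p l = z * h \<and> A l t = z * h \<and> A l p = h" if "i = 0" for l
      using that n unfolding A_def p_def t_def pos_def by auto
    have eF: "qq powi (ee l t - ee l p) = (if l = p then inverse qq else if l = t then qq else 1)"
      and eE: "qq powi (ee l p - ee l t) = (if l = p then qq else if l = t then inverse qq else 1)" for l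
      using ne by (auto simp: ee_def power_int_minus)
    \<comment> \<open>These four identities serve all nodes: at node 0 the weights of the two orders
      are exchanged, and multiplication by suitable spectral parameters brings the same identities
      back.\<close>
    have I: "inverse qq * (z * h) + (1 - z) = inverse qq * r" "inverse qq * (1 - z) + h = r"
      "qq * r = qq * h + (1 - z)" "r = qq * (1 - z) + z * h"
      by (simp_all add: r_def h_def field_simps)
    have iu: "inverse u = inverse v * z" and v': "v = u * z"
      using uv(1,2) unfolding z_def inverse_eq_divide by simp_all
    show "intertwines ?B ?B (R_explicit z) (WW_F n u v i) (WW_F n v u i)"
    proof (rule intertwinesI)
      fix b c
      assume "b \<in> ?B" "c \<in> ?B"
      then obtain j k j' k' where b: "b = (j, k)" "j \<in> {1..n}" "k \<in> {1..n}"
        and c: "c = (j', k')" "j' \<in> {1..n}" "k' \<in> {1..n}" by blast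
      show "lin ?B (R_explicit z) (WW_F n u v i b) c = lin ?B (WW_F n v u i) (R_explicit z b) c"
        unfolding b(1) c(1) WW_F_left[OF n i b(2,3)] WW_F_right[OF n i c(2,3)]
          p_def[symmetric] t_def[symmetric] eF Rz
      proof (rule six_vertex_F[OF ne])
        fix l assume "l \<in> {j, k}" and l: "l \<noteq> p" "l \<noteq> t"
        then have "l \<in> {1..n}" using b by auto
        then show "(if i = 0 then inverse u else 1) * A t l = (if i = 0 then inverse v else 1) * A p l \<and>
          (if i = 0 then inverse v else 1) * A l t = (if i = 0 then inverse u else 1) * A l p"
          using nonzero(3,4)[OF _ l] zero(3)[OF _ _ l]
            by (cases "i = 0") (simp_all add: iu)
      next
        let ?a = "if i = 0 then inverse u else 1" and ?b = "if i = 0 then inverse v else 1"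
        have "?a * inverse qq * A t p + ?b * (1 - z) = ?b * inverse qq * r
          \<and> ?a * inverse qq * (1 - z) + ?b * A p t = ?a * r
          \<and> ?a * qq * r = ?b * qq * A p t + ?a * (1 - z)
          \<and> ?b * r = ?b * qq * (1 - z) + ?a * A t p"
        proof (cases "i = 0")
          case True
          show ?thesis
            using arg_cong[OF I(1), of "\<lambda>x. inverse v * x"] arg_cong[OF I(2), of "\<lambda>x. inverse v * z * x"]
              arg_cong[OF I(3), of "\<lambda>x. inverse v * z * x"] arg_cong[OF I(4), of "\<lambda>x. inverse v * x"]
            unfolding zero(1,2)[OF True] if_P[OF True] iu by (simp add: algebra_simps)
        next
          case False
          then show ?thesis using I nonzero(1,2) by simp
        qed
        then show "?a * inverse qq * A t p + ?b * (1 - z) = ?b * inverse qq * r"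
          "?a * inverse qq * (1 - z) + ?b * A p t = ?a * r"
          "?a * qq * r = ?b * qq * A p t + ?a * (1 - z)"
          "?b * r = ?b * qq * (1 - z) + ?a * A t p"
          by blast+
      qed
    qed (rule R0 WW_support[OF n i], assumption, assumption)+
    show "intertwines ?B ?B (R_explicit z) (WW_E n u v i) (WW_E n v u i)"
    proof (rule intertwinesI)
      fix b c
      assume "b \<in> ?B" "c \<in> ?B"
      then obtain j k j' k' where b: "b = (j, k)" "j \<in> {1..n}" "k \<in> {1..n}"
        and c: "c = (j', k')" "j' \<in> {1..n}" "k' \<in> {1..n}" by blast
      show "lin ?B (R_explicit z) (WW_E n u v i b) c = lin ?B (WW_E n v u i) (R_explicit z b) c"
        unfolding b(1) c(1) WW_E_left[OF n i b(2,3)] WW_E_right[OF n i c(2,3)]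
          p_def[symmetric] t_def[symmetric] eE Rz
      proof (rule six_vertex_E[OF ne])
        fix l assume "l \<in> {j, k}" and l: "l \<noteq> p" "l \<noteq> t"
        then have "l \<in> {1..n}" using b by auto
        then show "(if i = 0 then u else 1) * A p l = (if i = 0 then v else 1) * A t l \<and>
          (if i = 0 then v else 1) * A l p = (if i = 0 then u else 1) * A l t"
          using nonzero(3,4)[OF _ l] zero(3)[OF _ _ l]
            by (cases "i = 0") (simp_all add: v')
      next
        let ?a = "if i = 0 then u else 1" and ?b = "if i = 0 then v else 1"
        have "?a * A p t + ?b * inverse qq * (1 - z) = ?b * r
          \<and> ?a * (1 - z) + ?b * inverse qq * A t p = ?a * inverse qq * r
          \<and> ?a * r = ?b * A t p + ?a * qq * (1 - z)
          \<and> ?b * qq * r = ?b * (1 - z) + ?a * qq * A p t"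
        proof (cases "i = 0")
          case True
          show ?thesis
            using arg_cong[OF I(2), of "\<lambda>x. u * z * x"] arg_cong[OF I(1), of "\<lambda>x. u * x"]
              arg_cong[OF I(4), of "\<lambda>x. u * x"] arg_cong[OF I(3), of "\<lambda>x. u * z * x"]
            unfolding zero(1,2)[OF True] if_P[OF True] v' by (simp add: algebra_simps)
        next
          case False
          have "(1 - z) + inverse qq * (z * h) = inverse qq * r" "h + inverse qq * (1 - z) = r"
            "r = z * h + qq * (1 - z)" "qq * r = (1 - z) + qq * h"
            by (subst add.commute, rule I)+
          then show ?thesis unfolding nonzero(1,2)[OF False] if_not_P[OF False] mult_1 by (intro conjI)
        qed
        then show "?a * A p t + ?b * inverse qq * (1 - z) = ?b * r"
          "?a * (1 - z) + ?b * inverse qq * A t p = ?a * inverse qq * r"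
          "?a * r = ?b * A t p + ?a * qq * (1 - z)"
          "?b * qq * r = ?b * (1 - z) + ?a * qq * A p t"
          by blast+
      qed
    qed (rule R0 WW_support[OF n i], assumption, assumption)+
    fix m :: int
    show "intertwines ?B ?B (R_explicit z) (WW_K n i m) (WW_K n i m)"
    proof (rule intertwinesI)
      fix b c
      assume "b \<in> ?B" "c \<in> ?B"
      then obtain j k j' k' where b: "b = (j, k)" "j \<in> {1..n}" "k \<in> {1..n}"
        and c: "c = (j', k')" "j' \<in> {1..n}" "k' \<in> {1..n}" by blast
      have "R_explicit z (j, k) (j', k') = 0 \<or> (j', k') = (j, k) \<or> (j', k') = (k, j)"
        using R_explicit_zero by blast
      then show "lin ?B (R_explicit z) (WW_K n i m b) c = lin ?B (WW_K n i m) (R_explicit z b) c"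
        unfolding b(1) c(1) WW_K_left[OF n i b(2,3)] WW_K_right[OF n i c(2,3)]
        by (auto simp: algebra_simps)
    qed (rule R0 WW_support[OF n i], assumption, assumption)+
  qed
  have bij: "bij_betw (lin ?B (R_explicit z)) (vspan ?B) (vspan ?B)"
    using uv unfolding z_def by (intro R_explicit_bij) simp_all
  show ?thesis
    unfolding is_R_matrix_def Let_def z_def[symmetric]
  proof (intro conjI allI impI)
    fix i assume i: "i < n"
    note m = main[OF i]
    show "intertwines ?B ?B (R_explicit z) (WW_E n u v i) (WW_E n v u i)"
      by (rule conjunct1[OF m])
    show "intertwines ?B ?B (R_explicit z) (WW_F n u v i) (WW_F n v u i)"
      by (rule conjunct1[OF conjunct2[OF m]])
    show "\<forall>m\<in>{1, -1}. intertwines ?B ?B (R_explicit z) (WW_K n i m) (WW_K n i m)"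
      by (rule conjunct2[OF conjunct2[OF m]])
  qed (rule bij, rule vs)
qed

section \<open>The K-matrix of the vector representation\<close>

lemma W_B_eq:
  assumes n: "n \<ge> 2" and i: "i < n" and j: "j \<in> {1..n}"
  shows "W_B n u i j k = W_F n u i j k
    + varsig n i * (qq powi (ee j (i + 1) - ee j (pos n i)) * W_E n u (neg_node n i) j k)"
proof -
  have "lin {1..n} (W_E n u (neg_node n i)) (W_K n i (-1) j) k
    = (\<Sum>b\<in>{1..n}. if b = j then qq powi (ee j (i + 1) - ee j (pos n i)) * W_E n u (neg_node n i) j k else 0)"
    unfolding lin_def by (intro sum.cong) (auto simp: W_K_eq)
  then show ?thesis using j by (simp add: W_B_def add_lmap_def)
qed

lemma W_KK_eq:
  assumes j: "j \<in> {1..n}"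
  shows "W_KK n i j k = (if j = k then qq powi (ee j (pos n i) - ee j (i + 1)
      - (ee j (pos n (neg_node n i)) - ee j (neg_node n i + 1))) else 0)"
proof -
  have "W_KK n i j k = (\<Sum>b\<in>{1..n}. if b = j then (if j = k then qq powi (ee j (pos n i) - ee j (i + 1)
      - (ee j (pos n (neg_node n i)) - ee j (neg_node n i + 1))) else 0) else 0)"
    unfolding W_KK_def lin_def by (intro sum.cong) (auto simp: W_K_eq power_int_add[symmetric] algebra_simps)
  then show ?thesis using j by simp
qed

lemma flip_intertwines:
  fixes M M' :: "(nat, nat) lmap"
  assumes sym: "\<And>j k. j \<in> {1..n} \<Longrightarrow> k \<in> {1..n} \<Longrightarrow> M j k = M' (n + 1 - j) (n + 1 - k)"
    and supp: "\<And>j k. j \<in> {1..n} \<Longrightarrow> k \<notin> {1..n} \<Longrightarrow> M' j k = 0"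
  shows "intertwines {1..n} {1..n} (\<lambda>j. unit_vec (n + 1 - j)) M M'"
  unfolding intertwines_def
proof (intro ballI ext)
  fix j c
  assume j: "j \<in> {1..n}"
  have fj: "n + 1 - j \<in> {1..n}" using j by auto
  have R: "lin {1..n} M' (unit_vec (n + 1 - j)) c = M' (n + 1 - j) c"
    using lin_unit_vec[of "{1..n}" "n + 1 - j" M'] fj by simp
  show "lin {1..n} (\<lambda>j. unit_vec (n + 1 - j)) (M j) c = lin {1..n} M' (unit_vec (n + 1 - j)) c"
  proof (cases "c \<in> {1..n}")
    case True
    have fc: "n + 1 - c \<in> {1..n}" using True by auto
    have "lin {1..n} (\<lambda>j. unit_vec (n + 1 - j)) (M j) c = (\<Sum>b\<in>{1..n}. if b = n + 1 - c then M j b else 0)"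
      unfolding lin_def unit_vec_def using True by (intro sum.cong) auto
    also have "\<dots> = M j (n + 1 - c)"
      using fc by (simp only: sum.delta finite_atLeastAtMost if_True)
    also have "\<dots> = M' (n + 1 - j) c" using sym[OF j fc] True by simp
    finally show ?thesis using R by simp
  next
    case False
    then have "lin {1..n} (\<lambda>j. unit_vec (n + 1 - j)) (M j) c = 0"
      unfolding lin_def unit_vec_def by (intro sum.neutral) auto
    then show ?thesis using R supp[OF fj False] by simp
  qed
qed

text \<open>The parameters \<open>varsig\<close> are exactly those that cancel the action of
  K_i^{-1} on the letter moved by E_{-i}. For i \<noteq> 0 the generator B_i then sends i to i + 1
  and the mirror letter n + 1 - i to n - i, both with coefficient 1; B_0 sends n to 1 with
  coefficient 1/u and 1 to n with coefficient u. The flip of letters preserves the former and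
  inverts u in the latter.\<close>

lemma K_W_exists:
  assumes n: "n \<ge> 2"
  shows "is_K_W n u (\<lambda>j. unit_vec (n + 1 - j))"
  unfolding is_K_W_def
proof (intro conjI allI impI ballI refl)
  fix i assume i: "i < n"
  have ni: "neg_node n i < n" using n by (simp add: neg_node_def)
  have neg: "neg_node n i = (if i = 0 then 0 else n - i)" using i by (simp add: neg_node_def)
  have node0: "neg_node n 0 = 0" "pos n 0 = n" by (simp_all add: neg_node_def pos_def)
  have supp: "W_F n x i j k = 0" "W_E n x (neg_node n i) j k = 0" if "k \<notin> {1..n}" for x j k
    using that n i ni by (auto simp: W_F_eq W_E_eq pos_def)
  show "intertwines {1..n} {1..n} (\<lambda>j. unit_vec (n + 1 - j)) (W_B n u i) (W_B n (inverse u) i)"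
  proof (rule flip_intertwines)
    fix j k assume j: "j \<in> {1..n}" and k: "k \<in> {1..n}"
    have j': "n + 1 - j \<in> {1..n}" using j by auto
    show "W_B n u i j k = W_B n (inverse u) i (n + 1 - j) (n + 1 - k)"
    proof (cases "i = 0")
      case True
      have c: "n + 1 - j = n \<longleftrightarrow> j = 1" "n + 1 - k = 1 \<longleftrightarrow> k = n" "n + 1 - j = 1 \<longleftrightarrow> j = n" "n + 1 - k = n \<longleftrightarrow> k = 1"
        using j k by auto
      have q: "varsig n 0 * qq powi (ee 1 1 - ee 1 n) = 1"
        using n by (simp add: varsig_def ee_def power_int_minus)
      have W: "W_B n x 0 j k = (if j = n \<and> k = 1 then inverse x else 0) + (if j = 1 \<and> k = n then x else 0)"
        if "j \<in> {1..n}" for x j k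
      proof -
        have "W_B n x 0 j k = (if j = n \<and> k = 1 then inverse x else 0)
          + varsig n 0 * (qq powi (ee j 1 - ee j n) * (if j = 1 \<and> k = n then x else 0))"
          unfolding W_B_eq[OF n i[unfolded True] that] node0 W_F_eq[OF n i[unfolded True]]
          using n by (subst W_E_eq) (auto simp: node0)
        then show ?thesis using q by (auto simp: mult.assoc[symmetric])
      qed
      show ?thesis unfolding True W[OF j] W[OF j'] c by auto
    next
      case False
      have c: "n + 1 - j = i \<longleftrightarrow> j = n - i + 1" "n + 1 - k = i + 1 \<longleftrightarrow> k = n - i"
        "n + 1 - j = n - i + 1 \<longleftrightarrow> j = i" "n + 1 - k = n - i \<longleftrightarrow> k = i + 1"
        using j k i False by auto
      have q: "varsig n i * qq powi (ee (n - i + 1) (i + 1) - ee (n - i + 1) i) = 1"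
      proof -
        \<comment> \<open>K_i^{-1} is nontrivial on the letter n - i + 1 only if this is i + 1 or i,
          that is for n = 2i or n + 1 = 2i. These are the two exceptional values of
          \<open>varsig\<close> at the node \<open>half n + 1\<close>.\<close>
        consider "n = 2 * i" | "n + 1 = 2 * i" | "n \<noteq> 2 * i" "n + 1 \<noteq> 2 * i" by blast
        then show ?thesis
        proof cases
          case 1
          then have "half n = i - 1" "even n" using False by (auto simp: half_def)
          then show ?thesis using 1 False by (simp add: varsig_def ee_def power_int_minus)
        next
          case 2
          then have "odd n" by presburger
          moreover have "half n = i - 1" using 2 False by (auto simp: half_def)
          moreover have "n - i + 1 = i" using 2 by simp
          ultimately show ?thesis using False by (simp add: varsig_def ee_def power_int_minus)
        next
          case 3
          then have "i \<noteq> half n + 1" unfolding half_def using n by presburger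
          moreover have "n - i + 1 \<noteq> i" "n - i + 1 \<noteq> i + 1" using 3 i by auto
          ultimately show ?thesis using False by (simp add: varsig_def ee_def)
        qed
      qed
      have W: "W_B n x i j k = (if j = i \<and> k = i + 1 then 1 else 0) + (if j = n - i + 1 \<and> k = n - i then 1 else 0)"
        if "j \<in> {1..n}" for x j k
      proof -
        have "W_B n x i j k = (if j = i \<and> k = i + 1 then 1 else 0)
          + varsig n i * (qq powi (ee j (i + 1) - ee j i) * (if j = n - i + 1 \<and> k = n - i then 1 else 0))"
          unfolding W_B_eq[OF n i that] W_F_eq[OF n i] W_E_eq[OF n ni]
          using False i by (auto simp: neg pos_def)
        then show ?thesis using q by (auto simp: mult.assoc[symmetric])
      qed
      show ?thesis unfolding W[OF j] W[OF j'] c by auto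
    qed
  next
    fix j k assume j: "j \<in> {1..n}" and k: "k \<notin> {1..n}"
    show "W_B n (inverse u) i j k = 0"
      unfolding W_B_eq[OF n i j] using supp[OF k] by simp
  qed
  show "intertwines {1..n} {1..n} (\<lambda>j. unit_vec (n + 1 - j)) (W_KK n i) (W_KK n i)"
  proof (rule flip_intertwines)
    fix j k assume j: "j \<in> {1..n}" and k: "k \<in> {1..n}"
    have j': "n + 1 - j \<in> {1..n}" using j by auto
    have c: "n + 1 - j = n + 1 - k \<longleftrightarrow> j = k" using j k by auto
    have e: "ee j (pos n i) - ee j (i + 1) - (ee j (pos n (neg_node n i)) - ee j (neg_node n i + 1))
      = ee (n + 1 - j) (pos n i) - ee (n + 1 - j) (i + 1)
        - (ee (n + 1 - j) (pos n (neg_node n i)) - ee (n + 1 - j) (neg_node n i + 1))"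
    proof -
      have fl: "ee (n + 1 - j) l = ee j (n + 1 - l)" if "l \<in> {1..n}" for l
        using that j by (auto simp: ee_def)
      have r: "pos n i \<in> {1..n}" "i + 1 \<in> {1..n}" "pos n (neg_node n i) \<in> {1..n}" "neg_node n i + 1 \<in> {1..n}"
        using i ni n by (auto simp: pos_def)
      have "n + 1 - pos n i = neg_node n i + 1" "n + 1 - (i + 1) = pos n (neg_node n i)"
        "n + 1 - pos n (neg_node n i) = i + 1" "n + 1 - (neg_node n i + 1) = pos n i"
        using i by (auto simp: pos_def neg)
      then show ?thesis unfolding fl[OF r(1)] fl[OF r(2)] fl[OF r(3)] fl[OF r(4)] by simp
    qed
    show "W_KK n i j k = W_KK n i (n + 1 - j) (n + 1 - k)"
      unfolding W_KK_eq[OF j] W_KK_eq[OF j'] c e ..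
  next
    fix j k assume "j \<in> {1..n}" "k \<notin> {1..n}"
    then show "W_KK n i j k = 0" by (auto simp: W_KK_eq)
  qed
qed

section \<open>The Hecke algebra of type B with parameter 1 at the special node\<close>

definition scl :: "'k::field \<Rightarrow> ('i \<Rightarrow> 'k) \<Rightarrow> 'i \<Rightarrow> 'k" (infixr "\<cdot>" 75) where
  "a \<cdot> f = (\<lambda>i. a * f i)"

lemma scl_apply: "(a \<cdot> f) i = a * f i"
  by (simp add: scl_def)

text \<open>Vector operations stay folded, so that operator identities rewrite whole vectors;
  \<open>vec_simps\<close> passes to coordinates.\<close>

declare plus_fun_apply [simp del] minus_apply [simp del] zero_fun_apply [simp del]

lemmas vec_simps = fun_eq_iff scl_apply plus_fun_apply minus_apply zero_fun_apply

lemma scl_scl [simp]: "a \<cdot> b \<cdot> f = (a * b) \<cdot> f"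
  by (simp add: vec_simps)

lemma scl_1 [simp]: "1 \<cdot> f = f"
  by (simp add: vec_simps)

lemma scl_add: "a \<cdot> (f + g) = a \<cdot> f + a \<cdot> g"
  by (simp add: vec_simps algebra_simps)

lemma scl_diff: "a \<cdot> (f - g) = a \<cdot> f - a \<cdot> g"
  by (simp add: vec_simps algebra_simps)

definition lin_op :: "(('i \<Rightarrow> 'k::field) \<Rightarrow> 'j \<Rightarrow> 'k) \<Rightarrow> bool" where
  "lin_op L \<longleftrightarrow> (\<forall>f g. L (f + g) = L f + L g) \<and> (\<forall>a f. L (a \<cdot> f) = a \<cdot> L f)"

lemma lin_opD:
  assumes "lin_op L"
  shows "L (f + g) = L f + L g" "L (a \<cdot> f) = a \<cdot> L f" "L (f - g) = L f - L g"
proof -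
  show add: "L (f + g) = L f + L g" and scale: "L (a \<cdot> f) = a \<cdot> L f" for f g a
    using assms by (auto simp: lin_op_def)
  have "f - g = f + (- 1) \<cdot> g" by (simp add: vec_simps)
  then have "L (f - g) = L f + (- 1) \<cdot> L g" by (simp only: add scale)
  also have "\<dots> = L f - L g" by (simp add: vec_simps)
  finally show "L (f - g) = L f - L g" .
qed

lemma lin_op_zero: "lin_op L \<Longrightarrow> L 0 = 0"
  using lin_opD(3)[of L 0 0] by simp

locale hecke_B =
  fixes s :: nat and q :: "'k::field"
    and T :: "nat \<Rightarrow> ('i \<Rightarrow> 'k) \<Rightarrow> 'i \<Rightarrow> 'k" and J :: "('i \<Rightarrow> 'k) \<Rightarrow> 'i \<Rightarrow> 'k"
  assumes q_nonzero: "q \<noteq> 0" and q_not_root: "m > 0 \<Longrightarrow> q ^ m \<noteq> 1"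
    and lin_T: "lin_op (T k)" and lin_J: "lin_op J"
    and T_quad: "1 \<le> k \<Longrightarrow> k < s \<Longrightarrow> T k (T k f) = f + (q - inverse q) \<cdot> T k f"
    and T_braid: "1 \<le> k \<Longrightarrow> Suc k < s \<Longrightarrow> T k (T (Suc k) (T k f)) = T (Suc k) (T k (T (Suc k) f))"
    and T_far: "1 \<le> j \<Longrightarrow> Suc j < k \<Longrightarrow> k < s \<Longrightarrow> T j (T k f) = T k (T j f)"
    and J_quad: "J (J f) = f"
    and J_far: "2 \<le> k \<Longrightarrow> k < s \<Longrightarrow> J (T k f) = T k (J f)"
    and J_braid: "1 < s \<Longrightarrow> J (T 1 (J (T 1 f))) = T 1 (J (T 1 (J f)))"
begin

lemmas linT = lin_opD[OF lin_T] and linJ = lin_opD[OF lin_J]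

primrec Y :: "nat \<Rightarrow> ('i \<Rightarrow> 'k) \<Rightarrow> 'i \<Rightarrow> 'k" where
  "Y 0 f = J f"
| "Y (Suc k) f = T (Suc k) (Y k (T (Suc k) f))"

primrec X :: "nat \<Rightarrow> ('i \<Rightarrow> 'k) \<Rightarrow> 'i \<Rightarrow> 'k" where
  "X 0 f = 0"
| "X (Suc k) f = X k f + Y k f"

text \<open>The factor with the largest index acts first: it sends a vector symmetric under T_1,
  ..., T_k to one symmetric under T_1, ..., T_{k-1}, to which an induction hypothesis for the
  shorter product applies (\<open>sym_diff_Y\<close>).\<close>

primrec C :: "nat \<Rightarrow> 'k \<Rightarrow> ('i \<Rightarrow> 'k) \<Rightarrow> 'i \<Rightarrow> 'k" where
  "C 0 z f = f"
| "C (Suc k) z f = C k z (z \<cdot> f - Y k f)"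

text \<open>The trivial isotypic part for the subalgebra of T_1, ..., T_{k-1}; the embedded KR
  module lies in it for k = s.\<close>

definition sym :: "nat \<Rightarrow> ('i \<Rightarrow> 'k) \<Rightarrow> bool" where
  "sym k f \<longleftrightarrow> (\<forall>i. 1 \<le> i \<and> i < k \<longrightarrow> T i f = q \<cdot> f)"

lemma lin_Y: "lin_op (Y k)"
  by (induction k) (auto simp: lin_op_def linT linJ)

lemmas linY = lin_opD[OF lin_Y]

lemma lin_C: "lin_op (C k z)"
proof (induction k)
  case (Suc k)
  show ?case unfolding lin_op_def
  proof (intro conjI allI)
    fix f g
    have "z \<cdot> (f + g) - Y k (f + g) = (z \<cdot> f - Y k f) + (z \<cdot> g - Y k g)"
      by (simp add: linY scl_add)
    then show "C (Suc k) z (f + g) = C (Suc k) z f + C (Suc k) z g"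
      by (simp only: C.simps lin_opD(1)[OF Suc.IH])
  next
    fix a f
    have "z \<cdot> a \<cdot> f - Y k (a \<cdot> f) = a \<cdot> (z \<cdot> f - Y k f)"
      by (simp add: linY scl_diff mult.commute)
    then show "C (Suc k) z (a \<cdot> f) = a \<cdot> C (Suc k) z f"
      by (simp only: C.simps lin_opD[OF Suc.IH])
  qed
qed (simp add: lin_op_def)

lemmas linC = lin_opD[OF lin_C]

section \<open>Commutation relations of the Jucys-Murphy elements\<close>

lemma T_Y_above: "Suc k < i \<Longrightarrow> i < s \<Longrightarrow> T i (Y k f) = Y k (T i f)"
proof (induction k arbitrary: f)
  case 0
  then show ?case by (simp add: J_far)
next
  case (Suc k)
  have "T i (T (Suc k) g) = T (Suc k) (T i g)" for g
    using Suc.prems T_far[of "Suc k" i] by simp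
  then show ?case using Suc by simp
qed

lemma T_Y_below: "1 \<le> i \<Longrightarrow> i < k \<Longrightarrow> k < s \<Longrightarrow> T i (Y k f) = Y k (T i f)"
proof (induction k arbitrary: f)
  case (Suc k)
  show ?case
  proof (cases "i = k")
    case False
    then have "T i (T (Suc k) g) = T (Suc k) (T i g)" for g
      using Suc.prems by (intro T_far) auto
    then show ?thesis using Suc False by simp
  next
    case True
    then obtain m where k: "k = Suc m" using Suc.prems by (cases k) auto
    \<comment> \<open>Here Y_{k+1} = T_{k+1} T_k Y_m T_k T_{k+1} with k = m + 1. The braid relation
      turns T_k into T_{k+1} on the left of Y_m, this commutes with Y_m, and the braid relation on
      the right turns it back into T_k.\<close>
    have br: "T k (T (Suc k) (T k g)) = T (Suc k) (T k (T (Suc k) g))" for g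
      using Suc.prems True by (intro T_braid) auto
    have "T i (Y (Suc k) f) = T k (T (Suc k) (T k (Y m (T k (T (Suc k) f)))))"
      by (simp add: True k)
    also have "\<dots> = T (Suc k) (T k (T (Suc k) (Y m (T k (T (Suc k) f)))))"
      by (rule br)
    also have "T (Suc k) (Y m (T k (T (Suc k) f))) = Y m (T (Suc k) (T k (T (Suc k) f)))"
      using Suc.prems k by (intro T_Y_above) auto
    also have "\<dots> = Y m (T k (T (Suc k) (T k f)))" by (simp only: br)
    finally show ?thesis by (simp add: True k)
  qed
qed simp

text \<open>For neighbours, T_k commutes with Y_{k+1} by \<open>T_Y_below\<close>, so Y_k = T_k
  Y_{k-1} T_k reduces the claim to the pair k - 1, k + 1. The start, Y_0 against Y_1, is the
  relation \<open>J_braid\<close>.\<close>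

lemma Y_commute_less: "k < s \<Longrightarrow> j < k \<Longrightarrow> Y j (Y k f) = Y k (Y j f)"
proof (induction k arbitrary: j f)
  case (Suc k)
  have less: "Y j (Y (Suc k) g) = Y (Suc k) (Y j g)" if "j < k" for j g
  proof -
    have "T (Suc k) (Y j h) = Y j (T (Suc k) h)" for h
      using that Suc.prems by (intro T_Y_above) auto
    moreover have "Y j (Y k h) = Y k (Y j h)" for h
      using Suc.IH[OF _ that] Suc.prems(1) by simp
    ultimately show ?thesis by simp metis
  qed
  show ?case
  proof (cases "j = k")
    case True
    show ?thesis
    proof (cases k)
      case 0
      then show ?thesis using True J_braid Suc.prems by simp
    next
      case (Suc m)
      have 1: "T k (Y (Suc k) g) = Y (Suc k) (T k g)" for g
        using Suc \<open>Suc k < s\<close> by (intro T_Y_below) auto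
      have 2: "Y m (Y (Suc k) g) = Y (Suc k) (Y m g)" for g
        using Suc by (intro less) auto
      have "Y k (Y (Suc k) f) = T k (Y m (T k (Y (Suc k) f)))"
        using Suc by simp
      also have "\<dots> = Y (Suc k) (T k (Y m (T k f)))"
        by (simp only: 1 2)
      finally show ?thesis using True Suc by simp
    qed
  qed (use less Suc.prems in auto)
qed simp

lemma Y_commute: "j < s \<Longrightarrow> k < s \<Longrightarrow> Y j (Y k f) = Y k (Y j f)"
  using Y_commute_less[of j k] Y_commute_less[of k j] by (cases j k rule: linorder_cases) auto

lemma Y_C: "k \<le> s \<Longrightarrow> j < s \<Longrightarrow> Y j (C k z f) = C k z (Y j f)"
  by (induction k arbitrary: f) (simp_all add: linY Y_commute)

lemma X_C: "k \<le> s \<Longrightarrow> j \<le> s \<Longrightarrow> X j (C k z f) = C k z (X j f)"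
  by (induction j) (simp_all add: linC Y_C lin_op_zero[OF lin_C])

lemma T_C_above: "k < i \<Longrightarrow> i < s \<Longrightarrow> T i (C k z f) = C k z (T i f)"
proof (induction k arbitrary: f)
  case (Suc k)
  then show ?case using T_Y_above[of k i] by (simp add: linT)
qed simp

text \<open>The action of T on the span of g, Y g, Y' g and Y Y' g for a symmetric vector g.\<close>

lemma T_Y_sym:
  assumes k: "Suc k < s" and g: "T (Suc k) g = q \<cdot> g"
  shows "T (Suc k) (Y k g) = inverse q \<cdot> Y (Suc k) g"
    and "T (Suc k) (Y (Suc k) g) = q \<cdot> Y k g + (q - inverse q) \<cdot> Y (Suc k) g"
    and "T (Suc k) (Y k (Y (Suc k) g)) = q \<cdot> Y k (Y (Suc k) g)"
proof -
  show 1: "T (Suc k) (Y k g) = inverse q \<cdot> Y (Suc k) g"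
    using q_nonzero by (simp add: g linY linT)
  have "T (Suc k) (T (Suc k) (Y k g)) = Y k g + (q - inverse q) \<cdot> T (Suc k) (Y k g)"
    using k by (intro T_quad) auto
  then show "T (Suc k) (Y (Suc k) g) = q \<cdot> Y k g + (q - inverse q) \<cdot> Y (Suc k) g"
    by (simp add: g linY linT scl_add algebra_simps)
  have "T (Suc k) (Y k (Y (Suc k) g)) = Y (Suc k) (Y k (T (Suc k) g))" by simp
  then show "T (Suc k) (Y k (Y (Suc k) g)) = q \<cdot> Y k (Y (Suc k) g)"
    using k by (simp only: g linY) (simp add: Y_commute del: Y.simps)
qed

text \<open>T_i commutes with all but two neighbouring Y and Y', and by \<open>T_Y_sym\<close> the
  sum of these two preserves the condition: q^{-1} Y' g and q Y g + (q - q^{-1}) Y' g add up to q (Y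
  + Y') g.\<close>

lemma T_X: "1 \<le> i \<Longrightarrow> i < k \<Longrightarrow> k \<le> s \<Longrightarrow> T i f = q \<cdot> f \<Longrightarrow> T i (X k f) = q \<cdot> X k f"
proof (induction k)
  case (Suc k)
  have above: "T i (X m f) = q \<cdot> X m f" if "m < i" "i < s" "T i f = q \<cdot> f" for m
    using that T_Y_above by (induction m) (simp_all add: lin_op_zero[OF lin_T] linT linY scl_add, simp add: vec_simps)
  show ?case
  proof (cases "i = k")
    case False
    then show ?thesis using Suc T_Y_below[of i k f] by (simp add: linT linY scl_add)
  next
    case True
    then obtain m where k: "k = Suc m" using Suc.prems by (cases k) auto
    have m: "Suc m < s" and f: "T (Suc m) f = q \<cdot> f" using Suc.prems True k by auto
    have Xm: "T (Suc m) (X m f) = q \<cdot> X m f" using above[of m] m f True k by simp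
    show ?thesis unfolding True k X.simps linT T_Y_sym[OF m f] Xm
      by (simp add: vec_simps algebra_simps del: Y.simps)
  qed
qed simp

text \<open>As for \<open>T_X\<close>, now with the product (z - Y) (z - Y') of two neighbours,
  which is symmetric in them.\<close>

lemma T_C_sym: "1 \<le> i \<Longrightarrow> i < k \<Longrightarrow> k \<le> s \<Longrightarrow> T i f = q \<cdot> f \<Longrightarrow> T i (C k z f) = q \<cdot> C k z f"
proof (induction k arbitrary: f)
  case (Suc k)
  show ?case
  proof (cases "i = k")
    case False
    then have "T i (z \<cdot> f - Y k f) = q \<cdot> (z \<cdot> f - Y k f)"
      using Suc.prems T_Y_below[of i k f] by (simp add: linT linY scl_diff mult.commute)
    then show ?thesis using Suc False by simp
  next
    case True
    then obtain m where k: "k = Suc m" using Suc.prems by (cases k) auto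
    have m: "Suc m < s" and f: "T (Suc m) f = q \<cdot> f" using Suc.prems True k by auto
    note TY = T_Y_sym[OF m f]
    let ?g = "z \<cdot> (z \<cdot> f - Y (Suc m) f) - Y m (z \<cdot> f - Y (Suc m) f)"
    have "T (Suc m) ?g = q \<cdot> ?g"
      unfolding linT linY TY f using q_nonzero by (auto simp: vec_simps field_simps)
    moreover have "C (Suc k) z f = C m z ?g" by (simp only: k C.simps)
    ultimately show ?thesis
      using T_C_above[of m "Suc m" z ?g] m by (simp only: True k linC)
  qed
qed simp

lemma sym_diff_Y: "sym (Suc k) f \<Longrightarrow> k < s \<Longrightarrow> sym k (z \<cdot> f - Y k f)"
  unfolding sym_def using T_Y_below by (auto simp: linT linY scl_diff mult.commute)

subsection \<open>A q-difference equation for the central polynomial\<close>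

text \<open>For m = 0 this is (1 + z J) (z - J) = (z^2 - 1) J, that is J^2 = 1. The step applies
  T_{m+1} to the hypothesis for g = (z - Y_{m+1}) f. On the left Y_m turns into q^{-1} Y_{m+1}; on
  the right T_{m+1} Y_m g = q (z / q^2 - Y_m) Y_{m+1} f supplies the missing factor of C at the
  shifted argument. This is where z / q^2 comes from.\<close>

lemma q_difference_aux:
  "m < s \<Longrightarrow> sym (Suc m) f \<Longrightarrow>
    (q ^ (2 * m)) \<cdot> C (Suc m) z f + z \<cdot> Y m (C (Suc m) z f)
      = ((z\<^sup>2 - 1) * q ^ (2 * m)) \<cdot> C m (z / q\<^sup>2) (Y m f)"
proof (induction m arbitrary: f)
  case 0
  show ?case by (simp add: linJ J_quad) (simp add: vec_simps algebra_simps power2_eq_square)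
next
  case (Suc m)
  define g where "g = z \<cdot> f - Y (Suc m) f"
  define P where "P = C (Suc m) z g"
  let ?T = "T (Suc m)"
  have CP: "C (Suc (Suc m)) z f = P" by (simp add: P_def g_def)
  have f: "?T f = q \<cdot> f" using Suc.prems by (simp add: sym_def)
  have P: "?T P = q \<cdot> P"
    using T_C_sym[of "Suc m" "Suc (Suc m)" f z] Suc.prems f CP by simp
  have sg: "sym (Suc m) g"
    unfolding g_def using Suc.prems sym_diff_Y by blast
  have "(q ^ (2 * m)) \<cdot> P + z \<cdot> Y m P = ((z\<^sup>2 - 1) * q ^ (2 * m)) \<cdot> C m (z / q\<^sup>2) (Y m g)"
    using Suc.IH[OF _ sg] Suc.prems by (simp add: P_def)
  then have "?T ((q ^ (2 * m)) \<cdot> P + z \<cdot> Y m P) = ?T (((z\<^sup>2 - 1) * q ^ (2 * m)) \<cdot> C m (z / q\<^sup>2) (Y m g))"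
    by simp
  moreover have "?T (C m (z / q\<^sup>2) (Y m g)) = C m (z / q\<^sup>2) (?T (Y m g))"
    using Suc.prems by (intro T_C_above) auto
  moreover have "?T (Y m g) = (z * inverse q) \<cdot> Y (Suc m) f - q \<cdot> Y m (Y (Suc m) f)"
    unfolding g_def linY linT using T_Y_sym(1,3)[OF Suc.prems(1) f] by simp
  ultimately have eq: "(q ^ (2 * m)) \<cdot> q \<cdot> P + z \<cdot> inverse q \<cdot> Y (Suc m) P
      = ((z\<^sup>2 - 1) * q ^ (2 * m)) \<cdot> C m (z / q\<^sup>2) ((z * inverse q) \<cdot> Y (Suc m) f - q \<cdot> Y m (Y (Suc m) f))"
    by (simp only: linT P T_Y_sym(1)[OF Suc.prems(1) P])
  have "C (Suc m) (z / q\<^sup>2) (Y (Suc m) f)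
      = inverse q \<cdot> C m (z / q\<^sup>2) ((z * inverse q) \<cdot> Y (Suc m) f - q \<cdot> Y m (Y (Suc m) f))"
    using q_nonzero by (simp add: linC vec_simps field_simps power2_eq_square del: Y.simps)
  define c where "c = C m (z / q\<^sup>2) ((z * inverse q) \<cdot> Y (Suc m) f - q \<cdot> Y m (Y (Suc m) f))"
  have c: "C (Suc m) (z / q\<^sup>2) (Y (Suc m) f) = inverse q \<cdot> c"
    unfolding c_def by fact
  show ?case unfolding CP c
  proof
    fix i
    have "((q ^ (2 * Suc m)) \<cdot> P + z \<cdot> Y (Suc m) P) i
        = q * (((q ^ (2 * m)) \<cdot> q \<cdot> P + z \<cdot> inverse q \<cdot> Y (Suc m) P) i)"
      using q_nonzero by (simp add: vec_simps field_simps del: Y.simps)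
    also have "\<dots> = q * ((((z\<^sup>2 - 1) * q ^ (2 * m)) \<cdot> c) i)"
      unfolding eq c_def ..
    also have "\<dots> = (((z\<^sup>2 - 1) * q ^ (2 * Suc m)) \<cdot> inverse q \<cdot> c) i"
      using q_nonzero by (simp add: vec_simps field_simps power2_eq_square)
    finally show "((q ^ (2 * Suc m)) \<cdot> P + z \<cdot> Y (Suc m) P) i
      = (((z\<^sup>2 - 1) * q ^ (2 * Suc m)) \<cdot> inverse q \<cdot> c) i" .
  qed
qed

text \<open>On an eigenvector of X this is a scalar equation between C(z / q^2) and C(z). The
  induction rewrites z - q^2 Y_k as (z - Y_k) - (q^2 - 1) Y_k: the hypothesis treats the former, and
  \<open>q_difference_aux\<close> turns the latter into the new summand Y_k of X.\<close>

lemma q_difference: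
  "k \<le> s \<Longrightarrow> sym k f \<Longrightarrow>
    ((z\<^sup>2 - 1) * q ^ (2 * k)) \<cdot> C k (z / q\<^sup>2) f
      = (z\<^sup>2 - q ^ (2 * k)) \<cdot> C k z f - (z * (q\<^sup>2 - 1)) \<cdot> X k (C k z f)"
proof (induction k arbitrary: f)
  case (Suc k)
  define g where "g = z \<cdot> f - Y k f"
  have k: "k < s" using Suc.prems by simp
  have sg: "sym k g" unfolding g_def using Suc.prems sym_diff_Y by auto
  have 1: "((z\<^sup>2 - 1) * q ^ (2 * k)) \<cdot> C k (z / q\<^sup>2) g
      = (z\<^sup>2 - q ^ (2 * k)) \<cdot> C k z g - (z * (q\<^sup>2 - 1)) \<cdot> X k (C k z g)"
    using Suc.IH[OF _ sg] Suc.prems by simp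
  have 2: "(q ^ (2 * k)) \<cdot> C k z g + z \<cdot> Y k (C k z g)
      = ((z\<^sup>2 - 1) * q ^ (2 * k)) \<cdot> C k (z / q\<^sup>2) (Y k f)"
    using q_difference_aux[OF k Suc.prems(2), of z] by (simp add: g_def)
  have 3: "C k (z / q\<^sup>2) g = z \<cdot> C k (z / q\<^sup>2) f - C k (z / q\<^sup>2) (Y k f)"
    by (simp add: g_def linC)
  have 4: "C (Suc k) (z / q\<^sup>2) f = (z / q\<^sup>2) \<cdot> C k (z / q\<^sup>2) f - C k (z / q\<^sup>2) (Y k f)"
    by (simp add: linC)
  have 5: "C (Suc k) z f = C k z g" by (simp add: g_def)
  show ?case
  proof
    fix i
    define A B where "A = C k (z / q\<^sup>2) f i" and "B = C k (z / q\<^sup>2) (Y k f) i"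
    define P X' Y' where "P = C k z g i" and "X' = X k (C k z g) i" and "Y' = Y k (C k z g) i"
    have e1: "(z\<^sup>2 - 1) * q ^ (2 * k) * (z * A - B) = (z\<^sup>2 - q ^ (2 * k)) * P - z * (q\<^sup>2 - 1) * X'"
      using fun_cong[OF 1, of i] unfolding 3 A_def B_def P_def X'_def by (simp add: vec_simps)
    have e2: "q ^ (2 * k) * P + z * Y' = (z\<^sup>2 - 1) * q ^ (2 * k) * B"
      using fun_cong[OF 2, of i] unfolding B_def P_def Y'_def by (simp add: vec_simps)
    have "(((z\<^sup>2 - 1) * q ^ (2 * Suc k)) \<cdot> C (Suc k) (z / q\<^sup>2) f) i
        = (z\<^sup>2 - 1) * q ^ (2 * k) * (z * A - q\<^sup>2 * B)"
      unfolding 4 A_def B_def using q_nonzero by (simp add: vec_simps field_simps power2_eq_square)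
    also have "\<dots> = (z\<^sup>2 - q ^ (2 * k) * q\<^sup>2) * P - z * (q\<^sup>2 - 1) * (X' + Y')"
    proof -
      have "(z\<^sup>2 - 1) * q ^ (2 * k) * (z * A - q\<^sup>2 * B)
          = (z\<^sup>2 - 1) * q ^ (2 * k) * (z * A - B) - (q\<^sup>2 - 1) * ((z\<^sup>2 - 1) * q ^ (2 * k) * B)"
        by (simp add: algebra_simps)
      then show ?thesis unfolding e1 e2[symmetric] by (simp add: algebra_simps)
    qed
    also have "\<dots> = ((z\<^sup>2 - q ^ (2 * Suc k)) \<cdot> C (Suc k) z f - (z * (q\<^sup>2 - 1)) \<cdot> X (Suc k) (C (Suc k) z f)) i"
      unfolding 5 P_def X'_def Y'_def by (simp add: vec_simps power2_eq_square)
    finally show "(((z\<^sup>2 - 1) * q ^ (2 * Suc k)) \<cdot> C (Suc k) (z / q\<^sup>2) f) i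
      = ((z\<^sup>2 - q ^ (2 * Suc k)) \<cdot> C (Suc k) z f - (z * (q\<^sup>2 - 1)) \<cdot> X (Suc k) (C (Suc k) z f)) i" .
  qed
qed (simp add: vec_simps lin_op_zero)

lemma C_coordinate_poly:
  "\<exists>p. degree p \<le> k \<and> coeff p k = f i \<and> (\<forall>z. C k z f i = poly p z)"
proof (induction k arbitrary: f)
  case 0
  show ?case by (intro exI[of _ "[:f i:]"]) simp
next
  case (Suc k)
  obtain p where p: "degree p \<le> k" "coeff p k = f i" "\<And>z. C k z f i = poly p z"
    using Suc by blast
  obtain r where r: "degree r \<le> k" "\<And>z. C k z (Y k f) i = poly r z"
    using Suc by blast
  have "degree (pCons 0 p - r) \<le> Suc k"
    using p(1) r(1) by (intro degree_diff_le) (auto intro: order.trans[OF degree_pCons_le])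
  moreover have "coeff (pCons 0 p - r) (Suc k) = f i"
    using p(2) r(1) by (simp add: coeff_eq_0)
  ultimately show ?case
    by (intro exI[of _ "pCons 0 p - r"]) (auto simp: linC p r vec_simps)
qed

text \<open>The roots q^{2i}, i < k, and -q^{2i}, i < j, are the Jucys-Murphy contents of the
  bipartition ((k), (j)), with one row for each eigenvalue of J.\<close>

definition eigenpoly :: "nat \<Rightarrow> nat \<Rightarrow> 'k poly" where
  "eigenpoly k j = (\<Prod>i<k. [:- (q ^ (2 * i)), 1:]) * (\<Prod>i<j. [:q ^ (2 * i), 1:])"

lemma poly_eigenpoly:
  "poly (eigenpoly k j) z = (\<Prod>i<k. z - q ^ (2 * i)) * (\<Prod>i<j. z + q ^ (2 * i))"
  by (simp add: eigenpoly_def poly_prod algebra_simps)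

lemma degree_eigenpoly: "degree (eigenpoly k j) = k + j"
  and lead_coeff_eigenpoly: "coeff (eigenpoly k j) (k + j) = 1"
proof -
  have 1: "degree (\<Prod>i<m. [:c i, 1::'k:]) = m \<and> lead_coeff (\<Prod>i<m. [:c i, 1::'k:]) = 1" for m :: nat and c
  proof (induction m)
    case (Suc m)
    then have "(\<Prod>i<m. [:c i, 1::'k:]) \<noteq> 0" by auto
    then have "degree ((\<Prod>i<m. [:c i, 1::'k:]) * [:c m, 1:]) = m + 1"
      using Suc by (subst degree_mult_eq) auto
    moreover have "lead_coeff ((\<Prod>i<m. [:c i, 1::'k:]) * [:c m, 1:]) = 1"
      unfolding lead_coeff_mult using Suc by (auto simp del: lead_coeff_mult)
    ultimately show ?case unfolding prod.lessThan_Suc by (metis Suc_eq_plus1)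
  qed simp
  have 2: "(\<Prod>i<m. [:c i, 1::'k:]) \<noteq> 0" for m :: nat and c using 1[of c m] by auto
  show deg: "degree (eigenpoly k j) = k + j"
    unfolding eigenpoly_def using 1 2 by (simp add: degree_mult_eq)
  have "lead_coeff (eigenpoly k j) = 1"
    unfolding eigenpoly_def lead_coeff_mult by (simp only: conjunct2[OF 1] mult_1)
  then show "coeff (eigenpoly k j) (k + j) = 1" by (simp add: deg)
qed

text \<open>Passing to z / q^2 multiplies all roots by q^2, so in each of the two products the first
  root is merely replaced by a new last one.\<close>

lemma eigenpoly_q_difference:
  "(z\<^sup>2 - 1) * q ^ (2 * (k + j)) * poly (eigenpoly k j) (z / q\<^sup>2)
    = (z - q ^ (2 * k)) * (z + q ^ (2 * j)) * poly (eigenpoly k j) z"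
proof -
  have shift: "q ^ (2 * m) * (\<Prod>i<m. z / q\<^sup>2 - c * q ^ (2 * i)) = (\<Prod>i<m. z - c * q ^ (2 * Suc i))" for m c
  proof (induction m)
    case (Suc m)
    have "q ^ (2 * Suc m) * (\<Prod>i<Suc m. z / q\<^sup>2 - c * q ^ (2 * i))
        = (q ^ (2 * m) * (\<Prod>i<m. z / q\<^sup>2 - c * q ^ (2 * i))) * (q\<^sup>2 * (z / q\<^sup>2 - c * q ^ (2 * m)))"
      by (simp add: power2_eq_square)
    then show ?case unfolding Suc.IH using q_nonzero
      by (simp add: field_simps power2_eq_square)
  qed simp
  have "(z - c) * (\<Prod>i<m. z - c * q ^ (2 * Suc i)) = (z - c * q ^ (2 * m)) * (\<Prod>i<m. z - c * q ^ (2 * i))" for m c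
    using prod.lessThan_Suc_shift[of "\<lambda>i. z - c * q ^ (2 * i)" m]
    by (simp add: mult.commute)
  then have *: "(z - c) * (q ^ (2 * m) * (\<Prod>i<m. z / q\<^sup>2 - c * q ^ (2 * i)))
      = (z - c * q ^ (2 * m)) * (\<Prod>i<m. z - c * q ^ (2 * i))" for m c
    unfolding shift .
  have "(z\<^sup>2 - 1) * q ^ (2 * (k + j)) * poly (eigenpoly k j) (z / q\<^sup>2)
     = ((z - 1) * (q ^ (2 * k) * (\<Prod>i<k. z / q\<^sup>2 - 1 * q ^ (2 * i))))
       * ((z - (- 1)) * (q ^ (2 * j) * (\<Prod>i<j. z / q\<^sup>2 - (- 1) * q ^ (2 * i))))"
    unfolding poly_eigenpoly by (simp add: algebra_simps power2_eq_square power_add)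
  also have "\<dots> = (z - q ^ (2 * k)) * (z + q ^ (2 * j)) * poly (eigenpoly k j) z"
    unfolding * poly_eigenpoly by (simp add: algebra_simps)
  finally show ?thesis .
qed

lemma infinite_field: "infinite (UNIV :: 'k set)"
proof -
  have "inj (\<lambda>m::nat. q ^ m)"
  proof (rule linorder_injI)
    fix x y :: nat
    assume "x < y"
    then show "q ^ x \<noteq> q ^ y"
      using q_not_root[of "y - x"] q_nonzero by (simp add: power_diff)
  qed
  then show ?thesis using infinite_iff_countable_subset by blast
qed

text \<open>Comparing leading coefficients gives q^{2d} = q^{2 deg R}, impossible for deg R < d
  because q is not a root of unity.\<close>

lemma q_difference_unique:
  assumes deg: "degree R < d"
    and eq: "\<And>z. (z\<^sup>2 - 1) * q ^ (2 * d) * poly R (z / q\<^sup>2) = (z\<^sup>2 + B * z + c) * poly R z"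
  shows "R = (0 :: 'k poly)"
proof (rule ccontr)
  assume R: "R \<noteq> 0"
  define L where "L = [:-1, 0, 1:] * smult (q ^ (2 * d)) (R \<circ>\<^sub>p [:0, inverse (q\<^sup>2):]) - [:c, B, 1:] * R"
  have "poly L z = 0" for z
    using eq[of z] by (simp add: L_def poly_pcompose field_simps power2_eq_square)
  then have "L = 0"
    using poly_roots_finite[of L] infinite_field by auto
  then have "lead_coeff ([:-1, 0, 1:] * smult (q ^ (2 * d)) (R \<circ>\<^sub>p [:0, inverse (q\<^sup>2):]))
      = lead_coeff ([:c, B, 1:] * R)"
    by (simp add: L_def)
  then have "q ^ (2 * d) * (lead_coeff R * inverse (q\<^sup>2) ^ degree R) = lead_coeff R"
    unfolding lead_coeff_mult lead_coeff_smult using q_nonzero by (simp add: lead_coeff_comp)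
  then have "q ^ (2 * d) = q ^ (2 * degree R)"
    using R q_nonzero by (simp add: field_simps flip: power_mult)
  then have "q ^ (2 * (d - degree R)) = 1"
    using deg q_nonzero by (simp add: power_diff diff_mult_distrib2)
  then show False using q_not_root[of "2 * (d - degree R)"] deg by simp
qed

text \<open>The hypothesis on \<theta> says that it is the sum of the contents of ((k), (j)). Each
  coordinate of C(z) f is a polynomial in z that satisfies the same q-difference equation as
  \<open>eigenpoly k j\<close>, with leading coefficient f i in degree s. Its difference from f i
  times \<open>eigenpoly k j\<close> has smaller degree and vanishes by uniqueness.\<close>

lemma C_eigenvector:
  assumes f: "sym s f" and X: "X s f = \<theta> \<cdot> f"
    and \<theta>: "\<theta> * (q\<^sup>2 - 1) = q ^ (2 * k) - q ^ (2 * j)" and s: "k + j = s"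
  shows "C s z f = poly (eigenpoly k j) z \<cdot> f"
proof
  fix i
  obtain p where p: "degree p \<le> s" "coeff p s = f i" "\<And>z. C s z f i = poly p z"
    using C_coordinate_poly by blast
  define R where "R = p - smult (f i) (eigenpoly k j)"
  have eqp: "(z\<^sup>2 - 1) * q ^ (2 * s) * poly p (z / q\<^sup>2)
      = (z\<^sup>2 + (q ^ (2 * j) - q ^ (2 * k)) * z + - (q ^ (2 * k) * q ^ (2 * j))) * poly p z" for z
  proof -
    have "((z\<^sup>2 - 1) * q ^ (2 * s)) \<cdot> C s (z / q\<^sup>2) f
      = (z\<^sup>2 - q ^ (2 * s)) \<cdot> C s z f - (z * (q\<^sup>2 - 1)) \<cdot> \<theta> \<cdot> C s z f"
      using q_difference[OF order.refl f, of z] by (simp add: X_C X linC)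
    from fun_cong[OF this, of i]
    have "(z\<^sup>2 - 1) * q ^ (2 * s) * poly p (z / q\<^sup>2)
      = (z\<^sup>2 - q ^ (2 * s)) * poly p z - z * (\<theta> * (q\<^sup>2 - 1)) * poly p z"
      by (simp add: p(3) vec_simps algebra_simps)
    then show ?thesis unfolding \<theta> s[symmetric] by (simp add: algebra_simps power_add)
  qed
  have eqe: "(z\<^sup>2 - 1) * q ^ (2 * s) * poly (eigenpoly k j) (z / q\<^sup>2)
      = (z\<^sup>2 + (q ^ (2 * j) - q ^ (2 * k)) * z + - (q ^ (2 * k) * q ^ (2 * j))) * poly (eigenpoly k j) z" for z
    using eigenpoly_q_difference[of z k j] unfolding s
    by (simp add: algebra_simps power2_eq_square)
  have "R = 0"
  proof (cases "s = 0")
    case True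
    then show ?thesis using p s by (auto simp: R_def eigenpoly_def elim!: degree_eq_zeroE)
  next
    case False
    have "degree R \<le> s"
      unfolding R_def using p(1) degree_eigenpoly[of k j] s
      by (intro degree_diff_le) (auto intro: order.trans[OF degree_smult_le])
    moreover have "coeff R s = 0"
      unfolding R_def using p(2) lead_coeff_eigenpoly[of k j] s by simp
    ultimately have "degree R < s"
      using False by (cases "R = 0") (auto simp: le_less)
    then show ?thesis
    proof (rule q_difference_unique)
      fix z
      show "(z\<^sup>2 - 1) * q ^ (2 * s) * poly R (z / q\<^sup>2)
        = (z\<^sup>2 + (q ^ (2 * j) - q ^ (2 * k)) * z + - (q ^ (2 * k) * q ^ (2 * j))) * poly R z"
      proof -
        have "(z\<^sup>2 - 1) * q ^ (2 * s) * poly R (z / q\<^sup>2)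
          = (z\<^sup>2 - 1) * q ^ (2 * s) * poly p (z / q\<^sup>2)
            - f i * ((z\<^sup>2 - 1) * q ^ (2 * s) * poly (eigenpoly k j) (z / q\<^sup>2))"
          by (simp add: R_def algebra_simps)
        then show ?thesis unfolding eqp eqe by (simp add: R_def algebra_simps)
      qed
    qed
  qed
  then have "poly p z = f i * poly (eigenpoly k j) z"
    by (simp add: R_def)
  then show "C s z f i = (poly (eigenpoly k j) z \<cdot> f) i"
    by (simp add: p(3) vec_simps)
qed

subsection \<open>Fusion of the K-matrix\<close>

text \<open>The R-matrix is \<open>T - z T\<^sup>-\<^sup>1\<close>.\<close>

definition Rop :: "nat \<Rightarrow> 'k \<Rightarrow> ('i \<Rightarrow> 'k) \<Rightarrow> 'i \<Rightarrow> 'k" where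
  "Rop k z f = (1 - z) \<cdot> T k f + (z * (q - inverse q)) \<cdot> f"

lemma lin_Rop: "lin_op (Rop k z)"
  unfolding lin_op_def Rop_def by (auto simp: linT vec_simps algebra_simps)

lemmas linR = lin_opD[OF lin_Rop]

text \<open>On a q-symmetric vector R exchanges the parameters of neighbouring factors: (b - Y_k) (a
  - Y_{k+1}) becomes (a / q^2 - Y_k) (q^2 b - Y_{k+1}) up to a scalar. So a travels to the left and
  is divided by q^2 at each step, while b is multiplied by q^2.\<close>

lemma Rop_exchange:
  assumes k: "Suc k < s" and g: "T (Suc k) g = q \<cdot> g" and a: "a \<noteq> 0" and z: "z = q\<^sup>2 * b / a"
  shows "Rop (Suc k) z (b \<cdot> (a \<cdot> g - Y (Suc k) g) - Y k (a \<cdot> g - Y (Suc k) g))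
    = (q - z / q) \<cdot> ((a / q\<^sup>2) \<cdot> ((q\<^sup>2 * b) \<cdot> g - Y (Suc k) g) - Y k ((q\<^sup>2 * b) \<cdot> g - Y (Suc k) g))"
  unfolding Rop_def linT linY T_Y_sym[OF k g] g z using a q_nonzero
  by (auto simp: vec_simps field_simps power2_eq_square simp del: Y.simps)

primrec tailprod :: "'k \<Rightarrow> nat list \<Rightarrow> ('i \<Rightarrow> 'k) \<Rightarrow> 'i \<Rightarrow> 'k" where
  "tailprod z [] f = f"
| "tailprod z (i # is) f = z \<cdot> tailprod z is f - Y i (tailprod z is f)"

text \<open>\<open>mixed j b a b' m f\<close> is the product of \<open>b - Y\<^sub>i\<close> for \<open>i < m\<close>, of \<open>a - Y\<^sub>m\<close>,
  and of \<open>b' - Y\<^sub>i\<close> for \<open>m < i < j\<close>, applied to f.\<close>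

definition mixed :: "nat \<Rightarrow> 'k \<Rightarrow> 'k \<Rightarrow> 'k \<Rightarrow> nat \<Rightarrow> ('i \<Rightarrow> 'k) \<Rightarrow> 'i \<Rightarrow> 'k" where
  "mixed j b a b' m f = C m b (a \<cdot> tailprod b' [Suc m..<j] f - Y m (tailprod b' [Suc m..<j] f))"

lemma T_tailprod:
  "1 \<le> m \<Longrightarrow> \<forall>i\<in>set is. m < i \<and> i < s \<Longrightarrow> T m f = q \<cdot> f \<Longrightarrow> T m (tailprod z is f) = q \<cdot> tailprod z is f"
  by (induction "is") (auto simp: linT linY T_Y_below scl_diff mult.commute)

lemma tailprod_append: "tailprod z (is @ js) f = tailprod z is (tailprod z js f)"
  by (induction "is") auto

lemma tailprod_C: "k \<le> s \<Longrightarrow> tailprod z [0..<k] f = C k z f"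
proof (induction k arbitrary: f)
  case (Suc k)
  then show ?case by (simp add: tailprod_append)
qed simp

lemma Rop_mixed:
  assumes m: "1 \<le> m" "m < j" "j \<le> s" and f: "sym j f" and a: "a \<noteq> 0" and z: "z = q\<^sup>2 * b / a"
  shows "Rop m z (mixed j b a (q\<^sup>2 * b) m f) = (q - z / q) \<cdot> mixed j b (a / q\<^sup>2) (q\<^sup>2 * b) (m - 1) f"
proof -
  obtain k where k: "m = Suc k" using m by (cases m) auto
  define g where "g = tailprod (q\<^sup>2 * b) [Suc m..<j] f"
  have g: "T (Suc k) g = q \<cdot> g"
    unfolding g_def using m f k by (intro T_tailprod) (auto simp: sym_def)
  have RC: "Rop (Suc k) z (C k b v) = C k b (Rop (Suc k) z v)" for v
    unfolding Rop_def using T_C_above[of k "Suc k" b v] m k by (simp add: linC)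
  have up: "[Suc k..<j] = Suc k # [Suc m..<j]"
    using m k by (simp add: upt_rec)
  have "Rop m z (mixed j b a (q\<^sup>2 * b) m f)
    = C k b (Rop (Suc k) z (b \<cdot> (a \<cdot> g - Y (Suc k) g) - Y k (a \<cdot> g - Y (Suc k) g)))"
    by (simp add: mixed_def k RC[symmetric] g_def[symmetric] del: Y.simps) (simp add: g_def k del: Y.simps)
  also have "\<dots> = (q - z / q) \<cdot> C k b ((a / q\<^sup>2) \<cdot> ((q\<^sup>2 * b) \<cdot> g - Y (Suc k) g) - Y k ((q\<^sup>2 * b) \<cdot> g - Y (Suc k) g))"
    using m k by (subst Rop_exchange[OF _ g a z]) (simp_all only: linC)
  also have "\<dots> = (q - z / q) \<cdot> mixed j b (a / q\<^sup>2) (q\<^sup>2 * b) (m - 1) f"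
    by (simp add: mixed_def k up g_def del: Y.simps upt_Suc)
  finally show ?thesis .
qed

text \<open>The parameter a is carried from position m to position 0. The scalar depends on the
  parameters only, and its factors q - z k / q are nonzero because z k is not q^2.\<close>

lemma fold_Rop_mixed:
  assumes "j \<le> s" and a: "a \<noteq> 0"
    and z: "\<And>k. 1 \<le> k \<Longrightarrow> k \<le> m \<Longrightarrow> z k = q\<^sup>2 * b / (a / q ^ (2 * (m - k))) \<and> z k \<noteq> q\<^sup>2"
  shows "m < j \<Longrightarrow> \<exists>c. c \<noteq> 0 \<and> (\<forall>f. sym j f \<longrightarrow>
      fold (\<lambda>k. Rop k (z k)) (rev [1..<Suc m]) (mixed j b a (q\<^sup>2 * b) m f)
      = c \<cdot> mixed j b (a / q ^ (2 * m)) (q\<^sup>2 * b) 0 f)"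
  using a z
proof (induction m arbitrary: a)
  case 0
  show ?case by (intro exI[of _ 1]) simp
next
  case (Suc m)
  have z: "z (Suc m) = q\<^sup>2 * b / a" and zq: "z (Suc m) \<noteq> q\<^sup>2" using Suc.prems(3)[of "Suc m"] by auto
  have fold_scl: "fold (\<lambda>k. Rop k (z k)) ks (c \<cdot> v) = c \<cdot> fold (\<lambda>k. Rop k (z k)) ks v" for ks c v
    by (induction ks arbitrary: v) (auto simp: linR)
  have first: "Rop (Suc m) (z (Suc m)) (mixed j b a (q\<^sup>2 * b) (Suc m) f)
      = (q - z (Suc m) / q) \<cdot> mixed j b (a / q\<^sup>2) (q\<^sup>2 * b) m f" if "sym j f" for f
    using Rop_mixed[of "Suc m" j f a "z (Suc m)" b] Suc.prems \<open>j \<le> s\<close> that z by simp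
  have nz: "q - z (Suc m) / q \<noteq> 0"
    using zq q_nonzero by (simp add: field_simps power2_eq_square)
  have "\<exists>c. c \<noteq> 0 \<and> (\<forall>f. sym j f \<longrightarrow>
      fold (\<lambda>k. Rop k (z k)) (rev [1..<Suc m]) (mixed j b (a / q\<^sup>2) (q\<^sup>2 * b) m f)
      = c \<cdot> mixed j b ((a / q\<^sup>2) / q ^ (2 * m)) (q\<^sup>2 * b) 0 f)"
  proof (rule Suc.IH)
    fix k
    assume k: "1 \<le> k" "k \<le> m"
    then have "q ^ (2 * (Suc m - k)) = q\<^sup>2 * q ^ (2 * (m - k))"
      by (simp add: Suc_diff_le power_add power2_eq_square)
    then have aq: "a / q\<^sup>2 / q ^ (2 * (m - k)) = a / q ^ (2 * (Suc m - k))" by simp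
    show "z k = q\<^sup>2 * b / (a / q\<^sup>2 / q ^ (2 * (m - k))) \<and> z k \<noteq> q\<^sup>2"
      unfolding aq using k by (intro Suc.prems(3)) auto
  qed (use Suc.prems q_nonzero in auto)
  then obtain c where c: "c \<noteq> 0" "\<And>f. sym j f \<Longrightarrow>
      fold (\<lambda>k. Rop k (z k)) (rev [1..<Suc m]) (mixed j b (a / q\<^sup>2) (q\<^sup>2 * b) m f)
      = c \<cdot> mixed j b ((a / q\<^sup>2) / q ^ (2 * m)) (q\<^sup>2 * b) 0 f" by blast
  have step: "fold (\<lambda>k. Rop k (z k)) (rev [1..<Suc (Suc m)]) v
      = fold (\<lambda>k. Rop k (z k)) (rev [1..<Suc m]) (Rop (Suc m) (z (Suc m)) v)" for v
    by simp
  have aq: "a / q\<^sup>2 / q ^ (2 * m) = a / q ^ (2 * Suc m)"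
    by (simp add: power2_eq_square mult.assoc)
  have "fold (\<lambda>k. Rop k (z k)) (rev [1..<Suc (Suc m)]) (mixed j b a (q\<^sup>2 * b) (Suc m) f)
      = ((q - z (Suc m) / q) * c) \<cdot> mixed j b (a / q ^ (2 * Suc m)) (q\<^sup>2 * b) 0 f"
    if "sym j f" for f
    unfolding step first[OF that] fold_scl c(2)[OF that] aq by simp
  then show ?case using nz c(1) by (intro exI[of _ "(q - z (Suc m) / q) * c"]) (simp del: upt_Suc)
qed

text \<open>The j-th factor of the K-matrix up to a scalar; z j k is the ratio of the spectral
  parameters of its R-matrix at k, k + 1.\<close>

definition Kfac :: "(nat \<Rightarrow> nat \<Rightarrow> 'k) \<Rightarrow> nat \<Rightarrow> ('i \<Rightarrow> 'k) \<Rightarrow> 'i \<Rightarrow> 'k" where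
  "Kfac z j f = J (fold (\<lambda>k. Rop k (z j k)) (rev [1..<j]) f)"

lemma lin_Kfac: "lin_op (Kfac z j)"
proof -
  have "lin_op (\<lambda>f. fold (\<lambda>k. Rop k (z j k)) ks f)" for ks
    by (induction ks) (auto simp: lin_op_def linR)
  then show ?thesis unfolding lin_op_def Kfac_def by (auto simp: linJ)
qed

text \<open>Where C(a) is invertible on the symmetric part, the product of all factors is thus a
  multiple of C(v s) / C(a). Factor j + 1 carries the last parameter a to position 0, where it has
  become a0 = a / q^{2j}, the inverse of v (j + 1). There J reflects it, J (a0 - J) = -a0 (1 / a0 -
  J), after which all parameters equal v (j + 1).\<close>

lemma fusion:
  assumes a: "a \<noteq> 0" and v: "\<And>j. v (Suc j) = q\<^sup>2 * v j" and av: "a * v 1 = 1"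
    and z: "\<And>j k. 1 \<le> k \<Longrightarrow> k < j \<Longrightarrow> j \<le> s \<Longrightarrow> z j k = v j / (a / q ^ (2 * (j - 1 - k))) \<and> z j k \<noteq> q\<^sup>2"
  shows "j \<le> s \<Longrightarrow> \<exists>\<rho>. \<rho> \<noteq> 0 \<and> (\<forall>f. sym j f \<longrightarrow> fold (Kfac z) [1..<Suc j] (C j a f) = \<rho> \<cdot> C j (v j) f)"
proof (induction j)
  case 0
  show ?case by (intro exI[of _ 1]) simp
next
  case (Suc j)
  then obtain \<rho> where \<rho>: "\<rho> \<noteq> 0"
    and IH: "\<forall>f. sym j f \<longrightarrow> fold (Kfac z) [1..<Suc j] (C j a f) = \<rho> \<cdot> C j (v j) f"
    by (auto simp del: upt_Suc)
  have vpow: "v (Suc i) = q ^ (2 * i) * v 1" for i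
    by (induction i) (auto simp: v power2_eq_square)
  have av': "a / q ^ (2 * j) * v (Suc j) = 1"
    using av q_nonzero unfolding vpow[of j] by simp
  have zv: "1 \<le> k \<Longrightarrow> k \<le> j \<Longrightarrow> z (Suc j) k = q\<^sup>2 * v j / (a / q ^ (2 * (j - k))) \<and> z (Suc j) k \<noteq> q\<^sup>2" for k
    using z[of k "Suc j", unfolded v diff_Suc_1] Suc.prems by (meson le_imp_less_Suc)
  obtain c where c: "c \<noteq> 0" and step: "\<forall>f. sym (Suc j) f \<longrightarrow>
      fold (\<lambda>k. Rop k (z (Suc j) k)) (rev [1..<Suc j]) (mixed (Suc j) (v j) a (q\<^sup>2 * v j) j f)
      = c \<cdot> mixed (Suc j) (v j) (a / q ^ (2 * j)) (q\<^sup>2 * v j) 0 f"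
    using fold_Rop_mixed[OF Suc.prems a zv] by blast
  define a0 where "a0 = a / q ^ (2 * j)"
  have a0: "a0 \<noteq> 0" "a0 * (q\<^sup>2 * v j) = 1"
    using a q_nonzero av' by (auto simp: a0_def v)
  have fold_scl: "fold (\<lambda>k. Rop k (z (Suc j) k)) ks (c \<cdot> v) = c \<cdot> fold (\<lambda>k. Rop k (z (Suc j) k)) ks v" for ks c v
    by (induction ks arbitrary: v) (auto simp: linR)
  have "fold (Kfac z) [1..<Suc (Suc j)] (C (Suc j) a f) = (\<rho> * c * - a0) \<cdot> C (Suc j) (v (Suc j)) f"
    if f: "sym (Suc j) f" for f
  proof -
    define g where "g = tailprod (q\<^sup>2 * v j) [1..<Suc j] f"
    have sg: "sym j (a \<cdot> f - Y j f)" using sym_diff_Y f Suc.prems by simp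
    have "fold (Kfac z) [1..<Suc (Suc j)] (C (Suc j) a f)
        = Kfac z (Suc j) (fold (Kfac z) [1..<Suc j] (C j a (a \<cdot> f - Y j f)))"
      by simp
    also have "fold (Kfac z) [1..<Suc j] (C j a (a \<cdot> f - Y j f)) = \<rho> \<cdot> C j (v j) (a \<cdot> f - Y j f)"
      using IH sg by blast
    also have "C j (v j) (a \<cdot> f - Y j f) = mixed (Suc j) (v j) a (q\<^sup>2 * v j) j f"
      by (simp add: mixed_def)
    also have "Kfac z (Suc j) (\<rho> \<cdot> mixed (Suc j) (v j) a (q\<^sup>2 * v j) j f)
        = (\<rho> * c) \<cdot> J (mixed (Suc j) (v j) a0 (q\<^sup>2 * v j) 0 f)"
      unfolding Kfac_def a0_def using step f by (simp only: fold_scl linJ scl_scl)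
    also have "mixed (Suc j) (v j) a0 (q\<^sup>2 * v j) 0 f = a0 \<cdot> g - J g"
      by (simp add: mixed_def g_def del: upt_Suc)
    also have "J (a0 \<cdot> g - J g) = (- a0) \<cdot> ((q\<^sup>2 * v j) \<cdot> g - J g)"
      using a0(2) by (auto simp: linJ J_quad vec_simps algebra_simps)
    also have "(q\<^sup>2 * v j) \<cdot> g - J g = tailprod (q\<^sup>2 * v j) [0..<Suc j] f"
      unfolding g_def by (simp add: upt_conv_Cons del: upt_Suc)
    also have "\<dots> = C (Suc j) (v (Suc j)) f"
      using Suc.prems by (simp only: tailprod_C v)
    finally show ?thesis by simp
  qed
  then show ?case using \<rho>(1) c a0(1) by (intro exI[of _ "\<rho> * c * - a0"]) (simp del: upt_Suc)
qed

end

section \<open>The Hecke algebra action on words\<close>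

text \<open>Letters are arbitrary integers, so that \<open>l \<mapsto> n + 1 - l\<close> is an order-reversing involution
  of all letters and the relations hold for all functions on words.\<close>

definition T_word :: "nat \<Rightarrow> nat \<Rightarrow> (int list \<Rightarrow> cqx) \<Rightarrow> int list \<Rightarrow> cqx" where
  "T_word s k f w = (if length w = s \<and> 1 \<le> k \<and> k < s then
     let us = take (k - 1) w; a = w ! (k - 1); b = w ! k; vs = drop (k + 1) w in
       if a = b then qq * f w
       else if a < b then (qq - inverse qq) * f w + f (us @ b # a # vs)
       else f (us @ b # a # vs)
     else qq * f w)"

definition J_word :: "nat \<Rightarrow> nat \<Rightarrow> (int list \<Rightarrow> cqx) \<Rightarrow> int list \<Rightarrow> cqx" where
  "J_word n s f w = (if length w = s \<and> 0 < s then f ((int n + 1 - hd w) # tl w) else f w)"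

section \<open>Braid relations on two and three adjacent letters\<close>

definition exch :: "(int \<Rightarrow> int \<Rightarrow> cqx) \<Rightarrow> int \<Rightarrow> int \<Rightarrow> cqx" where
  "exch F a b = (if a = b then qq * F a b
     else if a < b then (qq - inverse qq) * F a b + F b a else F b a)"

lemma T_word_exch:
  assumes "k = Suc (length us)" "length us + 2 + length vs = s"
  shows "T_word s k f (us @ a # b # vs) = exch (\<lambda>x y. f (us @ x # y # vs)) a b"
  using assms by (simp add: T_word_def exch_def nth_append)

lemmas T_word_at = T_word_exch[unfolded exch_def]

lemma T_word_off: "length w \<noteq> s \<or> \<not> (1 \<le> k \<and> k < s) \<Longrightarrow> T_word s k f w = qq * f w"
  by (auto simp: T_word_def)

lemma J_word_at: "Suc (length vs) = s \<Longrightarrow> J_word n s f (l # vs) = f ((int n + 1 - l) # vs)"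
  by (simp add: J_word_def)

lemma split2:
  assumes "1 \<le> k" "k < length w"
  shows "\<exists>us a b vs. w = us @ a # b # vs \<and> k = Suc (length us)"
proof -
  have "w = take (k - 1) w @ w ! (k - 1) # drop (Suc (k - 1)) w"
    using assms by (intro id_take_nth_drop) simp
  also have "drop (Suc (k - 1)) w = w ! k # drop (Suc k) w"
    using assms by (simp add: Cons_nth_drop_Suc)
  finally have "w = take (k - 1) w @ w ! (k - 1) # w ! k # drop (Suc k) w" .
  moreover have "k = Suc (length (take (k - 1) w))" using assms by simp
  ultimately show ?thesis by blast
qed

definition exch12 :: "(int \<Rightarrow> int \<Rightarrow> int \<Rightarrow> cqx) \<Rightarrow> int \<Rightarrow> int \<Rightarrow> int \<Rightarrow> cqx" where
  "exch12 F a b c = exch (\<lambda>x y. F x y c) a b"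

definition exch23 :: "(int \<Rightarrow> int \<Rightarrow> int \<Rightarrow> cqx) \<Rightarrow> int \<Rightarrow> int \<Rightarrow> int \<Rightarrow> cqx" where
  "exch23 F a b c = exch (\<lambda>x y. F a x y) b c"

lemma qq_cancel: "qq * (inverse qq * x) = x" "inverse qq * (qq * x) = x"
  by (simp_all flip: mult.assoc)

lemma exch_braid: "exch12 (exch23 (exch12 F)) a b c = exch23 (exch12 (exch23 F)) a b c"
  by (cases a b rule: linorder_cases; cases b c rule: linorder_cases; cases a c rule: linorder_cases;
      simp add: exch12_def exch23_def exch_def; simp add: algebra_simps qq_cancel)

definition flip1 :: "int \<Rightarrow> (int \<Rightarrow> int \<Rightarrow> cqx) \<Rightarrow> int \<Rightarrow> int \<Rightarrow> cqx" where
  "flip1 N F a b = F (N - a) b"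

text \<open>Only the order of a and b and that of a and N - b matter, hence the sign of a + b - N;
  this gives nine cases. For a + b = N letters coincide after a flip, which becomes visible once N
  is substituted.\<close>

lemma exch_flip_braid: "flip1 N (exch (flip1 N (exch F))) a b = exch (flip1 N (exch (flip1 N F))) a b"
proof -
  consider "a < b" | "a = b" | "b < a" by linarith
  then show ?thesis
  proof cases
    case 1
    consider "a + b < N" | "a + b = N" | "a + b > N" by linarith
    then show ?thesis
    proof cases
      case 2
      then have "N = a + b" by simp
      then show ?thesis using 1 by (simp add: exch_def flip1_def field_simps)
    qed (use 1 in \<open>simp_all add: exch_def flip1_def field_simps\<close>)
  next
    case 2
    consider "a + b < N" | "a + b = N" | "a + b > N" by linarith
    then show ?thesis
    proof cases
      case 2
      then have "N = a + b" by simp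
      then show ?thesis using \<open>a = b\<close> by (simp add: exch_def flip1_def field_simps)
    qed (use 2 in \<open>simp_all add: exch_def flip1_def field_simps\<close>)
  next
    case 3
    consider "a + b < N" | "a + b = N" | "a + b > N" by linarith
    then show ?thesis
    proof cases
      case 2
      then have "N = a + b" by simp
      then show ?thesis using 3 by (simp add: exch_def flip1_def field_simps)
    qed (use 3 in \<open>simp_all add: exch_def flip1_def field_simps\<close>)
  qed
qed

text \<open>On words of length other than s the operators are the scalars q and 1, which satisfy all
  the relations. On words of length s a relation concerns a few letters only, and the rest of the
  word is a parameter.\<close>

lemma hecke_words: "hecke_B s qq (T_word s) (J_word n s)"
proof
  show "qq \<noteq> 0" by simp
  show "qq ^ m \<noteq> 1" if "m > 0" for m using that by (simp add: qq_power_eq_1_iff)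
  show "lin_op (T_word s k)" for k
    unfolding lin_op_def
  proof (intro conjI allI ext)
    fix f g :: "int list \<Rightarrow> cqx" and w
    show "T_word s k (f + g) w = (T_word s k f + T_word s k g) w"
      by (simp add: T_word_def Let_def vec_simps algebra_simps)
  next
    fix a and f :: "int list \<Rightarrow> cqx" and w
    show "T_word s k (a \<cdot> f) w = (a \<cdot> T_word s k f) w"
      by (simp add: T_word_def Let_def vec_simps algebra_simps)
  qed
  show "lin_op (J_word n s)"
    by (auto simp: lin_op_def J_word_def vec_simps)
  show "T_word s k (T_word s k f) = f + (qq - inverse qq) \<cdot> T_word s k f" if k: "1 \<le> k" "k < s" for k f
  proof
    fix w
    show "T_word s k (T_word s k f) w = (f + (qq - inverse qq) \<cdot> T_word s k f) w"
    proof (cases "length w = s")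
      case True
      then obtain us a b vs where w: "w = us @ a # b # vs" "k = Suc (length us)"
        using split2[of k w] k by auto
      then have l: "length us + 2 + length vs = s" using True by simp
      show ?thesis
        by (cases a b rule: linorder_cases)
          (simp_all add: w(1) T_word_at[OF w(2) l] vec_simps algebra_simps)
    next
      case False
      then show ?thesis by (simp add: T_word_off vec_simps algebra_simps)
    qed
  qed
  show "T_word s k (T_word s (Suc k) (T_word s k f)) = T_word s (Suc k) (T_word s k (T_word s (Suc k) f))"
    if k: "1 \<le> k" "Suc k < s" for k f
  proof
    fix w
    show "T_word s k (T_word s (Suc k) (T_word s k f)) w = T_word s (Suc k) (T_word s k (T_word s (Suc k) f)) w"
    proof (cases "length w = s")
      case True
      then obtain us a b vs' where w: "w = us @ a # b # vs'" "k = Suc (length us)"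
        using split2[of k w] k by auto
      then obtain c vs where vs: "vs' = c # vs" using True k by (cases vs') auto
      have l: "length us + 3 + length vs = s" using True w vs by simp
      let ?put = "\<lambda>g x y z. (g (us @ x # y # z # vs) :: cqx)"
      have 1: "?put (T_word s k g) = exch12 (?put g)" for g
        using l by (intro ext) (subst T_word_exch[OF w(2)], simp_all add: exch12_def)
      have 2: "?put (T_word s (Suc k) g) = exch23 (?put g)" for g
      proof (intro ext)
        fix x y z
        show "?put (T_word s (Suc k) g) x y z = exch23 (?put g) x y z"
          using T_word_exch[of "Suc k" "us @ [x]" vs s g y z] l w(2) by (simp add: exch23_def)
      qed
      have "?put (T_word s k (T_word s (Suc k) (T_word s k f)))
          = ?put (T_word s (Suc k) (T_word s k (T_word s (Suc k) f)))"
        unfolding 1 2 by (intro ext exch_braid)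
      from fun_cong[OF fun_cong[OF fun_cong[OF this]], of a b c] show ?thesis by (simp add: w vs)
    next
      case False
      then show ?thesis by (simp add: T_word_off)
    qed
  qed
  show "T_word s j (T_word s k f) = T_word s k (T_word s j f)" if jk: "1 \<le> j" "Suc j < k" "k < s" for j k f
  proof
    fix w
    show "T_word s j (T_word s k f) w = T_word s k (T_word s j f) w"
    proof (cases "length w = s")
      case True
      then obtain us a b vs' where w: "w = us @ a # b # vs'" "j = Suc (length us)"
        using split2[of j w] jk by auto
      have "1 \<le> k - j - 1" "k - j - 1 < length vs'" using jk True w by auto
      then obtain ms c d vs where vs: "vs' = ms @ c # d # vs" "k - j - 1 = Suc (length ms)"
        using split2 by blast
      have l: "length us + length ms + 4 + length vs = s" using True w vs by simp
      have k: "k = Suc (length (us @ x # y # ms))" for x y :: int using vs(2) w(2) jk by simp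
      have T1: "T_word s j g (us @ x # y # ms @ z # z' # vs) =
         (if x = y then qq * g (us @ x # y # ms @ z # z' # vs)
          else if x < y then (qq - inverse qq) * g (us @ x # y # ms @ z # z' # vs) + g (us @ y # x # ms @ z # z' # vs)
          else g (us @ y # x # ms @ z # z' # vs))" for g x y z z'
        using l by (subst T_word_at[OF w(2)]) simp_all
      have T2: "T_word s k g (us @ x # y # ms @ z # z' # vs) =
         (if z = z' then qq * g (us @ x # y # ms @ z # z' # vs)
          else if z < z' then (qq - inverse qq) * g (us @ x # y # ms @ z # z' # vs) + g (us @ x # y # ms @ z' # z # vs)
          else g (us @ x # y # ms @ z' # z # vs))" for g x y z z'
        using T_word_at[OF k[of x y], of vs s g z z'] l by simp
      show ?thesis unfolding w(1) vs(1)
        by (cases a b rule: linorder_cases; cases c d rule: linorder_cases)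
          (simp_all add: T1 T2 algebra_simps)
    next
      case False
      then show ?thesis by (simp add: T_word_off)
    qed
  qed
  show "J_word n s (J_word n s f) = f" for f
  proof
    fix w
    show "J_word n s (J_word n s f) w = f w"
      by (cases w) (auto simp: J_word_def)
  qed
  show "J_word n s (T_word s k f) = T_word s k (J_word n s f)" if k: "2 \<le> k" "k < s" for k f
  proof
    fix w
    show "J_word n s (T_word s k f) w = T_word s k (J_word n s f) w"
    proof (cases "length w = s")
      case True
      then obtain us' a b vs where w: "w = us' @ a # b # vs" "k = Suc (length us')"
        using split2[of k w] k by auto
      then obtain l us where us: "us' = l # us" using k by (cases us') auto
      have len: "length us + 3 + length vs = s" using True w us by simp
      have T: "T_word s k g (x # us @ y # z # vs) =
         (if y = z then qq * g (x # us @ y # z # vs)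
          else if y < z then (qq - inverse qq) * g (x # us @ y # z # vs) + g (x # us @ z # y # vs)
          else g (x # us @ z # y # vs))" for g x y z
        using T_word_at[of k "x # us" vs s g y z] len w us by simp
      show ?thesis unfolding w us using len
        by (simp add: T[simplified w us, simplified] J_word_at)
    next
      case False
      then show ?thesis by (simp add: T_word_off J_word_def)
    qed
  qed
  show "J_word n s (T_word s 1 (J_word n s (T_word s 1 f))) = T_word s 1 (J_word n s (T_word s 1 (J_word n s f)))"
    if s: "1 < s" for f
  proof
    fix w
    show "J_word n s (T_word s 1 (J_word n s (T_word s 1 f))) w = T_word s 1 (J_word n s (T_word s 1 (J_word n s f))) w"
    proof (cases "length w = s")
      case True
      then obtain a b vs where w: "w = a # b # vs" using s split2[of 1 w] by auto
      have len: "2 + length vs = s" using True w by simp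
      let ?put = "\<lambda>g x y. g (x # y # vs) :: cqx"
      have 1: "?put (T_word s 1 g) = exch (?put g)" for g
        using T_word_exch[of 1 "[]" vs s g] len by (intro ext) simp
      have 2: "?put (J_word n s g) = flip1 (int n + 1) (?put g)" for g
        using len by (intro ext) (simp add: J_word_at flip1_def)
      have "?put (J_word n s (T_word s 1 (J_word n s (T_word s 1 f))))
         = ?put (T_word s 1 (J_word n s (T_word s 1 (J_word n s f))))"
        unfolding 1 2 by (intro ext exch_flip_braid)
      from fun_cong[OF fun_cong[OF this], of a b] show ?thesis by (simp add: w)
    next
      case False
      then show ?thesis by (simp add: T_word_off J_word_def)
    qed
  qed
qed

section \<open>Inversions\<close>

primrec linv :: "'a::linorder list \<Rightarrow> nat" where
  "linv [] = 0"
| "linv (x # xs) = length (filter (\<lambda>y. y < x) xs) + linv xs"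

lemma linv_swap: "linv (us @ b # a # vs) = Suc (linv (us @ a # b # vs))" if "a < b"
  using that by (induction us) (auto simp: not_less)

lemma linv_remove:
  "linv (us @ l # vs) = linv (us @ vs) + length (filter (\<lambda>u. l < u) us) + length (filter (\<lambda>v. v < l) vs)"
  by (induction us) auto

lemma linv_le: "linv w \<le> length w * length w"
proof (induction w)
  case (Cons x xs)
  have "length (filter (\<lambda>y. y < x) xs) \<le> length xs" by simp
  from add_mono[OF this Cons] show ?case by simp
qed simp

lemma word_inv_eq_linv: "word_inv w = linv w"
proof (induction w)
  case (Cons x xs)
  let ?S = "{(p, p'). p < p' \<and> p' < length (x # xs) \<and> (x # xs) ! p > (x # xs) ! p'}"
  let ?A = "(\<lambda>p'. (0::nat, Suc p')) ` {p'. p' < length xs \<and> xs ! p' < x}"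
  let ?B = "map_prod Suc Suc ` {(p, p'). p < p' \<and> p' < length xs \<and> xs ! p > xs ! p'}"
  have S: "?S = ?A \<union> ?B"
  proof (rule set_eqI)
    fix pp :: "nat \<times> nat"
    obtain p p' where pp: "pp = (p, p')" by (cases pp)
    show "pp \<in> ?S \<longleftrightarrow> pp \<in> ?A \<union> ?B"
    proof (cases p)
      case 0
      then show ?thesis by (cases p') (auto simp: pp image_iff)
    next
      case (Suc m)
      then show ?thesis by (cases p') (auto simp: pp image_iff)
    qed
  qed
  have finA: "finite {p'. p' < length xs \<and> xs ! p' < x}" by simp
  have finB: "finite {(p, p'). p < p' \<and> p' < length xs \<and> xs ! p > xs ! p'}"
    by (rule finite_subset[of _ "{..<length xs} \<times> {..<length xs}"]) auto
  have "card (?A \<union> ?B) = card ?A + card ?B"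
    by (rule card_Un_disjoint) (use finA finB in auto)
  then have "card ?S = card ?A + card ?B"
    by (simp only: S)
  also have "card ?A = length (filter (\<lambda>y. y < x) xs)"
    by (subst card_image) (auto simp: inj_on_def length_filter_conv_card)
  also have "card ?B = word_inv xs"
    unfolding word_inv_def by (intro card_image) (auto simp: inj_on_def)
  finally show ?case using Cons by (simp add: word_inv_def)
qed (simp add: word_inv_def)

lemma ascent:
  fixes w :: "'a::linorder list"
  assumes "\<not> sorted_wrt (\<ge>) w"
  shows "\<exists>us a b vs. w = us @ a # b # vs \<and> a < b"
  using assms
proof (induction w)
  case (Cons x xs)
  show ?case
  proof (cases "sorted_wrt (\<ge>) xs")
    case False
    then obtain us a b vs where "xs = us @ a # b # vs" "a < b" using Cons by blast
    then show ?thesis by (intro exI[of _ "x # us"]) auto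
  next
    case True
    then obtain y where y: "y \<in> set xs" "x < y" using Cons.prems by auto
    then obtain z zs where xs: "xs = z # zs" by (cases xs) auto
    have "y \<le> z" using True y xs by auto
    then show ?thesis using xs y by (intro exI[of _ "[]"]) auto
  qed
qed simp

text \<open>Exchanging the letters of an ascent multiplies a symmetric function by q^{-1} and raises
  the number of inversions, so its values on weakly decreasing words determine it.\<close>

lemma sym_word_zero:
  assumes F: "hecke_B.sym qq (T_word s) s F"
    and dec: "\<And>w. length w = s \<Longrightarrow> sorted_wrt (\<ge>) w \<Longrightarrow> F w = 0"
  shows "length w = s \<Longrightarrow> F w = 0"
proof (induction "s * s - linv w" arbitrary: w rule: less_induct)
  case less
  show ?case
  proof (cases "sorted_wrt (\<ge>) w")
    case False
    then obtain us a b vs where w: "w = us @ a # b # vs" and ab: "a < b" using ascent by blast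
    have l: "length us + 2 + length vs = s" using less.prems w by simp
    have "T_word s (Suc (length us)) F = qq \<cdot> F"
      using F l unfolding hecke_B.sym_def[OF hecke_words] by auto
    from fun_cong[OF this, of w] have "F (us @ b # a # vs) = inverse qq * F w"
      using ab by (simp add: w T_word_at[OF refl l] vec_simps algebra_simps)
    moreover have "F (us @ b # a # vs) = 0"
    proof (rule less.hyps)
      have "length (us @ b # a # vs) = s" using l by simp
      then have "linv (us @ b # a # vs) \<le> s * s" using linv_le by metis
      then show "s * s - linv (us @ b # a # vs) < s * s - linv w"
        unfolding w linv_swap[OF ab] by simp
    qed (use l in simp)
    ultimately show ?thesis by simp
  qed (use dec less.prems in blast)
qed

section \<open>From tensor powers to words\<close>

definition lift :: "nat \<Rightarrow> nat \<Rightarrow> (nat list \<Rightarrow> cqx) \<Rightarrow> int list \<Rightarrow> cqx" where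
  "lift n s f W = (if W \<in> map int ` tensor_words n s then f (map nat W) else 0)"

lemma map_nat_map_int [simp]: "map nat (map int w) = w"
  by (induction w) auto

lemma lift_map: "w \<in> tensor_words n s \<Longrightarrow> lift n s f (map int w) = f w"
  unfolding lift_def by (simp only: image_eqI if_True map_nat_map_int)

lemma lift_off: "W \<notin> map int ` tensor_words n s \<Longrightarrow> lift n s f W = 0"
  by (simp add: lift_def)

lemma finite_tensor_words: "finite (tensor_words n s)"
  unfolding tensor_words_def by (rule finite_subset[OF _ finite_lists_length_eq[of "{1..n}" s]]) auto

lemma tensor_words_swap: "us @ b # a # vs \<in> tensor_words n s \<longleftrightarrow> us @ a # b # vs \<in> tensor_words n s"
  by (auto simp: tensor_words_def)

lemma image_words_swap:
  "us @ b # a # vs \<in> map int ` tensor_words n s \<longleftrightarrow> us @ a # b # vs \<in> map int ` tensor_words n s"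
proof -
  have "us @ b # a # vs \<in> map int ` tensor_words n s"
    if asm: "us @ a # b # vs \<in> map int ` tensor_words n s" for a b
  proof -
    obtain w where w: "w \<in> tensor_words n s" "us @ a # b # vs = map int w" using asm by blast
    then obtain us' a' b' vs' where w': "w = us' @ a' # b' # vs'" "us = map int us'" "a = int a'" "b = int b'" "vs = map int vs'"
      unfolding append_eq_map_conv Cons_eq_map_conv by blast
    have "us' @ b' # a' # vs' \<in> tensor_words n s" using w(1) unfolding w'(1) by (simp only: tensor_words_swap)
    then have "map int (us' @ b' # a' # vs') \<in> map int ` tensor_words n s" by (rule imageI)
    then show ?thesis by (simp add: w')
  qed
  then show ?thesis by blast
qed

lemma length_image_words: "W \<in> map int ` tensor_words n s \<Longrightarrow> length W = s"
  by (auto simp: tensor_words_def)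

lemma R_at_agree:
  assumes w': "w' = us @ a # b # vs" "k = Suc (length us)"
  shows "length w' = length w \<and> (\<forall>p<length w. p \<noteq> k - 1 \<and> p \<noteq> k \<longrightarrow> w' ! p = w ! p)
    \<longleftrightarrow> (\<exists>x y. w = us @ x # y # vs)"
proof
  assume *: "length w' = length w \<and> (\<forall>p<length w. p \<noteq> k - 1 \<and> p \<noteq> k \<longrightarrow> w' ! p = w ! p)"
  then have len: "length w = length us + 2 + length vs" using w' by simp
  then obtain us' x y vs' where w: "w = us' @ x # y # vs'" "k = Suc (length us')"
    using split2[of k w] w'(2) by auto
  have lu: "length us' = length us" using w(2) w'(2) by simp
  then have lv: "length vs' = length vs" using len w by simp
  have "us' = us"
  proof (rule nth_equalityI[OF lu])
    fix p assume "p < length us'"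
    then show "us' ! p = us ! p" using *[THEN conjunct2, rule_format, of p] w w' lu len by (simp add: nth_append)
  qed
  moreover have "vs' = vs"
  proof (rule nth_equalityI[OF lv])
    fix p assume "p < length vs'"
    then show "vs' ! p = vs ! p"
      using *[THEN conjunct2, rule_format, of "length us + 2 + p"] w w' lu lv len by (simp add: nth_append)
  qed
  ultimately show "\<exists>x y. w = us @ x # y # vs" using w by blast
next
  assume "\<exists>x y. w = us @ x # y # vs"
  then obtain x y where w: "w = us @ x # y # vs" by blast
  show "length w' = length w \<and> (\<forall>p<length w. p \<noteq> k - 1 \<and> p \<noteq> k \<longrightarrow> w' ! p = w ! p)"
  proof (intro conjI allI impI)
    fix p assume p: "p < length w" "p \<noteq> k - 1 \<and> p \<noteq> k"
    show "w' ! p = w ! p"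
    proof (cases "p < length us")
      case True
      then show ?thesis by (simp add: w w' nth_append)
    next
      case False
      define r where "r = p - length us - 2"
      have "p = length us + 2 + r" using False p w'(2) unfolding r_def by linarith
      then show ?thesis by (simp add: w w' nth_append)
    qed
  qed (simp add: w w')
qed

lemma R_at_value:
  assumes w': "w' = us @ a # b # vs" "k = Suc (length us)"
  shows "R_at k (R_explicit z) w w' =
    (if w = us @ a # b # vs then R_explicit z (a, b) (a, b)
     else if w = us @ b # a # vs then R_explicit z (b, a) (a, b) else 0)"
proof (cases "\<exists>x y. w = us @ x # y # vs")
  case True
  then obtain x y where w: "w = us @ x # y # vs" by blast
  have "R_at k (R_explicit z) w w' = R_explicit z (x, y) (a, b)"
    unfolding R_at_def if_P[OF R_at_agree[OF w', THEN iffD2, OF True]] using w w' by (simp add: nth_append)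
  moreover consider "x = a \<and> y = b" | "x = b \<and> y = a" | "\<not> (x = a \<and> y = b)" "\<not> (x = b \<and> y = a)" by blast
  then have "R_explicit z (x, y) (a, b) = (if x = a \<and> y = b then R_explicit z (a, b) (a, b)
     else if x = b \<and> y = a then R_explicit z (b, a) (a, b) else 0)"
  proof cases
    case 3
    have "R_explicit z (x, y) (a, b) = 0"
      by (rule R_explicit_zero) (use 3 in blast)+
    then show ?thesis by (simp only: 3 if_False)
  next
    case 2
    then show ?thesis by (cases "a = b") simp_all
  qed simp
  moreover have "w = us @ a # b # vs \<longleftrightarrow> x = a \<and> y = b" "w = us @ b # a # vs \<longleftrightarrow> x = b \<and> y = a"
    by (simp_all add: w)
  ultimately show ?thesis by (simp only:)
next
  case False
  then have nc: "\<not> (length w' = length w \<and> (\<forall>p<length w. p \<noteq> k - 1 \<and> p \<noteq> k \<longrightarrow> w' ! p = w ! p))"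
    using R_at_agree[OF w', of w] by blast
  have "R_at k (R_explicit z) w w' = 0"
    unfolding R_at_def if_not_P[OF nc] ..
  moreover have "w \<noteq> us @ a # b # vs" "w \<noteq> us @ b # a # vs" using False by blast+
  ultimately show ?thesis by simp
qed

text \<open>On coordinate functions the R-matrix acts from the side of the target word: the sources
  of a word are the word itself and its exchange at k, as in \<open>T_word\<close>.\<close>

lemma lift_R_at:
  assumes k: "1 \<le> k" "k < s"
  shows "lift n s (lin (tensor_words n s) (R_at k (R_explicit z)) f) = hecke_B.Rop qq (T_word s) k z (lift n s f)"
proof
  fix W
  let ?TW = "tensor_words n s"
  note Rop = hecke_B.Rop_def[OF hecke_words]
  show "lift n s (lin ?TW (R_at k (R_explicit z)) f) W = hecke_B.Rop qq (T_word s) k z (lift n s f) W"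
  proof (cases "W \<in> map int ` ?TW")
    case True
    then obtain w' where w': "w' \<in> ?TW" "W = map int w'" by blast
    then have "length w' = s" by (simp add: tensor_words_def)
    then obtain us a b vs where d: "w' = us @ a # b # vs" "k = Suc (length us)"
      using split2[of k w'] k by auto
    have l: "length us + 2 + length vs = s" using \<open>length w' = s\<close> d by simp
    have sw: "us @ b # a # vs \<in> ?TW" using w'(1) unfolding d(1) by (simp only: tensor_words_swap)
    have L: "lift n s (lin ?TW (R_at k (R_explicit z)) f) W = (\<Sum>w\<in>?TW. f w * R_at k (R_explicit z) w w')"
      using w' by (simp add: lift_map lin_def)
    have T: "T_word s k (lift n s f) W = (if a = b then qq * f w'
      else if a < b then (qq - inverse qq) * f w' + f (us @ b # a # vs) else f (us @ b # a # vs))"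
    proof -
      have La: "lift n s f (map int us @ int a # int b # map int vs) = f (us @ a # b # vs)"
        using lift_map[OF w'(1), of f] unfolding d(1) by simp
      have Lb: "lift n s f (map int us @ int b # int a # map int vs) = f (us @ b # a # vs)"
        using lift_map[OF sw, of f] by simp
      have l': "k = Suc (length (map int us))" "length (map int us) + 2 + length (map int vs) = s"
        using l d(2) by simp_all
      show ?thesis unfolding w'(2) d(1) list.map map_append T_word_at[OF l'] using La Lb
        by (cases a b rule: linorder_cases) simp_all
    qed
    have Lw: "lift n s f W = f w'" using w' by (simp add: lift_map)
    show ?thesis
    proof (cases "a = b")
      case True
      have "(\<Sum>w\<in>?TW. f w * R_at k (R_explicit z) w w') = (\<Sum>w\<in>?TW. if w = w' then (qq - z / qq) * f w' else 0)"
        unfolding R_at_value[OF d] using True d(1) by (intro sum.cong refl) (simp add: R_explicit_def)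
      also have "\<dots> = (qq - z / qq) * f w'" using w'(1) finite_tensor_words by simp
      finally show ?thesis unfolding L Rop vec_simps T Lw using True by (simp add: field_simps)
    next
      case False
      have S: "(\<Sum>w\<in>?TW. f w * R_at k (R_explicit z) w w')
        = (if a < b then 1 else z) * (qq - inverse qq) * f w' + (1 - z) * f (us @ b # a # vs)"
      proof (rule sum_two[OF finite_tensor_words w'(1) sw])
        fix w
        show "f w * R_at k (R_explicit z) w w' = (if w = w' then (if a < b then 1 else z) * (qq - inverse qq) * f w' else 0)
          + (if w = us @ b # a # vs then (1 - z) * f (us @ b # a # vs) else 0)"
          unfolding R_at_value[OF d] unfolding d(1) using False
          by (cases "w = us @ a # b # vs"; cases "w = us @ b # a # vs"; simp add: R_explicit_def)
      qed
      show ?thesis unfolding L S Rop vec_simps T Lw using False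
        by (cases "a < b") (simp_all add: field_simps)
    qed
  next
    case False
    have "T_word s k (lift n s f) W = 0"
    proof (cases "length W = s")
      case True
      then obtain us a b vs where d: "W = us @ a # b # vs" "k = Suc (length us)"
        using split2[of k W] k by auto
      have l: "length us + 2 + length vs = s" using True d by simp
      have "lift n s f (us @ b # a # vs) = 0" "lift n s f (us @ a # b # vs) = 0"
        using False unfolding d(1) by (simp_all only: lift_off image_words_swap not_False_eq_True)
      then show ?thesis unfolding d(1) T_word_at[OF d(2) l] by (cases "a = b") simp_all
    qed (simp add: T_word_off lift_off False)
    then show ?thesis unfolding Rop vec_simps by (simp add: lift_off False)
  qed
qed

lemma K_first_value:
  assumes KW: "\<forall>j\<in>{1..n}. KW j = unit_vec (n + 1 - j)" and w: "w \<in> tensor_words n s" and s: "s \<ge> 1"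
  shows "K_first KW w w' = (if w' = (n + 1 - hd w) # tl w then 1 else 0)"
proof -
  obtain l vs where lv: "w = l # vs" using w s by (cases w) (auto simp: tensor_words_def)
  have l: "l \<in> {1..n}" using w lv by (auto simp: tensor_words_def)
  show ?thesis
  proof (cases w')
    case Nil
    then show ?thesis using lv by (simp add: K_first_def)
  next
    case (Cons l' vs')
    have "(length w' = length w \<and> (\<forall>p<length w. p \<noteq> 0 \<longrightarrow> w' ! p = w ! p)) \<longleftrightarrow> vs' = vs"
    proof
      assume *: "length w' = length w \<and> (\<forall>p<length w. p \<noteq> 0 \<longrightarrow> w' ! p = w ! p)"
      show "vs' = vs"
      proof (rule nth_equalityI)
        fix p assume "p < length vs'"
        then show "vs' ! p = vs ! p" using *[THEN conjunct2, rule_format, of "Suc p"] * lv Cons by auto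
      qed (use * lv Cons in simp)
    next
      assume "vs' = vs"
      then show "length w' = length w \<and> (\<forall>p<length w. p \<noteq> 0 \<longrightarrow> w' ! p = w ! p)"
        using lv Cons by (simp add: nth_Cons')
    qed
    then show ?thesis unfolding K_first_def using KW l by (simp add: lv Cons unit_vec_def)
  qed
qed

lemma flip_words: "1 \<le> s \<Longrightarrow> w \<in> tensor_words n s \<Longrightarrow> (n + 1 - hd w) # tl w \<in> tensor_words n s"
  by (cases w) (auto simp: tensor_words_def)

lemma flip_words_flip: "1 \<le> s \<Longrightarrow> w \<in> tensor_words n s \<Longrightarrow> (n + 1 - (n + 1 - hd w)) # tl w = w"
  by (cases w) (auto simp: tensor_words_def)

lemma lin_K_first:
  assumes KW: "\<forall>j\<in>{1..n}. KW j = unit_vec (n + 1 - j)" and s: "s \<ge> 1"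
  shows "lin (tensor_words n s) (K_first KW) f w'
    = (if w' \<in> tensor_words n s then f ((n + 1 - hd w') # tl w') else 0)"
proof -
  let ?TW = "tensor_words n s"
  have "lin ?TW (K_first KW) f w' = (\<Sum>w\<in>?TW. if w' = (n + 1 - hd w) # tl w then f w else 0)"
    unfolding lin_def using K_first_value[OF KW _ s] by (intro sum.cong) auto
  also have "\<dots> = (\<Sum>w\<in>?TW. if w' \<in> ?TW \<and> w = (n + 1 - hd w') # tl w' then f ((n + 1 - hd w') # tl w') else 0)"
  proof (intro sum.cong refl)
    fix w assume w: "w \<in> ?TW"
    have eq: "w' = (n + 1 - hd w) # tl w \<longleftrightarrow> w' \<in> ?TW \<and> w = (n + 1 - hd w') # tl w'"
    proof
      assume w': "w' = (n + 1 - hd w) # tl w"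
      show "w' \<in> ?TW \<and> w = (n + 1 - hd w') # tl w'"
        unfolding w' list.sel flip_words_flip[OF s w] using flip_words[OF s w] by blast
    next
      assume w': "w' \<in> ?TW \<and> w = (n + 1 - hd w') # tl w'"
      show "w' = (n + 1 - hd w) # tl w"
        unfolding conjunct2[OF w'] list.sel flip_words_flip[OF s conjunct1[OF w']] ..
    qed
    show "(if w' = (n + 1 - hd w) # tl w then f w else 0)
      = (if w' \<in> ?TW \<and> w = (n + 1 - hd w') # tl w' then f ((n + 1 - hd w') # tl w') else 0)"
      unfolding eq by (intro if_cong refl arg_cong[of _ _ f]) blast
  qed
  also have "\<dots> = (if w' \<in> ?TW then f ((n + 1 - hd w') # tl w') else 0)"
    using flip_words[OF s, of w' n] finite_tensor_words by (cases "w' \<in> ?TW") simp_all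
  finally show ?thesis .
qed

lemma lift_K_first:
  assumes KW: "\<forall>j\<in>{1..n}. KW j = unit_vec (n + 1 - j)" and s: "s \<ge> 1"
  shows "lift n s (lin (tensor_words n s) (K_first KW) f) = J_word n s (lift n s f)"
proof
  fix W
  let ?TW = "tensor_words n s"
  have flip_map: "(int n + 1 - hd (map int w)) # tl (map int w) = map int ((n + 1 - hd w) # tl w)" if w: "w \<in> ?TW" for w
  proof -
    obtain l vs where lv: "w = l # vs" using w s by (cases w) (auto simp: tensor_words_def)
    then have "l \<le> n" using w by (auto simp: tensor_words_def)
    then show ?thesis by (simp add: lv of_nat_diff)
  qed
  show "lift n s (lin ?TW (K_first KW) f) W = J_word n s (lift n s f) W"
  proof (cases "W \<in> map int ` ?TW")
    case True
    then obtain w where w: "w \<in> ?TW" "W = map int w" by blast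
    have "length W = s" using True by (rule length_image_words)
    then have "J_word n s (lift n s f) W = lift n s f ((int n + 1 - hd W) # tl W)"
      using s by (simp add: J_word_def)
    also have "(int n + 1 - hd W) # tl W = map int ((n + 1 - hd w) # tl w)"
      unfolding w(2) by (rule flip_map[OF w(1)])
    also have "lift n s f (map int ((n + 1 - hd w) # tl w)) = f ((n + 1 - hd w) # tl w)"
      by (rule lift_map[OF flip_words[OF s w(1)]])
    finally have J: "J_word n s (lift n s f) W = f ((n + 1 - hd w) # tl w)" .
    show ?thesis unfolding J unfolding w(2) lift_map[OF w(1)] lin_K_first[OF KW s] if_P[OF w(1)] ..
  next
    case False
    have "J_word n s (lift n s f) W = 0"
    proof (cases "length W = s")
      case True
      have "(int n + 1 - hd W) # tl W \<notin> map int ` ?TW"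
      proof
        assume "(int n + 1 - hd W) # tl W \<in> map int ` ?TW"
        then obtain w where w: "(int n + 1 - hd W) # tl W = map int w" "w \<in> ?TW" by (rule imageE)
        have "W \<noteq> []" using True s by auto
        then have "W = hd W # tl W" by (rule list.collapse[symmetric])
        also have "\<dots> = (int n + 1 - (int n + 1 - hd W)) # tl W" unfolding diff_diff_eq2 by (simp only: add_diff_cancel_left')
        also have "\<dots> = (int n + 1 - hd (map int w)) # tl (map int w)" unfolding w(1)[symmetric] by (simp only: list.sel)
        also have "\<dots> = map int ((n + 1 - hd w) # tl w)" by (rule flip_map[OF w(2)])
        finally have "W \<in> map int ` ?TW" using imageI[OF flip_words[OF s w(2)], of "map int"] by (simp only:)
        with False show False by contradiction
      qed
      then have "lift n s f ((int n + 1 - hd W) # tl W) = 0" by (rule lift_off)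
      then show ?thesis using True s by (simp add: J_word_def)
    next
      case length: False
      then show ?thesis using lift_off[OF False, of f] by (simp add: J_word_def)
    qed
    then show ?thesis using lift_off[OF False] by simp
  qed
qed

lemma lift_scale: "lift n s (\<lambda>w. c * f w) = c \<cdot> lift n s f"
  by (simp add: lift_def vec_simps)

lemma lin_R_at_scale:
  assumes k: "1 \<le> k" "k < s" and c: "\<forall>b\<in>{1..n} \<times> {1..n}. \<forall>b'. R b b' = c * R' b b'"
  shows "lin (tensor_words n s) (R_at k R) f = (\<lambda>w. c * lin (tensor_words n s) (R_at k R') f w)"
proof
  fix w'
  have "R_at k R w w' = c * R_at k R' w w'" if "w \<in> tensor_words n s" for w
  proof -
    have "(w ! (k - 1), w ! k) \<in> {1..n} \<times> {1..n}"
    proof -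
      have "w ! (k - 1) \<in> set w" "w ! k \<in> set w"
        using that k by (auto simp: tensor_words_def)
      then show ?thesis using that unfolding tensor_words_def by blast
    qed
    then have e: "R (w ! (k - 1), w ! k) (w' ! (k - 1), w' ! k) = c * R' (w ! (k - 1), w ! k) (w' ! (k - 1), w' ! k)"
      using c by blast
    show ?thesis unfolding R_at_def e by (simp only: if_distrib[of "\<lambda>x. c * x"] mult_zero_right)
  qed
  then show "lin (tensor_words n s) (R_at k R) f w' = c * lin (tensor_words n s) (R_at k R') f w'"
    unfolding lin_def sum_distrib_left by (intro sum.cong) auto
qed

text \<open>The R-matrices are known up to scalars only. What matters is that the resulting scalar c
  is nonzero and the same for all f, so that a rescaling of the K-matrix absorbs it.\<close>

lemma lift_fold_R:
  assumes R: "\<And>k. k \<in> set ks \<Longrightarrow> 1 \<le> k \<and> k < s \<and> (\<exists>c. c \<noteq> 0 \<and>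
      (\<forall>b\<in>{1..n} \<times> {1..n}. \<forall>b'. R k b b' = c * R_explicit (z k) b b'))"
  shows "\<exists>c. c \<noteq> 0 \<and> (\<forall>f. lift n s (fold (\<lambda>k. lin (tensor_words n s) (R_at k (R k))) ks f)
      = c \<cdot> fold (\<lambda>k. hecke_B.Rop qq (T_word s) k (z k)) ks (lift n s f))"
  using R
proof (induction ks)
  case Nil
  show ?case by (intro exI[of _ 1]) simp
next
  case (Cons k ks)
  obtain c where c: "c \<noteq> 0" "\<And>f. lift n s (fold (\<lambda>k. lin (tensor_words n s) (R_at k (R k))) ks f)
      = c \<cdot> fold (\<lambda>k. hecke_B.Rop qq (T_word s) k (z k)) ks (lift n s f)"
    using Cons by (meson list.set_intros(2))
  obtain d where k: "1 \<le> k" "k < s" and d: "d \<noteq> 0"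
    "\<forall>b\<in>{1..n} \<times> {1..n}. \<forall>b'. R k b b' = d * R_explicit (z k) b b'"
    using Cons.prems by (meson list.set_intros(1))
  have fold_scl: "fold (\<lambda>k. hecke_B.Rop qq (T_word s) k (z k)) ks (a \<cdot> v)
      = a \<cdot> fold (\<lambda>k. hecke_B.Rop qq (T_word s) k (z k)) ks v" for a v
    by (induction ks arbitrary: v) (simp_all add: lin_opD(2)[OF hecke_B.lin_Rop[OF hecke_words]])
  have "lift n s (fold (\<lambda>k. lin (tensor_words n s) (R_at k (R k))) (k # ks) f)
      = (c * d) \<cdot> fold (\<lambda>k. hecke_B.Rop qq (T_word s) k (z k)) (k # ks) (lift n s f)" for f
  proof -
    have "lift n s (lin (tensor_words n s) (R_at k (R k)) f) = d \<cdot> hecke_B.Rop qq (T_word s) k (z k) (lift n s f)"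
      unfolding lin_R_at_scale[OF k d(2)] lift_scale lift_R_at[OF k] ..
    then show ?thesis by (simp add: c(2) fold_scl)
  qed
  then show ?case using c(1) d(1) by (intro exI[of _ "c * d"]) simp
qed

lemma lift_K_total:
  assumes s: "s \<ge> 1"
    and KW: "\<And>j. 1 \<le> j \<Longrightarrow> j \<le> s \<Longrightarrow> \<forall>l\<in>{1..n}. KW (par_K s j) l = unit_vec (n + 1 - l)"
    and R: "\<And>j k. 1 \<le> k \<Longrightarrow> k < j \<Longrightarrow> j \<le> s \<Longrightarrow> \<exists>c. c \<noteq> 0 \<and>
      (\<forall>b\<in>{1..n} \<times> {1..n}. \<forall>b'. R (par_R s j k) (par_K s j) b b' = c * R_explicit (z j k) b b')"
  shows "\<exists>c. c \<noteq> 0 \<and> (\<forall>f. lift n s (K_total n s KW R f)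
      = c \<cdot> fold (hecke_B.Kfac qq (T_word s) (J_word n s) z) [1..<Suc s] (lift n s f))"
proof -
  let ?F = "hecke_B.Kfac qq (T_word s) (J_word n s) z"
  have one: "\<exists>c. c \<noteq> 0 \<and> (\<forall>f. lift n s (K_factor n s KW R j f) = c \<cdot> ?F j (lift n s f))"
    if j: "1 \<le> j" "j \<le> s" for j
  proof -
    have "\<exists>c. c \<noteq> 0 \<and> (\<forall>f. lift n s (fold (\<lambda>k. lin (tensor_words n s) (R_at k (R (par_R s j k) (par_K s j)))) (rev [1..<j]) f)
      = c \<cdot> fold (\<lambda>k. hecke_B.Rop qq (T_word s) k (z j k)) (rev [1..<j]) (lift n s f))"
      using R j by (intro lift_fold_R) auto
    then obtain c where c: "c \<noteq> 0" "\<And>f. lift n s (fold (\<lambda>k. lin (tensor_words n s) (R_at k (R (par_R s j k) (par_K s j)))) (rev [1..<j]) f)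
      = c \<cdot> fold (\<lambda>k. hecke_B.Rop qq (T_word s) k (z j k)) (rev [1..<j]) (lift n s f)" by blast
    have "lift n s (K_factor n s KW R j f) = c \<cdot> ?F j (lift n s f)" for f
      unfolding K_factor_def lift_K_first[OF KW[OF j] s] c(2) hecke_B.Kfac_def[OF hecke_words]
      by (rule lin_opD(2)[OF hecke_B.lin_J[OF hecke_words]])
    then show ?thesis using c(1) by blast
  qed
  have "\<exists>c. c \<noteq> 0 \<and> (\<forall>f. lift n s (fold (K_factor n s KW R) js f) = c \<cdot> fold ?F js (lift n s f))"
    if "set js \<subseteq> {1..s}" for js
    using that
  proof (induction js)
    case Nil
    show ?case by (intro exI[of _ 1]) simp
  next
    case (Cons j js)
    obtain c where c: "c \<noteq> 0" "\<And>f. lift n s (fold (K_factor n s KW R) js f) = c \<cdot> fold ?F js (lift n s f)"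
      using Cons by auto
    obtain d where d: "d \<noteq> 0" "\<And>f. lift n s (K_factor n s KW R j f) = d \<cdot> ?F j (lift n s f)"
      using one[of j] Cons.prems by auto
    have fold_scl: "fold ?F js (a \<cdot> v) = a \<cdot> fold ?F js v" for a v
      by (induction js arbitrary: v) (simp_all add: lin_opD(2)[OF hecke_B.lin_Kfac[OF hecke_words]])
    have "lift n s (fold (K_factor n s KW R) (j # js) f) = (c * d) \<cdot> fold ?F (j # js) (lift n s f)" for f
      by (simp add: c(2) d(2) fold_scl)
    then show ?case using c(1) d(1) by (intro exI[of _ "c * d"]) simp
  qed
  moreover have "set [1..<Suc s] \<subseteq> {1..s}" by auto
  ultimately show ?thesis unfolding K_total_def Suc_eq_plus1 by blast
qed

lemma K_factor_off:
  assumes s: "s \<ge> 1" and KW: "\<forall>l\<in>{1..n}. KW (par_K s j) l = unit_vec (n + 1 - l)" and w: "w \<notin> tensor_words n s"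
  shows "K_factor n s KW R j f w = 0"
  unfolding K_factor_def lin_K_first[OF KW s] using w by simp

section \<open>The central element on the symmetric part\<close>

definition content :: "nat \<Rightarrow> nat list \<Rightarrow> nat \<Rightarrow> int" where
  "content n w = (\<lambda>k. if k \<in> {1..n} then int (count_list w k) else 0)"

lemma finite_comps: "finite (comps n s)"
proof -
  have "comps n s \<subseteq> {f. \<forall>x. (x \<in> {1..n} \<longrightarrow> f x \<in> {0..int s}) \<and> (x \<notin> {1..n} \<longrightarrow> f x = 0)}"
  proof
    fix \<alpha> assume a: "\<alpha> \<in> comps n s"
    have "\<alpha> x \<le> int s" if "x \<in> {1..n}" for x
    proof -
      have "\<alpha> x \<le> (\<Sum>k=1..n. \<alpha> k)" using a that by (intro member_le_sum) (auto simp: comps_def)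
      then show ?thesis using a by (simp add: comps_def)
    qed
    then show "\<alpha> \<in> {f. \<forall>x. (x \<in> {1..n} \<longrightarrow> f x \<in> {0..int s}) \<and> (x \<notin> {1..n} \<longrightarrow> f x = 0)}"
      using a by (auto simp: comps_def)
  qed
  then show ?thesis by (rule finite_subset) (rule finite_set_of_finite_funs; simp)
qed

lemma content_comps: "w \<in> tensor_words n s \<Longrightarrow> content n w \<in> comps n s"
proof -
  assume w: "w \<in> tensor_words n s"
  have "(\<Sum>k=1..n. content n w k) = (\<Sum>k=1..n. int (count_list w k))"
    by (intro sum.cong) (auto simp: content_def)
  also have "\<dots> = int (\<Sum>k\<in>{1..n}. count_list w k)" by simp
  also have "(\<Sum>k\<in>{1..n}. count_list w k) = length w"
    using w by (intro sum_count_set) (auto simp: tensor_words_def)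
  finally show ?thesis using w by (simp add: comps_def content_def tensor_words_def)
qed

text \<open>A word occurs in the image of exactly one v_\<alpha>, namely that of its
  content.\<close>

lemma lin_embed_KR:
  "lin (comps n s) (embed_KR n s) g w
    = (if w \<in> tensor_words n s then g (content n w) * qq powi (- int (linv w)) else 0)"
proof (cases "w \<in> tensor_words n s")
  case True
  have "embed_KR n s \<alpha> w = (if \<alpha> = content n w then qq powi (- int (linv w)) else 0)" if \<alpha>: "\<alpha> \<in> comps n s" for \<alpha>
  proof -
    have "(\<forall>k\<in>{1..n}. int (count_list w k) = \<alpha> k) \<longleftrightarrow> \<alpha> = content n w"
    proof
      assume *: "\<forall>k\<in>{1..n}. int (count_list w k) = \<alpha> k"
      show "\<alpha> = content n w"
      proof
        fix k
        have "k \<notin> {1..n} \<Longrightarrow> \<alpha> k = 0" using \<alpha> unfolding comps_def by blast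
        then show "\<alpha> k = content n w k"
          using * by (cases "k \<in> {1..n}") (simp_all only: content_def if_True if_False simp_thms)
      qed
    qed (simp add: content_def)
    then show ?thesis using True by (simp add: embed_KR_def word_inv_eq_linv)
  qed
  then have "lin (comps n s) (embed_KR n s) g w
    = (\<Sum>\<alpha>\<in>comps n s. if \<alpha> = content n w then g (content n w) * qq powi (- int (linv w)) else 0)"
    unfolding lin_def by (intro sum.cong) auto
  then show ?thesis using True content_comps[OF True] finite_comps by simp
next
  case False
  then show ?thesis by (simp add: lin_def embed_KR_def)
qed

definition emb :: "nat \<Rightarrow> nat \<Rightarrow> ((nat \<Rightarrow> int) \<Rightarrow> cqx) \<Rightarrow> int list \<Rightarrow> cqx" where
  "emb n s g = lift n s (lin (comps n s) (embed_KR n s) g)"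

lemma emb_map: "w \<in> tensor_words n s \<Longrightarrow> emb n s g (map int w) = g (content n w) * qq powi (- int (linv w))"
  unfolding emb_def by (simp only: lift_map lin_embed_KR if_True)

lemma emb_off: "W \<notin> map int ` tensor_words n s \<Longrightarrow> emb n s g W = 0"
  unfolding emb_def by (rule lift_off)

lemma content_append: "content n (us @ vs) = (\<lambda>k. content n us k + content n vs k)"
  by (auto simp: content_def)

lemma content_Cons: "x \<in> {1..n} \<Longrightarrow> content n (x # vs) = (\<lambda>k. ee x k + content n vs k)"
  by (auto simp: content_def ee_def)

lemma content_swap: "content n (us @ b # a # vs) = content n (us @ a # b # vs)"
  by (auto simp: content_def)

lemma emb_swap:
  assumes ab: "a < b"
  shows "emb n s g (us @ b # a # vs) = inverse qq * emb n s g (us @ a # b # vs)"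
proof (cases "us @ a # b # vs \<in> map int ` tensor_words n s")
  case True
  then obtain w where w: "us @ a # b # vs = map int w" "w \<in> tensor_words n s" by (rule imageE)
  then obtain us' a' b' vs' where w': "w = us' @ a' # b' # vs'" "us = map int us'" "a = int a'" "b = int b'" "vs = map int vs'"
    unfolding append_eq_map_conv Cons_eq_map_conv by blast
  have ab': "a' < b'" using ab w' by simp
  have 1: "us' @ a' # b' # vs' \<in> tensor_words n s" using w(2) unfolding w'(1) .
  have 2: "us' @ b' # a' # vs' \<in> tensor_words n s" using 1 by (simp only: tensor_words_swap)
  have pw: "qq powi (- int (Suc m)) = inverse qq * qq powi (- int m)" for m
    by (simp add: power_int_diff power_int_minus divide_inverse)
  have "emb n s g (map int (us' @ b' # a' # vs')) = inverse qq * emb n s g (map int (us' @ a' # b' # vs'))"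
    unfolding emb_map[OF 1] emb_map[OF 2] content_swap[of n us' b'] linv_swap[OF ab'] pw
    by (simp only: mult.left_commute)
  then show ?thesis by (simp add: w')
next
  case False
  then have "us @ b # a # vs \<notin> map int ` tensor_words n s" by (simp only: image_words_swap not_False_eq_True)
  then show ?thesis using False by (simp only: emb_off mult_zero_right not_False_eq_True)
qed

text \<open>Exchanging adjacent letters a < b changes the coefficient by q^{-1}, which is the
  eigenvalue condition for T at an ascent and at a descent. So the KR module sits in the q-symmetric
  part, where the results on \<open>hecke_B\<close> apply.\<close>

lemma sym_emb: "hecke_B.sym qq (T_word s) s (emb n s g)"
  unfolding hecke_B.sym_def[OF hecke_words]
proof (intro allI impI ext)
  fix i W
  assume i: "1 \<le> i \<and> i < s"
  show "T_word s i (emb n s g) W = (qq \<cdot> emb n s g) W"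
  proof (cases "length W = s")
    case True
    then obtain us a b vs where W: "W = us @ a # b # vs" "i = Suc (length us)"
      using split2[of i W] i by auto
    have l: "length us + 2 + length vs = s" using True W by simp
    show ?thesis unfolding W(1) T_word_at[OF W(2) l] scl_apply
    proof (cases a b rule: linorder_cases)
      case less
      show "(if a = b then qq * emb n s g (us @ a # b # vs)
        else if a < b then (qq - inverse qq) * emb n s g (us @ a # b # vs) + emb n s g (us @ b # a # vs)
        else emb n s g (us @ b # a # vs)) = qq * emb n s g (us @ a # b # vs)"
        using less emb_swap[OF less, of n s g us vs] by (simp add: algebra_simps)
    next
      case greater
      then show "(if a = b then qq * emb n s g (us @ a # b # vs)
        else if a < b then (qq - inverse qq) * emb n s g (us @ a # b # vs) + emb n s g (us @ b # a # vs)
        else emb n s g (us @ b # a # vs)) = qq * emb n s g (us @ a # b # vs)"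
        using emb_swap[OF greater, of n s g us vs] by (simp add: qq_cancel)
    qed simp
  next
    case False
    then show ?thesis by (simp add: T_word_off scl_apply)
  qed
qed

text \<open>The product T_k ... T_1, the outer half of Y_k. On a symmetric vector the inner half
  acts first and contributes only q^k.\<close>

primrec Tchain :: "nat \<Rightarrow> nat \<Rightarrow> (int list \<Rightarrow> cqx) \<Rightarrow> int list \<Rightarrow> cqx" where
  "Tchain s 0 g = g"
| "Tchain s (Suc k) g = T_word s (Suc k) (Tchain s k g)"

lemma Y_sym_chain:
  assumes F: "hecke_B.sym qq (T_word s) s F"
  shows "k < s \<Longrightarrow> hecke_B.Y (T_word s) (J_word n s) k F = qq ^ k \<cdot> Tchain s k (J_word n s F)"
proof (induction k)
  case 0
  show ?case by (simp add: hecke_B.Y.simps[OF hecke_words])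
next
  case (Suc k)
  have "T_word s (Suc k) F = qq \<cdot> F"
    using F Suc.prems unfolding hecke_B.sym_def[OF hecke_words] by auto
  then show ?case using Suc
    by (simp add: hecke_B.Y.simps[OF hecke_words] hecke_B.linY[OF hecke_words] hecke_B.linT[OF hecke_words])
qed

text \<open>If no letter before l is smaller, T meets no ascent on the way, so l moves to the front
  without branching and picks up q at each equal letter. This is why X is evaluated on decreasing
  words.\<close>

lemma Tchain_at:
  assumes "length us = k" "length us + 1 + length vs = s" "\<forall>u\<in>set us. l \<le> u"
  shows "Tchain s k g (us @ l # vs) = qq ^ count_list us l * g (l # us @ vs)"
  using assms
proof (induction k arbitrary: us vs)
  case (Suc k)
  then obtain us' u where us: "us = us' @ [u]" by (cases us rule: rev_cases) auto
  have k: "Suc k = Suc (length us')" and l: "length us' + 2 + length vs = s" using Suc.prems us by auto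
  have "l \<le> u" using Suc.prems us by auto
  have T: "Tchain s (Suc k) g (us @ l # vs) = (if u = l then qq * Tchain s k g (us' @ u # l # vs)
      else Tchain s k g (us' @ l # u # vs))"
    using T_word_at[OF k l, of "Tchain s k g" u l] \<open>l \<le> u\<close> by (simp add: us)
  have IH: "Tchain s k g (us' @ l # x # vs) = qq ^ count_list us' l * g (l # us' @ x # vs)" for x
    using Suc.prems us by (intro Suc.IH) auto
  show ?case
  proof (cases "u = l")
    case True
    then show ?thesis using T IH[of l] by (simp add: us)
  next
    case False
    then show ?thesis using T IH[of u] by (simp add: us)
  qed
qed simp

text \<open>A position is given by its letter l and the number r of earlier occurrences of l; in the
  application the sum over r is a geometric series.\<close>

lemma sum_by_letters:
  fixes \<Phi> :: "'a \<Rightarrow> nat \<Rightarrow> cqx"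
  assumes "finite A"
  shows "set w \<subseteq> A \<Longrightarrow> (\<Sum>k<length w. \<Phi> (w ! k) (count_list (take k w) (w ! k)))
    = (\<Sum>l\<in>A. \<Sum>r<count_list w l. \<Phi> l r)"
proof (induction w rule: rev_induct)
  case (snoc x w)
  have "(\<Sum>k<length (w @ [x]). \<Phi> ((w @ [x]) ! k) (count_list (take k (w @ [x])) ((w @ [x]) ! k)))
     = (\<Sum>k<length w. \<Phi> ((w @ [x]) ! k) (count_list (take k (w @ [x])) ((w @ [x]) ! k))) + \<Phi> x (count_list w x)"
    by simp
  also have "(\<Sum>k<length w. \<Phi> ((w @ [x]) ! k) (count_list (take k (w @ [x])) ((w @ [x]) ! k)))
     = (\<Sum>k<length w. \<Phi> (w ! k) (count_list (take k w) (w ! k)))"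
    by (intro sum.cong) (auto simp: nth_append)
  also have "\<dots> = (\<Sum>l\<in>A. \<Sum>r<count_list w l. \<Phi> l r)" using snoc by auto
  also have "\<dots> + \<Phi> x (count_list w x)
     = (\<Sum>l\<in>A. (\<Sum>r<count_list w l. \<Phi> l r) + (if l = x then \<Phi> x (count_list w x) else 0))"
    using snoc.prems assms by (simp add: sum.distrib)
  also have "\<dots> = (\<Sum>l\<in>A. \<Sum>r<count_list (w @ [x]) l. \<Phi> l r)"
    by (intro sum.cong) auto
  finally show ?case .
qed simp

lemma sum_content_filter:
  assumes "finite A" "A \<subseteq> {1..n}"
  shows "(\<Sum>k\<in>A. content n w k) = int (length (filter (\<lambda>u. u \<in> A) w))"
proof (induction w)
  case Nil
  show ?case by (simp add: content_def cong: if_cong)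
next
  case (Cons x w)
  have "(\<Sum>k\<in>A. content n (x # w) k) = (\<Sum>k\<in>A. content n w k + (if k = x then 1 else 0))"
    using assms(2) by (intro sum.cong) (auto simp: content_def)
  then show ?case using Cons assms(1) by (simp add: sum.distrib)
qed

lemma q_geometric: "(\<Sum>r<m. qq ^ (2 * r)) = qq powi (int m - 1) * q_int (int m)"
proof (induction m)
  case (Suc m)
  have h: "qq - inverse qq \<noteq> 0" using q_minus_qinv_nonzero by (simp add: power_int_minus)
  have "qq powi (int m) * q_int (int m + 1) = qq powi (int m) * (inverse qq * q_int (int m) + qq powi (int m))"
    by (simp only: q_int_add_1)
  also have "\<dots> = qq powi (int m - 1) * q_int (int m) + qq ^ (2 * m)"
    by (simp add: power_int_diff field_simps flip: power_add mult_2)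
  finally show ?case using Suc by (simp add: add.commute)
qed simp

text \<open>The operator on coefficient functions induced by the central element, divided by
  \<open>q\<^sup>s\<^sup>-\<^sup>1\<close>.\<close>

definition Zfull :: "nat \<Rightarrow> ((nat \<Rightarrow> int) \<Rightarrow> cqx) \<Rightarrow> (nat \<Rightarrow> int) \<Rightarrow> cqx" where
  "Zfull n g \<beta> = (\<Sum>l\<in>{1..n}. qq powi ((\<Sum>k\<in>{l+1..n}. \<beta> k) - (\<Sum>k\<in>{1..<n+1-l}. \<beta> k - ee l k))
     * q_int (\<beta> l) * g (\<lambda>k. \<beta> k - ee l k + ee (n + 1 - l) k))"

lemma J_emb_at:
  assumes w: "us @ l # vs \<in> tensor_words n s"
  shows "J_word n s (emb n s g) (map int (l # us @ vs))
    = g (\<lambda>k. content n (us @ l # vs) k - ee l k + ee (n + 1 - l) k)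
      * qq powi (- int (length (filter (\<lambda>u. u < n + 1 - l) (us @ vs)) + linv (us @ vs)))"
proof -
  let ?w = "(n + 1 - l) # us @ vs"
  have l: "l \<in> {1..n}" and l': "n + 1 - l \<in> {1..n}" using w by (auto simp: tensor_words_def)
  have w': "?w \<in> tensor_words n s" using w l' by (auto simp: tensor_words_def)
  have s: "Suc (length (map int (us @ vs))) = s" using w by (simp add: tensor_words_def)
  have "J_word n s (emb n s g) (map int (l # us @ vs)) = emb n s g ((int n + 1 - int l) # map int (us @ vs))"
    unfolding list.map by (rule J_word_at[OF s])
  also have "(int n + 1 - int l) # map int (us @ vs) = map int ?w"
    using l by (simp add: of_nat_diff)
  also have "emb n s g (map int ?w) = g (content n ?w) * qq powi (- int (linv ?w))"
    by (rule emb_map[OF w'])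
  also have "content n ?w = (\<lambda>k. content n (us @ l # vs) k - ee l k + ee (n + 1 - l) k)"
    unfolding content_Cons[OF l'] content_append content_Cons[OF l] by (auto simp: algebra_simps)
  finally show ?thesis by simp
qed

text \<open>At a position with letter l, the operator Y_k moves l to the front and flips it, and the
  embedding counts the inversions of the new word. The exponent of q grows by 2 with each earlier
  occurrence of l, so the occurrences of l together give the quantum integer [\<beta> l].\<close>

lemma X_emb_decreasing:
  assumes w: "w \<in> tensor_words n s" and dec: "sorted_wrt (\<ge>) w"
  shows "hecke_B.X (T_word s) (J_word n s) s (emb n s g) (map int w)
    = qq powi (int s - 1) * Zfull n g (content n w) * qq powi (- int (linv w))"
proof -
  let ?F = "emb n s g" and ?\<beta> = "content n w"
  have len: "length w = s" and sub: "set w \<subseteq> {1..n}" using w by (auto simp: tensor_words_def)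
  \<comment> \<open>G l counts the letters above l, and Q l the letters below the flipped letter n +
    1 - l once one copy of l is removed.\<close>
  define G where "G l = (\<Sum>k\<in>{l+1..n}. ?\<beta> k)" for l
  define Q where "Q l = (\<Sum>k\<in>{1..<n+1-l}. ?\<beta> k - ee l k)" for l
  define h where "h l = g (\<lambda>k. ?\<beta> k - ee l k + ee (n + 1 - l) k)" for l
  define \<Phi> where "\<Phi> l r = qq powi (2 * int r + G l + int s - ?\<beta> l - Q l - int (linv w)) * h l" for l r
  have X: "hecke_B.X (T_word s) (J_word n s) m F W = (\<Sum>k<m. hecke_B.Y (T_word s) (J_word n s) k F W)" for m F W
    by (induction m) (simp_all add: hecke_B.X.simps[OF hecke_words] vec_simps)
  have tm: "hecke_B.Y (T_word s) (J_word n s) k ?F (map int w) = \<Phi> (w ! k) (count_list (take k w) (w ! k))" if k: "k < s" for k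
  proof -
    define us l vs where "us = take k w" and "l = w ! k" and "vs = drop (Suc k) w"
    have w_eq: "w = us @ l # vs" unfolding us_def l_def vs_def using k len by (intro id_take_nth_drop) simp
    have lus: "length us = k" using k len by (simp add: us_def)
    have ge: "\<forall>u\<in>set us. l \<le> u" and le: "\<forall>v\<in>set vs. v \<le> l"
      using dec unfolding w_eq by (auto simp: sorted_wrt_append)
    have l: "l \<in> {1..n}" using sub w_eq by auto
    have cnt: "count_list (map int us) (int l) = count_list us l"
      by (induction us) auto
    have "hecke_B.Y (T_word s) (J_word n s) k ?F (map int w) = qq ^ k * Tchain s k (J_word n s ?F) (map int us @ int l # map int vs)"
      unfolding Y_sym_chain[OF sym_emb k] scl_apply by (simp add: w_eq)
    also have "Tchain s k (J_word n s ?F) (map int us @ int l # map int vs)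
        = qq ^ count_list us l * J_word n s ?F (map int (l # us @ vs))"
      using Tchain_at[of "map int us" k "map int vs" s "int l" "J_word n s ?F"] lus len ge cnt by (simp add: w_eq)
    also have "J_word n s ?F (map int (l # us @ vs)) = h l
        * qq powi (- int (length (filter (\<lambda>u. u < n + 1 - l) (us @ vs)) + linv (us @ vs)))"
      using J_emb_at[of us l vs n s g] w unfolding w_eq[symmetric] by (simp add: h_def)
    finally have Y: "hecke_B.Y (T_word s) (J_word n s) k ?F (map int w)
      = qq ^ k * (qq ^ count_list us l * (h l * qq powi (- int (length (filter (\<lambda>u. u < n + 1 - l) (us @ vs)) + linv (us @ vs)))))" .
    have G: "G l = int (length (filter (\<lambda>u. l < u) us))"
    proof -
      have "G l = int (length (filter (\<lambda>u. u \<in> {l+1..n}) w))"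
        unfolding G_def by (rule sum_content_filter) auto
      also have "filter (\<lambda>u. u \<in> {l+1..n}) w = filter (\<lambda>u. l < u) w"
        using sub by (intro filter_cong) auto
      also have "\<dots> = filter (\<lambda>u. l < u) us"
      proof -
        have "filter (\<lambda>u. l < u) vs = []" using le by (auto simp: filter_empty_conv)
        then show ?thesis by (simp add: w_eq)
      qed
      finally show ?thesis .
    qed
    have Q: "Q l = int (length (filter (\<lambda>u. u < n + 1 - l) (us @ vs)))"
    proof -
      have "?\<beta> k - ee l k = content n (us @ vs) k" for k
        unfolding w_eq content_append content_Cons[OF l] by simp
      then have "Q l = (\<Sum>k\<in>{1..<n+1-l}. content n (us @ vs) k)" unfolding Q_def by simp
      also have "\<dots> = int (length (filter (\<lambda>u. u \<in> {1..<n+1-l}) (us @ vs)))"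
        by (rule sum_content_filter) auto
      also have "filter (\<lambda>u. u \<in> {1..<n+1-l}) (us @ vs) = filter (\<lambda>u. u < n + 1 - l) (us @ vs)"
        using sub w_eq by (intro filter_cong) auto
      finally show ?thesis .
    qed
    have part: "length us = length (filter (\<lambda>u. l < u) us) + count_list us l" if "\<forall>u\<in>set us. l \<le> u" for us
      using that by (induction us) auto
    have part': "length vs = length (filter (\<lambda>v. v < l) vs) + count_list vs l" if "\<forall>v\<in>set vs. v \<le> l" for vs
      using that by (induction vs) auto
    have kG: "int k = G l + int (count_list us l)" using part[OF ge] lus G by simp
    have \<beta>: "?\<beta> l = int (count_list us l) + 1 + int (count_list vs l)" using l by (simp add: content_def w_eq)
    have "s = length us + 1 + length vs" using len w_eq by simp
    then have sl: "int (length (filter (\<lambda>v. v < l) vs)) = int s - G l - ?\<beta> l"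
      using part'[OF le] kG \<beta> lus by simp
    \<comment> \<open>Removing the letter l removes its inversions with the larger letters, all
      before it, and with the smaller letters, all after it.\<close>
    have inv: "int (linv w) = int (linv (us @ vs)) + G l + (int s - G l - ?\<beta> l)"
    proof -
      have "linv w = linv (us @ vs) + length (filter (\<lambda>u. l < u) us) + length (filter (\<lambda>v. v < l) vs)"
        unfolding w_eq by (rule linv_remove)
      then show ?thesis unfolding sl[symmetric] by (simp only: G of_nat_add)
    qed
    have e: "int k + int (count_list us l) - (Q l + int (linv (us @ vs)))
      = 2 * int (count_list us l) + G l + int s - ?\<beta> l - Q l - int (linv w)"
      using kG inv by simp
    have pw: "qq ^ i = qq powi (int i)" for i by simp
    have "hecke_B.Y (T_word s) (J_word n s) k ?F (map int w)
      = qq powi (int k + int (count_list us l) - (Q l + int (linv (us @ vs)))) * h l"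
      unfolding Y pw by (simp add: Q power_int_add power_int_diff power_int_minus field_simps)
    then show ?thesis unfolding e \<Phi>_def us_def[symmetric] l_def[symmetric] .
  qed
  have "hecke_B.X (T_word s) (J_word n s) s ?F (map int w) = (\<Sum>k<length w. \<Phi> (w ! k) (count_list (take k w) (w ! k)))"
    unfolding X len using tm by (intro sum.cong) auto
  also have "\<dots> = (\<Sum>l\<in>{1..n}. \<Sum>r<count_list w l. \<Phi> l r)"
    by (rule sum_by_letters[OF _ sub]) simp
  also have "\<dots> = (\<Sum>l\<in>{1..n}. qq powi (int s - 1) * (qq powi (G l - Q l) * q_int (?\<beta> l) * h l) * qq powi (- int (linv w)))"
  proof (intro sum.cong refl)
    fix l assume l: "l \<in> {1..n}"
    have b: "?\<beta> l = int (count_list w l)" using l by (simp add: content_def)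
    have "\<Phi> l r = qq ^ (2 * r) * (qq powi (G l + int s - ?\<beta> l - Q l - int (linv w)) * h l)" for r
    proof -
      have "qq powi (2 * int r + G l + int s - ?\<beta> l - Q l - int (linv w))
        = qq powi (int (2 * r)) * qq powi (G l + int s - ?\<beta> l - Q l - int (linv w))"
        by (subst power_int_add[symmetric]) (simp_all add: algebra_simps)
      then show ?thesis unfolding \<Phi>_def by (simp only: power_int_of_nat mult.assoc)
    qed
    then have "(\<Sum>r<count_list w l. \<Phi> l r) = (qq powi (?\<beta> l - 1) * q_int (?\<beta> l)) * (qq powi (G l + int s - ?\<beta> l - Q l - int (linv w)) * h l)"
      unfolding b by (simp only: sum_distrib_right[symmetric] q_geometric)
    also have "\<dots> = qq powi (int s - 1) * (qq powi (G l - Q l) * q_int (?\<beta> l) * h l) * qq powi (- int (linv w))"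
    proof -
      have pw: "qq powi (?\<beta> l - 1) * qq powi (G l + int s - ?\<beta> l - Q l - int (linv w))
        = qq powi (int s - 1) * (qq powi (G l - Q l) * qq powi (- int (linv w)))"
      proof -
        have qp: "qq powi i * qq powi j = qq powi (i + j)" for i j by (simp add: power_int_add)
        show ?thesis unfolding qp by (rule arg_cong[of _ _ "\<lambda>i. qq powi i"]) simp
      qed
      have "(qq powi (?\<beta> l - 1) * q_int (?\<beta> l)) * (qq powi (G l + int s - ?\<beta> l - Q l - int (linv w)) * h l)
        = (qq powi (?\<beta> l - 1) * qq powi (G l + int s - ?\<beta> l - Q l - int (linv w))) * (q_int (?\<beta> l) * h l)"
        by (simp only: mult_ac)
      then show ?thesis unfolding pw by (simp only: mult_ac)
    qed
    finally show "(\<Sum>r<count_list w l. \<Phi> l r) = qq powi (int s - 1) * (qq powi (G l - Q l) * q_int (?\<beta> l) * h l) * qq powi (- int (linv w))" .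
  qed
  also have "\<dots> = qq powi (int s - 1) * Zfull n g ?\<beta> * qq powi (- int (linv w))"
    unfolding Zfull_def G_def Q_def h_def sum_distrib_left sum_distrib_right ..
  finally show ?thesis .
qed

text \<open>Both sides are symmetric and supported on words with letters 1, ..., n, and
  \<open>X_emb_decreasing\<close> compares them on decreasing words; so \<open>sym_word_zero\<close>
  applies to their difference D.\<close>

lemma X_emb:
  assumes s: "s \<ge> 1"
  shows "hecke_B.X (T_word s) (J_word n s) s (emb n s g) = qq powi (int s - 1) \<cdot> emb n s (Zfull n g)"
proof -
  let ?T = "T_word s" and ?J = "J_word n s"
  define D where "D = hecke_B.X ?T ?J s (emb n s g) - qq powi (int s - 1) \<cdot> emb n s (Zfull n g)"
  define supp where "supp f \<longleftrightarrow> (\<forall>W. W \<notin> map int ` tensor_words n s \<longrightarrow> f W = 0)" for f :: "int list \<Rightarrow> cqx"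
  have T: "supp (?T k f)" if f: "supp f" for k f
    unfolding supp_def
  proof (intro allI impI)
    fix W assume W: "W \<notin> map int ` tensor_words n s"
    show "?T k f W = 0"
    proof (cases "length W = s \<and> 1 \<le> k \<and> k < s")
      case True
      then obtain us a b vs where e: "W = us @ a # b # vs" "k = Suc (length us)" using split2[of k W] by auto
      have l: "length us + 2 + length vs = s" using True e by simp
      have "us @ b # a # vs \<notin> map int ` tensor_words n s" using W unfolding e image_words_swap[of us b] .
      then have "f (us @ b # a # vs) = 0" "f W = 0" using f W unfolding supp_def by blast+
      then show ?thesis unfolding e(1) T_word_at[OF e(2) l] by (simp only: mult_zero_right add_0 if_cancel)
    next
      case False
      then have "length W \<noteq> s \<or> \<not> (1 \<le> k \<and> k < s)" by blast
      then have "?T k f W = qq * f W" by (rule T_word_off)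
      then show ?thesis using f W unfolding supp_def by simp
    qed
  qed
  have J: "supp (?J f)" if f: "supp f" for f
    unfolding supp_def
  proof (intro allI impI)
    fix W assume W: "W \<notin> map int ` tensor_words n s"
    have fW: "f W = 0" using f W unfolding supp_def by blast
    show "?J f W = 0"
    proof (cases "length W = s")
      case True
      then obtain l vs where e: "W = l # vs" using s by (cases W) auto
      have "(int n + 1 - l) # vs \<notin> map int ` tensor_words n s"
      proof
        assume "(int n + 1 - l) # vs \<in> map int ` tensor_words n s"
        then obtain w where w: "(int n + 1 - l) # vs = map int w" "w \<in> tensor_words n s" by (rule imageE)
        then obtain l' vs' where w': "w = l' # vs'" "int n + 1 - l = int l'" "vs = map int vs'" by auto
        have l': "1 \<le> l'" "l' \<le> n" using w(2) w'(1) by (auto simp: tensor_words_def)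
        have "W = map int ((n + 1 - l') # vs')" using e w' l' by (simp add: of_nat_diff)
        moreover have "(n + 1 - l') # vs' \<in> tensor_words n s" using w(2) w'(1) l' by (auto simp: tensor_words_def)
        ultimately show False using W by blast
      qed
      then have "f ((int n + 1 - l) # vs) = 0" using f unfolding supp_def by blast
      moreover have "Suc (length vs) = s" using True e by simp
      ultimately show ?thesis unfolding e by (simp only: J_word_at)
    next
      case False
      then show ?thesis using fW by (simp add: J_word_def)
    qed
  qed
  have Y: "supp (hecke_B.Y ?T ?J k f)" if "supp f" for k f
    using that by (induction k arbitrary: f) (simp_all add: hecke_B.Y.simps[OF hecke_words] T J)
  have X: "supp (hecke_B.X ?T ?J k f)" if "supp f" for k f
  proof (induction k)
    case (Suc k)
    then show ?case using Y[OF that, of k]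
      by (simp add: hecke_B.X.simps[OF hecke_words] supp_def vec_simps)
  qed (simp add: hecke_B.X.simps[OF hecke_words] supp_def vec_simps)
  have e: "supp (emb n s g)" for g unfolding supp_def by (simp add: emb_off)
  have D: "supp D" using X[OF e, of s g] e[of "Zfull n g"] unfolding D_def supp_def by (simp add: vec_simps)
  have symD: "hecke_B.sym qq ?T s D"
    unfolding hecke_B.sym_def[OF hecke_words]
  proof (intro allI impI)
    fix i assume i: "1 \<le> i \<and> i < s"
    have E: "?T i (emb n s g) = qq \<cdot> emb n s g" for g
      using sym_emb[of s n g] i unfolding hecke_B.sym_def[OF hecke_words] by blast
    have "?T i (hecke_B.X ?T ?J s (emb n s g)) = qq \<cdot> hecke_B.X ?T ?J s (emb n s g)"
      using i by (intro hecke_B.T_X[OF hecke_words] E) auto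
    then show "?T i D = qq \<cdot> D"
      unfolding D_def hecke_B.linT[OF hecke_words] E by (simp add: scl_diff mult.commute)
  qed
  have dec: "D W = 0" if l: "length W = s" and d: "sorted_wrt (\<ge>) W" for W
  proof (cases "W \<in> map int ` tensor_words n s")
    case True
    then obtain w where w: "W = map int w" "w \<in> tensor_words n s" by (rule imageE)
    have "sorted_wrt (\<ge>) w" using d unfolding w(1) by (simp add: sorted_wrt_map)
    from X_emb_decreasing[OF w(2) this, of g] show ?thesis
      unfolding D_def w(1) by (simp add: vec_simps emb_map[OF w(2)])
  next
    case False
    then show ?thesis using D unfolding supp_def by blast
  qed
  have "D W = 0" for W
  proof (cases "length W = s")
    case True
    show ?thesis by (rule sym_word_zero[OF symD dec True])
  next
    case False
    then have "W \<notin> map int ` tensor_words n s" by (auto simp: tensor_words_def)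
    then show ?thesis using D unfolding supp_def by blast
  qed
  then show ?thesis unfolding D_def by (simp add: vec_simps fun_eq_iff)
qed

text \<open>The value at the increasing word of content \<alpha> recovers the coefficient of
  v_\<alpha>.\<close>

lemma embed_KR_inject:
  assumes "f \<in> vspan (comps n s)" "g \<in> vspan (comps n s)"
    and eq: "lin (comps n s) (embed_KR n s) f = lin (comps n s) (embed_KR n s) g"
  shows "f = g"
proof
  fix \<alpha>
  show "f \<alpha> = g \<alpha>"
  proof (cases "\<alpha> \<in> comps n s")
    case True
    define w where "w = concat (map (\<lambda>k. replicate (nat (\<alpha> k)) k) [1..<Suc n])"
    have cnt: "count_list (concat (map (\<lambda>k. replicate (m k) k) ks)) x
      = (if x \<in> set ks then m x else 0)" if "distinct ks" for m x and ks :: "nat list"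
    proof -
      have rep: "count_list (replicate i y) x = (if x = y then i else 0)" for i and y :: nat
        by (induction i) auto
      show ?thesis using that by (induction ks) (auto simp: rep)
    qed
    have c: "count_list w x = (if x \<in> {1..n} then nat (\<alpha> x) else 0)" for x
      unfolding w_def by (subst cnt) auto
    have nn: "\<alpha> k \<ge> 0" if "k \<in> {1..n}" for k using True that unfolding comps_def by blast
    have z: "\<alpha> k = 0" if "k \<notin> {1..n}" for k using True that unfolding comps_def by blast
    have sub: "set w \<subseteq> {1..n}" unfolding w_def by auto
    have "length w = (\<Sum>k\<in>{1..n}. count_list w k)"
      by (rule sum_count_set[symmetric]) (use sub in auto)
    then have "int (length w) = (\<Sum>k\<in>{1..n}. int (nat (\<alpha> k)))" by (simp add: c)
    also have "\<dots> = (\<Sum>k\<in>{1..n}. \<alpha> k)" using nn by (intro sum.cong) auto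
    finally have "length w = s" using True by (simp add: comps_def)
    then have w: "w \<in> tensor_words n s" using sub by (simp add: tensor_words_def)
    have "content n w = \<alpha>"
    proof
      fix k show "content n w k = \<alpha> k"
        using nn[of k] z[of k] by (cases "k \<in> {1..n}") (simp_all only: content_def c if_True if_False simp_thms nat_0_le of_nat_0)
    qed
    then show ?thesis using fun_cong[OF eq, of w] w by (simp add: lin_embed_KR)
  next
    case False
    then show ?thesis using assms(1,2) by (simp add: vspan_def)
  qed
qed

section \<open>Eigenvectors of the K-matrix\<close>

definition eigP :: "nat \<Rightarrow> nat \<Rightarrow> cqx \<Rightarrow> cqx" where
  "eigP k j z = (\<Prod>i<k. z - qq ^ (2 * i)) * (\<Prod>i<j. z + qq ^ (2 * i))"

text \<open>The ratio of C at the two ends of the fusion: q^{s-1} x is the argument of the last K_1,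
  and q^{s-1} / x is the first argument of the R-matrix acting first in a factor.\<close>

definition eigval :: "nat \<Rightarrow> nat \<Rightarrow> nat \<Rightarrow> cqx" where
  "eigval s k j = eigP k j (qq powi (int s - 1) * xx) / eigP k j (qq powi (int s - 1) * inverse xx)"

lemma eigP_nonzero: "eigP k j (qq powi m * inverse xx) \<noteq> 0"
proof -
  have 1: "qq powi m * inverse xx \<noteq> qq powi l" for l
  proof
    assume "qq powi m * inverse xx = qq powi l"
    then have "qq powi l * xx ^ 1 = qq powi m" using xx_nonzero by (simp add: field_simps)
    then show False using qq_powi_xx_neq[of 1 l m] by simp
  qed
  \<comment> \<open>Squaring removes the sign and leads back to monomials, now with x^2.\<close>
  have 2: "qq powi m * inverse xx \<noteq> - (qq powi l)" for l
  proof
    assume "qq powi m * inverse xx = - (qq powi l)"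
    then have "(qq powi m * inverse xx)\<^sup>2 = (qq powi l)\<^sup>2" by simp
    then have "(qq powi l)\<^sup>2 * xx\<^sup>2 = (qq powi m)\<^sup>2"
      using xx_nonzero by (simp add: field_simps power_mult_distrib)
    then have "qq powi (2 * l) * xx ^ 2 = qq powi (2 * m)"
      by (simp add: power_int_mult mult.commute)
    then show False using qq_powi_xx_neq[of 2 "2 * l" "2 * m"] by simp
  qed
  have "qq powi m * inverse xx - qq ^ (2 * i) \<noteq> 0" for i using 1[of "int (2 * i)"] by (simp only: power_int_of_nat right_minus_eq not_False_eq_True)
  moreover have "qq powi m * inverse xx + qq ^ (2 * i) \<noteq> 0" for i
    using 2[of "int (2 * i)"] by (simp only: power_int_of_nat eq_neg_iff_add_eq_0 not_False_eq_True)
  ultimately show ?thesis unfolding eigP_def by simp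
qed

lemma emb_cong: "(\<And>\<beta>. \<beta> \<in> comps n s \<Longrightarrow> g \<beta> = g' \<beta>) \<Longrightarrow> emb n s g = emb n s g'"
  unfolding emb_def lin_def by (intro arg_cong[of _ _ "lift n s"] ext sum.cong) auto

lemma emb_scale: "emb n s (\<lambda>\<beta>. c * g \<beta>) = c \<cdot> emb n s g"
  unfolding emb_def lift_scale[symmetric] lin_def by (simp add: sum_distrib_left mult.assoc)

lemma qq_powi_add: "qq powi (i + j) = qq powi i * qq powi j"
  by (simp add: power_int_add)

lemma par_ratio: "par_K s j / par_R s j k = qq powi (4 * int j - 2 * int s - 2 * int k - 2) * xx ^ 2"
proof -
  have e: "- int s + 2 * int j - 1 = (4 * int j - 2 * int s - 2 * int k - 2) + (int s - 2 * int j + 2 * int k + 1)"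
    by simp
  have f: "a * b * x / (b * inverse x) = a * x\<^sup>2" if "b \<noteq> 0" "x \<noteq> 0" for a b x :: cqx
    using that by (simp add: power2_eq_square field_simps)
  show ?thesis unfolding par_K_def par_R_def e qq_powi_add by (rule f) (simp_all add: xx_nonzero)
qed

lemma K_total_off:
  assumes s: "s \<ge> 1" and KW: "\<forall>l\<in>{1..n}. KW (par_K s s) l = unit_vec (n + 1 - l)" and w: "w \<notin> tensor_words n s"
  shows "K_total n s KW R f w = 0"
proof -
  have "[1..<s + 1] = [1..<s] @ [s]" using s by (simp add: upt_Suc_append)
  then show ?thesis unfolding K_total_def using K_factor_off[where n = n and KW = KW and s = s and j = s, OF s KW w] by simp
qed

text \<open>By \<open>X_emb\<close> an eigenfunction g of \<open>Zfull\<close> gives an eigenvector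
  of X, on which C(z) is the scalar \<open>eigP k j z\<close>; fusion then yields
  \<open>eigval\<close>. The constant C gathers the scalars of the R-matrices and of the fusion, and
  is the same for all g, k and j.\<close>

lemma K_total_eigen:
  assumes n: "n \<ge> 3" and s: "s \<ge> 1"
    and KW: "\<forall>j\<in>{1..s}. is_K_W n (par_K s j) (KW (par_K s j))"
    and R: "\<forall>j\<in>{1..s}. \<forall>k\<in>{1..<j}. is_R_matrix n (par_R s j k) (par_K s j) (R (par_R s j k) (par_K s j))"
  shows "\<exists>C. C \<noteq> 0 \<and> (\<forall>g k j. k + j = s \<longrightarrow>
     (\<forall>\<beta>\<in>comps n s. Zfull n g \<beta> = q_int (int k - int j) * g \<beta>) \<longrightarrow>
     K_total n s KW R (lin (comps n s) (embed_KR n s) g)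
       = lin (comps n s) (embed_KR n s) (\<lambda>\<beta>. C * eigval s k j * g \<beta>))"
proof -
  interpret H: hecke_B s qq "T_word s" "J_word n s" by (rule hecke_words)
  define z where "z j k = par_K s j / par_R s j k" for j k
  define a where "a = qq powi (int s - 1) * inverse xx"
  have pK: "par_K s j \<noteq> 0" and pR: "par_R s j k \<noteq> 0" for j k
    by (simp_all add: par_K_def par_R_def xx_nonzero)
  have zq: "z j k \<noteq> qq\<^sup>2" for j k
    using qq_powi_xx_neq[of 2 "4 * int j - 2 * int s - 2 * int k - 2" 2] unfolding z_def par_ratio by simp
  have KW': "\<forall>l\<in>{1..n}. KW (par_K s j) l = unit_vec (n + 1 - l)" if "1 \<le> j" "j \<le> s" for j
    using KW that unfolding is_K_W_def by simp
  have R': "\<exists>c. c \<noteq> 0 \<and> (\<forall>b\<in>{1..n} \<times> {1..n}. \<forall>b'. R (par_R s j k) (par_K s j) b b' = c * R_explicit (z j k) b b')"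
    if "1 \<le> k" "k < j" "j \<le> s" for j k
  proof -
    have 1: "is_R_matrix n (par_R s j k) (par_K s j) (R (par_R s j k) (par_K s j))" using R that by simp
    show ?thesis unfolding z_def by (rule R_matrix_unique[OF 1 n pR pK zq[unfolded z_def]])
  qed
  obtain c where c: "c \<noteq> 0" "\<And>f. lift n s (K_total n s KW R f) = c \<cdot> fold (H.Kfac z) [1..<Suc s] (lift n s f)"
    using lift_K_total[OF s, of n KW R z] KW' R' by blast
  have a0: "a \<noteq> 0" by (simp add: a_def xx_nonzero)
  have v: "par_K s (Suc j) = qq\<^sup>2 * par_K s j" for j
  proof -
    have e: "- int s + 2 * int (Suc j) - 1 = 2 + (- int s + 2 * int j - 1)" by simp
    show ?thesis unfolding par_K_def e qq_powi_add by simp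
  qed
  have av: "a * par_K s 1 = 1"
  proof -
    have e: "- int s + 2 * int 1 - 1 = - (int s - 1)" by simp
    have f: "a * inverse x * (inverse a * x) = 1" if "a \<noteq> 0" "x \<noteq> 0" for a x :: cqx
      using that by (simp add: field_simps)
    show ?thesis unfolding a_def par_K_def e power_int_minus by (rule f) (simp_all add: xx_nonzero)
  qed
  have zv: "z j k = par_K s j / (a / qq ^ (2 * (j - 1 - k))) \<and> z j k \<noteq> qq\<^sup>2" if "1 \<le> k" "k < j" "j \<le> s" for j k
  proof -
    have e: "int s - 2 * int j + 2 * int k + 1 = (int s - 1) - int (2 * (j - 1 - k))" using that by (simp add: of_nat_diff)
    have f: "qq powi (i - int m) * y = qq powi i * y / qq ^ m" for i m y
      by (simp add: power_int_diff)
    have "par_R s j k = a / qq ^ (2 * (j - 1 - k))"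
      unfolding par_R_def a_def e by (rule f)
    then show ?thesis using zq[of j k] by (simp only: z_def simp_thms)
  qed
  have "\<exists>\<rho>. \<rho> \<noteq> 0 \<and> (\<forall>f. H.sym s f \<longrightarrow> fold (H.Kfac z) [1..<Suc s] (H.C s a f) = \<rho> \<cdot> H.C s (par_K s s) f)"
  proof (rule H.fusion[OF a0 v av])
    show "z j k = par_K s j / (a / qq ^ (2 * (j - 1 - k))) \<and> z j k \<noteq> qq\<^sup>2" if "1 \<le> k" "k < j" "j \<le> s" for j k
      by (rule zv[OF that])
  qed (rule order.refl)
  then obtain \<rho> where \<rho>: "\<rho> \<noteq> 0" "\<And>f. H.sym s f \<Longrightarrow> fold (H.Kfac z) [1..<Suc s] (H.C s a f) = \<rho> \<cdot> H.C s (par_K s s) f"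
    by (elim exE conjE) blast
  have lin_fold: "fold (H.Kfac z) ks (b \<cdot> f) = b \<cdot> fold (H.Kfac z) ks f" for ks b f
    by (induction ks arbitrary: f) (simp_all add: lin_opD(2)[OF H.lin_Kfac])
  show ?thesis
  proof (intro exI[of _ "c * \<rho>"] conjI allI impI)
    show "c * \<rho> \<noteq> 0" using c \<rho> by simp
    fix g k j
    assume kj: "k + j = s" and Z: "\<forall>\<beta>\<in>comps n s. Zfull n g \<beta> = q_int (int k - int j) * g \<beta>"
    let ?f = "lin (comps n s) (embed_KR n s) g"
    define \<theta> where "\<theta> = qq powi (int s - 1) * q_int (int k - int j)"
    have lf: "lift n s ?f = emb n s g" by (simp add: emb_def)
    have X: "H.X s (emb n s g) = \<theta> \<cdot> emb n s g"
    proof -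
      have "emb n s (Zfull n g) = emb n s (\<lambda>\<beta>. q_int (int k - int j) * g \<beta>)"
        using Z by (intro emb_cong) blast
      then show ?thesis unfolding X_emb[OF s] emb_scale \<theta>_def by simp
    qed
    have h: "qq - inverse qq \<noteq> 0" using q_minus_qinv_nonzero by (simp add: power_int_minus)
    have "\<theta> * (qq\<^sup>2 - 1) = qq ^ (2 * k) - qq ^ (2 * j)"
    proof -
      have hq: "qq\<^sup>2 - 1 = qq * (qq - inverse qq)" by (simp add: power2_eq_square algebra_simps)
      have "q_int (int k - int j) * (qq - inverse qq) = qq powi (int k - int j) - qq powi (- (int k - int j))"
        using h by (simp add: q_int_def power_int_minus)
      then have "\<theta> * (qq\<^sup>2 - 1) = (qq powi (int s - 1) * qq powi 1) * (qq powi (int k - int j) - qq powi (- (int k - int j)))"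
        unfolding \<theta>_def hq by (simp add: mult_ac)
      also have "\<dots> = qq powi (int s) * (qq powi (int k - int j) - qq powi (- (int k - int j)))"
        unfolding power_int_add[OF disjI1[OF qq_nonzero], symmetric] by simp
      also have "\<dots> = qq powi (int s + (int k - int j)) - qq powi (int s + (- (int k - int j)))"
        unfolding right_diff_distrib power_int_add[OF disjI1[OF qq_nonzero]] ..
      also have "int s + (int k - int j) = int (2 * k)" using kj by simp
      also have "int s + (- (int k - int j)) = int (2 * j)" using kj by simp
      finally show ?thesis unfolding power_int_of_nat .
    qed
    then have C: "H.C s y (emb n s g) = eigP k j y \<cdot> emb n s g" for y
      using H.C_eigenvector[OF sym_emb X _ kj, of y] by (simp add: H.poly_eigenpoly eigP_def)
    have vs: "par_K s s = qq powi (int s - 1) * xx" by (simp add: par_K_def)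
    have Pa: "eigP k j a \<noteq> 0" unfolding a_def by (rule eigP_nonzero)
    \<comment> \<open>Fusion describes the product on C(a) f. Here C(a) is a nonzero scalar and can
      be divided out.\<close>
    have "eigP k j a \<cdot> fold (H.Kfac z) [1..<Suc s] (emb n s g) = (\<rho> * eigP k j (par_K s s)) \<cdot> emb n s g"
      using \<rho>(2)[OF sym_emb[of s n g]] unfolding C lin_fold by simp
    then have "inverse (eigP k j a) \<cdot> eigP k j a \<cdot> fold (H.Kfac z) [1..<Suc s] (emb n s g)
       = inverse (eigP k j a) \<cdot> (\<rho> * eigP k j (par_K s s)) \<cdot> emb n s g" by simp
    then have "fold (H.Kfac z) [1..<Suc s] (emb n s g) = (\<rho> * eigval s k j) \<cdot> emb n s g"
      using Pa unfolding eigval_def vs a_def[symmetric] by (simp add: divide_inverse mult_ac)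
    then have "lift n s (K_total n s KW R ?f) = (c * \<rho> * eigval s k j) \<cdot> emb n s g"
      unfolding c(2) lf by (simp add: mult.assoc)
    also have "\<dots> = emb n s (\<lambda>\<beta>. c * \<rho> * eigval s k j * g \<beta>)" by (rule emb_scale[symmetric])
    finally have L: "lift n s (K_total n s KW R ?f) = emb n s (\<lambda>\<beta>. c * \<rho> * eigval s k j * g \<beta>)" .
    show "K_total n s KW R ?f = lin (comps n s) (embed_KR n s) (\<lambda>\<beta>. c * \<rho> * eigval s k j * g \<beta>)"
    proof
      fix w
      show "K_total n s KW R ?f w = lin (comps n s) (embed_KR n s) (\<lambda>\<beta>. c * \<rho> * eigval s k j * g \<beta>) w"
      proof (cases "w \<in> tensor_words n s")
        case True
        show ?thesis using fun_cong[OF L, of "map int w"] unfolding emb_def lift_map[OF True] .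
      next
        case False
        have "\<forall>l\<in>{1..n}. KW (par_K s s) l = unit_vec (n + 1 - l)" using KW'[of s] s by simp
        from K_total_off[where n = n and KW = KW and s = s, OF s this False] show ?thesis
          using False by (simp only: lin_embed_KR if_False)
      qed
    qed
  qed
qed

section \<open>Linearity, and transport along the embedding\<close>

definition sumlin :: "'a set \<Rightarrow> (('b \<Rightarrow> cqx) \<Rightarrow> 'c \<Rightarrow> cqx) \<Rightarrow> bool" where
  "sumlin A L \<longleftrightarrow> (\<forall>g F. L (\<lambda>w. \<Sum>\<alpha>\<in>A. g \<alpha> * F \<alpha> w) = (\<lambda>w. \<Sum>\<alpha>\<in>A. g \<alpha> * L (F \<alpha>) w))"

lemma sumlinD: "sumlin A L \<Longrightarrow> L (\<lambda>w. \<Sum>\<alpha>\<in>A. g \<alpha> * F \<alpha> w) = (\<lambda>w. \<Sum>\<alpha>\<in>A. g \<alpha> * L (F \<alpha>) w)"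
  by (simp add: sumlin_def)

lemma sumlin_lin: "sumlin A (lin B M)"
proof -
  have "(\<Sum>b\<in>B. (\<Sum>\<alpha>\<in>A. g \<alpha> * F \<alpha> b) * M b c) = (\<Sum>\<alpha>\<in>A. g \<alpha> * (\<Sum>b\<in>B. F \<alpha> b * M b c))" for g F c
    unfolding sum_distrib_left sum_distrib_right mult.assoc by (rule sum.swap)
  then show ?thesis unfolding sumlin_def lin_def by simp
qed

lemma sumlin_comp: "sumlin A L \<Longrightarrow> sumlin A M \<Longrightarrow> sumlin A (\<lambda>f. L (M f))"
  unfolding sumlin_def by simp

lemma sumlin_fold: "(\<And>k. sumlin A (L k)) \<Longrightarrow> sumlin A (\<lambda>f. fold L ks f)"
proof (induction ks)
  case Nil
  show ?case by (simp add: sumlin_def)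
next
  case (Cons k ks)
  then show ?case unfolding sumlin_def by simp
qed

lemma sumlin_K_total: "sumlin A (K_total n s KW R)"
proof -
  have "sumlin A (K_factor n s KW R j)" for j
    unfolding K_factor_def[abs_def] by (rule sumlin_comp[OF sumlin_lin sumlin_fold[OF sumlin_lin]])
  then show ?thesis using sumlin_fold[of A "K_factor n s KW R"] unfolding K_total_def[abs_def] by simp
qed

lemma lin_lin: "lin C M' (lin B M f) = lin B (\<lambda>b. lin C M' (M b)) f"
proof -
  have "lin C M' (\<lambda>w. \<Sum>\<alpha>\<in>B. f \<alpha> * M \<alpha> w) = (\<lambda>w. \<Sum>\<alpha>\<in>B. f \<alpha> * lin C M' (M \<alpha>) w)"
    by (rule sumlinD[OF sumlin_lin])
  then show ?thesis by (simp only: lin_def[of B])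
qed

lemma quantum_K_eigen:
  assumes n: "n \<ge> 3" and s: "s \<ge> 1" and \<kappa>: "quantum_K_matrix n s \<kappa>"
  shows "\<exists>C. C \<noteq> 0 \<and> (\<forall>g k j. g \<in> vspan (comps n s) \<longrightarrow> k + j = s \<longrightarrow>
     (\<forall>\<beta>\<in>comps n s. Zfull n g \<beta> = q_int (int k - int j) * g \<beta>) \<longrightarrow>
     lin (comps n s) \<kappa> g = (\<lambda>\<beta>. C * eigval s k j * g \<beta>))"
proof -
  from \<kappa> obtain KW R where KW: "\<forall>j\<in>{1..s}. is_K_W n (par_K s j) (KW (par_K s j))"
    and R: "\<forall>j\<in>{1..s}. \<forall>k\<in>{1..<j}. is_R_matrix n (par_R s j k) (par_K s j) (R (par_R s j k) (par_K s j))"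
    and \<kappa>2: "\<And>\<alpha>. \<alpha> \<in> comps n s \<Longrightarrow> \<kappa> \<alpha> \<in> vspan (comps n s)"
    and \<kappa>3: "\<And>\<alpha>. \<alpha> \<in> comps n s \<Longrightarrow> lin (comps n s) (embed_KR n s) (\<kappa> \<alpha>) = K_total n s KW R (embed_KR n s \<alpha>)"
    unfolding quantum_K_matrix_def by blast
  let ?e = "lin (comps n s) (embed_KR n s)"
  have emb: "?e (lin (comps n s) \<kappa> g) = K_total n s KW R (?e g)" for g
  proof -
    have "?e (lin (comps n s) \<kappa> g) = (\<lambda>w. \<Sum>\<alpha>\<in>comps n s. g \<alpha> * ?e (\<kappa> \<alpha>) w)"
      unfolding lin_lin by (simp only: lin_def[of "comps n s" "\<lambda>b. ?e (\<kappa> b)"])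
    also have "\<dots> = (\<lambda>w. \<Sum>\<alpha>\<in>comps n s. g \<alpha> * K_total n s KW R (embed_KR n s \<alpha>) w)"
      using \<kappa>3 by (intro ext sum.cong) auto
    also have "\<dots> = K_total n s KW R (?e g)"
      unfolding lin_def by (rule sumlinD[OF sumlin_K_total, symmetric])
    finally show ?thesis .
  qed
  from K_total_eigen[OF n s KW R] obtain C where C: "C \<noteq> 0" "\<And>g k j. k + j = s \<Longrightarrow>
     (\<forall>\<beta>\<in>comps n s. Zfull n g \<beta> = q_int (int k - int j) * g \<beta>) \<Longrightarrow>
     K_total n s KW R (?e g) = ?e (\<lambda>\<beta>. C * eigval s k j * g \<beta>)" by blast
  show ?thesis
  proof (intro exI[of _ C] conjI allI impI)
    fix g k j
    assume g: "g \<in> vspan (comps n s)" and kj: "k + j = s"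
      and Z: "\<forall>\<beta>\<in>comps n s. Zfull n g \<beta> = q_int (int k - int j) * g \<beta>"
    have "lin (comps n s) \<kappa> g \<in> vspan (comps n s)"
      using \<kappa>2 by (auto simp: vspan_def lin_def intro!: sum.neutral)
    moreover have "(\<lambda>\<beta>. C * eigval s k j * g \<beta>) \<in> vspan (comps n s)"
      using g by (simp add: vspan_def)
    ultimately show "lin (comps n s) \<kappa> g = (\<lambda>\<beta>. C * eigval s k j * g \<beta>)"
      by (rule embed_KR_inject) (simp only: emb C(2)[OF kj Z])
  qed (rule C(1))
qed

text \<open>A coefficient matrix \<kappa> exists only if the product of the factors maps the
  embedded KR module to itself. This follows from the spectrum: embedded eigenvectors go to
  multiples of themselves, and by hypothesis they span.\<close>

lemma quantum_K_matrix_exists: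
  assumes n: "n \<ge> 3" and s: "s \<ge> 1"
    and span: "\<And>\<alpha>. \<alpha> \<in> comps n s \<Longrightarrow> \<exists>(A :: 'a set) c g k j. finite A \<and> unit_vec \<alpha> = (\<lambda>\<beta>. \<Sum>i\<in>A. c i * g i \<beta>)
      \<and> (\<forall>i\<in>A. k i + j i = s \<and> g i \<in> vspan (comps n s) \<and>
          (\<forall>\<beta>\<in>comps n s. Zfull n (g i) \<beta> = q_int (int (k i) - int (j i)) * g i \<beta>))"
  shows "\<exists>\<kappa>. quantum_K_matrix n s \<kappa>"
proof -
  define KW :: "cqx \<Rightarrow> (nat, nat) lmap" where "KW u j = unit_vec (n + 1 - j)" for u j
  define R where "R u v = R_explicit (v / u)" for u v :: cqx
  let ?e = "lin (comps n s) (embed_KR n s)"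
  have n2: "n \<ge> 2" using n by simp
  have KW: "\<forall>j\<in>{1..s}. is_K_W n (par_K s j) (KW (par_K s j))"
    using K_W_exists[OF n2] unfolding KW_def[abs_def] by blast
  have R: "\<forall>j\<in>{1..s}. \<forall>k\<in>{1..<j}. is_R_matrix n (par_R s j k) (par_K s j) (R (par_R s j k) (par_K s j))"
  proof (intro ballI)
    fix j k
    have 1: "par_K s j / par_R s j k \<noteq> qq\<^sup>2"
      using qq_powi_xx_neq[of 2 "4 * int j - 2 * int s - 2 * int k - 2" 2] unfolding par_ratio by simp
    have 2: "par_K s j / par_R s j k \<noteq> inverse (qq\<^sup>2)"
      using qq_powi_xx_neq[of 2 "4 * int j - 2 * int s - 2 * int k - 2" "- 2"] unfolding par_ratio
      by (simp add: power_int_minus)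
    show "is_R_matrix n (par_R s j k) (par_K s j) (R (par_R s j k) (par_K s j))"
      unfolding R_def by (rule R_explicit_is_R_matrix[OF n2 _ _ 1 2]) (simp_all add: par_K_def par_R_def xx_nonzero)
  qed
  from K_total_eigen[OF n s KW R] obtain C where C: "\<And>g k j. k + j = s \<Longrightarrow>
     (\<forall>\<beta>\<in>comps n s. Zfull n g \<beta> = q_int (int k - int j) * g \<beta>) \<Longrightarrow>
     K_total n s KW R (?e g) = ?e (\<lambda>\<beta>. C * eigval s k j * g \<beta>)" by blast
  have "\<exists>f. f \<in> vspan (comps n s) \<and> ?e f = K_total n s KW R (embed_KR n s \<alpha>)" if \<alpha>: "\<alpha> \<in> comps n s" for \<alpha>
  proof -
    from span[OF \<alpha>] obtain A :: "'a set" and c g k j where Ag: "finite A \<and> unit_vec \<alpha> = (\<lambda>\<beta>. \<Sum>i\<in>A. c i * g i \<beta>)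
      \<and> (\<forall>i\<in>A. k i + j i = s \<and> g i \<in> vspan (comps n s) \<and>
          (\<forall>\<beta>\<in>comps n s. Zfull n (g i) \<beta> = q_int (int (k i) - int (j i)) * g i \<beta>))" by (elim exE)
    have A: "unit_vec \<alpha> = (\<lambda>\<beta>. \<Sum>i\<in>A. c i * g i \<beta>)" using Ag by (elim conjE)
    have g: "k i + j i = s" "g i \<in> vspan (comps n s)"
        "\<forall>\<beta>\<in>comps n s. Zfull n (g i) \<beta> = q_int (int (k i) - int (j i)) * g i \<beta>" if "i \<in> A" for i
    proof -
      have 1: "k i + j i = s \<and> g i \<in> vspan (comps n s) \<and> (\<forall>\<beta>\<in>comps n s. Zfull n (g i) \<beta> = q_int (int (k i) - int (j i)) * g i \<beta>)"
        using conjunct2[OF conjunct2[OF Ag]] that by (rule bspec)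
      show "k i + j i = s" using 1 by (elim conjE)
      show "g i \<in> vspan (comps n s)" using 1 by (elim conjE)
      show "\<forall>\<beta>\<in>comps n s. Zfull n (g i) \<beta> = q_int (int (k i) - int (j i)) * g i \<beta>" using 1 by (elim conjE)
    qed
    define f where "f = (\<lambda>\<beta>. \<Sum>i\<in>A. c i * (C * eigval s (k i) (j i) * g i \<beta>))"
    have E: "embed_KR n s \<alpha> = ?e (unit_vec \<alpha>)"
    proof
      fix w
      have "?e (unit_vec \<alpha>) w = (\<Sum>b\<in>comps n s. if b = \<alpha> then embed_KR n s b w else 0)"
        unfolding lin_def unit_vec_def by (intro sum.cong) auto
      then show "embed_KR n s \<alpha> w = ?e (unit_vec \<alpha>) w" using \<alpha> finite_comps[of n s] by simp
    qed
    have se: "?e (\<lambda>\<beta>. \<Sum>i\<in>A. c i * G i \<beta>) = (\<lambda>w. \<Sum>i\<in>A. c i * ?e (G i) w)" for G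
      by (rule sumlinD[OF sumlin_lin])
    have sk: "K_total n s KW R (\<lambda>w. \<Sum>i\<in>A. c i * G i w) = (\<lambda>w. \<Sum>i\<in>A. c i * K_total n s KW R (G i) w)" for G
      by (rule sumlinD[OF sumlin_K_total])
    have "K_total n s KW R (embed_KR n s \<alpha>) = (\<lambda>w. \<Sum>i\<in>A. c i * K_total n s KW R (?e (g i)) w)"
      unfolding E A se sk ..
    also have "\<dots> = (\<lambda>w. \<Sum>i\<in>A. c i * ?e (\<lambda>\<beta>. C * eigval s (k i) (j i) * g i \<beta>) w)"
    proof (intro ext sum.cong refl)
      fix w i assume i: "i \<in> A"
      show "c i * K_total n s KW R (?e (g i)) w = c i * ?e (\<lambda>\<beta>. C * eigval s (k i) (j i) * g i \<beta>) w"
        unfolding C[OF g(1)[OF i] g(3)[OF i]] ..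
    qed
    also have "\<dots> = ?e f" unfolding f_def se ..
    finally show ?thesis using g(2) by (intro exI[of _ f]) (simp add: f_def vspan_def)
  qed
  then have "\<exists>f. \<alpha> \<in> comps n s \<longrightarrow> f \<in> vspan (comps n s) \<and> ?e f = K_total n s KW R (embed_KR n s \<alpha>)" for \<alpha>
    by (cases "\<alpha> \<in> comps n s") simp_all
  then obtain \<kappa> where "\<forall>\<alpha>. \<alpha> \<in> comps n s \<longrightarrow> \<kappa> \<alpha> \<in> vspan (comps n s) \<and> ?e (\<kappa> \<alpha>) = K_total n s KW R (embed_KR n s \<alpha>)"
    using choice[of "\<lambda>\<alpha> f. \<alpha> \<in> comps n s \<longrightarrow> f \<in> vspan (comps n s) \<and> ?e f = K_total n s KW R (embed_KR n s \<alpha>)"] by blast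
  then have "\<forall>\<alpha>\<in>comps n s. \<kappa> \<alpha> \<in> vspan (comps n s) \<and> ?e (\<kappa> \<alpha>) = K_total n s KW R (embed_KR n s \<alpha>)" by blast
  with KW R show ?thesis unfolding quantum_K_matrix_def by (intro exI conjI)
qed

section \<open>Eigenfunctions, level by level\<close>

text \<open>The truncation of \<open>Zfull\<close> to the letters from lo to hi, with mirror letter
  lo + hi - l; eigenfunctions are built along these truncations.\<close>

definition Zint :: "nat \<Rightarrow> nat \<Rightarrow> ((nat \<Rightarrow> int) \<Rightarrow> cqx) \<Rightarrow> (nat \<Rightarrow> int) \<Rightarrow> cqx" where
  "Zint lo hi f \<beta> = (\<Sum>l\<in>{lo..hi}. qq powi ((\<Sum>k\<in>{l+1..hi}. \<beta> k) - (\<Sum>k\<in>{lo..<lo+hi-l}. \<beta> k - ee l k))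
     * q_int (\<beta> l) * f (\<lambda>k. \<beta> k - ee l k + ee (lo + hi - l) k))"

lemma Zfull_Zint: "Zfull n = Zint 1 n"
  by (intro ext) (simp add: Zfull_def Zint_def add.commute)

text \<open>The outer letters enter the inner terms only through one power of q, the same for all
  inner letters. The two outer terms preserve the sum of the two outer entries and shift c = \<beta>
  (h + 1) by -1 and by 1, which gives the operator of \<open>tri_eig\<close>.\<close>

lemma Zint_step:
  assumes jh: "j \<le> h"
  shows "Zint j (Suc h) f \<beta> = qq powi (\<beta> (Suc h) - \<beta> j) * Zint (Suc j) h f \<beta>
     + q_int (\<beta> (Suc h)) * f (\<lambda>k. \<beta> k - ee (Suc h) k + ee j k)
     + qq powi (\<beta> (Suc h) - \<beta> j + 1) * q_int (\<beta> j) * f (\<lambda>k. \<beta> k - ee j k + ee (Suc h) k)"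
proof -
  define t where "t l = qq powi ((\<Sum>k\<in>{l+1..Suc h}. \<beta> k) - (\<Sum>k\<in>{j..<j+Suc h-l}. \<beta> k - ee l k))
     * q_int (\<beta> l) * f (\<lambda>k. \<beta> k - ee l k + ee (j + Suc h - l) k)" for l
  have "{j..Suc h} = insert j (insert (Suc h) {Suc j..h})" using jh by auto
  then have "Zint j (Suc h) f \<beta> = t j + t (Suc h) + (\<Sum>l\<in>{Suc j..h}. t l)"
    unfolding Zint_def t_def[symmetric] using jh by simp
  also have "t j = qq powi (\<beta> (Suc h) - \<beta> j + 1) * q_int (\<beta> j) * f (\<lambda>k. \<beta> k - ee j k + ee (Suc h) k)"
  proof -
    have "{j+1..Suc h} = insert (Suc h) {Suc j..<Suc h}" using jh by auto
    then have 1: "(\<Sum>k\<in>{j+1..Suc h}. \<beta> k) = \<beta> (Suc h) + (\<Sum>k\<in>{Suc j..<Suc h}. \<beta> k)" by simp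
    have e: "j + Suc h - j = Suc h" and le: "j < Suc h" using jh by auto
    have "(\<Sum>k\<in>{j..<j+Suc h-j}. \<beta> k - ee j k) = (\<beta> j - ee j j) + (\<Sum>k\<in>{Suc j..<Suc h}. \<beta> k - ee j k)"
      unfolding e by (rule sum.atLeast_Suc_lessThan[OF le])
    also have "\<beta> j - ee j j = \<beta> j - 1" by (simp add: ee_def)
    also have "(\<Sum>k\<in>{Suc j..<Suc h}. \<beta> k - ee j k) = (\<Sum>k\<in>{Suc j..<Suc h}. \<beta> k)"
      by (intro sum.cong) (auto simp: ee_def)
    finally have "(\<Sum>k\<in>{j+1..Suc h}. \<beta> k) - (\<Sum>k\<in>{j..<j+Suc h-j}. \<beta> k - ee j k) = \<beta> (Suc h) - \<beta> j + 1"
      using 1 by simp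
    then show ?thesis unfolding t_def by simp
  qed
  also have "t (Suc h) = q_int (\<beta> (Suc h)) * f (\<lambda>k. \<beta> k - ee (Suc h) k + ee j k)"
    unfolding t_def by simp
  also have "(\<Sum>l\<in>{Suc j..h}. t l) = qq powi (\<beta> (Suc h) - \<beta> j) * Zint (Suc j) h f \<beta>"
    unfolding Zint_def sum_distrib_left
  proof (intro sum.cong refl)
    fix l assume l: "l \<in> {Suc j..h}"
    have 1: "(\<Sum>k\<in>{l+1..Suc h}. \<beta> k) = (\<Sum>k\<in>{l+1..h}. \<beta> k) + \<beta> (Suc h)" using l by simp
    have s: "j + Suc h - l = Suc j + h - l" and j: "j < Suc j + h - l" using l by auto
    have "(\<Sum>k\<in>{j..<j+Suc h-l}. \<beta> k - ee l k) = (\<beta> j - ee l j) + (\<Sum>k\<in>{Suc j..<Suc j + h - l}. \<beta> k - ee l k)"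
      unfolding s by (rule sum.atLeast_Suc_lessThan[OF j])
    then have "(\<Sum>k\<in>{l+1..Suc h}. \<beta> k) - (\<Sum>k\<in>{j..<j+Suc h-l}. \<beta> k - ee l k)
      = (\<beta> (Suc h) - \<beta> j) + ((\<Sum>k\<in>{l+1..h}. \<beta> k) - (\<Sum>k\<in>{Suc j..<Suc j + h - l}. \<beta> k - ee l k))"
      unfolding 1 using l by (simp add: ee_def)
    then show "t l = qq powi (\<beta> (Suc h) - \<beta> j) * (qq powi ((\<Sum>k\<in>{l+1..h}. \<beta> k) - (\<Sum>k\<in>{Suc j..<Suc j+h-l}. \<beta> k - ee l k))
     * q_int (\<beta> l) * f (\<lambda>k. \<beta> k - ee l k + ee (Suc j + h - l) k))"
      unfolding t_def s by (simp only: qq_powi_add mult.assoc)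
  qed
  finally show ?thesis by (simp only: add_ac)
qed

text \<open>Separation of variables: f depends on the inner letters and w on the outer pair, and the
  eigenvalue of f enters the equation of w as a parameter.\<close>

lemma Zint_product:
  assumes jh: "j \<le> h"
    and dep: "\<And>\<beta> \<beta>'. \<forall>k\<in>{Suc j..h}. \<beta> k = \<beta>' k \<Longrightarrow> f \<beta> = f \<beta>'"
    and eig: "\<And>\<beta>. \<forall>k. 0 \<le> \<beta> k \<Longrightarrow> Zint (Suc j) h f \<beta> = q_int T * f \<beta>"
    and tri: "tri_eig T m T' w" and pos: "\<forall>k. 0 \<le> \<beta> k"
  defines "F \<equiv> \<lambda>\<beta>. if \<beta> j + \<beta> (Suc h) = m then f \<beta> * w (\<beta> (Suc h)) else 0"
  shows "Zint j (Suc h) F \<beta> = q_int T' * F \<beta>"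
proof -
  have inner: "Zint (Suc j) h F \<beta> = (if \<beta> j + \<beta> (Suc h) = m then q_int T * f \<beta> * w (\<beta> (Suc h)) else 0)"
  proof -
    have "Zint (Suc j) h F \<beta> = (if \<beta> j + \<beta> (Suc h) = m then Zint (Suc j) h f \<beta> * w (\<beta> (Suc h)) else 0)"
    proof -
      define r where "r l = qq powi ((\<Sum>k\<in>{l+1..h}. \<beta> k) - (\<Sum>k\<in>{Suc j..<Suc j+h-l}. \<beta> k - ee l k)) * q_int (\<beta> l)" for l
      have "F (\<lambda>k. \<beta> k - ee l k + ee (Suc j + h - l) k)
        = (if \<beta> j + \<beta> (Suc h) = m then f (\<lambda>k. \<beta> k - ee l k + ee (Suc j + h - l) k) * w (\<beta> (Suc h)) else 0)"
        if l: "l \<in> {Suc j..h}" for l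
      proof -
        have "ee l j = 0" "ee (Suc j + h - l) j = 0" "ee l (Suc h) = 0" "ee (Suc j + h - l) (Suc h) = 0"
          using l by (auto simp: ee_def)
        then show ?thesis unfolding F_def by simp
      qed
      then show ?thesis unfolding Zint_def r_def[symmetric] by (simp add: sum_distrib_right mult.assoc)
    qed
    then show ?thesis unfolding eig[OF pos] .
  qed
  let ?c = "\<beta> (Suc h)" and ?b = "\<beta> j"
  have f1: "f (\<lambda>k. \<beta> k - ee (Suc h) k + ee j k) = f \<beta>" and f2: "f (\<lambda>k. \<beta> k - ee j k + ee (Suc h) k) = f \<beta>"
    by (rule dep; auto simp: ee_def)+
  have F1: "F (\<lambda>k. \<beta> k - ee (Suc h) k + ee j k) = (if ?b + ?c = m then f \<beta> * w (?c - 1) else 0)"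
    unfolding F_def f1 using jh by (simp add: ee_def add.commute)
  have F2: "F (\<lambda>k. \<beta> k - ee j k + ee (Suc h) k) = (if ?b + ?c = m then f \<beta> * w (?c + 1) else 0)"
    unfolding F_def f2 using jh by (simp add: ee_def add.commute)
  show ?thesis
  proof (cases "?b + ?c = m")
    case True
    have b: "?b = m - ?c" using True by simp
    have e: "?c - ?b = 2 * ?c - m" "?c - ?b + 1 = 2 * ?c + 1 - m" using b by auto
    have c: "0 \<le> ?c \<and> ?c \<le> m" using pos True by (metis add_increasing order_refl)
    have "q_int T' * w ?c = qq powi (2 * ?c - m) * q_int T * w ?c + q_int ?c * w (?c - 1)
       + qq powi (2 * ?c + 1 - m) * q_int (m - ?c) * w (?c + 1)"
      using tri c unfolding tri_eig_def by blast
    then have "q_int T' * F \<beta> = f \<beta> * (qq powi (2 * ?c - m) * q_int T * w ?c + q_int ?c * w (?c - 1)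
       + qq powi (2 * ?c + 1 - m) * q_int (m - ?c) * w (?c + 1))"
      unfolding F_def using True by (simp add: mult.left_commute[of _ "f \<beta>"])
    moreover have "q_int ?b = q_int (m - ?c)" unfolding b ..
    ultimately show ?thesis unfolding Zint_step[OF jh] inner F1 F2 e using True
      by (simp add: algebra_simps)
  next
    case False
    then show ?thesis unfolding Zint_step[OF jh] inner F1 F2 by (simp add: F_def)
  qed
qed

text \<open>Level d consists of the 2d middle positions for even n and of the 2d + 1 middle
  positions for odd n; level n div 2 is everything.\<close>

definition lo :: "nat \<Rightarrow> nat \<Rightarrow> nat" where "lo n d = n div 2 + 1 - d"
definition hi :: "nat \<Rightarrow> nat \<Rightarrow> nat" where "hi n d = n - n div 2 + d"

lemma lo_hi_Suc:
  assumes "d < n div 2"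
  shows "lo n d = Suc (lo n (Suc d))" "hi n (Suc d) = Suc (hi n d)" "lo n (Suc d) \<le> hi n d"
  using assms unfolding lo_def hi_def by auto

text \<open>The eigenvalue attached to \<open>\<alpha>\<close> on the positions \<open>lo n d, ..., hi n d\<close> is, up to sign, the
  quantum integer of \<open>tau n \<alpha> d\<close>.\<close>

primrec tau :: "nat \<Rightarrow> (nat \<Rightarrow> int) \<Rightarrow> nat \<Rightarrow> int" where
  "tau n \<alpha> 0 = (if odd n then \<alpha> (n div 2 + 1) else 0)"
| "tau n \<alpha> (Suc d) = (let a = \<alpha> (lo n (Suc d)); a' = \<alpha> (hi n (Suc d)); t = tau n \<alpha> d in
     if a < t then a' + t - a else if even (t - a) then a' else a' + 1)"

text \<open>The cases follow the reduction of the outer eigenvector. If a < t, it is a single basis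
  vector (\<open>tri_eig_single\<close>), and the partner of \<alpha> comes from the inner letters.
  Otherwise it is a pair c = \<tau>, c = \<tau> - 1 (\<open>tri_eig_pair\<close>): \<alpha> has the
  first value if t - a is even and the second if it is odd, and the partner has the other one. If a'
  = 0 in the even case, the other one would be -1, and \<alpha> is its own partner.\<close>

primrec sig :: "nat \<Rightarrow> (nat \<Rightarrow> int) \<Rightarrow> nat \<Rightarrow> nat \<Rightarrow> int" where
  "sig n \<alpha> 0 = \<alpha>"
| "sig n \<alpha> (Suc d) = (let a = \<alpha> (lo n (Suc d)); a' = \<alpha> (hi n (Suc d)); t = tau n \<alpha> d in
     if a < t then sig n \<alpha> d
     else if even (t - a) then
       (if a' = 0 then \<alpha> else (\<lambda>k. \<alpha> k + ee (lo n (Suc d)) k - ee (hi n (Suc d)) k))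
     else (\<lambda>k. \<alpha> k - ee (lo n (Suc d)) k + ee (hi n (Suc d)) k))"

lemma tau_nonneg: "\<forall>k. 0 \<le> \<alpha> k \<Longrightarrow> 0 \<le> tau n \<alpha> d"
proof (induction d)
  case (Suc d)
  have "0 \<le> \<alpha> (hi n (Suc d))" using Suc.prems by blast
  with Suc show ?case by (auto simp: Let_def intro: add_increasing)
qed simp

lemma inner_Suc_iff:
  assumes d: "d < n div 2"
  shows "(\<forall>k\<in>{lo n (Suc d)..hi n (Suc d)}. P k)
    \<longleftrightarrow> P (lo n (Suc d)) \<and> P (hi n (Suc d)) \<and> (\<forall>k\<in>{lo n d..hi n d}. P k)"
proof -
  have "{lo n (Suc d)..hi n (Suc d)} = insert (lo n (Suc d)) (insert (hi n (Suc d)) {lo n d..hi n d})"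
    using lo_hi_Suc[OF d] by auto
  then show ?thesis by simp
qed

text \<open>Size and parity make s + tau and s - tau even and nonnegative at the top level; their
  halves are the numbers k and j that label the eigenvalue.\<close>

lemma tau_bounds:
  assumes pos: "\<forall>k. 0 \<le> \<alpha> k"
  shows "d \<le> n div 2 \<Longrightarrow> tau n \<alpha> d \<le> (\<Sum>k\<in>{lo n d..hi n d}. \<alpha> k)
    \<and> even (tau n \<alpha> d - (\<Sum>k\<in>{lo n d..hi n d}. \<alpha> k))"
proof (induction d)
  case 0
  show ?case
  proof (cases "odd n")
    case True
    then have "lo n 0 = n div 2 + 1" "hi n 0 = n div 2 + 1" unfolding lo_def hi_def by (auto elim!: oddE)
    then show ?thesis using True by simp
  next
    case False
    then have "hi n 0 < lo n 0" unfolding lo_def hi_def by auto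
    then show ?thesis using False by simp
  qed
next
  case (Suc d)
  have d: "d < n div 2" using Suc.prems by simp
  have "{lo n (Suc d)..hi n (Suc d)} = insert (lo n (Suc d)) (insert (hi n (Suc d)) {lo n d..hi n d})"
    using lo_hi_Suc[OF d] by auto
  then have S: "(\<Sum>k\<in>{lo n (Suc d)..hi n (Suc d)}. \<alpha> k)
    = \<alpha> (lo n (Suc d)) + \<alpha> (hi n (Suc d)) + (\<Sum>k\<in>{lo n d..hi n d}. \<alpha> k)"
    using lo_hi_Suc[OF d] by simp
  have "tau n \<alpha> d \<le> (\<Sum>k\<in>{lo n d..hi n d}. \<alpha> k)" "even (tau n \<alpha> d - (\<Sum>k\<in>{lo n d..hi n d}. \<alpha> k))"
    using Suc.IH d by auto
  moreover have "0 \<le> \<alpha> (lo n (Suc d))" "0 \<le> \<alpha> (hi n (Suc d))" "0 \<le> tau n \<alpha> d" using pos tau_nonneg[OF pos] by auto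
  ultimately show ?case unfolding S tau.simps Let_def
    by (cases "\<alpha> (lo n (Suc d)) < tau n \<alpha> d"; cases "even (tau n \<alpha> d - \<alpha> (lo n (Suc d)))") (simp_all, presburger+)
qed

definition inner_eq :: "nat \<Rightarrow> nat \<Rightarrow> (nat \<Rightarrow> int) \<Rightarrow> (nat \<Rightarrow> int) \<Rightarrow> bool" where
  "inner_eq n d \<alpha> \<beta> \<longleftrightarrow> (\<forall>k\<in>{lo n d..hi n d}. \<alpha> k = \<beta> k)"

lemma sig_outside: "d \<le> n div 2 \<Longrightarrow> k \<notin> {lo n d..hi n d} \<Longrightarrow> sig n \<alpha> d k = \<alpha> k"
proof (induction d)
  case (Suc d)
  have d: "d < n div 2" using Suc.prems by simp
  have k: "k \<notin> {lo n d..hi n d}" "k \<noteq> lo n (Suc d)" "k \<noteq> hi n (Suc d)"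
    using Suc.prems(2) lo_hi_Suc[OF d] by auto
  have "sig n \<alpha> d k = \<alpha> k" using Suc.IH d k(1) by simp
  then show ?case using k by (simp add: Let_def ee_def)
qed simp

text \<open>The function \<open>f\<close> has eigenvalue \<open>[\<epsilon> \<tau>]\<close> and reduces to half of
  \<open>b\<^sub>\<alpha> + \<epsilon> b\<^sub>\<sigma>\<^sub>\<alpha>\<close>; when \<open>\<sigma> \<alpha> = \<alpha>\<close> and \<open>\<epsilon> = -1\<close> the zero function will do.\<close>

definition level_eig :: "nat \<Rightarrow> nat \<Rightarrow> (nat \<Rightarrow> int) \<Rightarrow> int \<Rightarrow> ((nat \<Rightarrow> int) \<Rightarrow> cqx) \<Rightarrow> bool" where
  "level_eig n d \<alpha> \<epsilon> f \<longleftrightarrow>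
     (\<forall>\<beta> \<beta>'. inner_eq n d \<beta> \<beta>' \<longrightarrow> f \<beta> = f \<beta>') \<and>
     (\<forall>\<beta>. (\<forall>k. 0 \<le> \<beta> k) \<longrightarrow> Zint (lo n d) (hi n d) f \<beta> = q_int (\<epsilon> * tau n \<alpha> d) * f \<beta>) \<and>
     (\<forall>\<beta>. (\<forall>k. 0 \<le> \<beta> k) \<longrightarrow> lead_q 0 (f \<beta>)
        (((if inner_eq n d \<alpha> \<beta> then 1 else 0) + of_int \<epsilon> * (if inner_eq n d (sig n \<alpha> d) \<beta> then 1 else 0)) / 2))"

lemma level_eig_zero: "sig n \<alpha> d = \<alpha> \<Longrightarrow> level_eig n d \<alpha> (-1) (\<lambda>_. 0)"
  unfolding level_eig_def by (simp add: Zint_def)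

lemma level_eig_0:
  assumes \<epsilon>: "\<epsilon> = 1 \<or> \<epsilon> = -1"
  shows "\<exists>f. level_eig n 0 \<alpha> \<epsilon> f"
proof (cases "\<epsilon> = 1")
  case True
  define f where "f \<beta> = (if inner_eq n 0 \<alpha> \<beta> then 1 else 0 :: cqx)" for \<beta>
  have dep: "f \<beta> = f \<beta>'" if "inner_eq n 0 \<beta> \<beta>'" for \<beta> \<beta>' using that unfolding f_def inner_eq_def by simp
  have Z: "Zint (lo n 0) (hi n 0) f \<beta> = q_int (tau n \<alpha> 0) * f \<beta>" for \<beta>
  proof (cases "odd n")
    case True
    then have h: "lo n 0 = n div 2 + 1" "hi n 0 = n div 2 + 1" unfolding lo_def hi_def by (auto elim!: oddE)
    show ?thesis using True unfolding Zint_def h f_def inner_eq_def by simp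
  next
    case False
    then have "hi n 0 < lo n 0" unfolding lo_def hi_def by auto
    then show ?thesis using False by (simp add: Zint_def)
  qed
  have r: "lead_q 0 (f \<beta>) (((if inner_eq n 0 \<alpha> \<beta> then 1 else 0) + of_int \<epsilon> * (if inner_eq n 0 (sig n \<alpha> 0) \<beta> then 1 else 0)) / 2)" for \<beta>
    using True two_neq_0_cx by (simp add: f_def lead_q_one)
  show ?thesis using dep Z r True unfolding level_eig_def by (intro exI[of _ f]) simp
next
  case False
  then show ?thesis using \<epsilon> level_eig_zero[of n \<alpha> 0] by auto
qed

text \<open>If a < t, the inner eigenfunction of the same sign is multiplied by a solution that
  reduces to a single vector. Otherwise the inner eigenfunctions of both signs are extended by pair
  solutions with the same outer label \<epsilon> \<tau> and added. The inner halves (b + \<sigma> b)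
  / 2 and (b - \<sigma> b) / 2 add up to b, so the inner partner disappears and only the outer pair
  is exchanged.\<close>

lemma level_eig_Suc:
  assumes d: "d < n div 2" and \<alpha>: "\<forall>k. 0 \<le> \<alpha> k" and \<epsilon>: "\<epsilon> = 1 \<or> \<epsilon> = -1"
    and IH: "\<And>\<epsilon>. \<epsilon> = 1 \<or> \<epsilon> = -1 \<Longrightarrow> \<exists>f. level_eig n d \<alpha> \<epsilon> f"
  shows "\<exists>f. level_eig n (Suc d) \<alpha> \<epsilon> f"
proof -
  define j where "j = lo n (Suc d)"
  define h where "h = hi n d"
  have lh: "lo n d = Suc j" "hi n d = h" "lo n (Suc d) = j" "hi n (Suc d) = Suc h" and jh: "j \<le> h"
    using lo_hi_Suc[OF d] by (auto simp: j_def h_def)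
  define a a' t where "a = \<alpha> j" and "a' = \<alpha> (Suc h)" and "t = tau n \<alpha> d"
  have pos: "0 \<le> a" "0 \<le> a'" "0 \<le> t" using \<alpha> tau_nonneg[OF \<alpha>] by (auto simp: a_def a'_def t_def)
  define m where "m = a + a'"
  define \<tau> where "\<tau> = tau n \<alpha> (Suc d)"
  have \<tau>: "\<tau> = (if a < t then a' + t - a else if even (t - a) then a' else a' + 1)"
    by (simp add: \<tau>_def Let_def lh a_def a'_def t_def)
  define ext where "ext f w = (\<lambda>\<beta> :: nat \<Rightarrow> int. if \<beta> j + \<beta> (Suc h) = m then f \<beta> * w (\<beta> (Suc h)) else 0)"
    for f :: "(nat \<Rightarrow> int) \<Rightarrow> cqx" and w :: "int \<Rightarrow> cqx"
  have inner: "inner_eq n (Suc d) \<gamma> \<beta> \<longleftrightarrow> \<gamma> j = \<beta> j \<and> \<gamma> (Suc h) = \<beta> (Suc h) \<and> inner_eq n d \<gamma> \<beta>" for \<gamma> \<beta>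
    using inner_Suc_iff[OF d, of "\<lambda>k. \<gamma> k = \<beta> k"] unfolding inner_eq_def lh .
  have dep: "ext f w \<beta> = ext f w \<beta>'" if f: "level_eig n d \<alpha> \<delta> f" and e: "inner_eq n (Suc d) \<beta> \<beta>'" for f w \<delta> \<beta> \<beta>'
  proof -
    have "f \<beta> = f \<beta>'" using f e unfolding level_eig_def inner by blast
    then show ?thesis using e unfolding ext_def inner by simp
  qed
  have eig: "Zint j (Suc h) (ext f w) \<beta> = q_int (\<epsilon> * \<tau>) * ext f w \<beta>"
    if f: "level_eig n d \<alpha> \<delta> f" and w: "tri_eig (\<delta> * t) m (\<epsilon> * \<tau>) w" and p: "\<forall>k. 0 \<le> \<beta> k" for f w \<delta> \<beta>
    unfolding ext_def
  proof (rule Zint_product[OF jh _ _ w p])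
    show "f \<beta> = f \<beta>'" if "\<forall>k\<in>{Suc j..h}. \<beta> k = \<beta>' k" for \<beta> \<beta>'
      using f that unfolding level_eig_def inner_eq_def lh by blast
    show "Zint (Suc j) h f \<beta> = q_int (\<delta> * t) * f \<beta>" if "\<forall>k. 0 \<le> \<beta> k" for \<beta>
      using f that unfolding level_eig_def lh t_def by blast
  qed
  have red: "lead_q 0 (ext f w \<beta>) (if \<beta> j + \<beta> (Suc h) = m then
      ((if inner_eq n d \<alpha> \<beta> then 1 else 0) + of_int \<delta> * (if inner_eq n d (sig n \<alpha> d) \<beta> then 1 else 0)) / 2 * L (\<beta> (Suc h)) else 0)"
    if f: "level_eig n d \<alpha> \<delta> f" and w: "\<forall>c\<in>{0..m}. lead_q 0 (w c) (L c)" and p: "\<forall>k. 0 \<le> \<beta> k" for f w \<delta> \<beta> L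
  proof (cases "\<beta> j + \<beta> (Suc h) = m")
    case True
    have "0 \<le> \<beta> j" "0 \<le> \<beta> (Suc h)" using p by auto
    then have "\<beta> (Suc h) \<in> {0..m}" using True by simp
    then have 1: "lead_q 0 (w (\<beta> (Suc h))) (L (\<beta> (Suc h)))" using w by blast
    have 2: "lead_q 0 (f \<beta>) (((if inner_eq n d \<alpha> \<beta> then 1 else 0) + of_int \<delta> * (if inner_eq n d (sig n \<alpha> d) \<beta> then 1 else 0)) / 2)"
      using f p unfolding level_eig_def by blast
    show ?thesis using lead_q_mult[OF 2 1] True by (simp add: ext_def)
  next
    case False
    then show ?thesis by (simp add: ext_def)
  qed
  have am: "\<alpha> j = \<beta> j \<and> \<alpha> (Suc h) = \<beta> (Suc h) \<longleftrightarrow> \<beta> j + \<beta> (Suc h) = m \<and> \<beta> (Suc h) = a'" for \<beta>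
    by (auto simp: m_def a_def a'_def)
  show ?thesis
  proof (cases "a < t")
    case True
    have sg: "sig n \<alpha> (Suc d) = sig n \<alpha> d"
      using True by (simp add: Let_def lh a_def t_def)
    have so: "sig n \<alpha> d j = \<alpha> j" "sig n \<alpha> d (Suc h) = \<alpha> (Suc h)"
      using d jh by (auto intro!: sig_outside simp: lh)
    obtain f where f: "level_eig n d \<alpha> \<epsilon> f" using IH[OF \<epsilon>] by blast
    have abs: "\<bar>\<epsilon> * t\<bar> = t" and sgn: "sgn (\<epsilon> * t) = \<epsilon>" using \<epsilon> True pos by auto
    obtain w where w: "tri_eig (\<epsilon> * t) m (\<epsilon> * \<tau>) w" "\<forall>c\<in>{0..m}. lead_q 0 (w c) (if c = a' then 1 else 0)"
      using tri_eig_single[of a "\<epsilon> * t" a'] pos True unfolding abs sgn m_def \<tau> by (auto simp: algebra_simps)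
    have "level_eig n (Suc d) \<alpha> \<epsilon> (ext f w)"
      unfolding level_eig_def sg \<tau>_def[symmetric] lh
    proof (intro conjI allI impI)
      fix \<beta> \<beta>' assume "inner_eq n (Suc d) \<beta> \<beta>'" then show "ext f w \<beta> = ext f w \<beta>'" by (rule dep[OF f])
    next
      fix \<beta> :: "nat \<Rightarrow> int" assume "\<forall>k. 0 \<le> \<beta> k"
      then show "Zint j (Suc h) (ext f w) \<beta> = q_int (\<epsilon> * \<tau>) * ext f w \<beta>" by (rule eig[OF f w(1)])
    next
      fix \<beta> :: "nat \<Rightarrow> int" assume p: "\<forall>k. 0 \<le> \<beta> k"
      have i1: "inner_eq n (Suc d) \<alpha> \<beta> \<longleftrightarrow> (\<beta> j + \<beta> (Suc h) = m \<and> \<beta> (Suc h) = a') \<and> inner_eq n d \<alpha> \<beta>"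
        and i2: "inner_eq n (Suc d) (sig n \<alpha> d) \<beta> \<longleftrightarrow> (\<beta> j + \<beta> (Suc h) = m \<and> \<beta> (Suc h) = a') \<and> inner_eq n d (sig n \<alpha> d) \<beta>"
        unfolding inner so am[symmetric] by blast+
      have "(if \<beta> j + \<beta> (Suc h) = m then
          ((if inner_eq n d \<alpha> \<beta> then 1 else 0) + of_int \<epsilon> * (if inner_eq n d (sig n \<alpha> d) \<beta> then 1 else 0)) / 2
            * (if \<beta> (Suc h) = a' then 1 else 0) else 0)
        = ((if inner_eq n (Suc d) \<alpha> \<beta> then 1 else 0) + of_int \<epsilon> * (if inner_eq n (Suc d) (sig n \<alpha> d) \<beta> then 1 else 0)) / (2 :: cx)"
        unfolding i1 i2 by simp
      then show "lead_q 0 (ext f w \<beta>) (((if inner_eq n (Suc d) \<alpha> \<beta> then 1 else 0)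
          + of_int \<epsilon> * (if inner_eq n (Suc d) (sig n \<alpha> d) \<beta> then 1 else 0)) / 2)"
        using red[OF f w(2) p] by (simp only:)
    qed
    then show ?thesis by blast
  next
    case False
    obtain f1 f2 where f: "level_eig n d \<alpha> 1 f1" "level_eig n d \<alpha> (-1) f2" using IH[of 1] IH[of "-1"] by blast
    \<comment> \<open>The entry a lowered to the parity of t; then m = a0 + \<tau> in both parity
      cases, as \<open>tri_eig_pair\<close> requires.\<close>
    define a0 where "a0 = (if even (t - a) then a else a - 1)"
    have a0: "t \<le> a0" "even (t - a0)" "m = a0 + \<tau>"
    proof -
      show "t \<le> a0"
      proof (cases "even (t - a)")
        case False
        then have "t \<noteq> a" by auto
        then show ?thesis using \<open>\<not> a < t\<close> False by (simp add: a0_def)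
      qed (use False in \<open>simp add: a0_def\<close>)
      show "even (t - a0)" by (simp add: a0_def)
      show "m = a0 + \<tau>" using False by (simp add: a0_def m_def \<tau>)
    qed
    have \<tau>0: "0 \<le> \<tau>" using pos False by (simp add: \<tau>)
    define L where "L c = (if c = \<tau> then 1 else if c = \<tau> - 1 then of_int \<epsilon> else 0 :: cx)" for c
    \<comment> \<open>Both inner signs admit a solution with the same outer label and the same
      reduction L; this makes the sum F an eigenfunction.\<close>
    have "\<exists>w. tri_eig (\<delta> * t) m (\<epsilon> * \<tau>) w \<and> (\<forall>c\<in>{0..m}. lead_q 0 (w c) (L c))" if \<delta>: "\<delta> = 1 \<or> \<delta> = -1" for \<delta>
    proof -
      have "\<bar>\<delta> * t\<bar> \<le> a0" "even (\<delta> * t - a0)" using \<delta> a0 pos by auto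
      from tri_eig_pair[OF this \<tau>0 \<epsilon>] show ?thesis unfolding a0(3) L_def .
    qed
    from this[of 1] this[of "-1"] obtain w1 w2 where
        w1: "tri_eig (1 * t) m (\<epsilon> * \<tau>) w1" "\<forall>c\<in>{0..m}. lead_q 0 (w1 c) (L c)"
      and w2: "tri_eig (-1 * t) m (\<epsilon> * \<tau>) w2" "\<forall>c\<in>{0..m}. lead_q 0 (w2 c) (L c)" by auto
    define F where "F \<beta> = ext f1 w1 \<beta> + ext f2 w2 \<beta>" for \<beta>
    have Fdep: "F \<beta> = F \<beta>'" if "inner_eq n (Suc d) \<beta> \<beta>'" for \<beta> \<beta>'
      unfolding F_def using dep[OF f(1) that] dep[OF f(2) that] by simp
    have Zadd: "Zint l k (\<lambda>\<beta>. x * (g1 \<beta> + g2 \<beta>)) \<beta> = x * (Zint l k g1 \<beta> + Zint l k g2 \<beta>)" for l k g1 g2 x \<beta>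
      unfolding Zint_def by (simp add: sum_distrib_left sum.distrib[symmetric] algebra_simps)
    have Feig: "Zint j (Suc h) (\<lambda>\<beta>. x * F \<beta>) \<beta> = q_int (\<epsilon> * \<tau>) * (x * F \<beta>)" if p: "\<forall>k. 0 \<le> \<beta> k" for \<beta> x
      unfolding F_def Zadd eig[OF f(1) w1(1) p] eig[OF f(2) w2(1) p] by (simp add: algebra_simps)
    have Fred: "lead_q 0 (F \<beta>) (if inner_eq n d \<alpha> \<beta> \<and> \<beta> j + \<beta> (Suc h) = m then L (\<beta> (Suc h)) else 0)" if p: "\<forall>k. 0 \<le> \<beta> k" for \<beta>
    proof -
      have "((x + of_int 1 * y) / 2 * l) + ((x + of_int (-1) * y) / 2 * l) = x * l" for x y l :: cx
        using two_neq_0_cx by (simp add: field_simps)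
      then have "(if \<beta> j + \<beta> (Suc h) = m then
          ((if inner_eq n d \<alpha> \<beta> then 1 else 0) + of_int 1 * (if inner_eq n d (sig n \<alpha> d) \<beta> then 1 else 0)) / 2 * L (\<beta> (Suc h)) else 0)
        + (if \<beta> j + \<beta> (Suc h) = m then
          ((if inner_eq n d \<alpha> \<beta> then 1 else 0) + of_int (-1) * (if inner_eq n d (sig n \<alpha> d) \<beta> then 1 else 0)) / 2 * L (\<beta> (Suc h)) else 0)
        = (if inner_eq n d \<alpha> \<beta> \<and> \<beta> j + \<beta> (Suc h) = m then L (\<beta> (Suc h)) else 0)"
        by (simp only: if_True if_False split: if_split) simp
      then show ?thesis using lead_q_add[OF red[OF f(1) w1(2) p] red[OF f(2) w2(2) p]] unfolding F_def by (simp only:)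
    qed
    have result: "\<exists>f. level_eig n (Suc d) \<alpha> \<epsilon> f"
      if x: "lead_q 0 x y" and y: "\<And>\<beta>. \<forall>k. 0 \<le> \<beta> k \<Longrightarrow>
         y * (if inner_eq n d \<alpha> \<beta> \<and> \<beta> j + \<beta> (Suc h) = m then L (\<beta> (Suc h)) else 0)
         = ((if inner_eq n (Suc d) \<alpha> \<beta> then 1 else 0)
          + of_int \<epsilon> * (if inner_eq n (Suc d) (sig n \<alpha> (Suc d)) \<beta> then 1 else 0)) / 2" for x y
    proof -
      have "lead_q 0 (x * F \<beta>) (((if inner_eq n (Suc d) \<alpha> \<beta> then 1 else 0)
          + of_int \<epsilon> * (if inner_eq n (Suc d) (sig n \<alpha> (Suc d)) \<beta> then 1 else 0)) / 2)" if p: "\<forall>k. 0 \<le> \<beta> k" for \<beta>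
        using lead_q_mult[OF x Fred[OF p]] unfolding y[OF p] by simp
      then have "level_eig n (Suc d) \<alpha> \<epsilon> (\<lambda>\<beta>. x * F \<beta>)"
        unfolding level_eig_def lh \<tau>_def[symmetric] using Fdep Feig by (intro conjI allI impI) auto
      then show ?thesis by blast
    qed
    have half: "lead_q 0 (const_x (1 / 2)) (1 / 2)" by (rule lead_q_const_x)
    \<comment> \<open>For odd t - a the entry a' is \<tau> - 1, where L is \<epsilon>; the factor
      \<epsilon> / 2 gives \<alpha> the coefficient 1/2.\<close>
    have halfe: "lead_q 0 (const_x (of_int \<epsilon> / 2)) (of_int \<epsilon> / 2)" by (rule lead_q_const_x)
    show ?thesis
    proof (cases "even (t - a)")
      case ev: True
      have \<tau>': "\<tau> = a'" using False ev by (simp add: \<tau>)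
      show ?thesis
      proof (cases "a' = 0")
        case True
        have sg: "sig n \<alpha> (Suc d) = \<alpha>" using False ev True by (simp add: Let_def lh a_def t_def a'_def)
        show ?thesis
        proof (cases "\<epsilon> = 1")
          case e1: True
          show ?thesis
          \<comment> \<open>Here \<alpha> is its own partner and the two halves coincide, so the
            factor is 1 instead of 1/2.\<close>
          proof (rule result[OF lead_q_one])
            fix \<beta> :: "nat \<Rightarrow> int" assume p: "\<forall>k. 0 \<le> \<beta> k"
            have i1: "inner_eq n (Suc d) \<alpha> \<beta> \<longleftrightarrow> (\<beta> j + \<beta> (Suc h) = m \<and> \<beta> (Suc h) = 0) \<and> inner_eq n d \<alpha> \<beta>"
              unfolding inner True[symmetric] am[symmetric] by blast
            have "\<beta> (Suc h) \<noteq> -1" using p by (metis neg_0_le_iff_le not_one_le_zero)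
            then have L: "L (\<beta> (Suc h)) = (if \<beta> (Suc h) = 0 then 1 else 0)"
              unfolding L_def \<tau>' True by simp
            show "1 * (if inner_eq n d \<alpha> \<beta> \<and> \<beta> j + \<beta> (Suc h) = m then L (\<beta> (Suc h)) else 0)
              = ((if inner_eq n (Suc d) \<alpha> \<beta> then 1 else 0)
                + of_int \<epsilon> * (if inner_eq n (Suc d) (sig n \<alpha> (Suc d)) \<beta> then 1 else 0)) / 2"
              unfolding sg i1 L e1 using two_neq_0_cx by simp
          qed
        next
          case False
          then show ?thesis using \<epsilon> level_eig_zero[OF sg] by auto
        qed
      next
        case a': False
        have sg: "sig n \<alpha> (Suc d) = (\<lambda>k. \<alpha> k + ee j k - ee (Suc h) k)"
          using False ev a' by (simp add: Let_def lh a_def t_def a'_def)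
        show ?thesis
        proof (rule result[OF half])
          fix \<beta> :: "nat \<Rightarrow> int"
          have i1: "inner_eq n (Suc d) \<alpha> \<beta> \<longleftrightarrow> (\<beta> j + \<beta> (Suc h) = m \<and> \<beta> (Suc h) = a') \<and> inner_eq n d \<alpha> \<beta>"
            unfolding inner am[symmetric] by blast
          have ie: "inner_eq n d (\<lambda>k. \<alpha> k + ee j k - ee (Suc h) k) \<beta> \<longleftrightarrow> inner_eq n d \<alpha> \<beta>"
            unfolding inner_eq_def lh by (intro ball_cong) (auto simp: ee_def)
          have i2: "inner_eq n (Suc d) (sig n \<alpha> (Suc d)) \<beta> \<longleftrightarrow> (\<beta> j + \<beta> (Suc h) = m \<and> \<beta> (Suc h) = a' - 1) \<and> inner_eq n d \<alpha> \<beta>"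
            unfolding inner sg ie using jh by (auto simp: ee_def m_def a_def a'_def)
          show "1 / 2 * (if inner_eq n d \<alpha> \<beta> \<and> \<beta> j + \<beta> (Suc h) = m then L (\<beta> (Suc h)) else 0)
            = ((if inner_eq n (Suc d) \<alpha> \<beta> then 1 else 0)
              + of_int \<epsilon> * (if inner_eq n (Suc d) (sig n \<alpha> (Suc d)) \<beta> then 1 else 0)) / 2"
            unfolding i1 i2 L_def \<tau>' by simp
        qed
      qed
    next
      case od: False
      have \<tau>': "\<tau> = a' + 1" using False od by (simp add: \<tau>)
      have sg: "sig n \<alpha> (Suc d) = (\<lambda>k. \<alpha> k - ee j k + ee (Suc h) k)"
        using False od by (simp add: Let_def lh a_def t_def a'_def)
      show ?thesis
      proof (rule result[OF halfe])
        fix \<beta> :: "nat \<Rightarrow> int"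
        have i1: "inner_eq n (Suc d) \<alpha> \<beta> \<longleftrightarrow> (\<beta> j + \<beta> (Suc h) = m \<and> \<beta> (Suc h) = a') \<and> inner_eq n d \<alpha> \<beta>"
          unfolding inner am[symmetric] by blast
        have ie: "inner_eq n d (\<lambda>k. \<alpha> k - ee j k + ee (Suc h) k) \<beta> \<longleftrightarrow> inner_eq n d \<alpha> \<beta>"
          unfolding inner_eq_def lh by (intro ball_cong) (auto simp: ee_def)
        have i2: "inner_eq n (Suc d) (sig n \<alpha> (Suc d)) \<beta> \<longleftrightarrow> (\<beta> j + \<beta> (Suc h) = m \<and> \<beta> (Suc h) = a' + 1) \<and> inner_eq n d \<alpha> \<beta>"
          unfolding inner sg ie using jh by (auto simp: ee_def m_def a_def a'_def)
        have ee: "of_int \<epsilon> * of_int \<epsilon> = (1 :: cx)" using \<epsilon> by auto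
        show "of_int \<epsilon> / 2 * (if inner_eq n d \<alpha> \<beta> \<and> \<beta> j + \<beta> (Suc h) = m then L (\<beta> (Suc h)) else 0)
          = ((if inner_eq n (Suc d) \<alpha> \<beta> then 1 else 0)
            + of_int \<epsilon> * (if inner_eq n (Suc d) (sig n \<alpha> (Suc d)) \<beta> then 1 else 0)) / 2"
          unfolding i1 i2 L_def \<tau>' using ee by simp
      qed
    qed
  qed
qed

lemma level_eig_exists:
  "d \<le> n div 2 \<Longrightarrow> \<forall>k. 0 \<le> \<alpha> k \<Longrightarrow> \<epsilon> = 1 \<or> \<epsilon> = -1 \<Longrightarrow> \<exists>f. level_eig n d \<alpha> \<epsilon> f"
proof (induction d arbitrary: \<epsilon>)
  case 0
  then show ?case by (intro level_eig_0)
next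
  case (Suc d)
  then show ?case by (intro level_eig_Suc) auto
qed

lemma comps_eigenvector:
  assumes n: "n \<ge> 2" and \<alpha>: "\<alpha> \<in> comps n s" and \<epsilon>: "\<epsilon> = 1 \<or> \<epsilon> = -1"
  defines "\<tau> \<equiv> tau n \<alpha> (n div 2)" and "\<sigma> \<equiv> sig n \<alpha> (n div 2)"
  shows "\<exists>g. g \<in> vspan (comps n s) \<and> (\<forall>\<beta>\<in>comps n s. Zfull n g \<beta> = q_int (\<epsilon> * \<tau>) * g \<beta>)
    \<and> (\<forall>\<beta>\<in>comps n s. lead_q 0 (g \<beta>)
        (((if \<alpha> = \<beta> then 1 else 0) + of_int \<epsilon> * (if \<sigma> = \<beta> then 1 else 0)) / 2))"
proof -
  have nonneg: "\<forall>k. 0 \<le> \<beta> k" and zero: "k \<notin> {1..n} \<Longrightarrow> \<beta> k = 0" if "\<beta> \<in> comps n s" for \<beta> k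
  proof -
    show z: "k \<notin> {1..n} \<Longrightarrow> \<beta> k = 0" for k using that unfolding comps_def by blast
    show "\<forall>k. 0 \<le> \<beta> k"
    proof
      fix k show "0 \<le> \<beta> k" using that z[of k] unfolding comps_def by (cases "k \<in> {1..n}") auto
    qed
  qed
  have lh: "lo n (n div 2) = 1" "hi n (n div 2) = n" by (auto simp: lo_def hi_def)
  obtain f where f: "level_eig n (n div 2) \<alpha> \<epsilon> f"
    using level_eig_exists[OF order.refl nonneg[OF \<alpha>] \<epsilon>] by blast
  define g where "g \<beta> = (if \<beta> \<in> comps n s then f \<beta> else 0)" for \<beta>
  have inner: "inner_eq n (n div 2) \<gamma> \<beta> \<longleftrightarrow> \<gamma> = \<beta>" if \<beta>: "\<beta> \<in> comps n s" and \<gamma>: "\<And>k. k \<notin> {1..n} \<Longrightarrow> \<gamma> k = 0" for \<gamma> \<beta>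
  proof
    assume "inner_eq n (n div 2) \<gamma> \<beta>"
    then have *: "\<And>k. k \<in> {1..n} \<Longrightarrow> \<gamma> k = \<beta> k" unfolding inner_eq_def lh by blast
    show "\<gamma> = \<beta>"
    proof
      fix k show "\<gamma> k = \<beta> k" by (cases "k \<in> {1..n}") (simp_all only: * \<gamma> zero[OF \<beta>] not_False_eq_True)
    qed
  qed (simp add: inner_eq_def)
  have \<sigma>0: "\<sigma> k = 0" if k: "k \<notin> {1..n}" for k
  proof -
    have "k \<notin> {lo n (n div 2)..hi n (n div 2)}" unfolding lh using k .
    then have "\<sigma> k = \<alpha> k" unfolding \<sigma>_def by (rule sig_outside[OF order.refl])
    then show ?thesis using zero[OF \<alpha> k] by simp
  qed
  show ?thesis
  proof (intro exI[of _ g] conjI ballI)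
    show "g \<in> vspan (comps n s)" by (simp add: vspan_def g_def)
    fix \<beta> assume \<beta>: "\<beta> \<in> comps n s"
    have "Zfull n g \<beta> = Zfull n f \<beta>"
      unfolding Zfull_def
    proof (intro sum.cong refl)
      fix l assume l: "l \<in> {1..n}"
      let ?\<gamma> = "\<lambda>k. \<beta> k - ee l k + ee (n + 1 - l) k"
      \<comment> \<open>A term of \<open>Zfull\<close> leaves \<open>comps n s\<close> only if
        \<beta> l = 0, and then its coefficient [\<beta> l] vanishes.\<close>
      have "?\<gamma> \<in> comps n s" if nz: "\<beta> l \<noteq> 0"
      proof -
        have l': "n + 1 - l \<in> {1..n}" using l by auto
        have b: "0 \<le> \<beta> k" for k using nonneg[OF \<beta>] by blast
        have bl: "1 \<le> \<beta> l" using b[of l] nz by simp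
        have "(\<Sum>k=1..n. ?\<gamma> k) = (\<Sum>k=1..n. \<beta> k) - (\<Sum>k=1..n. ee l k) + (\<Sum>k=1..n. ee (n + 1 - l) k)"
          by (simp add: sum.distrib sum_subtractf)
        also have "(\<Sum>k=1..n. ee l k) = 1" using l by (simp add: ee_def)
        also have "(\<Sum>k=1..n. ee (n + 1 - l) k) = 1" using l' by (simp add: ee_def)
        finally have S: "(\<Sum>k=1..n. ?\<gamma> k) = int s" using \<beta> by (simp add: comps_def)
        have "?\<gamma> k \<ge> 0" for k using b[of k] bl by (auto simp: ee_def)
        moreover have "?\<gamma> k = 0" if "k \<notin> {1..n}" for k
          using zero[OF \<beta> that] that l l' by (auto simp: ee_def)
        ultimately show ?thesis unfolding comps_def using S by blast
      qed
      then show "qq powi ((\<Sum>k\<in>{l+1..n}. \<beta> k) - (\<Sum>k\<in>{1..<n+1-l}. \<beta> k - ee l k)) * q_int (\<beta> l) * g ?\<gamma>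
        = qq powi ((\<Sum>k\<in>{l+1..n}. \<beta> k) - (\<Sum>k\<in>{1..<n+1-l}. \<beta> k - ee l k)) * q_int (\<beta> l) * f ?\<gamma>"
        by (cases "\<beta> l = 0") (simp_all only: g_def q_int_0 mult_zero_left mult_zero_right if_True not_False_eq_True)
    qed
    also have "\<dots> = q_int (\<epsilon> * \<tau>) * f \<beta>"
      using f nonneg[OF \<beta>] unfolding level_eig_def lh Zfull_Zint \<tau>_def by blast
    finally show "Zfull n g \<beta> = q_int (\<epsilon> * \<tau>) * g \<beta>" using \<beta> by (simp add: g_def)
    have i: "inner_eq n (n div 2) \<alpha> \<beta> \<longleftrightarrow> \<alpha> = \<beta>" "inner_eq n (n div 2) \<sigma> \<beta> \<longleftrightarrow> \<sigma> = \<beta>"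
      by (rule inner[OF \<beta>]; rule zero[OF \<alpha>] \<sigma>0; assumption)+
    have "lead_q 0 (f \<beta>) (((if inner_eq n (n div 2) \<alpha> \<beta> then 1 else 0) + of_int \<epsilon> * (if inner_eq n (n div 2) \<sigma> \<beta> then 1 else 0)) / 2)"
      using f nonneg[OF \<beta>] unfolding level_eig_def \<sigma>_def by blast
    then show "lead_q 0 (g \<beta>) (((if \<alpha> = \<beta> then 1 else 0) + of_int \<epsilon> * (if \<sigma> = \<beta> then 1 else 0)) / 2)"
      unfolding i using \<beta> by (simp only: g_def if_True)
  qed
qed

section \<open>The combinatorial description\<close>

text \<open>The recursion of the energy, read from the middle outwards; at level n div 2 it gives
  \<alpha>_n + \<gamma>_1. The recursion of \<open>tau\<close> rounds this up to the parity of the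
  content.\<close>

primrec del :: "nat \<Rightarrow> (nat \<Rightarrow> int) \<Rightarrow> nat \<Rightarrow> int" where
  "del n \<alpha> 0 = (if odd n then \<alpha> (n div 2 + 1) else 0)"
| "del n \<alpha> (Suc d) = \<alpha> (hi n (Suc d)) + max (del n \<alpha> d - \<alpha> (lo n (Suc d))) 0"

lemma tau_del: "tau n \<alpha> d = del n \<alpha> d \<or> tau n \<alpha> d = del n \<alpha> d + 1"
proof (induction d)
  case (Suc d)
  show ?case
  proof (cases "\<alpha> (lo n (Suc d)) < tau n \<alpha> d")
    case True
    then have "max (del n \<alpha> d - \<alpha> (lo n (Suc d))) 0 = del n \<alpha> d - \<alpha> (lo n (Suc d))" using Suc by auto
    then show ?thesis using True Suc by (auto simp: Let_def)
  next
    case False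
    then have "max (del n \<alpha> d - \<alpha> (lo n (Suc d))) 0 = 0" using Suc by auto
    then show ?thesis using False by (auto simp: Let_def)
  qed
qed simp

lemma del_energy_gamma:
  assumes \<alpha>: "\<forall>k. 0 \<le> \<alpha> k" and n: "n \<ge> 3"
  shows "1 \<le> j \<Longrightarrow> j \<le> half n \<Longrightarrow> \<alpha> (n + 1 - j) + energy_gamma n \<alpha> j = del n \<alpha> (n div 2 + 1 - j)"
proof (induction "half n - j" arbitrary: j)
  case 0
  then have j: "j = half n" by simp
  have g: "energy_gamma n \<alpha> j = max (\<alpha> (n - half n) - \<alpha> (half n)) 0"
    unfolding j by (subst energy_gamma.simps) simp
  show ?case
  proof (cases "odd n")
    case True
    then have h: "half n = n div 2" "n - half n = n div 2 + 1" "n + 1 - half n = n div 2 + 2"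
      unfolding half_def by (auto elim!: oddE)
    have 1: "n div 2 + 1 - j = Suc 0" "lo n (Suc 0) = n div 2" "hi n (Suc 0) = n div 2 + 2"
      using True unfolding j h(1) lo_def hi_def by (auto elim!: oddE)
    show ?thesis using True unfolding g 1 unfolding j h(2,3) by (simp add: 1 h(1))
  next
    case False
    then have h: "half n = n div 2 - 1" "n - half n = n div 2 + 1" "n + 1 - half n = n div 2 + 2"
      unfolding half_def using n by (auto elim!: evenE)
    have 2: "n div 2 + 1 - j = Suc (Suc 0)" "lo n (Suc (Suc 0)) = n div 2 - 1" "hi n (Suc (Suc 0)) = n div 2 + 2"
      "hi n (Suc 0) = n div 2 + 1"
      using False n unfolding j h(1) lo_def hi_def by (auto elim!: evenE)
    \<comment> \<open>For even n the recursion for \<gamma> starts one level later: level 1 is just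
      \<alpha> (n div 2 + 1), since the positive part of 0 - \<alpha> (n div 2) is 0.\<close>
    have "0 \<le> \<alpha> (lo n (Suc 0))" using \<alpha> by blast
    then show ?thesis using False unfolding g 2 unfolding j h(2,3) by (simp add: 2 h(1))
  qed
next
  case (Suc m)
  then have j: "j < half n" by simp
  have hN: "half n \<le> n div 2" unfolding half_def by simp
  have e: "n div 2 + 1 - j = Suc (n div 2 + 1 - Suc j)" using j hN by simp
  have l: "lo n (Suc (n div 2 + 1 - Suc j)) = j" "hi n (Suc (n div 2 + 1 - Suc j)) = n + 1 - j"
    using j hN unfolding lo_def hi_def by auto
  have "energy_gamma n \<alpha> j = max (energy_gamma n \<alpha> (j + 1) + \<alpha> (n - j) - \<alpha> j) 0"
    using j by (subst energy_gamma.simps) simp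
  moreover have "\<alpha> (n - j) + energy_gamma n \<alpha> (j + 1) = del n \<alpha> (n div 2 + 1 - Suc j)"
    using Suc.hyps(1)[of "Suc j"] Suc.hyps(2) j by simp
  ultimately show ?case unfolding e del.simps l by (simp add: algebra_simps)
qed

text \<open>By \<open>tau_del\<close>, tau is del or del + 1, and it has the parity of s. For even
  s, del rounded up to an even number is tau; for odd s, del rounded down to an even number is tau -
  1.\<close>

lemma energy_tau:
  assumes \<alpha>: "\<forall>k. 0 \<le> \<alpha> k" and n: "n \<ge> 3" and par: "even (tau n \<alpha> (n div 2) - int s)"
  shows "energy n s \<alpha> = of_bool (odd s) - tau n \<alpha> (n div 2)"
proof -
  have "1 \<le> half n" unfolding half_def using n by simp
  from del_energy_gamma[OF \<alpha> n _ this] have D: "\<alpha> n + energy_gamma n \<alpha> 1 = del n \<alpha> (n div 2)" by simp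
  show ?thesis unfolding energy_def D using tau_del[of n \<alpha> "n div 2"] par
    by (cases "even s") (auto elim!: evenE oddE)
qed

lemma tau_cong: "d \<le> n div 2 \<Longrightarrow> inner_eq n d \<alpha> \<beta> \<Longrightarrow> tau n \<alpha> d = tau n \<beta> d"
proof (induction d)
  case 0
  show ?case
  proof (cases "odd n")
    case True
    then have "lo n 0 = n div 2 + 1" "hi n 0 = n div 2 + 1" unfolding lo_def hi_def by (auto elim!: oddE)
    then show ?thesis using 0 by (simp add: inner_eq_def)
  qed simp
next
  case (Suc d)
  have d: "d < n div 2" using Suc.prems by simp
  have "\<alpha> (lo n (Suc d)) = \<beta> (lo n (Suc d))" "\<alpha> (hi n (Suc d)) = \<beta> (hi n (Suc d))" "inner_eq n d \<alpha> \<beta>"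
    using Suc.prems(2) inner_Suc_iff[OF d, of "\<lambda>k. \<alpha> k = \<beta> k"] unfolding inner_eq_def by auto
  then show ?case using Suc.IH d by simp
qed

text \<open>An exchange in the outer pair changes a by one. This flips the parity of t - a and keeps
  a \<ge> t, so a second application falls into the opposite case and undoes the first.\<close>

lemma tau_sig_involution:
  assumes \<alpha>: "\<forall>k. 0 \<le> \<alpha> k"
  shows "d \<le> n div 2 \<Longrightarrow> tau n (sig n \<alpha> d) d = tau n \<alpha> d \<and> sig n (sig n \<alpha> d) d = \<alpha>"
proof (induction d)
  case (Suc d)
  have d: "d < n div 2" using Suc.prems by simp
  note lh = lo_hi_Suc[OF d]
  define j h where "j = lo n (Suc d)" and "h = hi n (Suc d)"
  have jh: "j < h" "j \<notin> {lo n d..hi n d}" "h \<notin> {lo n d..hi n d}" using lh by (auto simp: j_def h_def)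
  define a a' t where "a = \<alpha> j" and "a' = \<alpha> h" and "t = tau n \<alpha> d"
  have swap: "tau n (\<lambda>k. \<alpha> k + x * (ee j k - ee h k)) d = t" for x
    unfolding t_def using jh d by (intro tau_cong) (auto simp: inner_eq_def ee_def)
  have T: "tau n \<beta> (Suc d) = (if \<beta> j < tau n \<beta> d then \<beta> h + tau n \<beta> d - \<beta> j else if even (tau n \<beta> d - \<beta> j) then \<beta> h else \<beta> h + 1)" for \<beta>
    by (simp add: Let_def j_def h_def)
  have S: "sig n \<beta> (Suc d) = (if \<beta> j < tau n \<beta> d then sig n \<beta> d
     else if even (tau n \<beta> d - \<beta> j) then (if \<beta> h = 0 then \<beta> else (\<lambda>k. \<beta> k + 1 * (ee j k - ee h k)))
     else (\<lambda>k. \<beta> k + (-1) * (ee j k - ee h k)))" for \<beta>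
    by (simp add: Let_def j_def h_def fun_eq_iff)
  show ?case
  proof (cases "a < t")
    case True
    have IH: "tau n (sig n \<alpha> d) d = t" "sig n (sig n \<alpha> d) d = \<alpha>" using Suc.IH d by (auto simp: t_def)
    have o: "sig n \<alpha> d j = a" "sig n \<alpha> d h = a'" using sig_outside jh d by (auto simp: a_def a'_def)
    have s: "sig n \<alpha> (Suc d) = sig n \<alpha> d" using True unfolding S a_def t_def by simp
    show ?thesis unfolding s unfolding S T IH o using True by (simp add: a_def t_def a'_def)
  next
    case False
    show ?thesis
    proof (cases "even (t - a)")
      case ev: True
      show ?thesis
      proof (cases "a' = 0")
        case True
        have s: "sig n \<alpha> (Suc d) = \<alpha>" using False ev True unfolding S a_def t_def a'_def by simp
        show ?thesis unfolding s by simp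
      next
        case a': False
        define \<beta> where "\<beta> = (\<lambda>k. \<alpha> k + 1 * (ee j k - ee h k))"
        have s: "sig n \<alpha> (Suc d) = \<beta>" using False ev a' unfolding S a_def t_def a'_def \<beta>_def by simp
        have v: "\<beta> j = a + 1" "\<beta> h = a' - 1" "tau n \<beta> d = t" using jh swap[of 1] by (auto simp: \<beta>_def ee_def a_def a'_def)
        have b: "(\<lambda>k. \<beta> k + (-1) * (ee j k - ee h k)) = \<alpha>" by (auto simp: \<beta>_def)
        have c: "\<not> a + 1 < t" "\<not> even (t - (a + 1))" using False ev by auto
        have c': "\<not> \<alpha> j < tau n \<alpha> d" "even (tau n \<alpha> d - \<alpha> j)" using False ev by (auto simp: a_def t_def)
        show ?thesis unfolding s unfolding S T[of \<beta>] T[of \<alpha>] v b if_not_P[OF c(1)] if_not_P[OF c(2)] if_not_P[OF c'(1)] if_P[OF c'(2)] by (simp add: a'_def)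
      qed
    next
      case od: False
      define \<beta> where "\<beta> = (\<lambda>k. \<alpha> k + (-1) * (ee j k - ee h k))"
      have s: "sig n \<alpha> (Suc d) = \<beta>" using False od unfolding S a_def t_def \<beta>_def by simp
      have v: "\<beta> j = a - 1" "\<beta> h = a' + 1" "tau n \<beta> d = t" using jh swap[of "-1"] by (auto simp: \<beta>_def ee_def a_def a'_def)
      have b: "(\<lambda>k. \<beta> k + 1 * (ee j k - ee h k)) = \<alpha>" by (auto simp: \<beta>_def)
      \<comment> \<open>Odd t - a excludes a = t, so that a - 1 is still at least t.\<close>
      have "t \<noteq> a" using od by auto
      then have c: "\<not> a - 1 < t" "even (t - (a - 1))" using False od by auto
      have c': "\<not> \<alpha> j < tau n \<alpha> d" "\<not> even (tau n \<alpha> d - \<alpha> j)" using False od by (auto simp: a_def t_def)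
      have nz: "tau n \<alpha> (Suc d) = a' + 1" unfolding T if_not_P[OF c'(1)] if_not_P[OF c'(2)] a'_def ..
      have "a' + 1 \<noteq> 0" using spec[OF \<alpha>, of h] by (simp add: a'_def)
      then show ?thesis unfolding s nz unfolding S T[of \<beta>] v b if_not_P[OF c(1)] if_P[OF c(2)] by simp
    qed
  qed
qed simp

lemma sig_nonneg: "\<forall>k. 0 \<le> \<alpha> k \<Longrightarrow> 0 \<le> sig n \<alpha> d k"
proof (induction d)
  case (Suc d)
  have p: "0 \<le> \<alpha> k" "0 \<le> \<alpha> (lo n (Suc d))" "0 \<le> \<alpha> (hi n (Suc d))" "0 \<le> tau n \<alpha> d"
    using Suc.prems tau_nonneg[OF Suc.prems] by auto
  have "sig n \<alpha> d k \<ge> 0" using Suc by simp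
  moreover have "\<alpha> (lo n (Suc d)) \<noteq> tau n \<alpha> d" if "odd (tau n \<alpha> d - \<alpha> (lo n (Suc d)))" using that by auto
  ultimately show ?case using p unfolding sig.simps Let_def
    by (cases "\<alpha> (lo n (Suc d)) < tau n \<alpha> d"; cases "even (tau n \<alpha> d - \<alpha> (lo n (Suc d)))") (auto simp: ee_def)
qed simp

lemma sig_sum: "d \<le> n div 2 \<Longrightarrow> (\<Sum>k=1..n. sig n \<alpha> d k) = (\<Sum>k=1..n. \<alpha> k)"
proof (induction d)
  case (Suc d)
  have r: "lo n (Suc d) \<in> {1..n}" "hi n (Suc d) \<in> {1..n}" using Suc.prems by (auto simp: lo_def hi_def)
  then have e: "(\<Sum>k=1..n. ee (lo n (Suc d)) k) = 1" "(\<Sum>k=1..n. ee (hi n (Suc d)) k) = 1" by (simp_all add: ee_def)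
  show ?case using Suc e by (simp add: Let_def sum.distrib sum_subtractf)
qed simp

lemma sig_comps:
  assumes \<alpha>: "\<alpha> \<in> comps n s" and pos: "\<forall>k. 0 \<le> \<alpha> k"
  shows "sig n \<alpha> (n div 2) \<in> comps n s"
proof -
  have "sig n \<alpha> (n div 2) k = 0" if k: "k \<notin> {1..n}" for k
  proof -
    have "k \<notin> {lo n (n div 2)..hi n (n div 2)}" using k by (auto simp: lo_def hi_def)
    then have "sig n \<alpha> (n div 2) k = \<alpha> k" by (rule sig_outside[OF order.refl])
    then show ?thesis using \<alpha> k unfolding comps_def by simp
  qed
  then show ?thesis using \<alpha> sig_nonneg[OF pos] sig_sum[of "n div 2" n \<alpha>] unfolding comps_def by simp
qed

text \<open>The pair of the positions \<open>i + 1\<close> and \<open>n - i\<close> is exchanged; \<open>e\<close> distinguishes Case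
  \<open>(2i+2)\<close> from Case \<open>(2i+1)\<close>. For n odd, \<open>i = n div 2\<close> is the middle position.\<close>

definition pair_type :: "nat \<Rightarrow> (nat \<Rightarrow> int) \<Rightarrow> nat \<Rightarrow> bool \<Rightarrow> bool" where
  "pair_type n \<alpha> i e \<longleftrightarrow> (if i < n div 2 then tau n \<alpha> (n div 2 - Suc i) \<le> \<alpha> (i + 1)
      \<and> (even (tau n \<alpha> (n div 2 - Suc i) - \<alpha> (i + 1)) \<longleftrightarrow> \<not> e) else \<not> e)"

text \<open>Condition (a) or (a') on the positions of level d; \<open>of_bool e\<close> makes the
  strict inequality weak in the second case. Conditions (b) and (c) are contained in
  \<open>pair_type\<close>, because tau records both a maximum of inner sums and their
  parity.\<close>

definition level_case :: "nat \<Rightarrow> (nat \<Rightarrow> int) \<Rightarrow> nat \<Rightarrow> nat \<Rightarrow> bool \<Rightarrow> bool" where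
  "level_case n \<alpha> d i e \<longleftrightarrow> n div 2 - d \<le> i \<and> i \<le> half n \<and> pair_type n \<alpha> i e \<and>
     (\<forall>k\<in>{n div 2 - d + 1..i}. (\<Sum>j=k..i. \<alpha> j) < (\<Sum>j=n-i..n-k. \<alpha> j) + of_bool e)"

definition pair_shift :: "nat \<Rightarrow> (nat \<Rightarrow> int) \<Rightarrow> nat \<Rightarrow> bool \<Rightarrow> nat \<Rightarrow> int" where
  "pair_shift n \<alpha> i e = (\<lambda>k. \<alpha> k + (if e then -1 else 1) * (ee (i + 1) k - ee (n - i) k))"

lemma half_cases: "odd n \<Longrightarrow> half n = n div 2" "even n \<Longrightarrow> n \<noteq> 0 \<Longrightarrow> Suc (half n) = n div 2"
  unfolding half_def by (auto elim!: oddE evenE)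

text \<open>The formula for tau turns the comparison a < t of the recursion into condition (a) at
  the new position. If a < t, the old pair passes this test and the new pair has the wrong type; if
  a \<ge> t, the old pair fails and the new one takes over, with e given by the parity of t - a. For
  even n level 0 has no position, and for tau = 0 the map \<open>sig\<close> may be trivial: hence
  the two exceptions.\<close>

lemma level_case_unique:
  assumes n: "n \<ge> 3" and \<alpha>: "\<forall>k. 0 \<le> \<alpha> k"
  shows "d \<le> n div 2 \<Longrightarrow> (even n \<and> d = 0) \<or> (\<exists>i e. (\<forall>i' e'. level_case n \<alpha> d i' e' \<longleftrightarrow> i' = i \<and> e' = e) \<and>
     tau n \<alpha> d = of_bool e + (\<Sum>j=n-i..n-(n div 2-d). \<alpha> j) - (\<Sum>j=n div 2-d+1..i. \<alpha> j) \<and>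
     (tau n \<alpha> d \<noteq> 0 \<longrightarrow> sig n \<alpha> d = pair_shift n \<alpha> i e))"
proof (induction d)
  case 0
  show ?case
  proof (cases "even n")
    case False
    have N: "half n = n div 2" and nn: "n - n div 2 = n div 2 + 1" using False half_cases(1) by (auto elim!: oddE)
    have "level_case n \<alpha> 0 i' e' \<longleftrightarrow> i' = n div 2 \<and> e' = False" for i' e'
      unfolding level_case_def N pair_type_def by auto
    moreover have "tau n \<alpha> 0 = of_bool False + (\<Sum>j=n-n div 2..n-(n div 2-0). \<alpha> j) - (\<Sum>j=n div 2-0+1..n div 2. \<alpha> j)"
      using False by (simp add: nn)
    moreover have "sig n \<alpha> 0 = pair_shift n \<alpha> (n div 2) False"
      unfolding pair_shift_def nn by simp
    ultimately show ?thesis by blast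
  qed simp
next
  case (Suc d)
  define i0 where "i0 = n div 2 - Suc d"
  have i0: "n div 2 - d = Suc i0" "n div 2 - Suc i0 = d" "i0 < n div 2" using Suc.prems by (auto simp: i0_def)
  have lh: "lo n (Suc d) = i0 + 1" "hi n (Suc d) = n - i0" using Suc.prems by (auto simp: lo_def hi_def i0_def)
  have ih: "i0 \<le> half n" using i0(3) unfolding half_def by linarith
  have lc: "level_case n \<alpha> (Suc d) i e \<longleftrightarrow> (if i = i0 then pair_type n \<alpha> i0 e else
     level_case n \<alpha> d i e \<and> (\<Sum>j=Suc i0..i. \<alpha> j) < (\<Sum>j=n-i..n-Suc i0. \<alpha> j) + of_bool e)" for i e
  proof (cases "i = i0")
    case True
    then show ?thesis using ih unfolding level_case_def i0_def[symmetric] by simp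
  next
    case False
    show ?thesis
    proof (cases "Suc i0 \<le> i")
      case True
      have "{i0+1..i} = insert (Suc i0) {Suc i0 + 1..i}" using True by auto
      then show ?thesis using False True unfolding level_case_def i0_def[symmetric] i0(1) by auto
    next
      case f: False
      then show ?thesis using False unfolding level_case_def i0_def[symmetric] i0(1) by auto
    qed
  qed
  define a where "a = \<alpha> (i0 + 1)"
  define t where "t = tau n \<alpha> d"
  have a0: "0 \<le> a" "0 \<le> t" using \<alpha> tau_nonneg[OF \<alpha>] by (auto simp: a_def t_def)
  show ?case
  proof (cases "a < t")
    case True
    have nb: "\<not> (even n \<and> d = 0)"
    proof
      assume "even n \<and> d = 0"
      then have "t = 0" by (simp add: t_def)
      then show False using True a0 by simp
    qed
    obtain i e where U: "\<And>i' e'. level_case n \<alpha> d i' e' \<longleftrightarrow> i' = i \<and> e' = e"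
      and tt: "t = of_bool e + (\<Sum>j=n-i..n-Suc i0. \<alpha> j) - (\<Sum>j=Suc i0+1..i. \<alpha> j)"
      and sg: "t \<noteq> 0 \<longrightarrow> sig n \<alpha> d = pair_shift n \<alpha> i e"
      using Suc.IH Suc.prems nb unfolding i0(1) t_def by (metis Suc_leD)
    have i: "Suc i0 \<le> i" "i \<le> half n" using U[of i e] unfolding level_case_def i0(1) by auto
    have "i < n" using i n unfolding half_def by linarith
    have Sa: "(\<Sum>j=Suc i0..i. \<alpha> j) = a + (\<Sum>j=Suc i0+1..i. \<alpha> j)"
      using i by (simp add: sum.atLeast_Suc_atMost a_def)
    have c: "(\<Sum>j=Suc i0..i. \<alpha> j) < (\<Sum>j=n-i..n-Suc i0. \<alpha> j) + of_bool e"
      using True tt unfolding Sa by simp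
    have npt: "\<not> pair_type n \<alpha> i0 e'" for e' using True i0 by (simp add: pair_type_def a_def t_def)
    have U': "level_case n \<alpha> (Suc d) i' e' \<longleftrightarrow> i' = i \<and> e' = e" for i' e'
    proof (cases "i' = i0")
      case True
      then show ?thesis unfolding lc using npt i by auto
    next
      case False
      then show ?thesis unfolding lc U using c by auto
    qed
    have "n - i0 = Suc (n - Suc i0)" using i0(3) by simp
    then have Sb: "(\<Sum>j=n-i..n-i0. \<alpha> j) = (\<Sum>j=n-i..n-Suc i0. \<alpha> j) + \<alpha> (n - i0)" using i by simp
    have "tau n \<alpha> (Suc d) = \<alpha> (n - i0) + t - a"
      using True by (simp add: Let_def lh a_def t_def)
    then have t': "tau n \<alpha> (Suc d) = of_bool e + (\<Sum>j=n-i..n-(n div 2-Suc d). \<alpha> j) - (\<Sum>j=n div 2-Suc d+1..i. \<alpha> j)"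
      unfolding i0_def[symmetric] Sb tt using Sa by simp
    have "sig n \<alpha> (Suc d) = pair_shift n \<alpha> i e"
      using True sg a0 by (simp add: Let_def lh a_def t_def)
    then show ?thesis using U' t' by blast
  next
    case False
    define e where "e \<longleftrightarrow> odd (t - a)"
    have pt: "pair_type n \<alpha> i0 e' \<longleftrightarrow> e' = e" for e'
      using False i0 unfolding pair_type_def e_def by (auto simp: a_def t_def)
    have no: "\<not> (level_case n \<alpha> d i e' \<and> (\<Sum>j=Suc i0..i. \<alpha> j) < (\<Sum>j=n-i..n-Suc i0. \<alpha> j) + of_bool e')" for i e'
    proof (cases "even n \<and> d = 0")
      case True
      then show ?thesis using half_cases(2)[of n] n unfolding level_case_def by auto
    next
      case nb: False
      obtain i1 e1 where U: "\<And>i' e'. level_case n \<alpha> d i' e' \<longleftrightarrow> i' = i1 \<and> e' = e1"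
        and tt: "t = of_bool e1 + (\<Sum>j=n-i1..n-Suc i0. \<alpha> j) - (\<Sum>j=Suc i0+1..i1. \<alpha> j)"
        using Suc.IH Suc.prems nb unfolding i0(1) t_def by (metis Suc_leD)
      have "Suc i0 \<le> i1" using U[of i1 e1] unfolding level_case_def i0(1) by auto
      then have Sa: "(\<Sum>j=Suc i0..i1. \<alpha> j) = a + (\<Sum>j=Suc i0+1..i1. \<alpha> j)"
        by (simp add: sum.atLeast_Suc_atMost a_def)
      have "\<not> (\<Sum>j=Suc i0..i1. \<alpha> j) < (\<Sum>j=n-i1..n-Suc i0. \<alpha> j) + of_bool e1"
        using False tt unfolding Sa by simp
      then show ?thesis unfolding U by auto
    qed
    have U': "level_case n \<alpha> (Suc d) i' e' \<longleftrightarrow> i' = i0 \<and> e' = e" for i' e'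
      unfolding lc using no[of i' e'] pt by auto
    have tv: "tau n \<alpha> (Suc d) = \<alpha> (n - i0) + of_bool e"
      using False by (simp add: Let_def lh a_def t_def e_def)
    have t': "tau n \<alpha> (Suc d) = of_bool e + (\<Sum>j=n-i0..n-(n div 2-Suc d). \<alpha> j) - (\<Sum>j=n div 2-Suc d+1..i0. \<alpha> j)"
      unfolding i0_def[symmetric] tv by simp
    have sv: "sig n \<alpha> (Suc d) = pair_shift n \<alpha> i0 e" if "tau n \<alpha> (Suc d) \<noteq> 0"
    proof (cases e)
      case True
      then show ?thesis using False
        by (simp add: Let_def lh a_def t_def e_def pair_shift_def fun_eq_iff)
    next
      case ne: False
      then have "\<alpha> (n - i0) \<noteq> 0" using that unfolding tv by simp
      then show ?thesis using False ne
        by (simp add: Let_def lh a_def t_def e_def pair_shift_def fun_eq_iff)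
    qed
    show ?thesis using U' t' sv by blast
  qed
qed

text \<open>Unrolled, \<open>del\<close> is a maximum of differences of partial sums, so a bound on
  it amounts to condition (b) for all k. The bound 0 \<le> x accounts for the value 0 from which the
  recursion starts for even n.\<close>

lemma del_le_iff:
  assumes n: "n \<ge> 3" and \<alpha>: "\<forall>k. 0 \<le> \<alpha> k"
  shows "i + Suc d = n div 2 \<Longrightarrow> 0 \<le> x \<Longrightarrow> del n \<alpha> d \<le> x
    \<longleftrightarrow> (\<forall>k\<in>{i+1..half n}. (\<Sum>j=n-k..n-i-1. \<alpha> j) - (\<Sum>j=i+2..k. \<alpha> j) \<le> x)"
proof (induction d arbitrary: i x)
  case 0
  show ?case
  proof (cases "odd n")
    case True
    have "half n = i + 1" "n - (i + 1) = n div 2 + 1" "n - i - 1 = n div 2 + 1" using 0 True half_cases(1) by (auto elim!: oddE)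
    then show ?thesis using True by simp
  next
    case False
    then have "half n = i" using 0 n half_cases(2)[of n] by simp
    then show ?thesis using 0 False by simp
  qed
next
  case (Suc d)
  have lh: "lo n (Suc d) = i + 2" "hi n (Suc d) = n - i - 1" using Suc.prems(1) by (auto simp: lo_def hi_def)
  have ih: "i + 1 \<le> half n" using Suc.prems(1) unfolding half_def by linarith
  have sp: "{i+1..half n} = insert (i+1) {i+1+1..half n}" using ih by auto
  have ak: "(\<Sum>j=n-k..n-i-1. \<alpha> j) - (\<Sum>j=i+2..k. \<alpha> j) \<le> x
    \<longleftrightarrow> (\<Sum>j=n-k..n-(i+1)-1. \<alpha> j) - (\<Sum>j=i+1+2..k. \<alpha> j) \<le> x - \<alpha> (n - i - 1) + \<alpha> (i + 2)"
    if k: "k \<in> {i+1+1..half n}" for k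
  proof -
    have kn: "k < n" "i + 2 \<le> k" using k n unfolding half_def by auto
    have e: "n - i - 1 = Suc (n - (i + 1) - 1)" using kn by simp
    have "(\<Sum>j=n-k..n-i-1. \<alpha> j) = (\<Sum>j=n-k..n-(i+1)-1. \<alpha> j) + \<alpha> (n - i - 1)" unfolding e using kn by simp
    moreover have "(\<Sum>j=i+2..k. \<alpha> j) = \<alpha> (i + 2) + (\<Sum>j=i+1+2..k. \<alpha> j)" using kn by (simp add: sum.atLeast_Suc_atMost)
    ultimately show ?thesis by linarith
  qed
  have nn: "n - (i + 1) = n - i - 1" by simp
  have k1: "(\<Sum>j=n-(i+1)..n-i-1. \<alpha> j) - (\<Sum>j=i+2..i+1. \<alpha> j) = \<alpha> (n - i - 1)" unfolding nn by simp
  have a2: "0 \<le> \<alpha> (i + 2)" using \<alpha> by blast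
  have "del n \<alpha> (Suc d) \<le> x \<longleftrightarrow> \<alpha> (n - i - 1) \<le> x \<and> del n \<alpha> d \<le> x - \<alpha> (n - i - 1) + \<alpha> (i + 2)"
    unfolding del.simps lh by linarith
  also have "\<dots> \<longleftrightarrow> \<alpha> (n - i - 1) \<le> x \<and> (\<forall>k\<in>{i+1+1..half n}.
      (\<Sum>j=n-k..n-(i+1)-1. \<alpha> j) - (\<Sum>j=i+1+2..k. \<alpha> j) \<le> x - \<alpha> (n - i - 1) + \<alpha> (i + 2))"
  proof (intro conj_cong refl)
    assume "\<alpha> (n - i - 1) \<le> x"
    then have "0 \<le> x - \<alpha> (n - i - 1) + \<alpha> (i + 2)" using a2 by simp
    moreover have "i + 1 + Suc d = n div 2" using Suc.prems(1) by simp
    ultimately show "del n \<alpha> d \<le> x - \<alpha> (n - i - 1) + \<alpha> (i + 2) \<longleftrightarrow> (\<forall>k\<in>{i+1+1..half n}.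
      (\<Sum>j=n-k..n-(i+1)-1. \<alpha> j) - (\<Sum>j=i+1+2..k. \<alpha> j) \<le> x - \<alpha> (n - i - 1) + \<alpha> (i + 2))"
      by - (rule Suc.IH)
  qed
  also have "\<dots> \<longleftrightarrow> (\<forall>k\<in>{i+1..half n}. (\<Sum>j=n-k..n-i-1. \<alpha> j) - (\<Sum>j=i+2..k. \<alpha> j) \<le> x)"
    unfolding sp ball_simps(7) k1 using ak by (simp only: cong: ball_cong)
  finally show ?case .
qed

lemma tau_comps_parity:
  assumes \<alpha>: "\<alpha> \<in> comps n s" "\<forall>k. 0 \<le> \<alpha> k"
  shows "tau n \<alpha> (n div 2) \<le> int s" "even (tau n \<alpha> (n div 2) - int s)"
proof -
  have "lo n (n div 2) = 1" "hi n (n div 2) = n" by (auto simp: lo_def hi_def)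
  then show "tau n \<alpha> (n div 2) \<le> int s" "even (tau n \<alpha> (n div 2) - int s)"
    using tau_bounds[OF \<alpha>(2), of "n div 2" n] \<alpha>(1) by (auto simp: comps_def)
qed

text \<open>Condition (a) is common to both sides. For odd s the parity of the outer letters in (c)
  determines that of the letters i + 1, ..., n - i - 1, hence by \<open>tau_bounds\<close> that of
  tau - \<alpha>_{i+1}. Condition (b) bounds \<open>del\<close> by \<alpha>_{i+1}, or by
  \<alpha>_{i+1} - 1 if e holds; given the parity, this is the bound of tau by
  \<alpha>_{i+1}.\<close>

lemma kcase_iff:
  assumes n: "n \<ge> 3" and \<alpha>: "\<alpha> \<in> comps n s" "\<forall>k. 0 \<le> \<alpha> k" and s: "odd s"
    and m: "m = 2 * i + 1 + of_bool e" "m \<le> n"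
  shows "kcase n m \<alpha> \<longleftrightarrow> level_case n \<alpha> (n div 2) i e"
proof -
  have i: "i \<le> half n" using m n unfolding half_def by auto
  have inn: "i < n" using i n unfolding half_def by linarith
  have e_iff: "of_bool e = (if e then 1 else 0 :: int)" by simp
  define A where "A \<longleftrightarrow> (\<forall>k\<in>{1..i}. (\<Sum>j=k..i. \<alpha> j) < (\<Sum>j=n-i..n-k. \<alpha> j) + of_bool e)"
  define B where "B \<longleftrightarrow> (\<forall>k\<in>{i+1..half n}. (\<Sum>j=i+1..k. \<alpha> j) \<ge> (\<Sum>j=n-k..n-i-1. \<alpha> j) + of_bool e)"
  define P where "P \<longleftrightarrow> (odd ((\<Sum>j=1..i. \<alpha> j) + (\<Sum>j=n-i..n. \<alpha> j)) \<longleftrightarrow> \<not> e)"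
  have K: "kcase n m \<alpha> \<longleftrightarrow> A \<and> B \<and> P"
  proof (cases e)
    case True
    have m': "m = 2 * i + 2" using m True by simp
    have "kcase n m \<alpha> \<longleftrightarrow> (\<forall>k\<in>{1..i}. (\<Sum>j=k..i. \<alpha> j) \<le> (\<Sum>j=n-i..n-k. \<alpha> j)) \<and>
         (\<forall>k\<in>{i+1..half n}. (\<Sum>j=i+1..k. \<alpha> j) > (\<Sum>j=n-k..n-i-1. \<alpha> j)) \<and>
         even ((\<Sum>j=1..i. \<alpha> j) + (\<Sum>j=n-i..n. \<alpha> j))"
    proof -
      have "m \<noteq> 2 * i' + 1" and "m = 2 * i' + 2 \<longleftrightarrow> i' = i" for i' unfolding m' by presburger+
      then show ?thesis unfolding kcase_def using i by (simp only: simp_thms) blast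
    qed
    then show ?thesis unfolding A_def B_def P_def using True by (simp add: zle_add1_eq_le add1_zle_eq)
  next
    case False
    have m': "m = 2 * i + 1" using m False by simp
    have "kcase n m \<alpha> \<longleftrightarrow> (\<forall>k\<in>{1..i}. (\<Sum>j=k..i. \<alpha> j) < (\<Sum>j=n-i..n-k. \<alpha> j)) \<and>
         (\<forall>k\<in>{i+1..half n}. (\<Sum>j=i+1..k. \<alpha> j) \<ge> (\<Sum>j=n-k..n-i-1. \<alpha> j)) \<and>
         odd ((\<Sum>j=1..i. \<alpha> j) + (\<Sum>j=n-i..n. \<alpha> j))"
    proof -
      have "m \<noteq> 2 * i' + 2" and "m = 2 * i' + 1 \<longleftrightarrow> i' = i" for i' unfolding m' by presburger+
      then show ?thesis unfolding kcase_def using i by (simp only: simp_thms) blast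
    qed
    then show ?thesis unfolding A_def B_def P_def using False by simp
  qed
  have total: "(\<Sum>j=1..n. \<alpha> j) = int s" using \<alpha>(1) by (simp add: comps_def)
  have "{1..n} = {1..i} \<union> {i+1..n-i-1} \<union> {n-i..n}"
    using i n unfolding half_def by (auto; linarith)
  moreover have "{1..i} \<inter> {i+1..n-i-1} = {}" "({1..i} \<union> {i+1..n-i-1}) \<inter> {n-i..n} = {}"
    using i n unfolding half_def by auto
  ultimately have split: "int s = (\<Sum>j=1..i. \<alpha> j) + (\<Sum>j=i+1..n-i-1. \<alpha> j) + (\<Sum>j=n-i..n. \<alpha> j)"
    unfolding total[symmetric] by (simp add: sum.union_disjoint)
  have P: "P \<longleftrightarrow> (even (\<Sum>j=i+1..n-i-1. \<alpha> j) \<longleftrightarrow> \<not> e)"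
  proof -
    have "odd (int s)" using s by simp
    then show ?thesis unfolding P_def split by auto
  qed
  have BP: "B \<and> P \<longleftrightarrow> pair_type n \<alpha> i e"
  proof (cases "i < n div 2")
    case True
    define d where "d = n div 2 - Suc i"
    have d: "i + Suc d = n div 2" using True by (simp add: d_def)
    have lh: "lo n d = i + 2" "hi n d = n - i - 1" using d by (auto simp: lo_def hi_def)
    have ni: "i + 1 \<le> n - i - 1" using True by linarith
    have "(\<Sum>j=i+1..n-i-1. \<alpha> j) = \<alpha> (i + 1) + (\<Sum>j=i+2..n-i-1. \<alpha> j)"
      using ni by (simp add: sum.atLeast_Suc_atMost)
    moreover have "even (tau n \<alpha> d - (\<Sum>j=i+2..n-i-1. \<alpha> j))"
      using tau_bounds[OF \<alpha>(2), of d n] d ni unfolding lh by simp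
    ultimately have P': "P \<longleftrightarrow> (even (tau n \<alpha> d - \<alpha> (i + 1)) \<longleftrightarrow> \<not> e)" unfolding P by auto
    have a0: "0 \<le> \<alpha> (i + 1)" and t0: "0 \<le> tau n \<alpha> d" using \<alpha>(2) tau_nonneg[OF \<alpha>(2)] by auto
    have B': "B \<longleftrightarrow> (\<forall>k\<in>{i+1..half n}. (\<Sum>j=n-k..n-i-1. \<alpha> j) - (\<Sum>j=i+2..k. \<alpha> j) \<le> \<alpha> (i + 1) - of_bool e)"
      unfolding B_def
    proof (intro ball_cong refl)
      fix k assume "k \<in> {i+1..half n}"
      then have "(\<Sum>j=i+1..k. \<alpha> j) = \<alpha> (i + 1) + (\<Sum>j=i+2..k. \<alpha> j)" by (simp add: sum.atLeast_Suc_atMost)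
      then show "(\<Sum>j=n-k..n-i-1. \<alpha> j) + of_bool e \<le> (\<Sum>j=i+1..k. \<alpha> j)
        \<longleftrightarrow> (\<Sum>j=n-k..n-i-1. \<alpha> j) - (\<Sum>j=i+2..k. \<alpha> j) \<le> \<alpha> (i + 1) - of_bool e" by linarith
    qed
    have B'': "B \<longleftrightarrow> del n \<alpha> d \<le> \<alpha> (i + 1) - of_bool e" if "0 \<le> \<alpha> (i + 1) - of_bool e"
      unfolding B' by (rule del_le_iff[OF n \<alpha>(2) d that, symmetric])
    \<comment> \<open>The bound could be negative only for e with \<alpha> (i + 1) = 0. Then (b) at
      k = i + 1 would force a negative entry or, if there is no such k, (c) fails.\<close>
    have nz: "0 \<le> \<alpha> (i + 1) - of_bool e" if bp: "B \<and> P"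
    proof (rule ccontr)
      assume "\<not> 0 \<le> \<alpha> (i + 1) - of_bool e"
      then have e: e and z: "\<alpha> (i + 1) = 0" using a0 by (cases e; simp)+
      show False
      proof (cases "i + 1 \<le> half n")
        case True
        then have "(\<Sum>j=n-(i+1)..n-i-1. \<alpha> j) - (\<Sum>j=i+2..i+1. \<alpha> j) \<le> \<alpha> (i + 1) - of_bool e"
          using bp unfolding B' by (auto dest!: bspec[of _ _ "i + 1"])
        then show False using z e spec[OF \<alpha>(2), of "n - i - 1"] by simp
      next
        case False
        then have "d = 0" "even n" using d i half_cases(1)[of n] by (cases "even n"; auto simp: half_def)+
        then show False using bp z e unfolding P' by simp
      qed
    qed
    have pt: "pair_type n \<alpha> i e \<longleftrightarrow> tau n \<alpha> d \<le> \<alpha> (i + 1) \<and> (even (tau n \<alpha> d - \<alpha> (i + 1)) \<longleftrightarrow> \<not> e)"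
      using True by (simp add: pair_type_def d_def)
    have td: "tau n \<alpha> d = del n \<alpha> d \<or> tau n \<alpha> d = del n \<alpha> d + 1" by (rule tau_del)
    show ?thesis
    proof
      assume bp: "B \<and> P"
      then have dl: "del n \<alpha> d \<le> \<alpha> (i + 1) - of_bool e" using B''[OF nz[OF bp]] by simp
      have p: "even (tau n \<alpha> d - \<alpha> (i + 1)) \<longleftrightarrow> \<not> e" using bp P' by simp
      have "tau n \<alpha> d \<le> \<alpha> (i + 1)"
      proof (cases e)
        case True
        then have "del n \<alpha> d \<le> \<alpha> (i + 1) - 1" using dl by simp
        then show ?thesis using td by linarith
      next
        case False
        then have "del n \<alpha> d \<le> \<alpha> (i + 1)" "\<alpha> (i + 1) \<noteq> tau n \<alpha> d - 1" using dl p by auto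
        then show ?thesis using td by linarith
      qed
      then show "pair_type n \<alpha> i e" using pt p by simp
    next
      assume "pair_type n \<alpha> i e"
      then have le: "tau n \<alpha> d \<le> \<alpha> (i + 1)" and p: "even (tau n \<alpha> d - \<alpha> (i + 1)) \<longleftrightarrow> \<not> e" using pt by auto
      have ne: "e \<Longrightarrow> tau n \<alpha> d \<noteq> \<alpha> (i + 1)" using p by auto
      have "0 \<le> \<alpha> (i + 1) - of_bool e" "del n \<alpha> d \<le> \<alpha> (i + 1) - of_bool e"
        using le ne t0 td by (cases e; auto)+
      then show "B \<and> P" using B'' P' p by simp
    qed
  next
    case False
    \<comment> \<open>The middle position of odd n: no letters lie strictly inside, so (b) is
      vacuous and (c) forces e to be false.\<close>
    then have on: "odd n" and iN: "i = n div 2" using i n half_cases(2)[of n] unfolding half_def by (auto; linarith)+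
    then have "n - i - 1 < i + 1" by auto
    moreover have "half n < i + 1" using iN half_cases(1)[OF on] by simp
    ultimately show ?thesis using False P by (simp add: B_def pair_type_def)
  qed
  have "level_case n \<alpha> (n div 2) i e \<longleftrightarrow> A \<and> pair_type n \<alpha> i e"
    unfolding level_case_def A_def using i by auto
  then show ?thesis unfolding K using BP by blast
qed

lemma case_shift_sig:
  assumes n: "n \<ge> 3" and \<alpha>: "\<alpha> \<in> comps n s" "\<forall>k. 0 \<le> \<alpha> k" and s: "odd s"
  shows "case_shift n (case_index n \<alpha>) \<alpha> = sig n \<alpha> (n div 2)"
proof -
  have "n div 2 \<noteq> 0" using n by linarith
  with level_case_unique[OF n \<alpha>(2) order.refl] obtain i e where
      U: "\<And>i' e'. level_case n \<alpha> (n div 2) i' e' \<longleftrightarrow> i' = i \<and> e' = e"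
      and sg: "tau n \<alpha> (n div 2) \<noteq> 0 \<longrightarrow> sig n \<alpha> (n div 2) = pair_shift n \<alpha> i e"
    by blast
  have "tau n \<alpha> (n div 2) \<noteq> 0" using tau_comps_parity(2)[OF \<alpha>] s by auto
  with sg have sg: "sig n \<alpha> (n div 2) = pair_shift n \<alpha> i e" by blast
  define m where "m = 2 * i + 1 + (of_bool e :: nat)"
  have lc: "i \<le> half n" "pair_type n \<alpha> i e" using U[of i e] unfolding level_case_def by auto
  have mn: "m \<le> n"
  proof (cases "i < n div 2")
    case True
    then show ?thesis unfolding m_def by (cases e) auto
  next
    case False
    then have "\<not> e" using lc(2) by (simp add: pair_type_def)
    then show ?thesis using lc(1) n unfolding m_def half_def by simp
  qed
  have "case_index n \<alpha> = m"
    unfolding case_index_def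
  proof (rule the_equality)
    show "1 \<le> m \<and> m \<le> n \<and> kcase n m \<alpha>" using mn kcase_iff[OF n \<alpha> s m_def mn] U by (simp add: m_def)
    fix m' assume m': "1 \<le> m' \<and> m' \<le> n \<and> kcase n m' \<alpha>"
    define i' where "i' = (m' - 1) div 2"
    define e' where "e' \<longleftrightarrow> even m'"
    have "m' = 2 * i' + 1 + of_bool e'"
      using m' unfolding i'_def e'_def by (cases "even m'") (auto elim!: evenE oddE)
    then have "level_case n \<alpha> (n div 2) i' e'" using kcase_iff[OF n \<alpha> s, of m' i' e'] m' by blast
    then have "i' = i" "e' = e" unfolding U by auto
    then show "m' = m" unfolding m_def using \<open>m' = 2 * i' + 1 + of_bool e'\<close> by simp
  qed
  moreover have "case_shift n m \<alpha> = pair_shift n \<alpha> i e"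
  proof -
    have "(m + 1) div 2 = i + 1" "(-1 :: int) ^ (m - 1) = (if e then -1 else 1)" "n - (i + 1) + 1 = n - i"
      using lc(1) n unfolding m_def half_def by (cases e; simp)+
    then show ?thesis unfolding case_shift_def pair_shift_def Let_def by simp
  qed
  ultimately show ?thesis using sg by simp
qed

section \<open>Reduction modulo the inverse of q\<close>

lemma cx_x_neq: "cx_x \<noteq> 1" "cx_x \<noteq> - 1"
proof -
  have sq: "cx_x ^ 2 \<noteq> 1"
  proof
    assume "cx_x ^ 2 = 1"
    then have "const_x (cx_x ^ 2) = 1" by simp
    then have "xx ^ 2 = 1" unfolding power2_eq_square const_x_mult xx_eq_const .
    then show False using qq_powi_xx_neq[of 2 0 0] by simp
  qed
  show "cx_x \<noteq> 1" using sq by (metis power_one)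
  show "cx_x \<noteq> - 1" using sq by (metis power2_minus power_one)
qed

text \<open>The reduction of one factor of \<open>eigval\<close>, from comparing the degrees s - 1
  and 2i: x / x^{-1} if the former dominates, 1 if the latter does, and (x - e) / (x^{-1} - e) = - e
  x in case of a tie.\<close>

definition edge :: "nat \<Rightarrow> cx \<Rightarrow> nat \<Rightarrow> cx" where
  "edge s e i = (if 2 * i + 1 < s then cx_x\<^sup>2 else if 2 * i + 1 = s then - e * cx_x else 1)"

lemma eigval_factor_lead:
  assumes e: "e = 1 \<or> e = -1"
  shows "lead_q 0 ((qq powi (int s - 1) * xx - const_x e * qq ^ (2 * i))
     / (qq powi (int s - 1) * inverse xx - const_x e * qq ^ (2 * i))) (edge s e i)"
proof -
  have x1: "lead_q (int s - 1) (qq powi (int s - 1) * xx) cx_x"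
    using lead_q_qpow_mult[OF lead_q_const_x[of cx_x], of "int s - 1"] by (simp add: xx_eq_const)
  have x2: "lead_q (int s - 1) (qq powi (int s - 1) * inverse xx) (inverse cx_x)"
    using lead_q_qpow_mult[OF lead_q_inverse[OF lead_q_const_x[of cx_x] cx_x_nonzero], of "int s - 1"] by (simp add: xx_eq_const)
  have q: "lead_q (int (2 * i)) (const_x e * qq ^ (2 * i)) e"
    using lead_q_mult[OF lead_q_const_x[of e] lead_q_qpow[of "int (2 * i)"]] unfolding power_int_of_nat by simp
  have e0: "e \<noteq> 0" "e * e = 1" using e by auto
  have xe: "cx_x \<noteq> e" using e cx_x_neq by auto
  have xi: "inverse cx_x - e \<noteq> 0"
  proof
    assume "inverse cx_x - e = 0"
    then have "inverse cx_x = e" by simp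
    then have "cx_x = inverse e" by (metis inverse_inverse_eq)
    then show False using xe e by auto
  qed
  consider "2 * i + 1 < s" | "2 * i + 1 = s" | "s < 2 * i + 1" by linarith
  then show ?thesis
  proof cases
    case 1
    then have "lead_q (int s - 1) (const_x e * qq ^ (2 * i)) 0" by (intro lead_q_lower[OF q]) simp
    from lead_q_divide[OF lead_q_diff[OF x1 this] lead_q_diff[OF x2 this]] show ?thesis
      using 1 cx_x_nonzero by (simp add: edge_def power2_eq_square divide_inverse)
  next
    case 2
    then have "int (2 * i) = int s - 1" by simp
    then have "lead_q (int s - 1) (const_x e * qq ^ (2 * i)) e" using q by simp
    from lead_q_divide[OF lead_q_diff[OF x1 this] lead_q_diff[OF x2 this] xi]
    have L: "lead_q 0 ((qq powi (int s - 1) * xx - const_x e * qq ^ (2 * i))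
       / (qq powi (int s - 1) * inverse xx - const_x e * qq ^ (2 * i))) ((cx_x - e) / (inverse cx_x - e))" by simp
    have "(cx_x - e) = (- e * cx_x) * (inverse cx_x - e)"
      using e0 cx_x_nonzero by (simp add: algebra_simps)
    then have "(cx_x - e) / (inverse cx_x - e) = - e * cx_x"
      using xi by (simp add: nonzero_divide_eq_eq)
    then show ?thesis using L 2 by (simp add: edge_def)
  next
    case 3
    then have l: "int s - 1 < int (2 * i)" by simp
    from lead_q_divide[OF lead_q_diff[OF lead_q_lower[OF x1 l] q] lead_q_diff[OF lead_q_lower[OF x2 l] q]] show ?thesis
      using 3 e0 by (simp add: edge_def)
  qed
qed

lemma lead_q_prod:
  "(\<And>i. i < k \<Longrightarrow> lead_q 0 (r i) (L i)) \<Longrightarrow> lead_q 0 (\<Prod>i<k. r i) (\<Prod>i<(k::nat). L i)"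
proof (induction k)
  case (Suc k)
  have "lead_q (0 + 0) ((\<Prod>i<k. r i) * r k) ((\<Prod>i<k. L i) * L k)"
    by (rule lead_q_mult) (use Suc in auto)
  then show ?case by simp
qed (simp add: lead_q_one)

lemma prod_edge:
  "(\<Prod>i<k. edge s e i) = cx_x ^ (2 * min k (s div 2)) * (if odd s \<and> s div 2 < k then - e * cx_x else 1)"
proof (induction k)
  case (Suc k)
  consider "2 * k + 1 < s" | "2 * k + 1 = s" | "s < 2 * k + 1" by linarith
  then show ?case
  proof cases
    case 1
    then have "min (Suc k) (s div 2) = Suc k" "min k (s div 2) = k" "\<not> s div 2 < Suc k" "\<not> s div 2 < k" by auto
    then show ?thesis using Suc 1 by (simp add: edge_def power2_eq_square)
  next
    case 2
    then have s: "s = 2 * k + 1" by simp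
    show ?thesis using Suc unfolding s by (simp add: edge_def)
  next
    case 3
    then have "s div 2 \<le> k" "odd s \<Longrightarrow> s div 2 < k" by (auto elim!: oddE)
    then have "min (Suc k) (s div 2) = s div 2" "min k (s div 2) = s div 2"
      "(odd s \<and> s div 2 < Suc k) = (odd s \<and> s div 2 < k)" by auto
    then show ?thesis using Suc 3 by (simp add: edge_def)
  qed
qed simp

text \<open>For odd s the tie 2i = s - 1 occurs in the longer of the two products only, and this
  factor carries the sign \<epsilon>. The constant in front is independent of k and j and brings the
  exponent to the form of \<open>energy_comps\<close>.\<close>

lemma eigval_lead:
  assumes kj: "k + j = s" "int k - int j = \<epsilon> * \<tau>" and \<tau>: "0 \<le> \<tau>" and \<epsilon>: "\<epsilon> = 1 \<or> \<epsilon> = -1"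
  shows "lead_q 0 (const_x ((-1) ^ s * cx_x powi (of_bool (odd s) - 2 * int s)) * eigval s k j)
    (of_int \<epsilon> ^ s * cx_x powi (of_bool (odd s) - \<tau>))"
proof -
  define r where "r e i = (qq powi (int s - 1) * xx - const_x e * qq ^ (2 * i))
     / (qq powi (int s - 1) * inverse xx - const_x e * qq ^ (2 * i))" for e i
  have "const_x (-1) + const_x 1 = 0" unfolding const_x_add[symmetric] by simp
  then have m1: "const_x (-1) = -1" by (simp add: eq_neg_iff_add_eq_0)
  have ev: "eigval s k j = (\<Prod>i<k. r 1 i) * (\<Prod>i<j. r (-1) i)"
    unfolding eigval_def eigP_def r_def prod_dividef m1 const_x_1 by simp
  have L: "lead_q 0 (eigval s k j) ((\<Prod>i<k. edge s 1 i) * (\<Prod>i<j. edge s (-1) i))"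
  proof -
    have r: "lead_q 0 (r e i) (edge s e i)" if "e = 1 \<or> e = -1" for e i
      unfolding r_def by (rule eigval_factor_lead[OF that])
    have "lead_q 0 (\<Prod>i<k. r 1 i) (\<Prod>i<k. edge s 1 i)" by (rule lead_q_prod, rule r, simp)
    moreover have "lead_q 0 (\<Prod>i<j. r (-1) i) (\<Prod>i<j. edge s (-1) i)" by (rule lead_q_prod, rule r, simp)
    ultimately have "lead_q (0 + 0) (eigval s k j) ((\<Prod>i<k. edge s 1 i) * (\<Prod>i<j. edge s (-1) i))"
      unfolding ev by (rule lead_q_mult)
    then show ?thesis by (simp only: add_0)
  qed
  have "(-1) ^ s * cx_x powi (of_bool (odd s) - 2 * int s) * ((\<Prod>i<k. edge s 1 i) * (\<Prod>i<j. edge s (-1) i))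
    = of_int \<epsilon> ^ s * cx_x powi (of_bool (odd s) - \<tau>)"
  proof (cases "even s")
    case True
    obtain h where h: "s = 2 * h" using True by (elim evenE)
    then have hs: "s div 2 = h" by simp
    have "2 * int (min k (s div 2)) + 2 * int (min j (s div 2)) = 2 * int s - \<tau>"
    proof (cases "\<epsilon> = 1")
      case True
      then have "j \<le> h" "h \<le> k" using kj \<tau> h by auto
      then show ?thesis unfolding hs using kj True h by (simp add: min_def)
    next
      case False
      then have e: "\<epsilon> = -1" using \<epsilon> by simp
      then have "k \<le> h" "h \<le> j" using kj \<tau> h by auto
      then show ?thesis unfolding hs using kj e h by (simp add: min_def)
    qed
    then have p: "int (2 * min k (s div 2) + 2 * min j (s div 2)) = 2 * int s - \<tau>" by simp
    have "(\<Prod>i<k. edge s 1 i) * (\<Prod>i<j. edge s (-1) i) = cx_x ^ (2 * min k (s div 2) + 2 * min j (s div 2))"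
      unfolding prod_edge using True by (simp add: power_add)
    also have "\<dots> = cx_x powi (2 * int s - \<tau>)" unfolding p[symmetric] power_int_of_nat ..
    finally have "cx_x powi (- 2 * int s) * ((\<Prod>i<k. edge s 1 i) * (\<Prod>i<j. edge s (-1) i)) = cx_x powi (- \<tau>)"
      using cx_x_nonzero by (simp add: power_int_add[symmetric])
    moreover have "(of_int \<epsilon> :: cx) ^ s = 1" using \<epsilon> True by auto
    ultimately show ?thesis using True by simp
  next
    case False
    obtain h where h: "s = 2 * h + 1" using False by (elim oddE)
    then have hs: "s div 2 = h" by simp
    have t0: "\<tau> \<noteq> 0"
    proof
      assume "\<tau> = 0"
      then have "k = j" using kj(2) by simp
      then show False using kj(1) h by presburger
    qed
    have ord: "if \<epsilon> = 1 then j \<le> h \<and> h < k else k \<le> h \<and> h < j"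
    proof (cases "\<epsilon> = 1")
      case True
      then show ?thesis using kj \<tau> h t0 by auto
    next
      case False
      then have "\<epsilon> = -1" using \<epsilon> by simp
      then show ?thesis using kj \<tau> h t0 by auto
    qed
    have "2 * int (min k (s div 2)) + 2 * int (min j (s div 2)) + 1 = 2 * int s - \<tau>"
    proof (cases "\<epsilon> = 1")
      case True
      then have "j \<le> h" "h < k" using ord by auto
      then show ?thesis unfolding hs using kj True h by (simp add: min_def)
    next
      case False
      then have e: "\<epsilon> = -1" using \<epsilon> by simp
      have "k \<le> h" "h < j" using ord False by auto
      then show ?thesis unfolding hs using kj e h by (simp add: min_def)
    qed
    then have p: "int (2 * min k (s div 2) + 2 * min j (s div 2) + 1) = 2 * int s - \<tau>" by simp
    have sg: "(if s div 2 < k then - 1 * cx_x else 1) * (if s div 2 < j then - (-1) * cx_x else 1) = - of_int \<epsilon> * cx_x"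
    proof (cases "\<epsilon> = 1")
      case True
      then have "s div 2 < k" "\<not> s div 2 < j" using ord hs by auto
      then show ?thesis using True by simp
    next
      case f: False
      then have "\<not> s div 2 < k" "s div 2 < j" using ord hs by auto
      then show ?thesis using f \<epsilon> by simp
    qed
    have "(\<Prod>i<k. edge s 1 i) * (\<Prod>i<j. edge s (-1) i)
      = cx_x ^ (2 * min k (s div 2)) * cx_x ^ (2 * min j (s div 2))
        * ((if s div 2 < k then - 1 * cx_x else 1) * (if s div 2 < j then - (-1) * cx_x else 1))"
      unfolding prod_edge using False by (simp only: simp_thms mult_ac)
    also have "\<dots> = - of_int \<epsilon> * cx_x ^ (2 * min k (s div 2) + 2 * min j (s div 2) + 1)"
      unfolding sg by (simp add: power_add)
    also have "cx_x ^ (2 * min k (s div 2) + 2 * min j (s div 2) + 1) = cx_x powi (2 * int s - \<tau>)"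
      unfolding p[symmetric] power_int_of_nat ..
    finally have "cx_x powi (1 - 2 * int s) * ((\<Prod>i<k. edge s 1 i) * (\<Prod>i<j. edge s (-1) i))
      = - of_int \<epsilon> * (cx_x powi (1 - 2 * int s) * cx_x powi (2 * int s - \<tau>))" by simp
    also have "cx_x powi (1 - 2 * int s) * cx_x powi (2 * int s - \<tau>) = cx_x powi (1 - \<tau>)"
      using cx_x_nonzero by (simp add: power_int_add[symmetric])
    finally have x: "cx_x powi (1 - 2 * int s) * ((\<Prod>i<k. edge s 1 i) * (\<Prod>i<j. edge s (-1) i))
      = - of_int \<epsilon> * cx_x powi (1 - \<tau>)" .
    have "(of_int \<epsilon> :: cx) ^ s = of_int \<epsilon>" using \<epsilon> False by auto
    then show ?thesis using False x by (simp add: mult.assoc)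
  qed
  note E = this
  show ?thesis
    using lead_q_mult[OF lead_q_const_x[of "(-1) ^ s * cx_x powi (of_bool (odd s) - 2 * int s)"] L]
    unfolding E by (simp only: add_0)
qed

text \<open>Elimination over the local ring at q^{-1} = 0: a matrix that reduces to the identity has
  unit pivots, and each step preserves the reductions, so the solution c reduces like f.\<close>

lemma unitriangular_solve:
  fixes M :: "'b \<Rightarrow> 'b \<Rightarrow> cqx"
  assumes "finite B"
  shows "(\<And>\<alpha> \<beta>. \<alpha> \<in> B \<Longrightarrow> \<beta> \<in> B \<Longrightarrow> lead_q 0 (M \<alpha> \<beta>) (if \<alpha> = \<beta> then 1 else 0))
    \<Longrightarrow> (\<And>\<beta>. \<beta> \<in> B \<Longrightarrow> lead_q 0 (f \<beta>) (\<phi> \<beta>))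
    \<Longrightarrow> \<exists>c. (\<forall>\<alpha>\<in>B. lead_q 0 (c \<alpha>) (\<phi> \<alpha>)) \<and> (\<forall>\<beta>\<in>B. f \<beta> = (\<Sum>\<alpha>\<in>B. c \<alpha> * M \<alpha> \<beta>))"
  using assms
proof (induction B arbitrary: M f rule: finite_induct)
  case (insert x B)
  have Mxx: "lead_q 0 (M x x) 1" using insert.prems(1)[of x x] by simp
  have nz: "M x x \<noteq> 0" using lead_q_nonzero[OF Mxx] by simp
  have row: "lead_q 0 (M x \<beta>) 0" and col: "lead_q 0 (M \<beta> x) 0" if "\<beta> \<in> B" for \<beta>
    using insert.prems(1)[of x \<beta>] insert.prems(1)[of \<beta> x] that insert.hyps(2) by (auto split: if_splits)
  define M' where "M' \<alpha> \<beta> = M \<alpha> \<beta> - M \<alpha> x / M x x * M x \<beta>" for \<alpha> \<beta>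
  define f' where "f' \<beta> = f \<beta> - f x / M x x * M x \<beta>" for \<beta>
  have M': "lead_q 0 (M' \<alpha> \<beta>) (if \<alpha> = \<beta> then 1 else 0)" if "\<alpha> \<in> B" "\<beta> \<in> B" for \<alpha> \<beta>
    using lead_q_diff[OF insert.prems(1)[of \<alpha> \<beta>] lead_q_mult[OF lead_q_divide[OF col[OF that(1)] Mxx] row[OF that(2)], simplified]] that
    unfolding M'_def by simp
  have f': "lead_q 0 (f' \<beta>) (\<phi> \<beta>)" if "\<beta> \<in> B" for \<beta>
    using lead_q_diff[OF insert.prems(2)[of \<beta>] lead_q_mult[OF lead_q_divide[OF insert.prems(2)[of x] Mxx] row[OF that], simplified]] that
    unfolding f'_def by simp
  obtain c where c: "\<And>\<alpha>. \<alpha> \<in> B \<Longrightarrow> lead_q 0 (c \<alpha>) (\<phi> \<alpha>)" "\<And>\<beta>. \<beta> \<in> B \<Longrightarrow> f' \<beta> = (\<Sum>\<alpha>\<in>B. c \<alpha> * M' \<alpha> \<beta>)"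
    using insert.IH[of M' f', OF M' f'] by blast
  define cx where "cx = (f x - (\<Sum>\<alpha>\<in>B. c \<alpha> * M \<alpha> x)) / M x x"
  have "lead_q 0 (\<Sum>\<alpha>\<in>B. c \<alpha> * M \<alpha> x) (\<Sum>\<alpha>\<in>B. 0)"
  proof (rule lead_q_sum)
    fix \<alpha> assume "\<alpha> \<in> B"
    from lead_q_mult[OF c(1)[OF this] col[OF this]] show "lead_q 0 (c \<alpha> * M \<alpha> x) 0" by simp
  qed
  then have cx: "lead_q 0 cx (\<phi> x)"
    using lead_q_divide[OF lead_q_diff[OF insert.prems(2)[of x]] Mxx] unfolding cx_def by fastforce
  define c' where "c' \<alpha> = (if \<alpha> = x then cx else c \<alpha>)" for \<alpha>
  have sum': "(\<Sum>\<alpha>\<in>insert x B. c' \<alpha> * M \<alpha> \<beta>) = cx * M x \<beta> + (\<Sum>\<alpha>\<in>B. c \<alpha> * M \<alpha> \<beta>)" for \<beta>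
  proof -
    have "(\<Sum>\<alpha>\<in>B. c' \<alpha> * M \<alpha> \<beta>) = (\<Sum>\<alpha>\<in>B. c \<alpha> * M \<alpha> \<beta>)"
      using insert.hyps(2) by (intro sum.cong) (auto simp: c'_def)
    then show ?thesis using insert.hyps by (simp add: c'_def)
  qed
  have "f \<beta> = cx * M x \<beta> + (\<Sum>\<alpha>\<in>B. c \<alpha> * M \<alpha> \<beta>)" if "\<beta> \<in> insert x B" for \<beta>
  proof (cases "\<beta> = x")
    case True
    then show ?thesis using nz by (simp add: cx_def)
  next
    case False
    then have "\<beta> \<in> B" using that by simp
    from c(2)[OF this] have "f \<beta> = f x / M x x * M x \<beta> + (\<Sum>\<alpha>\<in>B. c \<alpha> * (M \<alpha> \<beta> - M \<alpha> x / M x x * M x \<beta>))"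
      unfolding f'_def M'_def by (simp add: algebra_simps)
    also have "(\<Sum>\<alpha>\<in>B. c \<alpha> * (M \<alpha> \<beta> - M \<alpha> x / M x x * M x \<beta>))
      = (\<Sum>\<alpha>\<in>B. c \<alpha> * M \<alpha> \<beta>) - (\<Sum>\<alpha>\<in>B. c \<alpha> * M \<alpha> x) / M x x * M x \<beta>"
      by (simp add: sum_subtractf right_diff_distrib sum_distrib_right sum_divide_distrib mult.assoc)
    finally show ?thesis by (simp add: cx_def diff_divide_distrib left_diff_distrib)
  qed
  then show ?case using c(1) cx sum' by (intro exI[of _ c']) (auto simp: c'_def)
qed simp

section \<open>The family of eigenvectors and the reduced map\<close>

lemma comps_nonneg: "\<alpha> \<in> comps n s \<Longrightarrow> \<forall>k. 0 \<le> \<alpha> k"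
proof
  fix k assume "\<alpha> \<in> comps n s"
  then show "0 \<le> \<alpha> k" unfolding comps_def by (cases "k \<in> {1..n}") auto
qed

definition refl_map :: "nat \<Rightarrow> nat \<Rightarrow> (nat \<Rightarrow> int) \<Rightarrow> nat \<Rightarrow> int" where
  "refl_map n s \<alpha> = (if even s then \<alpha> else sig n \<alpha> (n div 2))"

lemma refl_map_comps:
  assumes \<alpha>: "\<alpha> \<in> comps n s"
  shows "refl_map n s \<alpha> \<in> comps n s" "refl_map n s (refl_map n s \<alpha>) = \<alpha>"
    "tau n (refl_map n s \<alpha>) (n div 2) = tau n \<alpha> (n div 2)"
proof -
  note inv = tau_sig_involution[OF comps_nonneg[OF \<alpha>], of "n div 2" n, OF order.refl]
  show "refl_map n s \<alpha> \<in> comps n s"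
  proof (cases "even s")
    case True
    then show ?thesis using \<alpha> by (simp only: refl_map_def if_True)
  next
    case False
    then show ?thesis using sig_comps[OF \<alpha> comps_nonneg[OF \<alpha>]] by (simp only: refl_map_def if_False)
  qed
  show "refl_map n s (refl_map n s \<alpha>) = \<alpha>"
  proof (cases "even s")
    case True
    then show ?thesis by (simp only: refl_map_def if_True)
  next
    case False
    then show ?thesis by (simp only: refl_map_def if_False inv)
  qed
  show "tau n (refl_map n s \<alpha>) (n div 2) = tau n \<alpha> (n div 2)"
  proof (cases "even s")
    case True
    then show ?thesis by (simp only: refl_map_def if_True)
  next
    case False
    then show ?thesis by (simp only: refl_map_def if_False inv)
  qed
qed

lemma energy_comps:
  assumes n: "n \<ge> 3" and \<alpha>: "\<alpha> \<in> comps n s"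
  shows "energy n s \<alpha> = of_bool (odd s) - tau n \<alpha> (n div 2)"
  by (rule energy_tau[OF comps_nonneg[OF \<alpha>] n tau_comps_parity(2)[OF \<alpha> comps_nonneg[OF \<alpha>]]])

definition eigen_family :: "nat \<Rightarrow> nat \<Rightarrow> ((nat \<Rightarrow> int) \<Rightarrow> int \<Rightarrow> (nat \<Rightarrow> int) \<Rightarrow> cqx) \<Rightarrow> bool" where
  "eigen_family n s G \<longleftrightarrow> (\<forall>\<alpha>\<in>comps n s. \<forall>\<epsilon>\<in>{1, -1}. G \<alpha> \<epsilon> \<in> vspan (comps n s) \<and>
     (\<exists>k j. k + j = s \<and> int k - int j = \<epsilon> * tau n \<alpha> (n div 2) \<and>
       (\<forall>\<beta>\<in>comps n s. Zfull n (G \<alpha> \<epsilon>) \<beta> = q_int (int k - int j) * G \<alpha> \<epsilon> \<beta>)) \<and>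
     (\<forall>\<beta>\<in>comps n s. lead_q 0 (G \<alpha> \<epsilon> \<beta>)
        (((if \<alpha> = \<beta> then 1 else 0) + of_int \<epsilon> * (if sig n \<alpha> (n div 2) = \<beta> then 1 else 0)) / 2)))"

lemma choice2:
  assumes "\<And>a b. \<exists>g. P a b g"
  shows "\<exists>G. \<forall>a b. P a b (G a b)"
proof -
  have "P a b (SOME g. P a b g)" for a b using assms[of a b] by (rule someI_ex)
  then show ?thesis by (intro exI[of _ "\<lambda>a b. SOME g. P a b g"] allI)
qed

lemma eigen_family_exists:
  assumes n: "n \<ge> 3"
  shows "\<exists>G. eigen_family n s G"
proof -
  have "\<exists>g. \<alpha> \<in> comps n s \<and> \<epsilon> \<in> {1, -1} \<longrightarrow> g \<in> vspan (comps n s) \<and>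
     (\<exists>k j. k + j = s \<and> int k - int j = \<epsilon> * tau n \<alpha> (n div 2) \<and>
       (\<forall>\<beta>\<in>comps n s. Zfull n g \<beta> = q_int (int k - int j) * g \<beta>)) \<and>
     (\<forall>\<beta>\<in>comps n s. lead_q 0 (g \<beta>)
        (((if \<alpha> = \<beta> then 1 else 0) + of_int \<epsilon> * (if sig n \<alpha> (n div 2) = \<beta> then 1 else 0)) / 2))" for \<alpha> \<epsilon>
  proof (cases "\<alpha> \<in> comps n s \<and> \<epsilon> \<in> {1, -1}")
    case True
    define \<tau> where "\<tau> = tau n \<alpha> (n div 2)"
    have \<epsilon>: "\<epsilon> = 1 \<or> \<epsilon> = -1" using True by simp
    have \<alpha>: "\<alpha> \<in> comps n s" using True by simp
    have b: "\<tau> \<le> int s" "even (\<tau> - int s)" "0 \<le> \<tau>"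
      using tau_comps_parity[OF \<alpha> comps_nonneg[OF \<alpha>]] tau_nonneg[OF comps_nonneg[OF \<alpha>]] by (auto simp: \<tau>_def)
    define k where "k = nat ((int s + \<epsilon> * \<tau>) div 2)"
    define j where "j = nat ((int s - \<epsilon> * \<tau>) div 2)"
    obtain u where u: "\<tau> - int s = 2 * u" using b(2) by (elim evenE)
    have h: "(int s + \<tau>) div 2 = \<tau> - u" "(int s - \<tau>) div 2 = - u" "u \<le> 0" using u b(1) by auto
    have kj: "k + j = s" "int k - int j = \<epsilon> * \<tau>"
    proof -
      have "int k = (if \<epsilon> = 1 then \<tau> - u else - u)" "int j = (if \<epsilon> = 1 then - u else \<tau> - u)"
        using \<epsilon> h b(3) unfolding k_def j_def by auto
      then show "int k - int j = \<epsilon> * \<tau>" "k + j = s" using \<epsilon> u by (auto split: if_splits)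
    qed
    have n2: "n \<ge> 2" using n by simp
    from comps_eigenvector[OF n2 \<alpha> \<epsilon>] obtain g where g: "g \<in> vspan (comps n s)"
      "\<forall>\<beta>\<in>comps n s. Zfull n g \<beta> = q_int (\<epsilon> * \<tau>) * g \<beta>"
      "\<forall>\<beta>\<in>comps n s. lead_q 0 (g \<beta>)
        (((if \<alpha> = \<beta> then 1 else 0) + of_int \<epsilon> * (if sig n \<alpha> (n div 2) = \<beta> then 1 else 0)) / 2)"
      unfolding \<tau>_def by blast
    have "k + j = s \<and> int k - int j = \<epsilon> * tau n \<alpha> (n div 2) \<and>
       (\<forall>\<beta>\<in>comps n s. Zfull n g \<beta> = q_int (int k - int j) * g \<beta>)"
      using kj g(2) by (simp add: \<tau>_def)
    then show ?thesis using g(1,3) by blast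
  qed blast
  then have "\<exists>G. \<forall>\<alpha> \<epsilon>. \<alpha> \<in> comps n s \<and> \<epsilon> \<in> {1, -1} \<longrightarrow> G \<alpha> \<epsilon> \<in> vspan (comps n s) \<and>
     (\<exists>k j. k + j = s \<and> int k - int j = \<epsilon> * tau n \<alpha> (n div 2) \<and>
       (\<forall>\<beta>\<in>comps n s. Zfull n (G \<alpha> \<epsilon>) \<beta> = q_int (int k - int j) * G \<alpha> \<epsilon> \<beta>)) \<and>
     (\<forall>\<beta>\<in>comps n s. lead_q 0 (G \<alpha> \<epsilon> \<beta>)
        (((if \<alpha> = \<beta> then 1 else 0) + of_int \<epsilon> * (if sig n \<alpha> (n div 2) = \<beta> then 1 else 0)) / 2))"
    by (rule choice2)
  then obtain G where G: "\<forall>\<alpha> \<epsilon>. \<alpha> \<in> comps n s \<and> \<epsilon> \<in> {1, -1} \<longrightarrow> G \<alpha> \<epsilon> \<in> vspan (comps n s) \<and>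
     (\<exists>k j. k + j = s \<and> int k - int j = \<epsilon> * tau n \<alpha> (n div 2) \<and>
       (\<forall>\<beta>\<in>comps n s. Zfull n (G \<alpha> \<epsilon>) \<beta> = q_int (int k - int j) * G \<alpha> \<epsilon> \<beta>)) \<and>
     (\<forall>\<beta>\<in>comps n s. lead_q 0 (G \<alpha> \<epsilon> \<beta>)
        (((if \<alpha> = \<beta> then 1 else 0) + of_int \<epsilon> * (if sig n \<alpha> (n div 2) = \<beta> then 1 else 0)) / 2))"
    by (elim exE)
  show ?thesis unfolding eigen_family_def
    by (intro exI[of _ G] ballI, rule G[THEN spec, THEN spec, THEN mp], rule conjI)
qed

text \<open>The sum over both signs reduces to b_\<alpha>, so these sums form a basis of the
  lattice, and the coefficients of f in it reduce like its coordinates.\<close>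

lemma eigen_family_expand:
  assumes G: "eigen_family n s G" and f: "f \<in> vspan (comps n s)"
    and \<phi>: "\<And>\<beta>. \<beta> \<in> comps n s \<Longrightarrow> lead_q 0 (f \<beta>) (\<phi> \<beta>)"
  shows "\<exists>c. (\<forall>\<alpha>\<in>comps n s. lead_q 0 (c \<alpha>) (\<phi> \<alpha>)) \<and>
    f = (\<lambda>\<beta>. \<Sum>\<alpha>\<in>comps n s. c \<alpha> * (G \<alpha> 1 \<beta> + G \<alpha> (-1) \<beta>))"
proof -
  have M: "lead_q 0 (G \<alpha> 1 \<beta> + G \<alpha> (-1) \<beta>) (if \<alpha> = \<beta> then 1 else 0)"
    if "\<alpha> \<in> comps n s" "\<beta> \<in> comps n s" for \<alpha> \<beta>
  proof -
    have h: "(x + of_int 1 * y) / 2 + (x + of_int (-1) * y) / 2 = x" for x y :: cx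
      using two_neq_0_cx by (simp add: field_simps)
    have "lead_q 0 (G \<alpha> \<epsilon> \<beta>) (((if \<alpha> = \<beta> then 1 else 0) + of_int \<epsilon> * (if sig n \<alpha> (n div 2) = \<beta> then 1 else 0)) / 2)"
      if "\<epsilon> \<in> {1, -1}" for \<epsilon>
      using G that \<open>\<alpha> \<in> comps n s\<close> \<open>\<beta> \<in> comps n s\<close> unfolding eigen_family_def by blast
    from lead_q_add[OF this[of 1] this[of "-1"]] show ?thesis unfolding h by simp
  qed
  obtain c where c: "\<forall>\<alpha>\<in>comps n s. lead_q 0 (c \<alpha>) (\<phi> \<alpha>)"
      "\<forall>\<beta>\<in>comps n s. f \<beta> = (\<Sum>\<alpha>\<in>comps n s. c \<alpha> * (G \<alpha> 1 \<beta> + G \<alpha> (-1) \<beta>))"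
  proof -
    have "\<exists>c. (\<forall>\<alpha>\<in>comps n s. lead_q 0 (c \<alpha>) (\<phi> \<alpha>)) \<and> (\<forall>\<beta>\<in>comps n s. f \<beta> = (\<Sum>\<alpha>\<in>comps n s. c \<alpha> * (G \<alpha> 1 \<beta> + G \<alpha> (-1) \<beta>)))"
      by (rule unitriangular_solve[OF finite_comps]) (erule (1) M, erule \<phi>)
    then show ?thesis using that by (elim exE conjE)
  qed
  have z: "G \<alpha> 1 \<beta> + G \<alpha> (-1) \<beta> = 0" if "\<alpha> \<in> comps n s" "\<beta> \<notin> comps n s" for \<alpha> \<beta>
  proof -
    have "G \<alpha> 1 \<in> vspan (comps n s)" "G \<alpha> (-1) \<in> vspan (comps n s)"
      using G that(1) unfolding eigen_family_def by auto
    then show ?thesis using that(2) by (simp add: vspan_def)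
  qed
  have "f = (\<lambda>\<beta>. \<Sum>\<alpha>\<in>comps n s. c \<alpha> * (G \<alpha> 1 \<beta> + G \<alpha> (-1) \<beta>))"
  proof
    fix \<beta>
    show "f \<beta> = (\<Sum>\<alpha>\<in>comps n s. c \<alpha> * (G \<alpha> 1 \<beta> + G \<alpha> (-1) \<beta>))"
    proof (cases "\<beta> \<in> comps n s")
      case True
      then show ?thesis using c(2) by blast
    next
      case False
      then have "f \<beta> = 0" using f by (simp add: vspan_def)
      also have "0 = (\<Sum>\<alpha>\<in>comps n s. c \<alpha> * (G \<alpha> 1 \<beta> + G \<alpha> (-1) \<beta>))"
        by (intro sum.neutral[symmetric] ballI) (simp only: z[OF _ False] mult_zero_right)
      finally show ?thesis .
    qed
  qed
  then show ?thesis using c(1) by blast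
qed

text \<open>In the sum over both signs the factor \<epsilon>^s of the eigenvalue selects one of the
  two terms of b_\<alpha> + \<epsilon> b_{\<sigma>\<alpha>}; the expansion in these sums carries the
  result over to every lattice vector.\<close>

lemma K_reduction:
  assumes n: "n \<ge> 3" and s: "s \<ge> 1" and \<kappa>: "quantum_K_matrix n s \<kappa>"
  shows "\<exists>c. c \<noteq> 0 \<and> (\<forall>f \<phi>. f \<in> vspan (comps n s) \<longrightarrow> (\<forall>\<beta>\<in>comps n s. lead_q 0 (f \<beta>) (\<phi> \<beta>)) \<longrightarrow>
    (\<forall>\<beta>\<in>comps n s. lead_q 0 (c * lin (comps n s) \<kappa> f \<beta>)
       (\<Sum>\<alpha>\<in>comps n s. \<phi> \<alpha> * (cx_x powi energy n s \<alpha> * (if refl_map n s \<alpha> = \<beta> then 1 else 0)))))"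
proof -
  obtain G where G: "eigen_family n s G" using eigen_family_exists[OF n] by blast
  obtain C where C: "C \<noteq> 0" "\<And>g k j. g \<in> vspan (comps n s) \<Longrightarrow> k + j = s \<Longrightarrow>
     (\<forall>\<beta>\<in>comps n s. Zfull n g \<beta> = q_int (int k - int j) * g \<beta>) \<Longrightarrow>
     lin (comps n s) \<kappa> g = (\<lambda>\<beta>. C * eigval s k j * g \<beta>)"
    using quantum_K_eigen[OF n s \<kappa>] by blast
  define p where "p = const_x ((-1) ^ s * cx_x powi (of_bool (odd s) - 2 * int s))"
  have p: "p \<noteq> 0" using cx_x_nonzero by (simp add: p_def)
  have red: "lead_q 0 (p * inverse C * lin (comps n s) \<kappa> (G \<alpha> \<epsilon>) \<beta>) (of_int \<epsilon> ^ s * cx_x powi energy n s \<alpha> *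
      (((if \<alpha> = \<beta> then 1 else 0) + of_int \<epsilon> * (if sig n \<alpha> (n div 2) = \<beta> then 1 else 0)) / 2))"
    if \<alpha>: "\<alpha> \<in> comps n s" and \<beta>: "\<beta> \<in> comps n s" and \<epsilon>: "\<epsilon> = 1 \<or> \<epsilon> = -1" for \<alpha> \<beta> \<epsilon>
  proof -
    have e: "\<epsilon> \<in> {1, -1}" using \<epsilon> by simp
    obtain k j where kj: "k + j = s" "int k - int j = \<epsilon> * tau n \<alpha> (n div 2)"
      and Z: "\<forall>\<beta>\<in>comps n s. Zfull n (G \<alpha> \<epsilon>) \<beta> = q_int (int k - int j) * G \<alpha> \<epsilon> \<beta>"
      and v: "G \<alpha> \<epsilon> \<in> vspan (comps n s)"
      and L: "lead_q 0 (G \<alpha> \<epsilon> \<beta>) (((if \<alpha> = \<beta> then 1 else 0) + of_int \<epsilon> * (if sig n \<alpha> (n div 2) = \<beta> then 1 else 0)) / 2)"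
      using G \<alpha> \<beta> e unfolding eigen_family_def by blast
    have E: "p * inverse C * lin (comps n s) \<kappa> (G \<alpha> \<epsilon>) \<beta> = p * eigval s k j * G \<alpha> \<epsilon> \<beta>"
      unfolding C(2)[OF v kj(1) Z] using C(1) by simp
    have le: "lead_q 0 (p * eigval s k j) (of_int \<epsilon> ^ s * cx_x powi energy n s \<alpha>)"
      using eigval_lead[OF kj tau_nonneg[OF comps_nonneg[OF \<alpha>]] \<epsilon>] unfolding p_def energy_comps[OF n \<alpha>] .
    show ?thesis unfolding E using lead_q_mult[OF le L] by (simp only: add_0)
  qed
  show ?thesis
  proof (intro exI[of _ "p * inverse C"] conjI allI impI ballI)
    show "p * inverse C \<noteq> 0" using p C(1) by simp
    fix f \<phi> \<beta>
    assume f: "f \<in> vspan (comps n s)" "\<forall>\<beta>\<in>comps n s. lead_q 0 (f \<beta>) (\<phi> \<beta>)" and \<beta>: "\<beta> \<in> comps n s"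
    obtain c where c: "\<forall>\<alpha>\<in>comps n s. lead_q 0 (c \<alpha>) (\<phi> \<alpha>)"
      and fc: "f = (\<lambda>\<beta>. \<Sum>\<alpha>\<in>comps n s. c \<alpha> * (G \<alpha> 1 \<beta> + G \<alpha> (-1) \<beta>))"
    proof -
      have "\<exists>c. (\<forall>\<alpha>\<in>comps n s. lead_q 0 (c \<alpha>) (\<phi> \<alpha>)) \<and>
        f = (\<lambda>\<beta>. \<Sum>\<alpha>\<in>comps n s. c \<alpha> * (G \<alpha> 1 \<beta> + G \<alpha> (-1) \<beta>))"
        by (rule eigen_family_expand[OF G f(1)]) (rule f(2)[rule_format])
      then show ?thesis using that by (elim exE conjE)
    qed
    have la: "lin (comps n s) \<kappa> (\<lambda>\<beta>. g \<beta> + h \<beta>) \<beta> = lin (comps n s) \<kappa> g \<beta> + lin (comps n s) \<kappa> h \<beta>" for g h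
      unfolding lin_def by (simp add: sum.distrib distrib_right)
    have "lin (comps n s) \<kappa> f \<beta> = (\<Sum>\<alpha>\<in>comps n s. c \<alpha> * (lin (comps n s) \<kappa> (G \<alpha> 1) \<beta> + lin (comps n s) \<kappa> (G \<alpha> (-1)) \<beta>))"
      unfolding fc sumlinD[OF sumlin_lin] la ..
    then have E: "p * inverse C * lin (comps n s) \<kappa> f \<beta> = (\<Sum>\<alpha>\<in>comps n s. c \<alpha> *
        (p * inverse C * lin (comps n s) \<kappa> (G \<alpha> 1) \<beta> + p * inverse C * lin (comps n s) \<kappa> (G \<alpha> (-1)) \<beta>))"
      by (simp add: sum_distrib_left algebra_simps)
    show "lead_q 0 (p * inverse C * lin (comps n s) \<kappa> f \<beta>)
       (\<Sum>\<alpha>\<in>comps n s. \<phi> \<alpha> * (cx_x powi energy n s \<alpha> * (if refl_map n s \<alpha> = \<beta> then 1 else 0)))"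
      unfolding E
    proof (rule lead_q_sum)
      fix \<alpha> assume \<alpha>: "\<alpha> \<in> comps n s"
      let ?x = "cx_x powi energy n s \<alpha>"
      let ?a = "if \<alpha> = \<beta> then 1 else 0 :: cx" and ?b = "if sig n \<alpha> (n div 2) = \<beta> then 1 else 0 :: cx"
      have "of_int 1 ^ s * ?x * ((?a + of_int 1 * ?b) / 2) + of_int (-1) ^ s * ?x * ((?a + of_int (-1) * ?b) / 2)
        = ?x * (if refl_map n s \<alpha> = \<beta> then 1 else 0)"
      proof -
        have hf: "y / 2 + y / 2 = y" for y :: cx
          using two_neq_0_cx by (simp add: field_simps)
        have "of_int 1 ^ s * x * ((a + of_int 1 * b) / 2) + of_int (-1) ^ s * x * ((a + of_int (-1) * b) / 2)
          = x * (if even s then a / 2 + a / 2 else b / 2 + b / 2)" for x a b :: cx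
          by (cases "even s") (simp_all add: add_divide_distrib diff_divide_distrib algebra_simps)
        moreover have "(if refl_map n s \<alpha> = \<beta> then 1 else 0) = (if even s then ?a else ?b)"
          by (simp add: refl_map_def)
        ultimately show ?thesis unfolding hf by (simp only:)
      qed
      then have "lead_q 0 (p * inverse C * lin (comps n s) \<kappa> (G \<alpha> 1) \<beta> + p * inverse C * lin (comps n s) \<kappa> (G \<alpha> (-1)) \<beta>)
        (?x * (if refl_map n s \<alpha> = \<beta> then 1 else 0))"
        using lead_q_add[OF red[OF \<alpha> \<beta>, of 1] red[OF \<alpha> \<beta>, of "-1"]] by (simp only: simp_thms)
      from lead_q_mult[OF c[rule_format, OF \<alpha>] this]
      show "lead_q 0 (c \<alpha> * (p * inverse C * lin (comps n s) \<kappa> (G \<alpha> 1) \<beta> + p * inverse C * lin (comps n s) \<kappa> (G \<alpha> (-1)) \<beta>))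
        (\<phi> \<alpha> * (?x * (if refl_map n s \<alpha> = \<beta> then 1 else 0)))" by (simp only: add_0)
    qed
  qed
qed

lemma quantum_K_exists:
  assumes n: "n \<ge> 3" and s: "s \<ge> 1"
  shows "\<exists>\<kappa>. quantum_K_matrix n s \<kappa>"
proof (rule quantum_K_matrix_exists[OF n s])
  fix \<alpha> assume \<alpha>: "\<alpha> \<in> comps n s"
  obtain G where G: "eigen_family n s G" using eigen_family_exists[OF n] by blast
  have "unit_vec \<alpha> \<in> vspan (comps n s)" using \<alpha> by (auto simp: vspan_def unit_vec_def)
  moreover have "lead_q 0 (unit_vec \<alpha> \<beta>) (if \<beta> = \<alpha> then 1 else 0)" for \<beta>
    by (simp add: unit_vec_def lead_q_one)
  ultimately obtain c where c: "unit_vec \<alpha> = (\<lambda>\<beta>. \<Sum>\<alpha>\<in>comps n s. c \<alpha> * (G \<alpha> 1 \<beta> + G \<alpha> (-1) \<beta>))"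
    using eigen_family_expand[OF G, of "unit_vec \<alpha>" "\<lambda>\<beta>. if \<beta> = \<alpha> then 1 else 0"] by blast
  define A where "A = comps n s \<times> {1, -1 :: int}"
  have u: "unit_vec \<alpha> = (\<lambda>\<beta>. \<Sum>i\<in>A. c (fst i) * G (fst i) (snd i) \<beta>)"
    unfolding c A_def by (simp add: sum.cartesian_product' distrib_left)
  have A: "fst i \<in> comps n s" "snd i \<in> {1, -1}" if "i \<in> A" for i
    using that unfolding A_def by (simp_all only: mem_Times_iff)
  have "\<forall>i. \<exists>kj. i \<in> A \<longrightarrow> fst kj + snd kj = s \<and> (\<forall>\<beta>\<in>comps n s.
      Zfull n (G (fst i) (snd i)) \<beta> = q_int (int (fst kj) - int (snd kj)) * G (fst i) (snd i) \<beta>)"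
  proof
    fix i
    show "\<exists>kj. i \<in> A \<longrightarrow> fst kj + snd kj = s \<and> (\<forall>\<beta>\<in>comps n s.
      Zfull n (G (fst i) (snd i)) \<beta> = q_int (int (fst kj) - int (snd kj)) * G (fst i) (snd i) \<beta>)"
  proof (cases "i \<in> A")
    case True
    then obtain k j where "k + j = s" "\<forall>\<beta>\<in>comps n s. Zfull n (G (fst i) (snd i)) \<beta> = q_int (int k - int j) * G (fst i) (snd i) \<beta>"
      using G A[OF True] unfolding eigen_family_def by blast
    then show ?thesis by (intro exI[of _ "(k, j)"]) simp
  qed simp
  qed
  from choice[OF this] obtain kj where kj: "\<forall>i. i \<in> A \<longrightarrow> fst (kj i) + snd (kj i) = s \<and> (\<forall>\<beta>\<in>comps n s.
      Zfull n (G (fst i) (snd i)) \<beta> = q_int (int (fst (kj i)) - int (snd (kj i))) * G (fst i) (snd i) \<beta>)" by (elim exE)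
  have v: "G (fst i) (snd i) \<in> vspan (comps n s)" if "i \<in> A" for i
    using G A[OF that] unfolding eigen_family_def by blast
  have fin: "finite A" unfolding A_def using finite_comps by simp
  show "\<exists>(A :: ((nat \<Rightarrow> int) \<times> int) set) c g k j. finite A \<and> unit_vec \<alpha> = (\<lambda>\<beta>. \<Sum>i\<in>A. c i * g i \<beta>)
      \<and> (\<forall>i\<in>A. k i + j i = s \<and> g i \<in> vspan (comps n s) \<and>
          (\<forall>\<beta>\<in>comps n s. Zfull n (g i) \<beta> = q_int (int (k i) - int (j i)) * g i \<beta>))"
  proof (intro exI conjI ballI)
    show "finite A" by (rule fin)
    show "unit_vec \<alpha> = (\<lambda>\<beta>. \<Sum>i\<in>A. c (fst i) * G (fst i) (snd i) \<beta>)" by (rule u)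
    fix i assume i: "i \<in> A"
    show "fst (kj i) + snd (kj i) = s" using kj i by blast
    show "G (fst i) (snd i) \<in> vspan (comps n s)" by (rule v[OF i])
    fix \<beta> assume "\<beta> \<in> comps n s"
    then show "Zfull n (G (fst i) (snd i)) \<beta> = q_int (int (fst (kj i)) - int (snd (kj i))) * G (fst i) (snd i) \<beta>"
      using kj i by blast
  qed
qed


section \<open>The combinatorial K-matrix\<close>

definition Kbar :: "nat \<Rightarrow> nat \<Rightarrow> ((nat \<Rightarrow> int) \<Rightarrow> cx) \<Rightarrow> (nat \<Rightarrow> int) \<Rightarrow> cx" where
  "Kbar n s \<phi> \<beta> = (\<Sum>\<alpha>\<in>comps n s. \<phi> \<alpha> * (cx_x powi energy n s \<alpha> * (if refl_map n s \<alpha> = \<beta> then 1 else 0)))"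

lemma sum_x_pow_b:
  assumes "\<alpha> \<in> comps n s"
  shows "(\<Sum>\<gamma>\<in>comps n s. x_pow_b d \<alpha> \<gamma> * (cx_x powi e \<gamma> * (if r \<gamma> = \<beta> then 1 else 0)))
    = x_pow_b (d + e \<alpha>) (r \<alpha>) \<beta>"
proof -
  have "(\<Sum>\<gamma>\<in>comps n s. x_pow_b d \<alpha> \<gamma> * (cx_x powi e \<gamma> * (if r \<gamma> = \<beta> then 1 else 0)))
    = (\<Sum>\<gamma>\<in>comps n s. if \<gamma> = \<alpha> then cx_x powi d * (cx_x powi e \<alpha> * (if r \<alpha> = \<beta> then 1 else 0)) else 0)"
    by (intro sum.cong) (auto simp: x_pow_b_def)
  also have "\<dots> = cx_x powi d * (cx_x powi e \<alpha> * (if r \<alpha> = \<beta> then 1 else 0))"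
    using assms finite_comps by (simp only: sum.delta if_True)
  also have "\<dots> = x_pow_b (d + e \<alpha>) (r \<alpha>) \<beta>"
    using cx_x_nonzero by (auto simp: x_pow_b_def power_int_add)
  finally show ?thesis .
qed

lemma Kbar_x_pow_b:
  assumes "\<alpha> \<in> comps n s"
  shows "Kbar n s (x_pow_b d \<alpha>) = x_pow_b (d + energy n s \<alpha>) (refl_map n s \<alpha>)"
  unfolding Kbar_def[abs_def] by (rule ext) (rule sum_x_pow_b[OF assms])

text \<open>\<open>refl_map\<close> is an involution that preserves tau and hence the energy, so the
  inverse is the same map with the exponent negated.\<close>

lemma Kbar_bij:
  assumes n: "n \<ge> 3"
  shows "bij_betw (Kbar n s) (crystal n s) (crystal n s)"
proof -
  define Kinv :: "((nat \<Rightarrow> int) \<Rightarrow> cx) \<Rightarrow> (nat \<Rightarrow> int) \<Rightarrow> cx" where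
    "Kinv \<phi> = (\<lambda>\<beta>. \<Sum>\<alpha>\<in>comps n s. \<phi> \<alpha> * (cx_x powi (- energy n s \<alpha>) * (if refl_map n s \<alpha> = \<beta> then 1 else 0)))" for \<phi>
  have I: "Kinv (x_pow_b d \<alpha>) = x_pow_b (d - energy n s \<alpha>) (refl_map n s \<alpha>)" if "\<alpha> \<in> comps n s" for d \<alpha>
    unfolding Kinv_def by (intro ext) (simp add: sum_x_pow_b[OF that, of d "\<lambda>\<gamma>. - energy n s \<gamma>"])
  have e: "energy n s (refl_map n s \<alpha>) = energy n s \<alpha>" if "\<alpha> \<in> comps n s" for \<alpha>
    unfolding energy_comps[OF n that] energy_comps[OF n refl_map_comps(1)[OF that]] refl_map_comps(3)[OF that] ..
  show ?thesis
  proof (rule bij_betw_byWitness[where f' = Kinv])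
    show "\<forall>b\<in>crystal n s. Kinv (Kbar n s b) = b" "\<forall>b\<in>crystal n s. Kbar n s (Kinv b) = b"
      by (auto simp: crystal_def Kbar_x_pow_b I refl_map_comps(1,2) e)
    have cr: "x_pow_b d \<alpha> \<in> crystal n s" if "\<alpha> \<in> comps n s" for d \<alpha>
      using that unfolding crystal_def by blast
    have img: "h ` crystal n s \<subseteq> crystal n s"
      if "\<And>d \<alpha>. \<alpha> \<in> comps n s \<Longrightarrow> h (x_pow_b d \<alpha>) \<in> crystal n s" for h
      using that unfolding crystal_def image_subset_iff by blast
    show "Kbar n s ` crystal n s \<subseteq> crystal n s"
      by (rule img) (simp only: Kbar_x_pow_b cr refl_map_comps(1))
    show "Kinv ` crystal n s \<subseteq> crystal n s"
      by (rule img) (simp only: I cr refl_map_comps(1))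
  qed
qed

lemma const_scaled_unit:
  assumes "\<alpha> \<in> comps n s"
  defines "f \<equiv> \<lambda>d \<beta>. const_x (cx_x powi d) * unit_vec \<alpha> \<beta>"
  shows "f d \<in> kr_lattice n s" "lattice_class (f d) = x_pow_b d \<alpha>"
proof -
  have l: "lead_q 0 (f d \<beta>) (x_pow_b d \<alpha> \<beta>)" for \<beta>
    by (simp add: f_def unit_vec_def x_pow_b_def lead_q_const_x)
  show "f d \<in> kr_lattice n s"
    using lead_qD(1)[OF l] assms(1) by (auto simp: kr_lattice_def vspan_def f_def unit_vec_def)
  show "lattice_class (f d) = x_pow_b d \<alpha>"
    unfolding lattice_class_def using lead_qD(2)[OF l] by blast
qed

theorem proposition19:
  fixes n s :: nat
  assumes "n \<ge> 3" and "s \<ge> 1"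
  shows "(\<exists>\<kappa>. quantum_K_matrix n s \<kappa>) \<and>
    (\<forall>\<kappa>. quantum_K_matrix n s \<kappa> \<longrightarrow>
       (\<exists>\<K>. combinatorial_K_matrix n s \<kappa> \<K> \<and>
          (\<forall>d. \<forall>\<alpha>\<in>comps n s.
             \<K> (x_pow_b d \<alpha>) =
               x_pow_b (d + energy n s \<alpha>)
                 (if even s then \<alpha> else case_shift n (case_index n \<alpha>) \<alpha>)) \<and>
          (\<forall>\<K>'. combinatorial_K_matrix n s \<kappa> \<K>' \<longrightarrow>
             (\<exists>m. \<forall>b\<in>crystal n s. \<K>' b = (\<lambda>\<beta>. cx_x powi m * \<K> b \<beta>)))))"
proof (intro conjI allI impI)
  show "\<exists>\<kappa>. quantum_K_matrix n s \<kappa>" by (rule quantum_K_exists[OF assms])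
  fix \<kappa> assume \<kappa>: "quantum_K_matrix n s \<kappa>"
  let ?B = "comps n s"
  have \<kappa>v: "\<kappa> \<alpha> \<in> vspan ?B" if "\<alpha> \<in> ?B" for \<alpha>
    using \<kappa> that unfolding quantum_K_matrix_def by blast
  obtain c where c: "c \<noteq> 0" and red: "\<And>f \<phi> \<beta>. f \<in> vspan ?B \<Longrightarrow> \<forall>\<beta>\<in>?B. lead_q 0 (f \<beta>) (\<phi> \<beta>) \<Longrightarrow> \<beta> \<in> ?B \<Longrightarrow>
      lead_q 0 (c * lin ?B \<kappa> f \<beta>) (Kbar n s \<phi> \<beta>)"
    using K_reduction[OF assms \<kappa>] unfolding Kbar_def by blast
  have scale: "lin ?B (\<lambda>\<alpha> \<beta>. r * \<kappa> \<alpha> \<beta>) f = (\<lambda>\<beta>. r * lin ?B \<kappa> f \<beta>)" for r f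
    unfolding lin_def by (simp add: sum_distrib_left mult.left_commute)
  have off: "lin ?B \<kappa> f \<beta> = 0" if "\<beta> \<notin> ?B" for f \<beta>
    unfolding lin_def using \<kappa>v that by (auto simp: vspan_def intro!: sum.neutral)
  have Kbar_off: "Kbar n s \<phi> \<beta> = 0" if "\<beta> \<notin> ?B" for \<phi> \<beta>
    unfolding Kbar_def using refl_map_comps(1) that by (intro sum.neutral) auto
  have lead: "lead_q 0 (c * lin ?B \<kappa> f \<beta>) (Kbar n s (lattice_class f) \<beta>)" if f: "f \<in> kr_lattice n s" for f \<beta>
  proof (cases "\<beta> \<in> ?B")
    case True
    have "\<forall>\<beta>\<in>?B. lead_q 0 (f \<beta>) (lattice_class f \<beta>)"
      using f by (simp add: kr_lattice_def lattice_class_def lead_q_0_iff)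
    then show ?thesis using red[of f "lattice_class f" \<beta>] f True by (simp add: kr_lattice_def)
  next
    case False
    then show ?thesis by (simp add: off Kbar_off)
  qed
  let ?\<kappa>' = "lin ?B (\<lambda>\<alpha> \<beta>. c * \<kappa> \<alpha> \<beta>)"
  \<comment> \<open>This reference vector serves twice: it shows that the reduction is nonzero, and
    it controls the ratio of two admissible scalings.\<close>
  define \<alpha>0 :: "nat \<Rightarrow> int" where "\<alpha>0 = (\<lambda>k. if k = 1 then int s else 0)"
  have \<alpha>0: "\<alpha>0 \<in> ?B" using assms by (auto simp: comps_def \<alpha>0_def)
  define \<beta>0 where "\<beta>0 = refl_map n s \<alpha>0"
  have \<beta>0: "\<beta>0 \<in> ?B" unfolding \<beta>0_def by (rule refl_map_comps(1)[OF \<alpha>0])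
  define f0 where "f0 d \<alpha> = (\<lambda>\<beta>. const_x (cx_x powi d) * unit_vec \<alpha> \<beta>)" for d and \<alpha> :: "nat \<Rightarrow> int"
  have f0: "f0 d \<alpha> \<in> kr_lattice n s" "lattice_class (f0 d \<alpha>) = x_pow_b d \<alpha>" if "\<alpha> \<in> ?B" for d \<alpha>
    unfolding f0_def by (rule const_scaled_unit[OF that])+
  have Kb0: "Kbar n s (x_pow_b 0 \<alpha>0) \<beta>0 = cx_x powi energy n s \<alpha>0"
    unfolding Kbar_x_pow_b[OF \<alpha>0] \<beta>0_def by (simp add: x_pow_b_def)
  have comb: "combinatorial_K_matrix n s \<kappa> (Kbar n s)"
    unfolding combinatorial_K_matrix_def Let_def
  proof (intro exI conjI)
    show "c \<noteq> 0" by (rule c)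
    show "\<forall>f\<in>kr_lattice n s. ?\<kappa>' f \<in> kr_lattice n s"
      unfolding scale kr_lattice_def vspan_def using lead_qD(1)[OF lead] off by (auto simp: kr_lattice_def vspan_def)
    show "\<forall>f\<in>kr_lattice n s. Kbar n s (lattice_class f) = lattice_class (?\<kappa>' f)"
      unfolding scale using lead_qD(2)[OF lead] by (auto simp: lattice_class_def[of "\<lambda>\<beta>. c * lin ?B \<kappa> _ \<beta>"])
    show "\<exists>f\<in>kr_lattice n s. Kbar n s (lattice_class f) \<noteq> (\<lambda>_. 0)"
    proof
      show "f0 0 \<alpha>0 \<in> kr_lattice n s" by (rule f0(1)[OF \<alpha>0])
      show "Kbar n s (lattice_class (f0 0 \<alpha>0)) \<noteq> (\<lambda>_. 0)"
      proof
        assume "Kbar n s (lattice_class (f0 0 \<alpha>0)) = (\<lambda>_. 0)"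
        then have "cx_x powi energy n s \<alpha>0 = 0" using Kb0 unfolding f0(2)[OF \<alpha>0] by simp
        then show False by simp
      qed
    qed
    show "bij_betw (Kbar n s) (crystal n s) (crystal n s)" by (rule Kbar_bij[OF assms(1)])
    show "\<forall>b\<in>crystal n s. Kbar n s b = Kbar n s b" by simp
  qed
  show "\<exists>\<K>. combinatorial_K_matrix n s \<kappa> \<K> \<and>
          (\<forall>d. \<forall>\<alpha>\<in>?B. \<K> (x_pow_b d \<alpha>) = x_pow_b (d + energy n s \<alpha>)
                 (if even s then \<alpha> else case_shift n (case_index n \<alpha>) \<alpha>)) \<and>
          (\<forall>\<K>'. combinatorial_K_matrix n s \<kappa> \<K>' \<longrightarrow>
             (\<exists>m. \<forall>b\<in>crystal n s. \<K>' b = (\<lambda>\<beta>. cx_x powi m * \<K> b \<beta>)))"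
  proof (intro exI[of _ "Kbar n s"] conjI allI impI ballI)
    show "combinatorial_K_matrix n s \<kappa> (Kbar n s)" by (rule comb)
  next
    fix d \<alpha> assume \<alpha>: "\<alpha> \<in> ?B"
    have "refl_map n s \<alpha> = (if even s then \<alpha> else case_shift n (case_index n \<alpha>) \<alpha>)"
      using case_shift_sig[OF assms(1) \<alpha> comps_nonneg[OF \<alpha>]] by (simp add: refl_map_def)
    then show "Kbar n s (x_pow_b d \<alpha>) = x_pow_b (d + energy n s \<alpha>)
        (if even s then \<alpha> else case_shift n (case_index n \<alpha>) \<alpha>)"
      unfolding Kbar_x_pow_b[OF \<alpha>] by simp
  next
    fix \<K>' assume "combinatorial_K_matrix n s \<kappa> \<K>'"
    then obtain c' Kbar' where c': "c' \<noteq> 0"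
      and lat: "\<forall>f\<in>kr_lattice n s. lin ?B (\<lambda>\<alpha> \<beta>. c' * \<kappa> \<alpha> \<beta>) f \<in> kr_lattice n s"
      and cl: "\<forall>f\<in>kr_lattice n s. Kbar' (lattice_class f) = lattice_class (lin ?B (\<lambda>\<alpha> \<beta>. c' * \<kappa> \<alpha> \<beta>) f)"
      and bij: "bij_betw Kbar' (crystal n s) (crystal n s)"
      and K': "\<forall>b\<in>crystal n s. \<K>' b = Kbar' b"
      unfolding combinatorial_K_matrix_def Let_def by (elim exE conjE)
    have rc: "c' * y = (c' / c) * (c * y)" for y using c by simp
    have r0: "lead_q 0 (c * lin ?B \<kappa> (f0 0 \<alpha>0) \<beta>0) (cx_x powi energy n s \<alpha>0)"
      using lead[OF f0(1)[OF \<alpha>0], of 0 \<beta>0] unfolding f0(2)[OF \<alpha>0] Kb0 .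
    have "c' * lin ?B \<kappa> (f0 0 \<alpha>0) \<beta>0 \<in> A_x"
      using lat[rule_format, OF f0(1)[OF \<alpha>0, of 0]] \<beta>0 unfolding scale by (simp add: kr_lattice_def)
    then have "lead_q 0 (c' * lin ?B \<kappa> (f0 0 \<alpha>0) \<beta>0) (mod_qinv (c' * lin ?B \<kappa> (f0 0 \<alpha>0) \<beta>0))"
      by (simp add: lead_q_0_iff)
    \<comment> \<open>In the coordinate \<beta>0 the reduction for the scaling c is a power of x,
      hence invertible; so c' / c is regular at q^{-1} = 0, with some reduction L.\<close>
    from lead_q_divide[OF this r0] obtain L where
      "lead_q 0 (c' * lin ?B \<kappa> (f0 0 \<alpha>0) \<beta>0 / (c * lin ?B \<kappa> (f0 0 \<alpha>0) \<beta>0)) L" by auto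
    moreover have "lin ?B \<kappa> (f0 0 \<alpha>0) \<beta>0 \<noteq> 0" using lead_q_nonzero[OF r0] by auto
    ultimately have L: "lead_q 0 (c' / c) L" by simp
    have K2: "Kbar' (x_pow_b d \<alpha>) = (\<lambda>\<beta>. L * Kbar n s (x_pow_b d \<alpha>) \<beta>)" if \<alpha>: "\<alpha> \<in> ?B" for d \<alpha>
    proof
      fix \<beta>
      have "lead_q 0 (c' * lin ?B \<kappa> (f0 d \<alpha>) \<beta>) (L * Kbar n s (x_pow_b d \<alpha>) \<beta>)"
        unfolding rc using lead_q_mult[OF L lead[OF f0(1)[OF \<alpha>], of d \<beta>]] unfolding f0(2)[OF \<alpha>] by simp
      from lead_qD(2)[OF this] show "Kbar' (x_pow_b d \<alpha>) \<beta> = L * Kbar n s (x_pow_b d \<alpha>) \<beta>"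
        using cl[rule_format, OF f0(1)[OF \<alpha>, of d]] unfolding f0(2)[OF \<alpha>] scale by (simp add: lattice_class_def)
    qed
    have "x_pow_b 0 \<alpha>0 \<in> crystal n s" using \<alpha>0 unfolding crystal_def by blast
    then have "Kbar' (x_pow_b 0 \<alpha>0) \<in> crystal n s" using bij by (rule bij_betwE[THEN bspec, rotated])
    \<comment> \<open>As Kbar' maps the crystal to itself, L times a power of x is again a power of
      x, and therefore so is L.\<close>
    then obtain d' \<alpha>' where d': "Kbar' (x_pow_b 0 \<alpha>0) = x_pow_b d' \<alpha>'" unfolding crystal_def by blast
    have eq: "L * x_pow_b (energy n s \<alpha>0) \<beta>0 \<beta> = x_pow_b d' \<alpha>' \<beta>" for \<beta>
      using fun_cong[OF d', of \<beta>] unfolding K2[OF \<alpha>0] Kbar_x_pow_b[OF \<alpha>0] \<beta>0_def by simp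
    have "\<alpha>' = \<beta>0"
    proof (rule ccontr)
      assume "\<alpha>' \<noteq> \<beta>0"
      then have "cx_x powi d' = 0" using eq[of \<alpha>'] by (simp add: x_pow_b_def)
      then show False by simp
    qed
    then have "L * cx_x powi energy n s \<alpha>0 = cx_x powi d'" using eq[of \<beta>0] by (simp add: x_pow_b_def)
    then have Lx: "L = cx_x powi (d' - energy n s \<alpha>0)" by (simp add: power_int_diff field_simps)
    show "\<exists>m. \<forall>b\<in>crystal n s. \<K>' b = (\<lambda>\<beta>. cx_x powi m * Kbar n s b \<beta>)"
    proof (intro exI ballI)
      fix b assume b: "b \<in> crystal n s"
      then obtain d \<alpha> where "b = x_pow_b d \<alpha>" "\<alpha> \<in> ?B" unfolding crystal_def by blast
      then show "\<K>' b = (\<lambda>\<beta>. cx_x powi (d' - energy n s \<alpha>0) * Kbar n s b \<beta>)"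
        using K' b K2 unfolding Lx by simp
    qed
  qed
qed

end
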